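(* (a) Let $\Delta$ be a finitely generated nilpotent group, with upper central series $\{Z_i\}_{i=0}^c$. Let $\Gamma$ be a finitely generated group and suppose that $(Z_i/Z_{i-1})\wr\Gamma$ is Hopfian for all $i=1,\ldots,c$. Then $\Delta\wr\Gamma$ is Hopfian. (b) In particular, Kaplansky's stable finiteness conjecture holds if and only if $\Delta\wr\Gamma$ is Hopfian for every finitely generated nilpotent group $\Delta$ and every finitely generated Hopfian group $\Gamma$.
   Context: The upper central series $\{Z_i\}_{i=0}^c$ of a nilpotent group $\Delta$ is the series $\{1\}=Z_0\le Z_1\le\cdots\le Z_c=\Delta$ in which $Z_i/Z_{i-1}$ is the centre of $\Delta/Z_{i-1}$; so $Z_1$ is the centre of $\Delta$. The (standard, restricted) wreath product of discrete groups is $\Delta\wr\Gamma:=\left(\bigoplus_\Gamma\Delta\right)\rtimes\Gamma$, where $\bigoplus_\Gamma\Delta$ is the group of finitely supported functions $f\colon\Gamma\to\Delta$ and $\Gamma$ acts by shifting coordinates, $({}_\gamma f)(x)=f(\gamma^{-1}x)$. A group is Hopfian if every surjective endomorphism of it is an automorphism. A ring $R$ with identity is directly finite if for all $x,y\in R$, $xy=1$ implies $yx=1$; it is stably finite if the matrix ring $\mathbb{M}_d(R)$ is directly finite for every $d\ge1$. Kaplansky's stable finiteness conjecture asserts that the group ring $\mathbb{F}[G]$ is stably finite for every group $G$ and every field $\mathbb{F}$. *)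

theory Defs
  imports "HOL-Algebra.Algebra"
begin

section \<open>Groups\<close>

definition finitely_generated :: "('a, 'm) monoid_scheme \<Rightarrow> bool" where
  "finitely_generated G \<longleftrightarrow>
     (\<exists>S. finite S \<and> S \<subseteq> carrier G \<and> generate G S = carrier G)"

definition hopfian :: "('a, 'm) monoid_scheme \<Rightarrow> bool" where
  "hopfian G \<longleftrightarrow> (\<forall>\<phi>\<in>epi G G. \<phi> \<in> iso G G)"

definition centre :: "('a, 'm) monoid_scheme \<Rightarrow> 'a set" where
  "centre G = {z \<in> carrier G. \<forall>x\<in>carrier G. z \<otimes>\<^bsub>G\<^esub> x = x \<otimes>\<^bsub>G\<^esub> z}"

text \<open>The term of index \<open>i + 1\<close> is the preimage, under the projection
  \<open>G \<rightarrow> G / Z\<^sub>i\<close>, of the centre of \<open>G / Z\<^sub>i\<close>.\<close>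

primrec upper_central :: "('a, 'm) monoid_scheme \<Rightarrow> nat \<Rightarrow> 'a set" where
  "upper_central G 0 = {\<one>\<^bsub>G\<^esub>}"
| "upper_central G (Suc i) =
     {x \<in> carrier G. upper_central G i #>\<^bsub>G\<^esub> x \<in> centre (G Mod upper_central G i)}"

definition nilpotent_group :: "('a, 'm) monoid_scheme \<Rightarrow> bool" where
  "nilpotent_group G \<longleftrightarrow> group G \<and> (\<exists>c. upper_central G c = carrier G)"

text \<open>The quotient \<open>Z\<^sub>i / Z\<^sub>i\<^sub>-\<^sub>1\<close>, for \<open>i \<ge> 1\<close>.\<close>

definition upper_central_factor :: "('a, 'm) monoid_scheme \<Rightarrow> nat \<Rightarrow> 'a set monoid" where
  "upper_central_factor G i =
     (G\<lparr>carrier := upper_central G i\<rparr>) Mod upper_central G (i - 1)"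

definition semidirect_product ::
  "('a, 'm) monoid_scheme \<Rightarrow> ('b, 'n) monoid_scheme \<Rightarrow> ('b \<Rightarrow> 'a \<Rightarrow> 'a) \<Rightarrow> ('a \<times> 'b) monoid"
  where
  "semidirect_product N H \<alpha> =
     \<lparr>carrier = carrier N \<times> carrier H,
      monoid.mult = (\<lambda>(m, g) (n, h). (m \<otimes>\<^bsub>N\<^esub> \<alpha> g n, g \<otimes>\<^bsub>H\<^esub> h)),
      one = (\<one>\<^bsub>N\<^esub>, \<one>\<^bsub>H\<^esub>)\<rparr>"

definition shift_action :: "('b, 'n) monoid_scheme \<Rightarrow> 'b \<Rightarrow> ('b \<Rightarrow> 'a) \<Rightarrow> 'b \<Rightarrow> 'a" where
  "shift_action \<Gamma> \<gamma> f = (\<lambda>x\<in>carrier \<Gamma>. f (inv\<^bsub>\<Gamma>\<^esub> \<gamma> \<otimes>\<^bsub>\<Gamma>\<^esub> x))"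

text \<open>\<open>sum_group\<close> consists of the finitely supported functions: this is the restricted
  wreath product.\<close>

definition wreath_product ::
  "('a, 'm) monoid_scheme \<Rightarrow> ('b, 'n) monoid_scheme \<Rightarrow> (('b \<Rightarrow> 'a) \<times> 'b) monoid"
  (infixl \<open>\<wr>\<close> 70) where
  "\<Delta> \<wr> \<Gamma> =
     semidirect_product (sum_group (carrier \<Gamma>) (\<lambda>_. \<Delta>)) \<Gamma> (shift_action \<Gamma>)"

section \<open>Rings\<close>

definition directly_finite :: "('a, 'm) ring_scheme \<Rightarrow> bool" where
  "directly_finite R \<longleftrightarrow>
     (\<forall>x\<in>carrier R. \<forall>y\<in>carrier R. x \<otimes>\<^bsub>R\<^esub> y = \<one>\<^bsub>R\<^esub> \<longrightarrow> y \<otimes>\<^bsub>R\<^esub> x = \<one>\<^bsub>R\<^esub>)"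

text \<open>Matrices are functions on pairs of indices below \<open>d\<close>, with value \<open>undefined\<close> at all
  other pairs.\<close>

definition matrix_ring :: "nat \<Rightarrow> ('a, 'm) ring_scheme \<Rightarrow> (nat \<times> nat \<Rightarrow> 'a) ring" where
  "matrix_ring d R =
     \<lparr>carrier = ({..<d} \<times> {..<d}) \<rightarrow>\<^sub>E carrier R,
      monoid.mult = (\<lambda>A B. \<lambda>(i, j)\<in>{..<d} \<times> {..<d}. \<Oplus>\<^bsub>R\<^esub>k\<in>{..<d}. A (i, k) \<otimes>\<^bsub>R\<^esub> B (k, j)),
      one = (\<lambda>(i, j)\<in>{..<d} \<times> {..<d}. if i = j then \<one>\<^bsub>R\<^esub> else \<zero>\<^bsub>R\<^esub>),
      ring.zero = (\<lambda>_\<in>{..<d} \<times> {..<d}. \<zero>\<^bsub>R\<^esub>),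
      ring.add = (\<lambda>A B. \<lambda>p\<in>{..<d} \<times> {..<d}. A p \<oplus>\<^bsub>R\<^esub> B p)\<rparr>"

definition stably_finite :: "('a, 'm) ring_scheme \<Rightarrow> bool" where
  "stably_finite R \<longleftrightarrow> (\<forall>d\<ge>1. directly_finite (matrix_ring d R))"

text \<open>The formal sum \<open>\<Sum>\<^sub>g x\<^sub>g g\<close> is the function \<open>g \<mapsto> x\<^sub>g\<close>; the coefficient of \<open>g\<close> in
  a product \<open>x y\<close> is the sum of \<open>x\<^sub>h y\<^sub>k\<close> over all \<open>h k = g\<close>, that is, over \<open>h\<close> in the
  support of \<open>x\<close> with \<open>k = h\<inverse> g\<close>.\<close>

definition group_ring ::
  "('k, 'm) ring_scheme \<Rightarrow> ('g, 'n) monoid_scheme \<Rightarrow> ('g \<Rightarrow> 'k) ring" where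
  "group_ring R G =
     \<lparr>carrier = {x \<in> carrier G \<rightarrow>\<^sub>E carrier R. finite {g \<in> carrier G. x g \<noteq> \<zero>\<^bsub>R\<^esub>}},
      monoid.mult = (\<lambda>x y. \<lambda>g\<in>carrier G.
        \<Oplus>\<^bsub>R\<^esub>h\<in>{h \<in> carrier G. x h \<noteq> \<zero>\<^bsub>R\<^esub>}. x h \<otimes>\<^bsub>R\<^esub> y (inv\<^bsub>G\<^esub> h \<otimes>\<^bsub>G\<^esub> g)),
      one = (\<lambda>g\<in>carrier G. if g = \<one>\<^bsub>G\<^esub> then \<one>\<^bsub>R\<^esub> else \<zero>\<^bsub>R\<^esub>),
      ring.zero = (\<lambda>_\<in>carrier G. \<zero>\<^bsub>R\<^esub>),
      ring.add = (\<lambda>x y. \<lambda>g\<in>carrier G. x g \<oplus>\<^bsub>R\<^esub> y g)\<rparr>"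

end

theory Submission
  imports Defs "HOL-Number_Theory.Residues"
begin

text \<open>Part (a). The base group \<open>B\<close> of \<open>W = \<Delta> \<wr> \<Gamma>\<close> is nilpotent, and a surjective endomorphism \<open>\<phi>\<close> of \<open>W\<close> maps it
  to a normal nilpotent subgroup. If \<open>\<Gamma>\<close> is Hopfian with at least three elements, this image lies in \<open>B\<close>
  (\<open>surjective_endomorphism_preserves_base\<close>), so \<open>\<phi>\<close> induces a surjective endomorphism of \<open>\<Gamma>\<close>, which is an
  automorphism and may be taken to be the identity (\<open>hopfian_if_injective_over_top\<close>); for smaller \<open>\<Gamma>\<close> the
  group \<open>W\<close> is Noetherian. The functions with values in \<open>Z\<^sub>i\<close> form a normal series of \<open>W\<close> that \<open>\<phi>\<close> respects,
  and the Hopf property of \<open>(Z\<^sub>i / Z\<^sub>i\<^sub>-\<^sub>1) \<wr> \<Gamma>\<close> shows, from the top layer down, that the kernel of \<open>\<phi>\<close> lies in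
  ever smaller terms (\<open>hopfian_wreath_nilpotent\<close>). The group \<open>\<Gamma>\<close> is Hopfian because \<open>Z\<^sub>1 \<wr> \<Gamma>\<close> is
  (\<open>hopfian_top_if_comm\<close>).

  Part (b), from stable finiteness. By the same reduction the base may be taken to be a finitely generated
  abelian group \<open>A\<close>. For a prime \<open>p\<close>, the functions \<open>\<Gamma> \<rightarrow> A / p A\<close> of finite support form a free module over
  \<open>\<bbbF>\<^sub>p[\<Gamma>]\<close> on which \<open>\<phi>\<close> acts by a matrix with a one-sided inverse. If that matrix is invertible, the
  kernel of \<open>\<phi>\<close> consists of functions with values in \<open>p A\<close> (\<open>kernel_in_powers\<close>); applied to the subgroups
  \<open>n A\<close> this makes the values divisible by every integer, hence zero (\<open>hopfian_wreath_abelian\<close>).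

  Part (b), to stable finiteness. Let \<open>A B = 1 \<noteq> B A\<close> over \<open>F[G]\<close>. Only finitely many coefficients and group
  elements occur. The coefficients generate a subring of \<open>F\<close> whose residue fields are finite
  (\<open>exists_finite_residue_field\<close>), and the group elements generate a group that embeds in a finitely
  generated Hopfian group \<open>\<Gamma>\<close> (\<open>embeds_in_hopfian\<close>); so it may be assumed that \<open>F = k\<close> is finite and
  \<open>G = \<Gamma>\<close>. Now \<open>k[\<Gamma>]\<^sup>d\<close> is the base group of \<open>k\<^sup>d \<wr> \<Gamma>\<close>, and \<open>v \<mapsto> v B\<close> extends to a surjective
  endomorphism of this wreath product that is not injective (\<open>directly_finite_if_hopfian\<close>).\<close>

section \<open>Word identities and cosets\<close>

context group
begin

lemma inv_mult_cancel:
  "x \<in> carrier G \<Longrightarrow> y \<in> carrier G \<Longrightarrow> x \<otimes> (inv x \<otimes> y) = y"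
  "x \<in> carrier G \<Longrightarrow> y \<in> carrier G \<Longrightarrow> inv x \<otimes> (x \<otimes> y) = y"
  by (simp_all flip: m_assoc)

lemmas word_simps = m_assoc inv_mult_group inv_mult_cancel

lemma coset_eq_iff:
  assumes "subgroup L G" "a \<in> carrier G" "b \<in> carrier G"
  shows "L #> a = L #> b \<longleftrightarrow> a \<otimes> inv b \<in> L"
proof -
  interpret L: subgroup L G by fact
  show ?thesis
  proof
    assume "L #> a = L #> b"
    then have "a \<in> L #> b" using assms rcos_self by metis
    then show "a \<otimes> inv b \<in> L"
      using L.rcos_module_imp assms is_group by blast
  next
    assume "a \<otimes> inv b \<in> L"
    then have "a \<in> L #> b" using L.rcos_module_rev assms is_group by blast
    then show "L #> a = L #> b"
      using repr_independence assms by metis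
  qed
qed

lemma coset_eq_self_iff:
  assumes "subgroup L G" "a \<in> carrier G"
  shows "L #> a = L \<longleftrightarrow> a \<in> L"
  using coset_eq_iff[OF assms(1,2) one_closed] assms
  by (simp add: coset_mult_one subgroup.subset)

end

section \<open>Hopfian groups\<close>

lemma hopfianI:
  assumes "group G"
    and "\<And>\<phi> x. \<phi> \<in> hom G G \<Longrightarrow> \<phi> ` carrier G = carrier G \<Longrightarrow> x \<in> carrier G \<Longrightarrow>
                \<phi> x = \<one>\<^bsub>G\<^esub> \<Longrightarrow> x = \<one>\<^bsub>G\<^esub>"
  shows "hopfian G"
  unfolding hopfian_def
proof
  fix \<phi> assume "\<phi> \<in> epi G G"
  then have hom: "\<phi> \<in> hom G G" and surj: "\<phi> ` carrier G = carrier G"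
    by (auto simp: epi_def)
  interpret group_hom G G \<phi>
    using hom assms(1) by (simp add: group_hom_def group_hom_axioms_def)
  have "inj_on \<phi> (carrier G)"
  proof (rule inj_onI)
    fix x y assume xy: "x \<in> carrier G" "y \<in> carrier G" "\<phi> x = \<phi> y"
    then have "\<phi> (x \<otimes>\<^bsub>G\<^esub> inv\<^bsub>G\<^esub> y) = \<one>\<^bsub>G\<^esub>" by simp
    then have "x \<otimes>\<^bsub>G\<^esub> inv\<^bsub>G\<^esub> y = \<one>\<^bsub>G\<^esub>"
      using assms(2)[OF hom surj] xy by simp
    then show "x = y"
      using xy G.inv_equality[of x "inv\<^bsub>G\<^esub> y"] by simp
  qed
  then show "\<phi> \<in> iso G G" using hom surj by (simp add: iso_def bij_betw_def)
qed

lemma hopfianD: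
  assumes "hopfian G" "\<phi> \<in> hom G G" "\<phi> ` carrier G = carrier G"
  shows "inj_on \<phi> (carrier G)"
  using assms unfolding hopfian_def epi_def iso_def bij_betw_def by blast

section \<open>Groups all of whose subgroups are finitely generated\<close>

definition noetherian_in :: "('a, 'm) monoid_scheme \<Rightarrow> 'a set \<Rightarrow> bool" where
  "noetherian_in G H \<longleftrightarrow>
     (\<forall>K. subgroup K G \<and> K \<subseteq> H \<longrightarrow> (\<exists>S. finite S \<and> S \<subseteq> K \<and> generate G S = K))"

lemma noetherian_inE:
  assumes "noetherian_in G H" "subgroup K G" "K \<subseteq> H"
  obtains S where "finite S" "S \<subseteq> K" "generate G S = K"
  using assms unfolding noetherian_in_def by metis

lemma noetherian_in_mono: "noetherian_in G H \<Longrightarrow> H' \<subseteq> H \<Longrightarrow> noetherian_in G H'"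
  unfolding noetherian_in_def by blast

lemma (in group) noetherian_in_finite:
  assumes "finite H" shows "noetherian_in G H"
  unfolding noetherian_in_def
proof (intro allI impI)
  fix K assume K: "subgroup K G \<and> K \<subseteq> H"
  then have "generate G K = K"
    by (intro equalityI generate_subgroup_incl) (auto intro: generate.incl)
  then show "\<exists>S. finite S \<and> S \<subseteq> K \<and> generate G S = K"
    using K assms finite_subset by (intro exI[of _ K]) auto
qed

text \<open>The kernels of the iterates of a surjective endomorphism form an ascending chain, which
  must stop; surjectivity then moves an element of the first kernel into two consecutive equal
  ones.\<close>

lemma noetherian_imp_hopfian:
  assumes "group G" "noetherian_in G (carrier G)"
  shows "hopfian G"
proof (rule hopfianI[OF assms(1)])
  fix \<phi> x assume hom: "\<phi> \<in> hom G G" and surj: "\<phi> ` carrier G = carrier G"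
    and x: "x \<in> carrier G" "\<phi> x = \<one>\<^bsub>G\<^esub>"
  interpret group_hom G G \<phi>
    using hom assms(1) by (simp add: group_hom_def group_hom_axioms_def)
  have it_closed: "(\<phi> ^^ n) y \<in> carrier G" if "y \<in> carrier G" for n y
    using that by (induction n) auto
  have it_mult: "(\<phi> ^^ n) (y \<otimes>\<^bsub>G\<^esub> z) = (\<phi> ^^ n) y \<otimes>\<^bsub>G\<^esub> (\<phi> ^^ n) z"
    if "y \<in> carrier G" "z \<in> carrier G" for n y z
    using that it_closed by (induction n) auto
  have it_inv: "(\<phi> ^^ n) (inv\<^bsub>G\<^esub> y) = inv\<^bsub>G\<^esub> ((\<phi> ^^ n) y)" if "y \<in> carrier G" for n y
    using that it_closed by (induction n) auto
  have it_one: "(\<phi> ^^ n) \<one>\<^bsub>G\<^esub> = \<one>\<^bsub>G\<^esub>" for n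
    by (induction n) auto
  have it_surj: "\<exists>y\<in>carrier G. (\<phi> ^^ n) y = z" if "z \<in> carrier G" for n z
    using that
  proof (induction n arbitrary: z)
    case (Suc n)
    obtain w where w: "w \<in> carrier G" "\<phi> w = z" using Suc.prems surj by (metis imageE)
    obtain y where "y \<in> carrier G" "(\<phi> ^^ n) y = w" using Suc.IH[OF w(1)] by blast
    with w show ?case by (intro bexI[of _ y]) auto
  qed auto
  define K where "K n = {y \<in> carrier G. (\<phi> ^^ n) y = \<one>\<^bsub>G\<^esub>}" for n
  have K_step: "K n \<subseteq> K (Suc n)" for n by (auto simp: K_def)
  have K_mono: "m \<le> n \<Longrightarrow> K m \<subseteq> K n" for m n
    by (rule lift_Suc_mono_le[where f = K]) (rule K_step)
  have K_sub: "subgroup (K n) G" for n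
    by (rule G.subgroupI) (auto simp: K_def it_mult it_inv intro: it_one)
  have U_sub: "subgroup (\<Union>n. K n) G"
  proof (rule G.subgroupI)
    show "(\<Union>n. K n) \<subseteq> carrier G" by (auto simp: K_def)
    show "(\<Union>n. K n) \<noteq> {}" using subgroup.one_closed[OF K_sub[of 0]] by blast
    show "inv\<^bsub>G\<^esub> a \<in> (\<Union>n. K n)" if "a \<in> (\<Union>n. K n)" for a
    proof -
      obtain n where "a \<in> K n" using \<open>a \<in> (\<Union>n. K n)\<close> by blast
      then show ?thesis using subgroup.m_inv_closed[OF K_sub] by blast
    qed
    show "a \<otimes>\<^bsub>G\<^esub> b \<in> (\<Union>n. K n)" if ab: "a \<in> (\<Union>n. K n)" "b \<in> (\<Union>n. K n)" for a b
    proof -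
      obtain m n where "a \<in> K m" "b \<in> K n" using ab by blast
      then have "a \<in> K (max m n)" "b \<in> K (max m n)"
        using K_mono[of m "max m n"] K_mono[of n "max m n"] by auto
      then show ?thesis using subgroup.m_closed[OF K_sub] by blast
    qed
  qed
  obtain S where S: "finite S" "S \<subseteq> (\<Union>n. K n)" "generate G S = (\<Union>n. K n)"
    using noetherian_inE[OF assms(2) U_sub subgroup.subset[OF U_sub]] .
  have "\<forall>s\<in>S. \<exists>n. s \<in> K n" using S(2) by blast
  then obtain f where f: "\<forall>s\<in>S. s \<in> K (f s)" by metis
  define n where "n = Max (insert 0 (f ` S))"
  have "S \<subseteq> K n"
  proof
    fix s assume s: "s \<in> S"
    then have "f s \<le> n" unfolding n_def using S(1) by (intro Max_ge) auto
    then show "s \<in> K n" using f s K_mono by blast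
  qed
  then have stop: "K m \<subseteq> K n" for m
    using G.generate_subgroup_incl[OF _ K_sub] S(3) by blast
  obtain y where y: "y \<in> carrier G" "(\<phi> ^^ n) y = x" using it_surj x by blast
  then have "y \<in> K (Suc n)" using x by (simp add: K_def)
  then have "y \<in> K n" using stop by blast
  then show "x = \<one>\<^bsub>G\<^esub>" using y by (simp add: K_def)
qed

text \<open>A subgroup \<open>K\<close> is generated by generators of its intersection with the kernel together with preimages
  of generators of its image.\<close>

lemma noetherian_in_extension:
  assumes G: "group G" and Q: "group Q" and H: "subgroup H G"
    and p_closed: "\<And>x. x \<in> H \<Longrightarrow> p x \<in> carrier Q"
    and p_mult: "\<And>x y. x \<in> H \<Longrightarrow> y \<in> H \<Longrightarrow> p (x \<otimes>\<^bsub>G\<^esub> y) = p x \<otimes>\<^bsub>Q\<^esub> p y"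
    and noeth_Q: "noetherian_in Q (carrier Q)"
    and noeth_ker: "noetherian_in G {x \<in> H. p x = \<one>\<^bsub>Q\<^esub>}"
  shows "noetherian_in G H"
  unfolding noetherian_in_def
proof (intro allI impI, elim conjE)
  fix K assume K: "subgroup K G" "K \<subseteq> H"
  interpret G: group G by fact
  interpret Q: group Q by fact
  have p_one: "p \<one>\<^bsub>G\<^esub> = \<one>\<^bsub>Q\<^esub>"
    using p_mult[of "\<one>\<^bsub>G\<^esub>" "\<one>\<^bsub>G\<^esub>"] p_closed[of "\<one>\<^bsub>G\<^esub>"] H subgroup.one_closed Q.r_cancel_one
    by (metis G.l_one G.one_closed)
  have p_inv: "p (inv\<^bsub>G\<^esub> x) = inv\<^bsub>Q\<^esub> p x" if "x \<in> H" for x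
  proof -
    have "p (inv\<^bsub>G\<^esub> x) \<otimes>\<^bsub>Q\<^esub> p x = \<one>\<^bsub>Q\<^esub>"
      using p_mult[of "inv\<^bsub>G\<^esub> x" x] that p_one subgroup.m_inv_closed[OF H]
        subgroup.mem_carrier[OF H] by simp
    then show ?thesis
      using Q.inv_equality[of "p (inv\<^bsub>G\<^esub> x)" "p x"] p_closed that subgroup.m_inv_closed[OF H] by simp
  qed
  have pK: "subgroup (p ` K) Q"
  proof (rule Q.subgroupI)
    show "p ` K \<subseteq> carrier Q" using K p_closed by blast
    show "p ` K \<noteq> {}" using K subgroup.one_closed by blast
    show "inv\<^bsub>Q\<^esub> a \<in> p ` K" if a: "a \<in> p ` K" for a
    proof -
      obtain x where "x \<in> K" "a = p x" using a by blast
      then show ?thesis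
        using K p_inv[of x] subgroup.m_inv_closed[OF K(1), of x] by (metis imageI subsetD)
    qed
    show "a \<otimes>\<^bsub>Q\<^esub> b \<in> p ` K" if ab: "a \<in> p ` K" "b \<in> p ` K" for a b
    proof -
      obtain x y where "x \<in> K" "a = p x" "y \<in> K" "b = p y" using ab by blast
      then show ?thesis
        using K p_mult[of x y] subgroup.m_closed[OF K(1), of x y] by (metis imageI subsetD)
    qed
  qed
  obtain S where S: "finite S" "S \<subseteq> p ` K" "generate Q S = p ` K"
    using noetherian_inE[OF noeth_Q pK subgroup.subset[OF pK]] .
  obtain T where T: "T \<subseteq> K" "finite T" "S = p ` T"
    using finite_subset_image[OF S(1,2)] by blast
  define U where "U = {x \<in> K. p x = \<one>\<^bsub>Q\<^esub>}"
  have U: "subgroup U G"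
    by (rule G.subgroupI)
      (use K p_one p_inv p_mult subgroup.one_closed[OF K(1)] subgroup.m_inv_closed[OF K(1)]
         subgroup.m_closed[OF K(1)] subgroup.mem_carrier[OF K(1)] in \<open>auto simp: U_def subset_iff\<close>)
  have U_ker: "U \<subseteq> {x \<in> H. p x = \<one>\<^bsub>Q\<^esub>}" using K by (auto simp: U_def)
  obtain V where V: "finite V" "V \<subseteq> U" "generate G V = U"
    using noetherian_inE[OF noeth_ker U U_ker] .
  have TV: "T \<union> V \<subseteq> K" using T V by (auto simp: U_def)
  have TVc: "T \<union> V \<subseteq> carrier G" and Tc: "T \<subseteq> carrier G"
    using TV T K subgroup.subset by blast+
  have gT: "generate G T \<subseteq> K" using G.generate_subgroup_incl[OF T(1) K(1)] .
  have "subgroup (p ` generate G T) Q"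
  proof (rule Q.subgroupI)
    note gs = G.generate_is_subgroup[OF Tc]
    show "p ` generate G T \<subseteq> carrier Q" using gT K p_closed by blast
    show "p ` generate G T \<noteq> {}" using subgroup.one_closed[OF gs] by blast
    show "inv\<^bsub>Q\<^esub> a \<in> p ` generate G T" if a: "a \<in> p ` generate G T" for a
    proof -
      obtain x where "x \<in> generate G T" "a = p x" using a by blast
      then show ?thesis
        using gT K p_inv[of x] subgroup.m_inv_closed[OF gs, of x] by (metis imageI subsetD)
    qed
    show "a \<otimes>\<^bsub>Q\<^esub> b \<in> p ` generate G T"
      if ab: "a \<in> p ` generate G T" "b \<in> p ` generate G T" for a b
    proof -
      obtain x y where "x \<in> generate G T" "a = p x" "y \<in> generate G T" "b = p y" using ab by blast
      then show ?thesis
        using gT K p_mult[of x y] subgroup.m_closed[OF gs, of x y] by (metis imageI subsetD)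
    qed
  qed
  moreover have "p ` T \<subseteq> p ` generate G T" by (auto intro: generate.incl)
  ultimately have img: "p ` K \<subseteq> p ` generate G T"
    using Q.generate_subgroup_incl S T by blast
  have "K \<subseteq> generate G (T \<union> V)"
  proof
    fix x assume x: "x \<in> K"
    then obtain t where t: "t \<in> generate G T" "p x = p t" using img by blast
    have tK: "t \<in> K" using t gT by blast
    have "p (x \<otimes>\<^bsub>G\<^esub> inv\<^bsub>G\<^esub> t) = \<one>\<^bsub>Q\<^esub>"
      using x tK K p_mult p_inv p_closed t subgroup.m_inv_closed[OF K(1)]
      by (metis Q.r_inv subsetD)
    then have "x \<otimes>\<^bsub>G\<^esub> inv\<^bsub>G\<^esub> t \<in> generate G V"
      using x tK K V subgroup.m_inv_closed[OF K(1)] subgroup.m_closed[OF K(1)]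
      by (auto simp: U_def)
    then have "(x \<otimes>\<^bsub>G\<^esub> inv\<^bsub>G\<^esub> t) \<otimes>\<^bsub>G\<^esub> t \<in> generate G (T \<union> V)"
      using t G.mono_generate[of V "T \<union> V"] G.mono_generate[of T "T \<union> V"]
      by (blast intro: generate.eng)
    then show "x \<in> generate G (T \<union> V)"
      using x tK K subgroup.mem_carrier[OF K(1)] by (simp add: G.m_assoc)
  qed
  then have "generate G (T \<union> V) = K"
    using G.generate_subgroup_incl[OF TV K(1)] by blast
  then show "\<exists>S. finite S \<and> S \<subseteq> K \<and> generate G S = K"
    using TV T V by (intro exI[of _ "T \<union> V"]) auto
qed

text \<open>Over a normal subgroup all of whose subgroups are finitely generated, one more generator
  adds at most one generator to each subgroup: the element with least positive exponent.\<close>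

lemma (in group) noetherian_in_cyclic_extension:
  assumes "H \<lhd> G" and noeth: "noetherian_in G H" and s: "s \<in> carrier G"
    and M: "\<And>x. x \<in> M \<Longrightarrow> x \<in> carrier G \<and> (\<exists>i::int. H #> x = H #> s [^] i)"
  shows "noetherian_in G M"
  unfolding noetherian_in_def
proof (intro allI impI, elim conjE)
  interpret H: normal H G by fact
  have H_sub: "subgroup H G" by (rule H.subgroup_axioms)
  interpret q: group_hom G "G Mod H" "\<lambda>a. H #> a"
    using H.r_coset_hom_Mod H.factorgroup_is_group is_group
    by (simp add: group_hom_def group_hom_axioms_def)
  fix K assume K: "subgroup K G" "K \<subseteq> M"
  interpret K: subgroup K G by fact
  obtain U where U: "finite U" "U \<subseteq> K \<inter> H" "generate G U = K \<inter> H"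
    using noetherian_inE[OF noeth subgroups_Inter_pair[OF K(1) H_sub] Int_lower2] .
  define I where "I = {i::int. \<exists>x\<in>K. H #> x = H #> s [^] i}"
  show "\<exists>S. finite S \<and> S \<subseteq> K \<and> generate G S = K"
  proof (cases "\<exists>n::nat. 0 < n \<and> int n \<in> I")
    case False
    have "K \<subseteq> H"
    proof
      fix x assume x: "x \<in> K"
      then obtain i :: int where i: "H #> x = H #> s [^] i" using M[of x] subsetD[OF K(2) x] by blast
      have "H #> inv x = H #> s [^] (-i)"
        using i x s q.hom_inv[of x] q.hom_inv[of "s [^] i"] int_pow_neg[OF s, of i]
        K.mem_carrier[OF x] int_pow_closed[OF s, of i] by metis
      then have "- i \<in> I" "i \<in> I" using i x unfolding I_def by blast+
      then have "\<not> 0 < i" "\<not> 0 < - i"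
        using False by (metis zero_less_nat_eq int_nat_eq less_imp_le)+
      then have "i = 0" by linarith
      then have "H #> x = H #> \<one>" using i by simp
      then show "x \<in> H" using coset_eq_iff[OF H_sub, of x \<one>] x by simp
    qed
    then show ?thesis using noeth K unfolding noetherian_in_def by blast
  next
    case True
    define n where "n = (LEAST n::nat. 0 < n \<and> int n \<in> I)"
    have n: "0 < n" "int n \<in> I"
      using LeastI_ex[OF True] by (simp_all add: n_def)
    have n_least: "\<not> (0 < m \<and> int m \<in> I)" if "m < n" for m
      using not_less_Least that unfolding n_def by blast
    obtain k where k: "k \<in> K" "H #> k = H #> s [^] int n" using n unfolding I_def by blast
    have kU: "insert k U \<subseteq> K" using k U by blast
    have "K \<subseteq> generate G (insert k U)"
    proof
      fix x assume x: "x \<in> K"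
      then obtain i :: int where i: "H #> x = H #> s [^] i" using M[of x] subsetD[OF K(2) x] by blast
      define e where "e = i div int n"
      let ?y = "x \<otimes> inv (k [^] e)"
      have ke: "k [^] e \<in> K" using subgroup_int_pow_closed[OF K(1) k(1)] .
      have yK: "?y \<in> K" using x ke by simp
      have "H #> (k [^] e) = (H #> k) [^]\<^bsub>G Mod H\<^esub> e"
        using k q.hom_int_pow by simp
      also have "\<dots> = H #> ((s [^] int n) [^] e)"
        using k s q.hom_int_pow[of "s [^] int n"] by simp
      also have "(s [^] int n) [^] e = s [^] (int n * e)" using s by (simp add: int_pow_pow)
      finally have ek: "H #> (k [^] e) = H #> s [^] (int n * e)" .
      have "H #> ?y = H #> (s [^] i \<otimes> inv (s [^] (int n * e)))"
        using x k s i ek ke by (simp del: H.rcos_inv)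
      also have "s [^] i \<otimes> inv (s [^] (int n * e)) = s [^] (i mod int n)"
        using s by (simp add: int_pow_diff[symmetric] e_def minus_mult_div_eq_mod)
      finally have y: "H #> ?y = H #> s [^] (i mod int n)" .
      have "i mod int n = 0"
      proof (rule ccontr)
        assume ne: "i mod int n \<noteq> 0"
        have "i mod int n \<ge> 0" "i mod int n < int n" using n by simp_all
        then have "nat (i mod int n) < n" "0 < nat (i mod int n)"
          using ne by linarith+
        moreover have "int (nat (i mod int n)) \<in> I"
          using y yK n unfolding I_def by auto
        ultimately show False using n_least by blast
      qed
      then have "?y \<in> H"
        using y coset_eq_iff[OF H_sub, of ?y \<one>] yK by simp
      then have "?y \<in> generate G (insert k U)"
        using yK U mono_generate[of U "insert k U"] by blast
      moreover have "k [^] e \<in> generate G (insert k U)"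
        using subgroup_int_pow_closed[OF generate_is_subgroup] kU K.subset
          generate.incl[of k "insert k U" G] by (meson insertI1 order_trans)
      ultimately have "?y \<otimes> k [^] e \<in> generate G (insert k U)" by (rule generate.eng)
      then show "x \<in> generate G (insert k U)"
        using x ke K.mem_carrier by (simp add: m_assoc)
    qed
    then have "generate G (insert k U) = K"
      using generate_subgroup_incl[OF kU K(1)] by blast
    then show ?thesis using U kU by (intro exI[of _ "insert k U"]) auto
  qed
qed

section \<open>Commutators and the upper central series\<close>

definition commutator :: "('a, 'm) monoid_scheme \<Rightarrow> 'a \<Rightarrow> 'a \<Rightarrow> 'a" where
  "commutator G x y = x \<otimes>\<^bsub>G\<^esub> y \<otimes>\<^bsub>G\<^esub> inv\<^bsub>G\<^esub> x \<otimes>\<^bsub>G\<^esub> inv\<^bsub>G\<^esub> y"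

primrec left_normed :: "('a, 'm) monoid_scheme \<Rightarrow> 'a \<Rightarrow> 'a list \<Rightarrow> 'a" where
  "left_normed G x [] = x"
| "left_normed G x (y # ys) = left_normed G (commutator G x y) ys"

lemma left_normed_append: "left_normed G x (ys @ zs) = left_normed G (left_normed G x ys) zs"
  by (induction ys arbitrary: x) auto

definition nilpotent_class :: "('a, 'm) monoid_scheme \<Rightarrow> nat \<Rightarrow> bool" where
  "nilpotent_class G c \<longleftrightarrow>
     (\<forall>x\<in>carrier G. \<forall>ys. set ys \<subseteq> carrier G \<longrightarrow> length ys = c \<longrightarrow> left_normed G x ys = \<one>\<^bsub>G\<^esub>)"

context group
begin

lemma commutator_closed [simp]:
  "x \<in> carrier G \<Longrightarrow> y \<in> carrier G \<Longrightarrow> commutator G x y \<in> carrier G"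
  by (simp add: commutator_def)

lemma commutator_one [simp]:
  "x \<in> carrier G \<Longrightarrow> commutator G \<one> x = \<one>" "x \<in> carrier G \<Longrightarrow> commutator G x \<one> = \<one>"
  by (simp_all add: commutator_def)

lemma left_normed_closed [simp]:
  "x \<in> carrier G \<Longrightarrow> set ys \<subseteq> carrier G \<Longrightarrow> left_normed G x ys \<in> carrier G"
  by (induction ys arbitrary: x) auto

lemma commutator_eq_one_iff:
  assumes "x \<in> carrier G" "y \<in> carrier G"
  shows "commutator G x y = \<one> \<longleftrightarrow> x \<otimes> y = y \<otimes> x"
proof -
  have "commutator G x y = (x \<otimes> y) \<otimes> inv (y \<otimes> x)"
    using assms by (simp add: commutator_def word_simps)
  then show ?thesis using assms
    by (metis inv_closed inv_equality inv_inv m_closed r_inv)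
qed

lemma subgroup_commutes_mod:
  assumes "L \<lhd> G" "a \<in> carrier G"
  shows "subgroup {g \<in> carrier G. commutator G a g \<in> L} G"
proof -
  interpret L: normal L G by fact
  show ?thesis
  proof (rule subgroupI)
    show "{g \<in> carrier G. commutator G a g \<in> L} \<noteq> {}" using assms L.one_closed
      by (auto intro!: exI[of _ \<one>])
  next
    fix g assume g: "g \<in> {g \<in> carrier G. commutator G a g \<in> L}"
    have "commutator G a (inv g) = inv g \<otimes> inv (commutator G a g) \<otimes> g"
      using g assms by (simp add: commutator_def word_simps)
    then show "inv g \<in> {g \<in> carrier G. commutator G a g \<in> L}"
      using g assms L.inv_op_closed1 by auto
  next
    fix g h assume g: "g \<in> {g \<in> carrier G. commutator G a g \<in> L}"
      and h: "h \<in> {g \<in> carrier G. commutator G a g \<in> L}"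
    have "commutator G a (g \<otimes> h) = commutator G a g \<otimes> (g \<otimes> commutator G a h \<otimes> inv g)"
      using g h assms by (simp add: commutator_def word_simps)
    then show "g \<otimes> h \<in> {g \<in> carrier G. commutator G a g \<in> L}"
      using g h assms L.inv_op_closed2 by auto
  qed auto
qed

lemma normal_central_mod:
  assumes "L \<lhd> G"
  shows "{x \<in> carrier G. \<forall>g\<in>carrier G. commutator G x g \<in> L} \<lhd> G" (is "?C \<lhd> G")
proof -
  interpret L: normal L G by fact
  have "subgroup ?C G"
  proof (rule subgroupI)
    show "?C \<noteq> {}" using L.one_closed by (auto intro!: exI[of _ \<one>])
  next
    fix x assume x: "x \<in> ?C"
    have "commutator G (inv x) g \<in> L" if g: "g \<in> carrier G" for g
    proof -
      have "commutator G (inv x) g = inv x \<otimes> inv (commutator G x g) \<otimes> x"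
        using g x by (simp add: commutator_def word_simps)
      then show ?thesis using g x L.inv_op_closed1 by auto
    qed
    then show "inv x \<in> ?C" using x by auto
  next
    fix x y assume x: "x \<in> ?C" and y: "y \<in> ?C"
    have "commutator G (x \<otimes> y) g \<in> L" if g: "g \<in> carrier G" for g
    proof -
      have "commutator G (x \<otimes> y) g = (x \<otimes> commutator G y g \<otimes> inv x) \<otimes> commutator G x g"
        using g x y by (simp add: commutator_def word_simps)
      then show ?thesis using g x y L.inv_op_closed2 by auto
    qed
    then show "x \<otimes> y \<in> ?C" using x y by auto
  qed auto
  moreover have "h \<otimes> x \<otimes> inv h \<in> ?C" if x: "x \<in> ?C" and h: "h \<in> carrier G" for x h
  proof -
    have "commutator G (h \<otimes> x \<otimes> inv h) g \<in> L" if g: "g \<in> carrier G" for g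
    proof -
      have "commutator G (h \<otimes> x \<otimes> inv h) g = h \<otimes> commutator G x (inv h \<otimes> g \<otimes> h) \<otimes> inv h"
        using g x h by (simp add: commutator_def word_simps)
      then show ?thesis using g x h L.inv_op_closed2 by auto
    qed
    then show ?thesis using x h by auto
  qed
  ultimately show ?thesis by (auto intro!: normal_invI)
qed

lemma upper_central_Suc_if_normal:
  assumes "upper_central G i \<lhd> G"
  shows "upper_central G (Suc i) =
           {x \<in> carrier G. \<forall>g\<in>carrier G. commutator G x g \<in> upper_central G i}"
proof -
  let ?L = "upper_central G i"
  interpret L: normal ?L G by fact
  have L_sub: "subgroup ?L G" by (rule L.subgroup_axioms)
  have "?L #> x \<in> centre (G Mod ?L) \<longleftrightarrow> (\<forall>g\<in>carrier G. commutator G x g \<in> ?L)"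
    if x: "x \<in> carrier G" for x
  proof -
    have "?L #> x \<in> centre (G Mod ?L) \<longleftrightarrow>
            (\<forall>g\<in>carrier G. ?L #> (x \<otimes> g) = ?L #> (g \<otimes> x))"
      using x by (auto simp: centre_def carrier_FactGroup L.rcos_sum)
    also have "\<dots> \<longleftrightarrow> (\<forall>g\<in>carrier G. commutator G x g \<in> ?L)"
      using x by (intro ball_cong refl)
        (simp add: coset_eq_iff[OF L_sub] commutator_def word_simps)
    finally show ?thesis .
  qed
  then show ?thesis by auto
qed

lemma upper_central_normal: "upper_central G i \<lhd> G"
proof (induction i)
  case 0 show ?case using one_is_normal by simp
next
  case (Suc i)
  show ?case
    unfolding upper_central_Suc_if_normal[OF Suc] by (rule normal_central_mod[OF Suc])
qed

lemma upper_central_Suc: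
  "upper_central G (Suc i) =
     {x \<in> carrier G. \<forall>g\<in>carrier G. commutator G x g \<in> upper_central G i}"
  by (rule upper_central_Suc_if_normal[OF upper_central_normal])

declare upper_central.simps(2) [simp del]

lemma upper_central_subgroup: "subgroup (upper_central G i) G"
  using upper_central_normal normal_imp_subgroup by blast

lemma upper_central_mono_Suc: "upper_central G i \<subseteq> upper_central G (Suc i)"
proof
  fix x assume x: "x \<in> upper_central G i"
  interpret L: normal "upper_central G i" G by (rule upper_central_normal)
  have "commutator G x g \<in> upper_central G i" if "g \<in> carrier G" for g
  proof -
    have "commutator G x g = x \<otimes> (g \<otimes> inv x \<otimes> inv g)"
      using that x by (simp add: commutator_def word_simps)
    then show ?thesis using x that L.inv_op_closed2 by simp
  qed
  then show "x \<in> upper_central G (Suc i)" using x by (auto simp: upper_central_Suc)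
qed

lemma left_normed_upper_central:
  "x \<in> upper_central G (n + length ys) \<Longrightarrow> set ys \<subseteq> carrier G \<Longrightarrow>
   left_normed G x ys \<in> upper_central G n"
  by (induction ys arbitrary: x) (auto simp: upper_central_Suc)

lemma nilpotent_classI:
  assumes "upper_central G c = carrier G" shows "nilpotent_class G c"
  unfolding nilpotent_class_def using left_normed_upper_central[of _ 0] assms by auto

lemma normal_generate_central_mod:
  assumes "L \<lhd> G" "S \<subseteq> carrier G"
    and S: "\<And>s g. s \<in> S \<Longrightarrow> g \<in> carrier G \<Longrightarrow> commutator G s g \<in> L"
  shows "generate G (S \<union> L) \<lhd> G"
proof (rule normal_invI)
  interpret L: normal L G by fact
  let ?M = "generate G (S \<union> L)"
  let ?C = "{x \<in> carrier G. \<forall>g\<in>carrier G. commutator G x g \<in> L}"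
  have SL: "S \<union> L \<subseteq> carrier G" using assms L.subset by auto
  show sub: "subgroup ?M G" by (rule generate_is_subgroup[OF SL])
  have "commutator G l g \<in> L" if "l \<in> L" "g \<in> carrier G" for l g
  proof -
    have "commutator G l g = l \<otimes> (g \<otimes> inv l \<otimes> inv g)"
      using that by (simp add: commutator_def word_simps)
    then show ?thesis using that L.inv_op_closed2 by simp
  qed
  then have "S \<union> L \<subseteq> ?C" using S assms L.subset by auto
  then have MC: "?M \<subseteq> ?C"
    by (rule generate_subgroup_incl) (rule normal_imp_subgroup[OF normal_central_mod[OF assms(1)]])
  fix g x assume gx: "g \<in> carrier G" "x \<in> ?M"
  then have x: "x \<in> carrier G" and "commutator G x g \<in> L" using MC by auto
  then have "inv (commutator G x g) \<in> L" by simp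
  then have "inv (commutator G x g) \<in> ?M" by (auto intro: generate.incl)
  then have "inv (commutator G x g) \<otimes> x \<in> ?M" using gx by (blast intro: generate.eng)
  then show "g \<otimes> x \<otimes> inv g \<in> ?M" using gx x by (simp add: commutator_def word_simps)
qed

lemma noetherian_in_central_extension:
  assumes "finite S" "L \<lhd> G" "noetherian_in G L" "S \<subseteq> carrier G"
    and "\<And>s g. s \<in> S \<Longrightarrow> g \<in> carrier G \<Longrightarrow> commutator G s g \<in> L"
  shows "noetherian_in G (generate G (S \<union> L))"
  using assms(1,4,5)
proof (induction S)
  case empty
  have "generate G L = L"
    using normal_imp_subgroup[OF assms(2)] generate_subgroup_incl[of L L] generate.incl[of _ L G]
    by blast
  then show ?case using assms(3) by simp
next
  case (insert s S)
  let ?M = "generate G (S \<union> L)"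
  have sc: "s \<in> carrier G" and L: "L \<subseteq> carrier G"
    using insert.prems subgroup.subset[OF normal_imp_subgroup[OF assms(2)]] by auto
  have M: "?M \<lhd> G" using normal_generate_central_mod[OF assms(2)] insert by blast
  have noeth: "noetherian_in G ?M" using insert by blast
  interpret M: normal ?M G by fact
  interpret q: group_hom G "G Mod ?M" "\<lambda>a. ?M #> a"
    using M.r_coset_hom_Mod M.factorgroup_is_group is_group
    by (simp add: group_hom_def group_hom_axioms_def)
  have triv: "?M #> x = ?M #> s [^] (0::int)" if "x \<in> ?M" for x
    using that coset_eq_iff[OF M.subgroup_axioms, of x \<one>] M.mem_carrier by simp
  show ?case
  proof (rule noetherian_in_cyclic_extension[OF M noeth sc])
    fix x assume "x \<in> generate G (insert s S \<union> L)"
    then show "x \<in> carrier G \<and> (\<exists>i::int. ?M #> x = ?M #> s [^] i)"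
    proof (induction rule: generate.induct)
      case one then show ?case using triv[OF M.one_closed] by blast
    next
      case (incl h)
      show ?case
      proof (cases "h = s")
        case True
        then show ?thesis using sc by (metis int_pow_1)
      next
        case False
        then have "h \<in> ?M" using incl by (auto intro: generate.incl)
        then show ?thesis using triv M.mem_carrier by blast
      qed
    next
      case (inv h)
      show ?case
      proof (cases "h = s")
        case True
        then show ?thesis using sc by (metis int_pow_1 int_pow_neg inv_closed)
      next
        case False
        then have "inv h \<in> ?M" using inv by (auto intro: generate.inv)
        then show ?thesis using triv M.mem_carrier by blast
      qed
    next
      case (eng x y)
      then obtain i j :: int where ij: "?M #> x = ?M #> s [^] i" "?M #> y = ?M #> s [^] j"
        by blast
      have "?M #> (x \<otimes> y) = ?M #> (s [^] i \<otimes> s [^] j)"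
        using eng ij sc q.hom_mult[of x y] q.hom_mult[of "s [^] i" "s [^] j"] by simp
      then show ?case using eng sc by (metis int_pow_mult m_closed)
    qed
  qed
qed

text \<open>Let \<open>A\<close> generate \<open>G\<close>. The left-normed commutators in \<open>A\<close> of weight at least \<open>i + 1\<close> generate
  a subgroup \<open>L\<^sub>i\<close>, and \<open>L\<^sub>i\<close> is generated by finitely many elements that are central modulo
  \<open>L\<^sub>i\<^sub>+\<^sub>1\<close>, because they commute with the generators \<open>A\<close> modulo \<open>L\<^sub>i\<^sub>+\<^sub>1\<close>. So \<open>G = L\<^sub>0\<close> arises
  from the trivial group by finitely many central extensions by cyclic groups.\<close>

lemma finitely_generated_nilpotent_noetherian:
  assumes "finitely_generated G" "nilpotent_class G c"
  shows "noetherian_in G (carrier G)"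
proof -
  obtain A where A: "finite A" "A \<subseteq> carrier G" "generate G A = carrier G"
    using assms(1) unfolding finitely_generated_def by blast
  define S where "S i = {left_normed G s xs | s xs. s \<in> A \<and> set xs \<subseteq> A \<and> length xs = i}" for i
  define L where "L i = generate G (\<Union>j\<in>{i..<c}. S j)" for i
  have S_fin: "finite (S i)" for i
  proof -
    have "S i = (\<lambda>(s, xs). left_normed G s xs) ` (A \<times> {xs. set xs \<subseteq> A \<and> length xs = i})"
      by (auto simp: S_def image_iff)
    then show ?thesis using finite_lists_length_eq[OF A(1)] A(1) by auto
  qed
  have S_car: "S i \<subseteq> carrier G" for i
  proof -
    have "left_normed G s xs \<in> carrier G" if "s \<in> A" "set xs \<subseteq> A" for s xs
      using that A(2) by (intro left_normed_closed) auto
    then show ?thesis by (auto simp: S_def)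
  qed
  have S_c: "S i \<subseteq> {\<one>}" if "c = i" for i
    using that assms(2) A(2) unfolding S_def nilpotent_class_def by fastforce
  have L_step: "L i = generate G (S i \<union> L (Suc i))" if "i < c" for i
  proof (rule equalityI)
    have ivl: "{i..<c} = insert i {Suc i..<c}" using that by auto
    have "S i \<union> L (Suc i) \<subseteq> L i"
      unfolding L_def ivl using mono_generate[of "\<Union>j\<in>{Suc i..<c}. S j" "\<Union>j\<in>insert i {Suc i..<c}. S j"]
      by (auto intro: generate.incl)
    then show "generate G (S i \<union> L (Suc i)) \<subseteq> L i"
      unfolding L_def by (rule generate_subgroup_incl) (use S_car in \<open>auto intro: generate_is_subgroup\<close>)
    show "L i \<subseteq> generate G (S i \<union> L (Suc i))"
      unfolding L_def[of i] ivl
      by (rule mono_generate) (auto simp: L_def intro: generate.incl)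
  qed
  have "L (c - k) \<lhd> G \<and> noetherian_in G (L (c - k))" for k
  proof (induction k)
    case 0
    have "generate G {} = {\<one>}" using generate_empty by simp
    then have "L c = {\<one>}" by (simp add: L_def)
    then show ?case using one_is_normal noetherian_in_finite by simp
  next
    case (Suc k)
    show ?case
    proof (cases "k < c")
      case False then show ?thesis using Suc by simp
    next
      case True
      define i where "i = c - Suc k"
      have i: "i < c" "c - k = Suc i" using True by (auto simp: i_def)
      have normal: "L (Suc i) \<lhd> G" and noeth: "noetherian_in G (L (Suc i))" using Suc i by simp_all
      have central: "commutator G s g \<in> L (Suc i)" if s: "s \<in> S i" and g: "g \<in> carrier G" for s g
      proof -
        have "A \<subseteq> {g \<in> carrier G. commutator G s g \<in> L (Suc i)}"
        proof
          fix x assume x: "x \<in> A"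
          obtain t ts where t: "s = left_normed G t ts" "t \<in> A" "set ts \<subseteq> A" "length ts = i"
            using s by (auto simp: S_def)
          have "commutator G s x = left_normed G t (ts @ [x])" using t by (simp add: left_normed_append)
          then have *: "commutator G s x \<in> S (Suc i)"
            unfolding S_def using t x by (intro CollectI exI[of _ t] exI[of _ "ts @ [x]"]) auto
          have "commutator G s x \<in> L (Suc i)"
          proof (cases "Suc i < c")
            case True
            then show ?thesis unfolding L_def using * by (intro generate.incl) auto
          next
            case False
            then have "commutator G s x = \<one>" using * S_c i by (metis Suc_lessI singletonD subsetD)
            then show ?thesis by (simp add: L_def generate.one)
          qed
          then show "x \<in> {g \<in> carrier G. commutator G s g \<in> L (Suc i)}" using x A(2) by auto
        qed
        moreover have "s \<in> carrier G" using s S_car by blast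
        ultimately have "generate G A \<subseteq> {g \<in> carrier G. commutator G s g \<in> L (Suc i)}"
          using generate_subgroup_incl subgroup_commutes_mod[OF normal] by blast
        then show ?thesis using g A by blast
      qed
      show ?thesis
        using normal_generate_central_mod[OF normal S_car central]
          noetherian_in_central_extension[OF S_fin normal noeth S_car central]
        unfolding i_def[symmetric] L_step[OF i(1)] by blast
    qed
  qed
  from this[of c] have noeth: "noetherian_in G (L 0)" by simp
  have "L 0 = carrier G"
  proof (cases "c = 0")
    case True
    then have "carrier G = {\<one>}" using assms(2) unfolding nilpotent_class_def by fastforce
    then show ?thesis using True generate_empty by (simp add: L_def)
  next
    case False
    have "A \<subseteq> S 0" unfolding S_def by (auto intro: exI[of _ "[]"])
    then have "A \<subseteq> (\<Union>j\<in>{0..<c}. S j)" using False by auto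
    then have "carrier G \<subseteq> L 0" unfolding L_def using mono_generate A(3) by blast
    moreover have "L 0 \<subseteq> carrier G" unfolding L_def using S_car by (intro generate_incl) auto
    ultimately show ?thesis by blast
  qed
  then show ?thesis using noeth by simp
qed

end

section \<open>Wreath products\<close>

locale wreath = D: group D + T: group T
  for D :: "('a, 'm) monoid_scheme" and T :: "('b, 'n) monoid_scheme"
begin

abbreviation W :: "(('b \<Rightarrow> 'a) \<times> 'b) monoid" where
  "W \<equiv> D \<wr> T"

lemma carrier_W:
  "w \<in> carrier W \<longleftrightarrow> fst w \<in> carrier T \<rightarrow>\<^sub>E carrier D \<and>
     finite {x \<in> carrier T. fst w x \<noteq> \<one>\<^bsub>D\<^esub>} \<and> snd w \<in> carrier T"
  by (cases w) (auto simp: wreath_product_def semidirect_product_def carrier_sum_group D.is_group)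

lemma fst_closed [simp]: "w \<in> carrier W \<Longrightarrow> x \<in> carrier T \<Longrightarrow> fst w x \<in> carrier D"
  by (auto simp: carrier_W)

lemma snd_closed [simp]: "w \<in> carrier W \<Longrightarrow> snd w \<in> carrier T"
  by (auto simp: carrier_W)

lemma W_mult:
  "u \<otimes>\<^bsub>W\<^esub> v =
     ((\<lambda>x\<in>carrier T. fst u x \<otimes>\<^bsub>D\<^esub> fst v (inv\<^bsub>T\<^esub> (snd u) \<otimes>\<^bsub>T\<^esub> x)), snd u \<otimes>\<^bsub>T\<^esub> snd v)"
  by (cases u; cases v)
    (auto simp: wreath_product_def semidirect_product_def shift_action_def fun_eq_iff)

lemma snd_mult [simp]: "snd (u \<otimes>\<^bsub>W\<^esub> v) = snd u \<otimes>\<^bsub>T\<^esub> snd v"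
  by (simp add: W_mult)

lemma fst_mult [simp]:
  "x \<in> carrier T \<Longrightarrow>
   fst (u \<otimes>\<^bsub>W\<^esub> v) x = fst u x \<otimes>\<^bsub>D\<^esub> fst v (inv\<^bsub>T\<^esub> (snd u) \<otimes>\<^bsub>T\<^esub> x)"
  by (simp add: W_mult)

lemma snd_one [simp]: "snd \<one>\<^bsub>W\<^esub> = \<one>\<^bsub>T\<^esub>"
  by (simp add: wreath_product_def semidirect_product_def)

lemma fst_one [simp]: "x \<in> carrier T \<Longrightarrow> fst \<one>\<^bsub>W\<^esub> x = \<one>\<^bsub>D\<^esub>"
  by (simp add: wreath_product_def semidirect_product_def)

lemma W_eqI:
  assumes "u \<in> carrier W" "v \<in> carrier W" "snd u = snd v"
    and "\<And>x. x \<in> carrier T \<Longrightarrow> fst u x = fst v x"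
  shows "u = v"
proof (rule prod_eqI)
  show "fst u = fst v"
    by (rule PiE_ext[of _ "carrier T" "\<lambda>_. carrier D"]) (use assms in \<open>auto simp: carrier_W\<close>)
qed (use assms in auto)

lemma finite_shifted_support:
  assumes "finite {x \<in> carrier T. f x \<noteq> \<one>\<^bsub>D\<^esub>}" "g \<in> carrier T"
  shows "finite {x \<in> carrier T. f (g \<otimes>\<^bsub>T\<^esub> x) \<noteq> \<one>\<^bsub>D\<^esub>}"
proof (rule finite_subset)
  show "finite ((\<lambda>x. inv\<^bsub>T\<^esub> g \<otimes>\<^bsub>T\<^esub> x) ` {x \<in> carrier T. f x \<noteq> \<one>\<^bsub>D\<^esub>})"
    using assms by simp
  show "{x \<in> carrier T. f (g \<otimes>\<^bsub>T\<^esub> x) \<noteq> \<one>\<^bsub>D\<^esub>} \<subseteq>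
          (\<lambda>x. inv\<^bsub>T\<^esub> g \<otimes>\<^bsub>T\<^esub> x) ` {x \<in> carrier T. f x \<noteq> \<one>\<^bsub>D\<^esub>}"
  proof
    fix x assume "x \<in> {x \<in> carrier T. f (g \<otimes>\<^bsub>T\<^esub> x) \<noteq> \<one>\<^bsub>D\<^esub>}"
    then show "x \<in> (\<lambda>x. inv\<^bsub>T\<^esub> g \<otimes>\<^bsub>T\<^esub> x) ` {x \<in> carrier T. f x \<noteq> \<one>\<^bsub>D\<^esub>}"
      using assms(2) by (intro image_eqI[of _ _ "g \<otimes>\<^bsub>T\<^esub> x"]) (auto simp: T.inv_mult_cancel)
  qed
qed

lemma W_mult_closed: "u \<in> carrier W \<Longrightarrow> v \<in> carrier W \<Longrightarrow> u \<otimes>\<^bsub>W\<^esub> v \<in> carrier W"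
proof -
  assume uv: "u \<in> carrier W" "v \<in> carrier W"
  have "finite ({x \<in> carrier T. fst u x \<noteq> \<one>\<^bsub>D\<^esub>} \<union>
                {x \<in> carrier T. fst v (inv\<^bsub>T\<^esub> (snd u) \<otimes>\<^bsub>T\<^esub> x) \<noteq> \<one>\<^bsub>D\<^esub>})"
    using uv finite_shifted_support by (auto simp: carrier_W)
  then have "finite {x \<in> carrier T. fst (u \<otimes>\<^bsub>W\<^esub> v) x \<noteq> \<one>\<^bsub>D\<^esub>}"
    by (rule rev_finite_subset) auto
  then show ?thesis using uv by (auto simp: carrier_W W_mult)
qed

sublocale W: group W
proof (rule groupI)
  show one: "\<one>\<^bsub>W\<^esub> \<in> carrier W"
  proof (unfold carrier_W, intro conjI)
    show "fst \<one>\<^bsub>W\<^esub> \<in> carrier T \<rightarrow>\<^sub>E carrier D"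
      by (simp add: wreath_product_def semidirect_product_def)
    have "{x \<in> carrier T. fst \<one>\<^bsub>W\<^esub> x \<noteq> \<one>\<^bsub>D\<^esub>} = {}" by auto
    then show "finite {x \<in> carrier T. fst \<one>\<^bsub>W\<^esub> x \<noteq> \<one>\<^bsub>D\<^esub>}" by (simp only: finite.emptyI)
  qed simp
  fix u assume u: "u \<in> carrier W"
  show "\<one>\<^bsub>W\<^esub> \<otimes>\<^bsub>W\<^esub> u = u"
    by (rule W_eqI) (use u one W_mult_closed in auto)
  let ?v = "((\<lambda>x\<in>carrier T. inv\<^bsub>D\<^esub> (fst u (snd u \<otimes>\<^bsub>T\<^esub> x))), inv\<^bsub>T\<^esub> (snd u))"
  have "finite {x \<in> carrier T. fst u (snd u \<otimes>\<^bsub>T\<^esub> x) \<noteq> \<one>\<^bsub>D\<^esub>}"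
    using u finite_shifted_support by (auto simp: carrier_W)
  then have "finite {x \<in> carrier T. fst ?v x \<noteq> \<one>\<^bsub>D\<^esub>}"
    by (rule rev_finite_subset) (use u in auto)
  then have v: "?v \<in> carrier W" using u by (auto simp: carrier_W)
  have "?v \<otimes>\<^bsub>W\<^esub> u = \<one>\<^bsub>W\<^esub>"
    by (rule W_eqI) (use u v one W_mult_closed in auto)
  then show "\<exists>v\<in>carrier W. v \<otimes>\<^bsub>W\<^esub> u = \<one>\<^bsub>W\<^esub>" using v by blast
next
  fix u v w assume uvw: "u \<in> carrier W" "v \<in> carrier W" "w \<in> carrier W"
  show "u \<otimes>\<^bsub>W\<^esub> v \<otimes>\<^bsub>W\<^esub> w = u \<otimes>\<^bsub>W\<^esub> (v \<otimes>\<^bsub>W\<^esub> w)"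
    by (rule W_eqI) (use uvw W_mult_closed in \<open>auto simp: T.word_simps D.m_assoc\<close>)
qed (rule W_mult_closed)

lemma snd_inv [simp]: "w \<in> carrier W \<Longrightarrow> snd (inv\<^bsub>W\<^esub> w) = inv\<^bsub>T\<^esub> (snd w)"
  using snd_mult[of "inv\<^bsub>W\<^esub> w" w] T.inv_equality[of "snd (inv\<^bsub>W\<^esub> w)" "snd w"] by simp

lemma fst_inv [simp]:
  assumes "w \<in> carrier W" "x \<in> carrier T"
  shows "fst (inv\<^bsub>W\<^esub> w) x = inv\<^bsub>D\<^esub> (fst w (snd w \<otimes>\<^bsub>T\<^esub> x))"
proof -
  have "fst (inv\<^bsub>W\<^esub> w) x \<otimes>\<^bsub>D\<^esub> fst w (snd w \<otimes>\<^bsub>T\<^esub> x) = fst (inv\<^bsub>W\<^esub> w \<otimes>\<^bsub>W\<^esub> w) x"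
    using assms by (subst fst_mult) simp_all
  also have "\<dots> = \<one>\<^bsub>D\<^esub>" using assms by (simp del: fst_mult)
  finally show ?thesis using assms by (intro D.inv_equality[symmetric]) simp_all
qed

definition base :: "(('b \<Rightarrow> 'a) \<times> 'b) set" where
  "base = {w \<in> carrier W. snd w = \<one>\<^bsub>T\<^esub>}"

definition single :: "'b \<Rightarrow> 'a \<Rightarrow> ('b \<Rightarrow> 'a) \<times> 'b" where
  "single x d = ((\<lambda>y\<in>carrier T. if y = x then d else \<one>\<^bsub>D\<^esub>), \<one>\<^bsub>T\<^esub>)"

definition top :: "'b \<Rightarrow> ('b \<Rightarrow> 'a) \<times> 'b" where
  "top g = ((\<lambda>y\<in>carrier T. \<one>\<^bsub>D\<^esub>), g)"

lemma fst_single [simp]: "y \<in> carrier T \<Longrightarrow> fst (single x d) y = (if y = x then d else \<one>\<^bsub>D\<^esub>)"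
  and snd_single [simp]: "snd (single x d) = \<one>\<^bsub>T\<^esub>"
  and fst_top [simp]: "y \<in> carrier T \<Longrightarrow> fst (top g) y = \<one>\<^bsub>D\<^esub>"
  and snd_top [simp]: "snd (top g) = g"
  by (simp_all add: single_def top_def)

lemma base_carrier [simp]: "w \<in> base \<Longrightarrow> w \<in> carrier W"
  unfolding base_def by blast

lemma baseI: "w \<in> carrier W \<Longrightarrow> snd w = \<one>\<^bsub>T\<^esub> \<Longrightarrow> w \<in> base"
  unfolding base_def by blast

lemma snd_base [simp]: "w \<in> base \<Longrightarrow> snd w = \<one>\<^bsub>T\<^esub>"
  unfolding base_def by blast

lemma top_closed [simp]: "g \<in> carrier T \<Longrightarrow> top g \<in> carrier W"
proof (unfold carrier_W, intro conjI)
  show "fst (top g) \<in> carrier T \<rightarrow>\<^sub>E carrier D" by (simp add: top_def)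
  have "{x \<in> carrier T. fst (top g) x \<noteq> \<one>\<^bsub>D\<^esub>} = {}" by auto
  then show "finite {x \<in> carrier T. fst (top g) x \<noteq> \<one>\<^bsub>D\<^esub>}" by (metis finite.emptyI)
qed simp

lemma single_base [simp]:
  assumes "x \<in> carrier T" "d \<in> carrier D" shows "single x d \<in> base"
proof -
  have "finite {y \<in> carrier T. fst (single x d) y \<noteq> \<one>\<^bsub>D\<^esub>}"
    by (rule finite_subset[of _ "{x}"]) (auto split: if_splits)
  then show ?thesis 
    by (intro baseI) (use assms in \<open>auto simp: carrier_W single_def\<close>)
qed

lemma top_mult: "g \<in> carrier T \<Longrightarrow> h \<in> carrier T \<Longrightarrow> top (g \<otimes>\<^bsub>T\<^esub> h) = top g \<otimes>\<^bsub>W\<^esub> top h"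
  by (rule W_eqI) auto

lemma top_one: "top \<one>\<^bsub>T\<^esub> = \<one>\<^bsub>W\<^esub>"
  by (rule W_eqI) auto

lemma base_normal: "base \<lhd> W"
proof (rule W.normal_invI)
  have "\<one>\<^bsub>W\<^esub> \<in> base" by (rule baseI) simp_all
  then have "base \<noteq> {}" by blast
  then show "subgroup base W"
    by (intro W.subgroupI baseI) (simp_all add: subset_iff del: split_paired_All)
qed (intro baseI; simp)

sublocale base: normal base W by (rule base_normal)

lemma base_times_top:
  assumes "w \<in> carrier W" obtains b where "b \<in> base" "w = b \<otimes>\<^bsub>W\<^esub> top (snd w)"
proof
  show "w \<otimes>\<^bsub>W\<^esub> inv\<^bsub>W\<^esub> top (snd w) \<in> base" using assms by (intro baseI) simp_all
  show "w = w \<otimes>\<^bsub>W\<^esub> inv\<^bsub>W\<^esub> top (snd w) \<otimes>\<^bsub>W\<^esub> top (snd w)" using assms by (simp add: W.m_assoc)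
qed

lemma base_eqI:
  assumes "u \<in> base" "v \<in> base" "\<And>x. x \<in> carrier T \<Longrightarrow> fst u x = fst v x"
  shows "u = v"
  using assms by (intro W_eqI) simp_all

lemma fst_commutator_base:
  assumes "b \<in> base" "w \<in> carrier W" "x \<in> carrier T"
  shows "fst (commutator W b w) x =
           fst b x \<otimes>\<^bsub>D\<^esub> fst w x \<otimes>\<^bsub>D\<^esub> inv\<^bsub>D\<^esub> (fst b (inv\<^bsub>T\<^esub> (snd w) \<otimes>\<^bsub>T\<^esub> x)) \<otimes>\<^bsub>D\<^esub> inv\<^bsub>D\<^esub> (fst w x)"
  using assms by (simp add: commutator_def T.word_simps)

lemma commutator_base: "b \<in> base \<Longrightarrow> b' \<in> base \<Longrightarrow> commutator W b b' \<in> base"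
  by (intro baseI) (simp_all add: commutator_def)

lemma fst_left_normed_base:
  assumes "b \<in> base" "set bs \<subseteq> base" "x \<in> carrier T"
  shows "fst (left_normed W b bs) x = left_normed D (fst b x) (map (\<lambda>b. fst b x) bs)"
  using assms
proof (induction bs arbitrary: b)
  case (Cons b' bs)
  have "fst (commutator W b b') x = commutator D (fst b x) (fst b' x)"
    using Cons.prems by (simp add: fst_commutator_base base_carrier) (simp add: commutator_def)
  then show ?case using Cons commutator_base by simp
qed simp

lemma left_normed_base: "b \<in> base \<Longrightarrow> set bs \<subseteq> base \<Longrightarrow> left_normed W b bs \<in> base"
  by (induction bs arbitrary: b) (auto simp: commutator_base)

lemma nilpotent_class_base:
  assumes "nilpotent_class D c" "b \<in> base" "set bs \<subseteq> base" "length bs = c"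
  shows "left_normed W b bs = \<one>\<^bsub>W\<^esub>"
proof (rule base_eqI)
  show "left_normed W b bs \<in> base" "\<one>\<^bsub>W\<^esub> \<in> base" using assms left_normed_base by auto
  fix x assume x: "x \<in> carrier T"
  have "set (map (\<lambda>b. fst b x) bs) \<subseteq> carrier D" using assms(3) x
    unfolding set_map by (intro image_subsetI fst_closed base_carrier) blast+
  then show "fst (left_normed W b bs) x = fst \<one>\<^bsub>W\<^esub> x"
    using assms x unfolding nilpotent_class_def by (simp add: fst_left_normed_base base_carrier)
qed

end

lemma (in group_hom) hom_commutator:
  "x \<in> carrier G \<Longrightarrow> y \<in> carrier G \<Longrightarrow> h (commutator G x y) = commutator H (h x) (h y)"
  by (simp add: commutator_def)

lemma (in group_hom) hom_left_normed:
  "x \<in> carrier G \<Longrightarrow> set ys \<subseteq> carrier G \<Longrightarrow>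
   h (left_normed G x ys) = left_normed H (h x) (map h ys)"
  by (induction ys arbitrary: x) (auto simp: hom_commutator)

lemma (in group) left_normed_one: "set ys \<subseteq> carrier G \<Longrightarrow> left_normed G \<one> ys = \<one>"
  by (induction ys) auto

section \<open>Surjective endomorphisms preserve the base group\<close>

context wreath
begin

text \<open>Let \<open>C\<close> be the image of the base group \<open>B\<close>, a normal subgroup of the same nilpotency class
  \<open>m + 1\<close>. Call \<open>y \<noteq> 1\<close> available if \<open>C \<inter> B\<close> contains, for each \<open>d\<close>, an element with
  value \<open>d\<close> at \<open>1\<close> and support in \<open>{1, y}\<close>. A nontrivial commutator \<open>e\<close> of weight \<open>m + 1\<close> in \<open>D\<close>
  lifts to a commutator \<open>z\<close> of such elements; it is central in \<open>C\<close>, has value \<open>e\<close> at \<open>1\<close>, and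
  every element of \<open>C\<close> with top component \<open>g\<close> moves this value to \<open>g\<close>. So \<open>g \<in> {1, y}\<close>.

  An element of \<open>C\<close> with top component \<open>g \<noteq> 1\<close> makes \<open>g\<close> available, so \<open>C\<close> has at
  most one nontrivial top component \<open>g\<^sub>0\<close>, a central involution. The endomorphism \<open>\<alpha>\<close> that \<open>\<phi>\<close>
  induces on \<open>T\<close> is then onto up to \<open>g\<^sub>0\<close>, and the Hopf property of \<open>T\<close>, applied to \<open>\<alpha>\<close> or to
  its correction by \<open>g\<^sub>0\<close>, shows that \<open>C \<inter> B\<close> has index at most two in \<open>B\<close>. Now every
  \<open>y \<noteq> 1\<close> is available, which leaves room for at most two elements of \<open>T\<close>.\<close>

theorem surjective_endomorphism_preserves_base:
  assumes hopf: "hopfian T" and nil: "nilpotent_class D c"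
    and large: "\<And>y. \<exists>x\<in>carrier T. x \<noteq> \<one>\<^bsub>T\<^esub> \<and> x \<noteq> y"
    and hom: "\<phi> \<in> hom W W" and surj: "\<phi> ` carrier W = carrier W"
    and b: "b \<in> base"
  shows "\<phi> b \<in> base"
proof (rule ccontr)
  assume not_base: "\<phi> b \<notin> base"
  interpret \<phi>: group_hom W W \<phi>
    using hom W.is_group by (simp add: group_hom_def group_hom_axioms_def)
  define C where "C = \<phi> ` base"
  have C_car: "C \<subseteq> carrier W" using base.subset by (auto simp: C_def)
  have C: "C \<lhd> W"
  proof (rule W.normal_invI)
    show C_sub: "subgroup C W"
      unfolding C_def by (rule \<phi>.subgroup_img_is_subgroup[OF base.subgroup_axioms])
    fix x h assume xh: "x \<in> carrier W" "h \<in> C"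
    obtain a where a: "a \<in> base" "h = \<phi> a" using xh C_def by blast
    obtain v where v: "v \<in> carrier W" "x = \<phi> v" using xh surj by (metis imageE)
    have "x \<otimes>\<^bsub>W\<^esub> h \<otimes>\<^bsub>W\<^esub> inv\<^bsub>W\<^esub> x = \<phi> (v \<otimes>\<^bsub>W\<^esub> a \<otimes>\<^bsub>W\<^esub> inv\<^bsub>W\<^esub> v)"
      using a v by simp
    then show "x \<otimes>\<^bsub>W\<^esub> h \<otimes>\<^bsub>W\<^esub> inv\<^bsub>W\<^esub> x \<in> C"
      using base.inv_op_closed2[OF v(1) a(1)] unfolding C_def by (metis imageI)
  qed
  interpret C: normal C W by (rule C)

  obtain m where m: "nilpotent_class D (Suc m)" "\<not> nilpotent_class D m"
  proof -
    have "\<not> nilpotent_class D 0"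
    proof
      assume "nilpotent_class D 0"
      then have "d = \<one>\<^bsub>D\<^esub>" if "d \<in> carrier D" for d using that by (auto simp: nilpotent_class_def)
      then have "b = \<one>\<^bsub>W\<^esub>" using b by (intro base_eqI) (auto simp: base_carrier)
      then show False using not_base by simp
    qed
    then show ?thesis using that nil by (metis (full_types) exists_least_lemma not0_implies_Suc)
  qed
  obtain d ds where d: "d \<in> carrier D" "set ds \<subseteq> carrier D" "length ds = m"
      and e: "left_normed D d ds \<noteq> \<one>\<^bsub>D\<^esub>"
    using m(2) unfolding nilpotent_class_def by blast
  have nil_C: "left_normed W x ys = \<one>\<^bsub>W\<^esub>" if xys: "x \<in> C" "set ys \<subseteq> C" "length ys = Suc m" for x ys
  proof -
    obtain a where a: "a \<in> base" "x = \<phi> a" using xys C_def by blast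
    have "\<exists>f. \<forall>y\<in>C. f y \<in> base \<and> y = \<phi> (f y)" unfolding C_def by (intro bchoice) blast
    then obtain f where f: "\<forall>y\<in>C. f y \<in> base \<and> y = \<phi> (f y)" by blast
    have "ys = map \<phi> (map f ys)" using xys f by (intro nth_equalityI) (simp_all, metis nth_mem subsetD)
    then have "left_normed W x ys = \<phi> (left_normed W a (map f ys))"
      using a f xys base_carrier by (subst \<phi>.hom_left_normed) auto
    also have "left_normed W a (map f ys) = \<one>\<^bsub>W\<^esub>"
      using f xys a by (intro nilpotent_class_base[OF m(1)]) auto
    finally show ?thesis by simp
  qed

  define avail where "avail y \<longleftrightarrow> (\<forall>d\<in>carrier D. \<exists>b\<in>C \<inter> base. fst b \<one>\<^bsub>T\<^esub> = d \<and>
      (\<forall>x\<in>carrier T. x \<noteq> \<one>\<^bsub>T\<^esub> \<longrightarrow> x \<noteq> y \<longrightarrow> fst b x = \<one>\<^bsub>D\<^esub>))" for y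
  \<comment> \<open>A commutator \<open>z\<close> of weight \<open>m + 1\<close> in \<open>C\<close> is central in \<open>C\<close>, hence commutes with \<open>w\<close>.\<close>
  have avail_top: "y = snd w" if y: "avail y" and w: "w \<in> C" "snd w \<noteq> \<one>\<^bsub>T\<^esub>" for y w
  proof (rule ccontr)
    assume ne: "y \<noteq> snd w"
    have wW: "w \<in> carrier W" using w C_car by blast
    obtain f where f: "\<And>d. d \<in> carrier D \<Longrightarrow> f d \<in> C \<inter> base \<and> fst (f d) \<one>\<^bsub>T\<^esub> = d \<and>
        (\<forall>x\<in>carrier T. x \<noteq> \<one>\<^bsub>T\<^esub> \<longrightarrow> x \<noteq> y \<longrightarrow> fst (f d) x = \<one>\<^bsub>D\<^esub>)"
      using y unfolding avail_def by metis
    define z where "z = left_normed W (f d) (map f ds)"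
    have fds: "f d \<in> base" "set (map f ds) \<subseteq> base" using f d by auto
    have z: "z \<in> base" unfolding z_def by (rule left_normed_base[OF fds])
    have zW: "z \<in> carrier W" using z base_carrier by blast
    have "map (\<lambda>b. fst b \<one>\<^bsub>T\<^esub>) (map f ds) = ds" using f d by (auto intro!: map_idI)
    then have z1: "fst z \<one>\<^bsub>T\<^esub> = left_normed D d ds"
      unfolding z_def using f[OF d(1)] fst_left_normed_base[OF fds T.one_closed] by simp
    have "set (map (\<lambda>b. fst b (snd w)) (map f ds)) \<subseteq> carrier D" using fds wW base_carrier by auto
    then have zg: "fst z (snd w) = \<one>\<^bsub>D\<^esub>"
      unfolding z_def using f[OF d(1)] fst_left_normed_base[OF fds, of "snd w"] ne w wW
      by (simp add: D.left_normed_one)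
    have "left_normed W (f d) (map f ds @ [w]) = \<one>\<^bsub>W\<^esub>"
      by (rule nil_C) (use f d w in auto)
    then have "commutator W z w = \<one>\<^bsub>W\<^esub>" by (simp add: left_normed_append z_def)
    then have "z \<otimes>\<^bsub>W\<^esub> w = w \<otimes>\<^bsub>W\<^esub> z" using W.commutator_eq_one_iff zW wW by blast
    then have "fst (z \<otimes>\<^bsub>W\<^esub> w) (snd w) = fst (w \<otimes>\<^bsub>W\<^esub> z) (snd w)" by simp
    then have "fst w (snd w) = fst w (snd w) \<otimes>\<^bsub>D\<^esub> left_normed D d ds"
      using z zW wW zg z1 by simp
    then show False using e wW d by simp
  qed
  have avail_commutator: "avail (snd w)"
    if w: "w \<in> carrier W" "snd w \<noteq> \<one>\<^bsub>T\<^esub>" and cw: "\<And>b. b \<in> base \<Longrightarrow> commutator W b w \<in> C" for w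
    unfolding avail_def
  proof
    fix a assume a: "a \<in> carrier D"
    let ?b = "commutator W (single \<one>\<^bsub>T\<^esub> a) w"
    have s: "single \<one>\<^bsub>T\<^esub> a \<in> base" using a by simp
    have "?b \<in> base" using w s by (intro baseI) (simp_all add: commutator_def)
    moreover have "?b \<in> C" using cw s by blast
    moreover have "fst ?b \<one>\<^bsub>T\<^esub> = a"
      using w a s by (simp add: fst_commutator_base D.m_assoc)
    moreover have "fst ?b x = \<one>\<^bsub>D\<^esub>" if x: "x \<in> carrier T" "x \<noteq> \<one>\<^bsub>T\<^esub>" "x \<noteq> snd w" for x
    proof -
      have "inv\<^bsub>T\<^esub> (snd w) \<otimes>\<^bsub>T\<^esub> x \<noteq> \<one>\<^bsub>T\<^esub>"
        using w x by (metis T.inv_equality T.inv_inv T.inv_closed snd_closed T.inv_comm)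
      then show ?thesis using w a s x by (simp add: fst_commutator_base)
    qed
    ultimately show "\<exists>b\<in>C \<inter> base. fst b \<one>\<^bsub>T\<^esub> = a \<and>
      (\<forall>x\<in>carrier T. x \<noteq> \<one>\<^bsub>T\<^esub> \<longrightarrow> x \<noteq> snd w \<longrightarrow> fst b x = \<one>\<^bsub>D\<^esub>)" by blast
  qed

  define g0 where "g0 = snd (\<phi> b)"
  have bW: "b \<in> carrier W" using b base_carrier by blast
  have \<phi>b: "\<phi> b \<in> C" using b by (simp add: C_def)
  have g0: "g0 \<in> carrier T" "g0 \<noteq> \<one>\<^bsub>T\<^esub>"
    using bW not_base baseI[of "\<phi> b"] \<phi>.hom_closed[OF bW] snd_closed[of "\<phi> b"] unfolding g0_def by blast+
  have C_top: "snd w = \<one>\<^bsub>T\<^esub> \<or> snd w = g0" if w: "w \<in> C" for w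
  proof (cases "snd w = \<one>\<^bsub>T\<^esub>")
    case False
    have wW: "w \<in> carrier W" using w C_car by blast
    have "commutator W b' w \<in> C" if b': "b' \<in> base" for b'
    proof -
      have "b' \<otimes>\<^bsub>W\<^esub> w \<otimes>\<^bsub>W\<^esub> inv\<^bsub>W\<^esub> b' \<in> C" using w b' base_carrier C.inv_op_closed2 by blast
      then show ?thesis using w by (simp add: commutator_def)
    qed
    then have "avail (snd w)" using avail_commutator wW False by blast
    then show ?thesis using avail_top \<phi>b g0 g0_def by metis
  qed simp
  have g0_sq: "g0 \<otimes>\<^bsub>T\<^esub> g0 = \<one>\<^bsub>T\<^esub>"
  proof -
    have "\<phi> b \<otimes>\<^bsub>W\<^esub> \<phi> b \<in> C" using \<phi>b by simp
    then show ?thesis using C_top[of "\<phi> b \<otimes>\<^bsub>W\<^esub> \<phi> b"] g0 by (auto simp: g0_def)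
  qed
  have g0_inv: "inv\<^bsub>T\<^esub> g0 = g0" using g0_sq g0 T.inv_equality by blast
  have g0_cancel: "g0 \<otimes>\<^bsub>T\<^esub> (g0 \<otimes>\<^bsub>T\<^esub> t) = t" if "t \<in> carrier T" for t
    using that g0 g0_sq by (simp flip: T.m_assoc)
  have g0_central: "t \<otimes>\<^bsub>T\<^esub> g0 = g0 \<otimes>\<^bsub>T\<^esub> t" if t: "t \<in> carrier T" for t
  proof -
    have "top t \<otimes>\<^bsub>W\<^esub> \<phi> b \<otimes>\<^bsub>W\<^esub> inv\<^bsub>W\<^esub> top t \<in> C" using t \<phi>b C.inv_op_closed2 by simp
    from C_top[OF this] have "t \<otimes>\<^bsub>T\<^esub> g0 \<otimes>\<^bsub>T\<^esub> inv\<^bsub>T\<^esub> t = \<one>\<^bsub>T\<^esub> \<or> t \<otimes>\<^bsub>T\<^esub> g0 \<otimes>\<^bsub>T\<^esub> inv\<^bsub>T\<^esub> t = g0"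
      using t bW by (simp add: g0_def)
    moreover have "t \<otimes>\<^bsub>T\<^esub> g0 = (t \<otimes>\<^bsub>T\<^esub> g0 \<otimes>\<^bsub>T\<^esub> inv\<^bsub>T\<^esub> t) \<otimes>\<^bsub>T\<^esub> t" using t g0 by (simp add: T.word_simps)
    moreover have "t \<otimes>\<^bsub>T\<^esub> g0 \<noteq> \<one>\<^bsub>T\<^esub> \<otimes>\<^bsub>T\<^esub> t" using t g0 by simp
    ultimately show ?thesis by metis
  qed

  \<comment> \<open>The difference of the copies of \<open>a\<close> at \<open>1\<close> and at \<open>y\<close> lies in \<open>C\<close>, because these are conjugate and lie
    in the same of the two cosets.\<close>
  have no_index_two: False
    if t: "t \<in> carrier W" and index: "\<And>b. b \<in> base \<Longrightarrow> b \<in> C \<or> b \<otimes>\<^bsub>W\<^esub> inv\<^bsub>W\<^esub> t \<in> C" for t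
  proof -
    obtain y where y: "y \<in> carrier T" "y \<noteq> \<one>\<^bsub>T\<^esub>" "y \<noteq> g0" using large by blast
    have "avail y"
      unfolding avail_def
    proof
      fix a assume a: "a \<in> carrier D"
      let ?b1 = "single \<one>\<^bsub>T\<^esub> a" and ?b2 = "single y a"
      let ?b = "?b1 \<otimes>\<^bsub>W\<^esub> inv\<^bsub>W\<^esub> ?b2"
      have b12: "?b1 \<in> base" "?b2 \<in> base" using a y by simp_all
      note b12W = b12[THEN base_carrier]
      have conj: "?b2 = top y \<otimes>\<^bsub>W\<^esub> ?b1 \<otimes>\<^bsub>W\<^esub> inv\<^bsub>W\<^esub> top y"
      proof (rule base_eqI)
        show "top y \<otimes>\<^bsub>W\<^esub> ?b1 \<otimes>\<^bsub>W\<^esub> inv\<^bsub>W\<^esub> top y \<in> base"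
          using y b12 base.inv_op_closed2 by simp
        have "(inv\<^bsub>T\<^esub> y \<otimes>\<^bsub>T\<^esub> x = \<one>\<^bsub>T\<^esub>) = (x = y)" if "x \<in> carrier T" for x
          using that y by (metis T.inv_closed T.inv_equality T.inv_inv T.l_inv)
        then show "fst ?b2 x = fst (top y \<otimes>\<^bsub>W\<^esub> ?b1 \<otimes>\<^bsub>W\<^esub> inv\<^bsub>W\<^esub> top y) x" if "x \<in> carrier T" for x
          using that y a by (simp add: T.word_simps)
      qed (rule b12)
      have "?b1 \<in> C \<longleftrightarrow> ?b2 \<in> C"
      proof
        assume "?b1 \<in> C" then show "?b2 \<in> C" unfolding conj using y C.inv_op_closed2 by simp
      next
        assume "?b2 \<in> C"
        then have "inv\<^bsub>W\<^esub> top y \<otimes>\<^bsub>W\<^esub> ?b2 \<otimes>\<^bsub>W\<^esub> top y \<in> C" using y C.inv_op_closed1 by simp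
        then show "?b1 \<in> C" unfolding conj using y b12W by (simp add: W.word_simps)
      qed
      then consider "?b1 \<in> C" "?b2 \<in> C" | "?b1 \<otimes>\<^bsub>W\<^esub> inv\<^bsub>W\<^esub> t \<in> C" "?b2 \<otimes>\<^bsub>W\<^esub> inv\<^bsub>W\<^esub> t \<in> C"
        using index b12 by blast
      then have "?b \<in> C"
      proof cases
        case 2
        then have "(?b1 \<otimes>\<^bsub>W\<^esub> inv\<^bsub>W\<^esub> t) \<otimes>\<^bsub>W\<^esub> inv\<^bsub>W\<^esub> (?b2 \<otimes>\<^bsub>W\<^esub> inv\<^bsub>W\<^esub> t) \<in> C" by simp
        then show ?thesis using t b12W by (simp add: W.word_simps)
      qed simp
      moreover have "?b \<in> base" using b12 by simp
      moreover have "fst ?b \<one>\<^bsub>T\<^esub> = a" using a y by simp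
      moreover have "\<forall>x\<in>carrier T. x \<noteq> \<one>\<^bsub>T\<^esub> \<longrightarrow> x \<noteq> y \<longrightarrow> fst ?b x = \<one>\<^bsub>D\<^esub>" using a y by simp
      ultimately show "\<exists>b\<in>C \<inter> base. fst b \<one>\<^bsub>T\<^esub> = a \<and>
          (\<forall>x\<in>carrier T. x \<noteq> \<one>\<^bsub>T\<^esub> \<longrightarrow> x \<noteq> y \<longrightarrow> fst b x = \<one>\<^bsub>D\<^esub>)" by blast
    qed
    then show False using avail_top \<phi>b g0 y g0_def by metis
  qed

  define \<alpha> where "\<alpha> g = snd (\<phi> (top g))" for g
  have \<alpha>_closed [simp]: "\<alpha> g \<in> carrier T" if "g \<in> carrier T" for g using that by (simp add: \<alpha>_def)
  have \<alpha>_mult: "\<alpha> (g \<otimes>\<^bsub>T\<^esub> h) = \<alpha> g \<otimes>\<^bsub>T\<^esub> \<alpha> h" if "g \<in> carrier T" "h \<in> carrier T" for g h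
    using that by (simp add: \<alpha>_def top_mult)
  have \<alpha>_one: "\<alpha> \<one>\<^bsub>T\<^esub> = \<one>\<^bsub>T\<^esub>" by (simp add: \<alpha>_def top_one)
  have decompose: "\<exists>c g. c \<in> C \<and> g \<in> carrier T \<and> u = c \<otimes>\<^bsub>W\<^esub> \<phi> (top g)" if u: "u \<in> carrier W" for u
  proof -
    obtain v where v: "v \<in> carrier W" "u = \<phi> v" using u surj by (metis imageE)
    obtain a where a: "a \<in> base" "v = a \<otimes>\<^bsub>W\<^esub> top (snd v)" using base_times_top v by blast
    then have "\<phi> v = \<phi> a \<otimes>\<^bsub>W\<^esub> \<phi> (top (snd v))"
      using v base_carrier \<phi>.hom_mult[of a "top (snd v)"] by simp
    moreover have "\<phi> a \<in> C" using a by (simp add: C_def)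
    ultimately show ?thesis using v snd_closed by blast
  qed
  define H where "H = \<alpha> ` carrier T"
  have H_mult: "s \<otimes>\<^bsub>T\<^esub> t \<in> H" if "s \<in> H" "t \<in> H" for s t
  proof -
    obtain g h where "g \<in> carrier T" "s = \<alpha> g" "h \<in> carrier T" "t = \<alpha> h"
      using \<open>s \<in> H\<close> \<open>t \<in> H\<close> by (auto simp: H_def)
    then show ?thesis using \<alpha>_mult[of g h] unfolding H_def by (metis T.m_closed imageI)
  qed
  have H_car: "H \<subseteq> carrier T" by (auto simp: H_def)
  have H_cases: "t \<in> H \<or> g0 \<otimes>\<^bsub>T\<^esub> t \<in> H" if t: "t \<in> carrier T" for t
  proof -
    obtain c g where cg: "c \<in> C" "g \<in> carrier T" "top t = c \<otimes>\<^bsub>W\<^esub> \<phi> (top g)"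
      using decompose[of "top t"] t by auto
    then have "t = snd c \<otimes>\<^bsub>T\<^esub> \<alpha> g" by (metis \<alpha>_def snd_mult snd_top)
    then have "t = \<alpha> g \<or> g0 \<otimes>\<^bsub>T\<^esub> t = \<alpha> g" using C_top[OF cg(1)] cg g0_cancel by auto
    then show ?thesis using cg by (auto simp: H_def)
  qed
  have base_\<alpha>: "\<exists>c g. c \<in> C \<and> g \<in> carrier T \<and> u = c \<otimes>\<^bsub>W\<^esub> \<phi> (top g) \<and> (\<alpha> g = \<one>\<^bsub>T\<^esub> \<or> \<alpha> g = g0)"
    if u: "u \<in> base" for u
  proof -
    obtain c g where cg: "c \<in> C" "g \<in> carrier T" "u = c \<otimes>\<^bsub>W\<^esub> \<phi> (top g)"
      using decompose u base_carrier by blast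
    then have "\<one>\<^bsub>T\<^esub> = snd c \<otimes>\<^bsub>T\<^esub> \<alpha> g" using u by (metis \<alpha>_def snd_mult snd_base)
    then have "\<alpha> g = \<one>\<^bsub>T\<^esub> \<or> \<alpha> g = g0"
      using C_top[OF cg(1)] cg g0 g0_inv by (metis T.inv_equality T.inv_inv T.l_one \<alpha>_closed)
    then show ?thesis using cg by blast
  qed

  show False
  proof (cases "H = carrier T")
    case True
    have "\<alpha> \<in> hom T T" using \<alpha>_mult by (auto simp: hom_def)
    then have inj: "inj_on \<alpha> (carrier T)" using hopfianD[OF hopf] True by (simp add: H_def)
    obtain g1 where g1: "g1 \<in> carrier T" "\<alpha> g1 = g0" using True g0 unfolding H_def by (metis imageE)
    show False
    proof (rule no_index_two)
      show "\<phi> (top g1) \<in> carrier W" using g1 by simp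
      fix u assume "u \<in> base"
      then obtain c g where cg: "c \<in> C" "g \<in> carrier T" "u = c \<otimes>\<^bsub>W\<^esub> \<phi> (top g)"
          "\<alpha> g = \<one>\<^bsub>T\<^esub> \<or> \<alpha> g = g0"
        using base_\<alpha> by blast
      have "g = \<one>\<^bsub>T\<^esub> \<or> g = g1"
        using cg g1 inj \<alpha>_one by (metis T.one_closed inj_onD)
      then show "u \<in> C \<or> u \<otimes>\<^bsub>W\<^esub> inv\<^bsub>W\<^esub> \<phi> (top g1) \<in> C"
        using cg C_car g1 by (auto simp: top_one W.m_assoc subset_iff)
    qed
  next
    case False
    have g0_H: "g0 \<notin> H"
    proof
      assume "g0 \<in> H"
      then have "t \<in> H" if "t \<in> carrier T" for t
        using H_cases[OF that] H_mult[of g0 "g0 \<otimes>\<^bsub>T\<^esub> t"] g0_cancel that by auto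
      then show False using False H_car by blast
    qed
    have one_H: "\<one>\<^bsub>T\<^esub> \<in> H" using \<alpha>_one unfolding H_def by (metis T.one_closed imageI)
    have H_iff: "g0 \<otimes>\<^bsub>T\<^esub> t \<in> H \<longleftrightarrow> t \<notin> H" if t: "t \<in> carrier T" for t
    proof -
      have "inv\<^bsub>T\<^esub> t \<in> H" if "t \<in> H"
      proof -
        obtain s where s: "s \<in> carrier T" "t = \<alpha> s" using \<open>t \<in> H\<close> by (auto simp: H_def)
        have "\<alpha> (inv\<^bsub>T\<^esub> s) \<otimes>\<^bsub>T\<^esub> \<alpha> s = \<one>\<^bsub>T\<^esub>" using s \<alpha>_mult[of "inv\<^bsub>T\<^esub> s" s] \<alpha>_one by simp
        then have "inv\<^bsub>T\<^esub> t = \<alpha> (inv\<^bsub>T\<^esub> s)" using s T.inv_equality by simp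
        then show ?thesis using s by (simp add: H_def)
      qed
      then have "\<not> (t \<in> H \<and> g0 \<otimes>\<^bsub>T\<^esub> t \<in> H)"
        using H_mult[of "g0 \<otimes>\<^bsub>T\<^esub> t" "inv\<^bsub>T\<^esub> t"] g0_H g0 t by (auto simp: T.m_assoc)
      then show ?thesis using H_cases[OF t] by blast
    qed
    have \<alpha>_g0: "\<alpha> g0 = \<one>\<^bsub>T\<^esub>"
    proof (rule ccontr)
      assume ne: "\<alpha> g0 \<noteq> \<one>\<^bsub>T\<^esub>"
      let ?w = "\<phi> (top g0)"
      have "commutator W a ?w \<in> C" if a: "a \<in> base" for a
      proof -
        obtain c g where cg: "c \<in> C" "g \<in> carrier T" "a = c \<otimes>\<^bsub>W\<^esub> \<phi> (top g)"
          using decompose a base_carrier by blast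
        have cW: "c \<in> carrier W" and wW: "?w \<in> carrier W" and gW: "\<phi> (top g) \<in> carrier W"
          using cg C_car g0 by auto
        have "\<phi> (top g) \<otimes>\<^bsub>W\<^esub> ?w = ?w \<otimes>\<^bsub>W\<^esub> \<phi> (top g)"
          using cg g0 g0_central[of g] by (metis \<phi>.hom_mult top_closed top_mult)
        then have "\<phi> (top g) \<otimes>\<^bsub>W\<^esub> (?w \<otimes>\<^bsub>W\<^esub> (inv\<^bsub>W\<^esub> \<phi> (top g) \<otimes>\<^bsub>W\<^esub> v)) = ?w \<otimes>\<^bsub>W\<^esub> v"
          if "v \<in> carrier W" for v
          using wW gW that by (simp flip: W.m_assoc) (simp add: W.m_assoc)
        then have "commutator W a ?w = c \<otimes>\<^bsub>W\<^esub> (?w \<otimes>\<^bsub>W\<^esub> inv\<^bsub>W\<^esub> c \<otimes>\<^bsub>W\<^esub> inv\<^bsub>W\<^esub> ?w)"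
          using cW wW gW cg(3) by (simp add: commutator_def W.m_assoc W.inv_mult_group)
        then show ?thesis using cg wW C.inv_op_closed2 by simp
      qed
      then have "avail (\<alpha> g0)" using avail_commutator[of ?w] g0 ne by (simp add: \<alpha>_def)
      then have "\<alpha> g0 = g0" using avail_top \<phi>b g0 g0_def by metis
      then show False using g0_H g0 by (metis H_def imageI)
    qed
    \<comment> \<open>As \<open>T\<close> is the union of \<open>H\<close> and \<open>g0 H\<close>, multiplying \<open>\<alpha>\<close> by \<open>g0\<close> off \<open>H\<close> makes it surjective.\<close>
    define \<beta> where "\<beta> t = (if t \<in> H then \<alpha> t else \<alpha> t \<otimes>\<^bsub>T\<^esub> g0)" for t
    have \<alpha>_move: "\<alpha> (g0 \<otimes>\<^bsub>T\<^esub> t) = \<alpha> t" if "t \<in> carrier T" for t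
      using that \<alpha>_mult[OF g0(1)] \<alpha>_g0 by simp
    have "\<beta> \<in> hom T T"
    proof (rule homI)
      fix s t assume st: "s \<in> carrier T" "t \<in> carrier T"
      show "\<beta> s \<in> carrier T" using st g0 by (simp add: \<beta>_def)
      have eq: "g0 \<otimes>\<^bsub>T\<^esub> (s \<otimes>\<^bsub>T\<^esub> t) = s \<otimes>\<^bsub>T\<^esub> (g0 \<otimes>\<^bsub>T\<^esub> t)"
          "g0 \<otimes>\<^bsub>T\<^esub> (s \<otimes>\<^bsub>T\<^esub> t) = (g0 \<otimes>\<^bsub>T\<^esub> s) \<otimes>\<^bsub>T\<^esub> t"
        using st g0 g0_central[of s] by (simp_all flip: T.m_assoc)
      have par: "s \<otimes>\<^bsub>T\<^esub> t \<in> H \<longleftrightarrow> (s \<in> H \<longleftrightarrow> t \<in> H)"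
      proof (cases "s \<in> H")
        case True
        then show ?thesis
          using H_mult[of s t] H_mult[of s "g0 \<otimes>\<^bsub>T\<^esub> t"] H_iff[of t] H_iff[of "s \<otimes>\<^bsub>T\<^esub> t"] st eq
          by auto
      next
        case False
        then have gs: "g0 \<otimes>\<^bsub>T\<^esub> s \<in> H" using H_iff st by blast
        have "(g0 \<otimes>\<^bsub>T\<^esub> s) \<otimes>\<^bsub>T\<^esub> (g0 \<otimes>\<^bsub>T\<^esub> t) = s \<otimes>\<^bsub>T\<^esub> t"
          using st g0 g0_cancel eq by (metis T.m_assoc T.m_closed)
        then show ?thesis
          using False gs H_mult[OF gs, of t] H_mult[OF gs, of "g0 \<otimes>\<^bsub>T\<^esub> t"]
            H_iff[of t] H_iff[of "s \<otimes>\<^bsub>T\<^esub> t"] st eq by auto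
      qed
      have "\<alpha> s \<otimes>\<^bsub>T\<^esub> g0 \<otimes>\<^bsub>T\<^esub> (\<alpha> t \<otimes>\<^bsub>T\<^esub> g0) = \<alpha> s \<otimes>\<^bsub>T\<^esub> \<alpha> t"
        using st g0 g0_central[of "\<alpha> t"] g0_cancel by (simp add: T.m_assoc)
      moreover have "\<alpha> s \<otimes>\<^bsub>T\<^esub> g0 \<otimes>\<^bsub>T\<^esub> \<alpha> t = \<alpha> s \<otimes>\<^bsub>T\<^esub> \<alpha> t \<otimes>\<^bsub>T\<^esub> g0"
        using st g0 g0_central[of "\<alpha> t"] by (simp add: T.m_assoc)
      ultimately show "\<beta> (s \<otimes>\<^bsub>T\<^esub> t) = \<beta> s \<otimes>\<^bsub>T\<^esub> \<beta> t"
        using st g0 par by (auto simp: \<beta>_def \<alpha>_mult T.m_assoc)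
    qed
    moreover have "\<beta> ` carrier T = carrier T"
    proof
      show "\<beta> ` carrier T \<subseteq> carrier T" using g0 by (auto simp: \<beta>_def)
      show "carrier T \<subseteq> \<beta> ` carrier T"
      proof
        fix t assume t: "t \<in> carrier T"
        have "\<exists>s\<in>carrier T. (s \<in> H \<longleftrightarrow> P) \<and> \<alpha> s = u" if u: "u \<in> H" for u P
        proof -
          obtain s where s: "s \<in> carrier T" "\<alpha> s = u" using u by (auto simp: H_def)
          show ?thesis
          proof (cases "s \<in> H \<longleftrightarrow> P")
            case True then show ?thesis using s by blast
          next
            case False
            then show ?thesis using s H_iff[of s] \<alpha>_move[of s] g0 by (intro bexI[of _ "g0 \<otimes>\<^bsub>T\<^esub> s"]) auto
          qed
        qed
        note lift = this
        show "t \<in> \<beta> ` carrier T"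
        proof (cases "t \<in> H")
          case True
          then show ?thesis using lift[of t True] by (force simp: \<beta>_def)
        next
          case False
          then obtain s where s: "s \<in> carrier T" "s \<notin> H" "\<alpha> s = g0 \<otimes>\<^bsub>T\<^esub> t"
            using lift[of "g0 \<otimes>\<^bsub>T\<^esub> t" False] H_iff t by blast
          then have "\<beta> s = t" using t g0 g0_central[of "g0 \<otimes>\<^bsub>T\<^esub> t"] g0_cancel by (simp add: \<beta>_def)
          then show ?thesis using s by blast
        qed
      qed
    qed
    ultimately have inj: "inj_on \<beta> (carrier T)" using hopfianD[OF hopf] by blast
    show False
    proof (rule no_index_two)
      show "\<phi> (top g0) \<in> carrier W" using g0 by simp
      fix u assume "u \<in> base"
      then obtain c g where cg: "c \<in> C" "g \<in> carrier T" "u = c \<otimes>\<^bsub>W\<^esub> \<phi> (top g)"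
          "\<alpha> g = \<one>\<^bsub>T\<^esub> \<or> \<alpha> g = g0"
        using base_\<alpha> by blast
      then have "\<alpha> g = \<one>\<^bsub>T\<^esub>" using g0_H by (metis H_def imageI)
      then have "\<beta> g = \<beta> \<one>\<^bsub>T\<^esub> \<or> \<beta> g = \<beta> g0"
        using one_H g0_H \<alpha>_one \<alpha>_g0 g0 by (simp add: \<beta>_def)
      then have "g = \<one>\<^bsub>T\<^esub> \<or> g = g0"
        using cg g0 inj by (metis T.one_closed inj_onD)
      then show "u \<in> C \<or> u \<otimes>\<^bsub>W\<^esub> inv\<^bsub>W\<^esub> \<phi> (top g0) \<in> C"
        using cg C_car g0 by (auto simp: top_one W.m_assoc subset_iff)
    qed
  qed
qed

end

context wreath
begin

lemma restrict_W:
  assumes "f \<in> carrier T \<rightarrow> carrier D" "finite {x \<in> carrier T. f x \<noteq> \<one>\<^bsub>D\<^esub>}" "g \<in> carrier T"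
  shows "(restrict f (carrier T), g) \<in> carrier W"
proof -
  have "{x \<in> carrier T. restrict f (carrier T) x \<noteq> \<one>\<^bsub>D\<^esub>} = {x \<in> carrier T. f x \<noteq> \<one>\<^bsub>D\<^esub>}" by auto
  then show ?thesis using assms by (auto simp: carrier_W)
qed

lemma finite_support [simp]: "w \<in> carrier W \<Longrightarrow> finite {x \<in> carrier T. fst w x \<noteq> \<one>\<^bsub>D\<^esub>}"
  by (simp add: carrier_W)

text \<open>The base group is built up one coordinate at a time, each time an extension by \<open>D\<close>.\<close>

lemma finite_top_noetherian:
  assumes fin: "finite (carrier T)" and noeth: "noetherian_in D (carrier D)"
  shows "noetherian_in W (carrier W)"
proof -
  define B where "B J = {w \<in> base. \<forall>x\<in>carrier T - J. fst w x = \<one>\<^bsub>D\<^esub>}" for J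
  have B_sub: "subgroup (B J) W" for J
  proof (rule W.subgroupI)
    show "B J \<subseteq> carrier W" unfolding B_def using base.subset by blast
    have "\<one>\<^bsub>W\<^esub> \<in> B J" by (simp add: B_def)
    then show "B J \<noteq> {}" by blast
    show "inv\<^bsub>W\<^esub> a \<in> B J" if "a \<in> B J" for a using that by (simp add: B_def)
    show "a \<otimes>\<^bsub>W\<^esub> b \<in> B J" if "a \<in> B J" "b \<in> B J" for a b using that by (simp add: B_def)
  qed
  have "noetherian_in W (B J)" if "finite J" "J \<subseteq> carrier T" for J
    using that
  proof (induction J)
    case empty
    have "w = \<one>\<^bsub>W\<^esub>" if "w \<in> B {}" for w using that by (intro base_eqI) (simp_all add: B_def)
    then have "B {} \<subseteq> {\<one>\<^bsub>W\<^esub>}" by blast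
    then show ?case using W.noetherian_in_finite finite_subset by blast
  next
    case (insert x J)
    show ?case
    proof (rule noetherian_in_extension[where Q = D and p = "\<lambda>w. fst w x"])
      show "noetherian_in W {w \<in> B (insert x J). fst w x = \<one>\<^bsub>D\<^esub>}"
      proof (rule noetherian_in_mono)
        show "noetherian_in W (B J)" using insert by blast
        show "{w \<in> B (insert x J). fst w x = \<one>\<^bsub>D\<^esub>} \<subseteq> B J" by (auto simp: B_def)
      qed
    qed (use insert.prems noeth B_sub W.is_group D.is_group in \<open>auto simp: B_def\<close>)
  qed
  from this[of "carrier T"] have noeth_base: "noetherian_in W base" using fin by (simp add: B_def)
  show ?thesis
  proof (rule noetherian_in_extension[where Q = T and p = snd])
    show "noetherian_in W {w \<in> carrier W. snd w = \<one>\<^bsub>T\<^esub>}" using noeth_base unfolding base_def .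
    show "noetherian_in T (carrier T)" using fin by (rule T.noetherian_in_finite)
  qed (simp_all add: W.is_group T.is_group W.subgroup_self)
qed

definition relabel :: "('b \<Rightarrow> 'b) \<Rightarrow> ('b \<Rightarrow> 'b) \<Rightarrow> ('b \<Rightarrow> 'a) \<times> 'b \<Rightarrow> ('b \<Rightarrow> 'a) \<times> 'b" where
  "relabel \<alpha> \<beta> w = ((\<lambda>x\<in>carrier T. fst w (\<alpha> x)), \<beta> (snd w))"

text \<open>An endomorphism that preserves the base group induces a surjective endomorphism of \<open>T\<close>, an
  automorphism by the Hopf property. Relabelling the coordinates by its inverse reduces the
  question to endomorphisms that induce the identity on \<open>T\<close>.\<close>

lemma hopfian_if_injective_over_top:
  assumes hopf: "hopfian T" and fg: "finitely_generated D" and nil: "nilpotent_class D c"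
    and inj: "\<And>\<phi> w. \<lbrakk>\<phi> \<in> hom W W; \<phi> ` carrier W = carrier W;
                 \<And>u. u \<in> carrier W \<Longrightarrow> snd (\<phi> u) = snd u; w \<in> base; \<phi> w = \<one>\<^bsub>W\<^esub>\<rbrakk> \<Longrightarrow> w = \<one>\<^bsub>W\<^esub>"
  shows "hopfian W"
proof (cases "\<forall>y. \<exists>x\<in>carrier T. x \<noteq> \<one>\<^bsub>T\<^esub> \<and> x \<noteq> y")
  case False
  \<comment> \<open>Now \<open>T\<close> has at most two elements and \<open>W\<close> is Noetherian.\<close>
  then obtain y where "carrier T \<subseteq> {\<one>\<^bsub>T\<^esub>, y}" by blast
  then have "finite (carrier T)" using finite_subset by blast
  then show ?thesis
    using noetherian_imp_hopfian[OF W.is_group] finite_top_noetherian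
      D.finitely_generated_nilpotent_noetherian[OF fg nil] by blast
next
  case True
  show ?thesis
  proof (rule hopfianI[OF W.is_group])
    fix \<phi> w assume hom: "\<phi> \<in> hom W W" and surj: "\<phi> ` carrier W = carrier W"
      and w: "w \<in> carrier W" "\<phi> w = \<one>\<^bsub>W\<^esub>"
    interpret \<phi>: group_hom W W \<phi>
      using hom W.is_group by (simp add: group_hom_def group_hom_axioms_def)
    define \<alpha> where "\<alpha> g = snd (\<phi> (top g))" for g
    have snd_\<phi>: "snd (\<phi> u) = \<alpha> (snd u)" if u: "u \<in> carrier W" for u
    proof -
      obtain b where b: "b \<in> base" "u = b \<otimes>\<^bsub>W\<^esub> top (snd u)" using base_times_top[OF u] .
      have "\<phi> u = \<phi> b \<otimes>\<^bsub>W\<^esub> \<phi> (top (snd u))"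
        using b u \<phi>.hom_mult[of b "top (snd u)"] by simp
      moreover have "\<phi> b \<in> base"
        using surjective_endomorphism_preserves_base[OF hopf nil _ hom surj b(1)] True by blast
      ultimately show ?thesis using u by (simp add: \<alpha>_def)
    qed
    have \<alpha>_closed: "\<alpha> g \<in> carrier T" if "g \<in> carrier T" for g using that by (simp add: \<alpha>_def)
    have \<alpha>_mult: "\<alpha> (g \<otimes>\<^bsub>T\<^esub> h) = \<alpha> g \<otimes>\<^bsub>T\<^esub> \<alpha> h" if "g \<in> carrier T" "h \<in> carrier T" for g h
      using that by (simp add: \<alpha>_def top_mult)
    have \<alpha>_hom: "\<alpha> \<in> hom T T" using \<alpha>_closed \<alpha>_mult by (simp add: hom_def)
    have \<alpha>_surj: "\<alpha> ` carrier T = carrier T"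
    proof
      show "\<alpha> ` carrier T \<subseteq> carrier T" using \<alpha>_closed by blast
      show "carrier T \<subseteq> \<alpha> ` carrier T"
      proof
        fix t assume t: "t \<in> carrier T"
        then have "top t \<in> \<phi> ` carrier W" using surj by simp
        then obtain v where "v \<in> carrier W" "top t = \<phi> v" by blast
        then show "t \<in> \<alpha> ` carrier T" using snd_\<phi>[of v] by (metis imageI snd_closed snd_top)
      qed
    qed
    have \<alpha>_inj: "inj_on \<alpha> (carrier T)" by (rule hopfianD[OF hopf \<alpha>_hom \<alpha>_surj])
    define \<beta> where "\<beta> = inv_into (carrier T) \<alpha>"
    have \<beta>: "\<beta> t \<in> carrier T" "\<alpha> (\<beta> t) = t" "\<beta> (\<alpha> t) = t" if "t \<in> carrier T" for t
      using that \<alpha>_inj \<alpha>_surj unfolding \<beta>_def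
      by (metis inv_into_into, metis f_inv_into_f, metis inv_into_f_f)
    have \<beta>_mult: "\<beta> (g \<otimes>\<^bsub>T\<^esub> h) = \<beta> g \<otimes>\<^bsub>T\<^esub> \<beta> h" if "g \<in> carrier T" "h \<in> carrier T" for g h
      using that \<beta> \<alpha>_mult[of "\<beta> g" "\<beta> h"] by (metis T.m_closed)
    have relabel_closed: "relabel \<gamma> \<delta> u \<in> carrier W"
      if u: "u \<in> carrier W" and \<gamma>\<delta>: "\<And>t. t \<in> carrier T \<Longrightarrow> \<gamma> t \<in> carrier T \<and> \<delta> t \<in> carrier T \<and> \<delta> (\<gamma> t) = t"
      for \<gamma> \<delta> u
      unfolding relabel_def
    proof (rule restrict_W)
      show "finite {x \<in> carrier T. fst u (\<gamma> x) \<noteq> \<one>\<^bsub>D\<^esub>}"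
      proof (rule finite_subset)
        show "{x \<in> carrier T. fst u (\<gamma> x) \<noteq> \<one>\<^bsub>D\<^esub>} \<subseteq> \<delta> ` {x \<in> carrier T. fst u x \<noteq> \<one>\<^bsub>D\<^esub>}"
        proof
          fix x assume "x \<in> {x \<in> carrier T. fst u (\<gamma> x) \<noteq> \<one>\<^bsub>D\<^esub>}"
          then show "x \<in> \<delta> ` {x \<in> carrier T. fst u x \<noteq> \<one>\<^bsub>D\<^esub>}"
            using \<gamma>\<delta>[of x] by (intro image_eqI[of _ _ "\<gamma> x"]) auto
        qed
      qed (use u in simp)
    qed (use u \<gamma>\<delta> in auto)
    let ?r = "relabel \<alpha> \<beta>"
    have r_closed: "?r u \<in> carrier W" if "u \<in> carrier W" for u
      using relabel_closed[OF that, of \<alpha> \<beta>] \<alpha>_closed \<beta> by blast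
    have \<alpha>_inv: "\<alpha> (inv\<^bsub>T\<^esub> g) = inv\<^bsub>T\<^esub> (\<alpha> g)" if "g \<in> carrier T" for g
      using that \<alpha>_hom group_hom.hom_inv[of T T \<alpha> g] T.is_group
      by (simp add: group_hom_def group_hom_axioms_def)
    have r_mult: "?r (u \<otimes>\<^bsub>W\<^esub> v) = ?r u \<otimes>\<^bsub>W\<^esub> ?r v" if uv: "u \<in> carrier W" "v \<in> carrier W" for u v
    proof (rule W_eqI)
      show "?r (u \<otimes>\<^bsub>W\<^esub> v) \<in> carrier W" "?r u \<otimes>\<^bsub>W\<^esub> ?r v \<in> carrier W" using uv r_closed by simp_all
      show "snd (?r (u \<otimes>\<^bsub>W\<^esub> v)) = snd (?r u \<otimes>\<^bsub>W\<^esub> ?r v)" using uv by (simp add: relabel_def \<beta>_mult)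
      show "fst (?r (u \<otimes>\<^bsub>W\<^esub> v)) x = fst (?r u \<otimes>\<^bsub>W\<^esub> ?r v) x" if "x \<in> carrier T" for x
        using that uv by (simp add: relabel_def \<beta> \<alpha>_closed \<alpha>_mult \<alpha>_inv)
    qed
    have r_surj: "u \<in> ?r ` carrier W" if u: "u \<in> carrier W" for u
    proof (rule image_eqI)
      show v: "relabel \<beta> \<alpha> u \<in> carrier W"
        using relabel_closed[OF u, of \<beta> \<alpha>] \<alpha>_closed \<beta> by blast
      show "u = ?r (relabel \<beta> \<alpha> u)"
        by (rule W_eqI[OF u r_closed[OF v]]) (use u in \<open>simp_all add: relabel_def \<beta> \<alpha>_closed\<close>)
    qed
    have "snd w = \<one>\<^bsub>T\<^esub>"
    proof -
      have "\<alpha> \<one>\<^bsub>T\<^esub> = \<one>\<^bsub>T\<^esub>" by (simp add: \<alpha>_def top_one)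
      then have "\<alpha> (snd w) = \<alpha> \<one>\<^bsub>T\<^esub>" using snd_\<phi>[OF w(1)] w(2) by simp
      then show ?thesis using \<alpha>_inj w(1) by (metis T.one_closed inj_onD snd_closed)
    qed
    then have wb: "w \<in> base" using w by (intro baseI)
    show "w = \<one>\<^bsub>W\<^esub>"
    proof (rule inj[of "?r \<circ> \<phi>"])
      show "?r \<circ> \<phi> \<in> hom W W" using r_closed r_mult by (auto simp: hom_def Pi_iff)
      have "?r ` carrier W = carrier W" using r_closed r_surj by blast
      then show "(?r \<circ> \<phi>) ` carrier W = carrier W" using surj by (metis image_comp)
      show "snd ((?r \<circ> \<phi>) u) = snd u" if "u \<in> carrier W" for u
        using that by (simp add: relabel_def snd_\<phi> \<beta>)
      have "\<alpha> \<one>\<^bsub>T\<^esub> = \<one>\<^bsub>T\<^esub>" by (simp add: \<alpha>_def top_one)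
      then have "\<beta> \<one>\<^bsub>T\<^esub> = \<one>\<^bsub>T\<^esub>" using \<beta>(3)[of "\<one>\<^bsub>T\<^esub>"] by simp
      then show "(?r \<circ> \<phi>) w = \<one>\<^bsub>W\<^esub>"
        using w r_closed[of "\<one>\<^bsub>W\<^esub>"] by (intro W_eqI) (simp_all add: relabel_def \<alpha>_closed)
    qed (rule wb)
  qed
qed

text \<open>A surjective endomorphism \<open>\<beta>\<close> of \<open>T\<close> extends to \<open>A \<wr> T\<close> with \<open>A\<close> abelian: multiply the
  values of a function along the fibres of \<open>\<beta>\<close>.\<close>

lemma hopfian_top_if_comm:
  assumes "comm_group D" and hopf: "hopfian W"
  shows "hopfian T"
proof (rule hopfianI[OF T.is_group])
  interpret C: comm_group D by fact
  fix \<beta> g0 assume hom: "\<beta> \<in> hom T T" and surj: "\<beta> ` carrier T = carrier T"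
    and g0: "g0 \<in> carrier T" "\<beta> g0 = \<one>\<^bsub>T\<^esub>"
  interpret \<beta>: group_hom T T \<beta>
    using hom T.is_group by (simp add: group_hom_def group_hom_axioms_def)
  define S where "S f x = {y \<in> carrier T. \<beta> y = x \<and> f y \<noteq> \<one>\<^bsub>D\<^esub>}" for f x
  define P where "P f x = finprod D f (S f x)" for f x
  define \<phi> where "\<phi> w = ((\<lambda>x\<in>carrier T. P (fst w) x), \<beta> (snd w))" for w
  have S_fin: "finite (S (fst w) x)" if "w \<in> carrier W" for w x
    by (rule finite_subset[OF _ finite_support[OF that]]) (auto simp: S_def)
  have P_sup: "P f x = finprod D f F"
    if "finite F" "S f x \<subseteq> F" "F \<subseteq> {y \<in> carrier T. \<beta> y = x}" "f \<in> carrier T \<rightarrow> carrier D" for f x F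
    unfolding P_def
    by (rule C.finprod_mono_neutral_cong_left) (use that in \<open>auto simp: S_def\<close>)
  have fst_Pi: "fst w \<in> carrier T \<rightarrow> carrier D" if "w \<in> carrier W" for w using that by auto
  have P_closed: "P (fst w) x \<in> carrier D" if "w \<in> carrier W" for w x
    unfolding P_def using that fst_Pi[OF that] by (intro C.finprod_closed) (auto simp: S_def)
  have \<phi>_closed: "\<phi> w \<in> carrier W" if w: "w \<in> carrier W" for w
    unfolding \<phi>_def
  proof (rule restrict_W)
    have "P (fst w) x = \<one>\<^bsub>D\<^esub>" if "S (fst w) x = {}" for x using that by (simp add: P_def)
    then have "S (fst w) x \<noteq> {}" if "P (fst w) x \<noteq> \<one>\<^bsub>D\<^esub>" for x using that by blast
    then have "{x \<in> carrier T. P (fst w) x \<noteq> \<one>\<^bsub>D\<^esub>} \<subseteq> \<beta> ` {x \<in> carrier T. fst w x \<noteq> \<one>\<^bsub>D\<^esub>}"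
      unfolding S_def by blast
    then show "finite {x \<in> carrier T. P (fst w) x \<noteq> \<one>\<^bsub>D\<^esub>}"
      using finite_support[OF w] by (meson finite_imageI finite_subset)
  qed (use w P_closed in auto)
  have "\<phi> (u \<otimes>\<^bsub>W\<^esub> v) = \<phi> u \<otimes>\<^bsub>W\<^esub> \<phi> v" if uv: "u \<in> carrier W" "v \<in> carrier W" for u v
  proof (rule W_eqI)
    show "\<phi> (u \<otimes>\<^bsub>W\<^esub> v) \<in> carrier W" "\<phi> u \<otimes>\<^bsub>W\<^esub> \<phi> v \<in> carrier W" using uv \<phi>_closed by simp_all
    show "snd (\<phi> (u \<otimes>\<^bsub>W\<^esub> v)) = snd (\<phi> u \<otimes>\<^bsub>W\<^esub> \<phi> v)" using uv by (simp add: \<phi>_def)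
    fix x assume x: "x \<in> carrier T"
    let ?g = "snd u"
    let ?z = "inv\<^bsub>T\<^esub> (\<beta> ?g) \<otimes>\<^bsub>T\<^esub> x"
    let ?h = "\<lambda>y. fst v (inv\<^bsub>T\<^esub> ?g \<otimes>\<^bsub>T\<^esub> y)"
    let ?F = "S (fst u) x \<union> (\<lambda>y. ?g \<otimes>\<^bsub>T\<^esub> y) ` S (fst v) ?z"
    have g: "?g \<in> carrier T" using uv by simp
    have F: "finite ?F" using uv S_fin by blast
    have F_fib: "?F \<subseteq> {y \<in> carrier T. \<beta> y = x}"
      using g x by (auto simp: S_def T.inv_mult_cancel)
    have F_car: "?F \<subseteq> carrier T" using F_fib by blast
    have h: "?h \<in> ?F \<rightarrow> carrier D" using uv g F_car by auto
    have "P (fst (u \<otimes>\<^bsub>W\<^esub> v)) x = finprod D (fst (u \<otimes>\<^bsub>W\<^esub> v)) ?F"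
    proof (rule P_sup[OF F _ F_fib fst_Pi])
      show "S (fst (u \<otimes>\<^bsub>W\<^esub> v)) x \<subseteq> ?F"
      proof
        fix y assume "y \<in> S (fst (u \<otimes>\<^bsub>W\<^esub> v)) x"
        then have y: "y \<in> carrier T" "\<beta> y = x" "fst u y \<otimes>\<^bsub>D\<^esub> ?h y \<noteq> \<one>\<^bsub>D\<^esub>"
          by (auto simp: S_def)
        then consider "fst u y \<noteq> \<one>\<^bsub>D\<^esub>" | "?h y \<noteq> \<one>\<^bsub>D\<^esub>" by force
        then show "y \<in> ?F"
        proof cases
          case 1 then show ?thesis using y by (simp add: S_def)
        next
          case 2
          have "inv\<^bsub>T\<^esub> ?g \<otimes>\<^bsub>T\<^esub> y \<in> S (fst v) ?z" using 2 y g by (simp add: S_def)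
          moreover have "y = ?g \<otimes>\<^bsub>T\<^esub> (inv\<^bsub>T\<^esub> ?g \<otimes>\<^bsub>T\<^esub> y)" using y g by (simp add: T.inv_mult_cancel)
          ultimately show ?thesis by blast
        qed
      qed
    qed (use uv in simp)
    also have "\<dots> = finprod D (\<lambda>y. fst u y \<otimes>\<^bsub>D\<^esub> ?h y) ?F"
      by (rule C.finprod_cong') (use uv g F_car h in auto)
    also have "\<dots> = finprod D (fst u) ?F \<otimes>\<^bsub>D\<^esub> finprod D ?h ?F"
      by (rule C.finprod_multf) (use uv F_car h in auto)
    also have "finprod D (fst u) ?F = P (fst u) x"
      by (rule P_sup[symmetric, OF F _ F_fib fst_Pi]) (use uv in auto)
    also have "finprod D ?h ?F = finprod D ?h ((\<lambda>y. ?g \<otimes>\<^bsub>T\<^esub> y) ` S (fst v) ?z)"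
    proof (rule C.finprod_mono_neutral_cong_right[OF F])
      show "?h y = \<one>\<^bsub>D\<^esub>" if y: "y \<in> ?F - (\<lambda>y. ?g \<otimes>\<^bsub>T\<^esub> y) ` S (fst v) ?z" for y
      proof (rule ccontr)
        assume "?h y \<noteq> \<one>\<^bsub>D\<^esub>"
        with y have "inv\<^bsub>T\<^esub> ?g \<otimes>\<^bsub>T\<^esub> y \<in> S (fst v) ?z" using F_fib g by (auto simp: S_def)
        moreover have "y = ?g \<otimes>\<^bsub>T\<^esub> (inv\<^bsub>T\<^esub> ?g \<otimes>\<^bsub>T\<^esub> y)"
          using y F_car g by (auto simp: T.inv_mult_cancel)
        ultimately show False using y by blast
      qed
    qed (use h in auto)
    also have "\<dots> = finprod D (\<lambda>y. ?h (?g \<otimes>\<^bsub>T\<^esub> y)) (S (fst v) ?z)"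
      by (rule C.finprod_reindex) (use h g in \<open>auto simp: inj_on_def S_def\<close>)
    also have "\<dots> = P (fst v) ?z"
      unfolding P_def
      by (rule C.finprod_cong') (use uv g in \<open>auto simp: S_def T.inv_mult_cancel\<close>)
    finally show "fst (\<phi> (u \<otimes>\<^bsub>W\<^esub> v)) x = fst (\<phi> u \<otimes>\<^bsub>W\<^esub> \<phi> v) x"
      using x g by (simp add: \<phi>_def)
  qed
  then have \<phi>_hom: "\<phi> \<in> hom W W" using \<phi>_closed by (simp add: hom_def)
  have \<phi>_surj: "w \<in> \<phi> ` carrier W" if w: "w \<in> carrier W" for w
  proof -
    define s where "s = inv_into (carrier T) \<beta>"
    have s: "s x \<in> carrier T" "\<beta> (s x) = x" if "x \<in> carrier T" for x
      using that surj unfolding s_def by (metis inv_into_into, metis f_inv_into_f)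
    \<comment> \<open>A preimage is supported on one point of each fibre.\<close>
    define f where "f y = (if y = s (\<beta> y) then fst w (\<beta> y) else \<one>\<^bsub>D\<^esub>)" for y
    let ?v = "(restrict f (carrier T), s (snd w))"
    have v: "?v \<in> carrier W"
    proof (rule restrict_W)
      show "finite {x \<in> carrier T. f x \<noteq> \<one>\<^bsub>D\<^esub>}"
      proof (rule finite_subset)
        show "{x \<in> carrier T. f x \<noteq> \<one>\<^bsub>D\<^esub>} \<subseteq> s ` {x \<in> carrier T. fst w x \<noteq> \<one>\<^bsub>D\<^esub>}"
        proof
          fix x assume "x \<in> {x \<in> carrier T. f x \<noteq> \<one>\<^bsub>D\<^esub>}"
          then have "x \<in> carrier T" "x = s (\<beta> x)" "fst w (\<beta> x) \<noteq> \<one>\<^bsub>D\<^esub>"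
            by (auto simp: f_def split: if_splits)
          then show "x \<in> s ` {x \<in> carrier T. fst w x \<noteq> \<one>\<^bsub>D\<^esub>}" by (intro image_eqI[of _ _ "\<beta> x"]) auto
        qed
      qed (use w in simp)
    qed (use w s in \<open>auto simp: f_def\<close>)
    have "w = \<phi> ?v"
    proof (rule W_eqI[OF w \<phi>_closed[OF v]])
      show "snd w = snd (\<phi> ?v)" using s w by (simp add: \<phi>_def)
      fix x assume x: "x \<in> carrier T"
      have "P (fst ?v) x = finprod D (fst ?v) {s x}"
      proof (rule P_sup[OF _ _ _ fst_Pi[OF v]])
        show "S (fst ?v) x \<subseteq> {s x}" by (auto simp: S_def f_def split: if_splits)
      qed (use s x in auto)
      also have "\<dots> = fst ?v (s x)"
        using s[OF x] fst_Pi[OF v] C.finprod_insert[of "{}" "s x" "fst ?v"] by (simp add: Pi_iff)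
      also have "\<dots> = fst w x" using s[OF x] by (simp add: f_def)
      finally show "fst w x = fst (\<phi> ?v) x" using x by (simp add: \<phi>_def)
    qed
    then show ?thesis using v by blast
  qed
  have "inj_on \<phi> (carrier W)"
    by (rule hopfianD[OF hopf \<phi>_hom]) (use \<phi>_closed \<phi>_surj in blast)
  moreover have "\<phi> (top g0) = \<phi> \<one>\<^bsub>W\<^esub>"
  proof (rule W_eqI)
    have "S (fst (top g0)) x = {}" "S (fst \<one>\<^bsub>W\<^esub>) x = {}" for x by (auto simp: S_def)
    then show "fst (\<phi> (top g0)) x = fst (\<phi> \<one>\<^bsub>W\<^esub>) x" if "x \<in> carrier T" for x
      using that by (simp add: \<phi>_def P_def)
    show "snd (\<phi> (top g0)) = snd (\<phi> \<one>\<^bsub>W\<^esub>)" using g0 by (simp add: \<phi>_def)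
  qed (use g0 \<phi>_closed in auto)
  ultimately have "top g0 = \<one>\<^bsub>W\<^esub>" using g0 by (meson W.one_closed inj_onD top_closed)
  then show "g0 = \<one>\<^bsub>T\<^esub>" by (metis snd_one snd_top)
qed

end

section \<open>Layers of the upper central series\<close>

context group
begin

lemma upper_central_factor_Suc:
  "upper_central_factor G (Suc i) = (G\<lparr>carrier := upper_central G (Suc i)\<rparr>) Mod upper_central G i"
  by (simp add: upper_central_factor_def)

lemma upper_central_normal_Suc:
  "upper_central G i \<lhd> (G\<lparr>carrier := upper_central G (Suc i)\<rparr>)"
  using normal_restrict_supergroup[OF upper_central_subgroup upper_central_normal]
    upper_central_mono_Suc by blast

lemma carrier_upper_central_factor:
  "carrier (upper_central_factor G (Suc i)) = (\<lambda>x. upper_central G i #> x) ` upper_central G (Suc i)"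
  by (simp add: upper_central_factor_Suc carrier_FactGroup)

lemma one_upper_central_factor [simp]:
  "\<one>\<^bsub>upper_central_factor G (Suc i)\<^esub> = upper_central G i"
  by (simp add: upper_central_factor_Suc)

lemma mult_upper_central_factor:
  assumes "x \<in> upper_central G (Suc i)" "y \<in> upper_central G (Suc i)"
  shows "(upper_central G i #> x) \<otimes>\<^bsub>upper_central_factor G (Suc i)\<^esub> (upper_central G i #> y) =
           upper_central G i #> (x \<otimes> y)"
  using normal.rcos_sum[OF upper_central_normal_Suc, of x i y] assms
  by (simp add: upper_central_factor_Suc)

lemma comm_group_upper_central_factor: "comm_group (upper_central_factor G (Suc i))"
proof -
  have grp: "group (upper_central_factor G (Suc i))"
    using normal.factorgroup_is_group[OF upper_central_normal_Suc] by (simp add: upper_central_factor_Suc)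
  show ?thesis
  proof (rule group.group_comm_groupI[OF grp])
    fix a b assume "a \<in> carrier (upper_central_factor G (Suc i))"
      "b \<in> carrier (upper_central_factor G (Suc i))"
    then obtain x y where xy: "x \<in> upper_central G (Suc i)" "a = upper_central G i #> x"
        "y \<in> upper_central G (Suc i)" "b = upper_central G i #> y"
      by (auto simp: carrier_upper_central_factor)
    then have c: "x \<in> carrier G" "y \<in> carrier G" "commutator G x y \<in> upper_central G i"
      by (auto simp: upper_central_Suc)
    have "upper_central G i #> (x \<otimes> y) = upper_central G i #> (y \<otimes> x)"
      using c coset_eq_iff[OF upper_central_subgroup, of "x \<otimes> y" "y \<otimes> x" i]
      by (simp add: commutator_def word_simps)
    then show "a \<otimes>\<^bsub>upper_central_factor G (Suc i)\<^esub> b = b \<otimes>\<^bsub>upper_central_factor G (Suc i)\<^esub> a"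
      using xy by (simp add: mult_upper_central_factor)
  qed
qed

end

context wreath
begin

text \<open>Write \<open>B\<^sub>i\<close> for the functions with values in the term of index \<open>i\<close> of the upper central series,
  the corresponding term for the base group. A surjective endomorphism maps each \<open>B\<^sub>i\<close> into
  itself, but perhaps not onto; surjectivity on \<open>B\<^sub>i\<close> comes from the top, since the Hopf property of
  the wreath product of a factor with \<open>T\<close> shows that the preimage of \<open>B\<^sub>i\<close> in \<open>B\<^sub>i\<^sub>+\<^sub>1\<close> is
  \<open>B\<^sub>i\<close>.\<close>

theorem hopfian_wreath_nilpotent:
  assumes fg: "finitely_generated D" and c: "upper_central D c = carrier D"
    and hopf_T: "hopfian T"
    and factors: "\<And>i. i < c \<Longrightarrow> hopfian (upper_central_factor D (Suc i) \<wr> T)"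
  shows "hopfian W"
proof (rule hopfian_if_injective_over_top[OF hopf_T fg D.nilpotent_classI[OF c]])
  fix \<phi> w assume hom: "\<phi> \<in> hom W W" and surj: "\<phi> ` carrier W = carrier W"
    and over: "\<And>u. u \<in> carrier W \<Longrightarrow> snd (\<phi> u) = snd u"
    and w: "w \<in> base" "\<phi> w = \<one>\<^bsub>W\<^esub>"
  interpret \<phi>: group_hom W W \<phi>
    using hom W.is_group by (simp add: group_hom_def group_hom_axioms_def)
  let ?Z = "upper_central D"
  define B where "B i = {b \<in> base. \<forall>x\<in>carrier T. fst b x \<in> ?Z i}" for i
  have B_base: "b \<in> base" if "b \<in> B i" for b i using that by (simp add: B_def)
  have B_W: "b \<in> carrier W" if "b \<in> B i" for b i using that by (simp add: B_def)
  note Z_sub = D.upper_central_subgroup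
  have B_mult: "a \<otimes>\<^bsub>W\<^esub> inv\<^bsub>W\<^esub> b \<in> B i" if "a \<in> B i" "b \<in> B i" for a b i
    using that subgroup.m_closed[OF Z_sub] subgroup.m_inv_closed[OF Z_sub] by (simp add: B_def)
  have \<phi>_base: "\<phi> u \<in> base \<longleftrightarrow> u \<in> base" if "u \<in> carrier W" for u
    using that over baseI snd_base by (metis \<phi>.hom_closed)
  have surj_pre: "\<exists>a\<in>carrier W. \<phi> a = u" if "u \<in> carrier W" for u
    using that surj by (metis imageE)
  have B_Suc: "b \<in> B (Suc i) \<longleftrightarrow> b \<in> base \<and> (\<forall>a\<in>base. commutator W b a \<in> B i)" for b i
  proof
    assume b: "b \<in> B (Suc i)"
    then show "b \<in> base \<and> (\<forall>a\<in>base. commutator W b a \<in> B i)"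
    proof (intro conjI ballI)
      fix a assume a: "a \<in> base"
      have bb: "b \<in> base" using b B_base by blast
      have "fst (commutator W b a) x \<in> ?Z i" if x: "x \<in> carrier T" for x
      proof -
        have "fst b x \<in> ?Z (Suc i)" using b x by (simp add: B_def)
        moreover have "fst (commutator W b a) x = commutator D (fst b x) (fst a x)"
          using x fst_left_normed_base[OF bb, of "[a]" x] a by simp
        ultimately show ?thesis using a x by (simp add: D.upper_central_Suc)
      qed
      then show "commutator W b a \<in> B i" using commutator_base[OF bb a] by (simp add: B_def)
    qed (use B_base in blast)
  next
    assume b: "b \<in> base \<and> (\<forall>a\<in>base. commutator W b a \<in> B i)"
    have "fst b x \<in> ?Z (Suc i)" if x: "x \<in> carrier T" for x
    proof -
      have "commutator D (fst b x) d \<in> ?Z i" if d: "d \<in> carrier D" for d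
      proof -
        have s: "single x d \<in> base" using x d by simp
        have "fst (commutator W b (single x d)) x = commutator D (fst b x) d"
          using x fst_left_normed_base[of b "[single x d]" x] b s by simp
        moreover have "fst (commutator W b (single x d)) x \<in> ?Z i" using b s x unfolding B_def by blast
        ultimately show ?thesis by simp
      qed
      then show ?thesis using b x by (simp add: D.upper_central_Suc)
    qed
    then show "b \<in> B (Suc i)" using b by (simp add: B_def)
  qed
  have \<phi>_B: "\<phi> b \<in> B i" if "b \<in> B i" for b i
    using that
  proof (induction i arbitrary: b)
    case 0
    then have "b = \<one>\<^bsub>W\<^esub>" by (intro base_eqI) (simp_all add: B_def)
    then show ?case using 0 by simp
  next
    case (Suc i)
    have "commutator W (\<phi> b) a \<in> B i" if a: "a \<in> base" for a
    proof -
      obtain a' where a': "a' \<in> carrier W" "\<phi> a' = a" using surj_pre a by (metis base_carrier)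
      then have "a' \<in> base" using \<phi>_base a by blast
      then have "\<phi> (commutator W b a') \<in> B i" using Suc B_Suc by blast
      then show ?thesis using a' Suc.prems B_W by (simp add: \<phi>.hom_commutator)
    qed
    moreover have "\<phi> b \<in> base" using \<phi>_base[OF B_W[OF Suc.prems]] B_base[OF Suc.prems] by blast
    ultimately show ?case unfolding B_Suc[of "\<phi> b"] by blast
  qed

  have step: "b \<in> B i"
    if i: "i < c" and pre: "\<And>u. u \<in> carrier W \<Longrightarrow> \<phi> u \<in> B (Suc i) \<Longrightarrow> u \<in> B (Suc i)"
      and b: "b \<in> B (Suc i)" "\<phi> b \<in> B i" for i b
  proof -
    let ?A = "upper_central_factor D (Suc i)"
    interpret A: comm_group ?A by (rule D.comm_group_upper_central_factor)
    interpret V: wreath ?A T by unfold_locales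
    let ?q = "\<lambda>d. ?Z i #>\<^bsub>D\<^esub> d"
    have q_eq: "?q d = ?q d' \<longleftrightarrow> d \<otimes>\<^bsub>D\<^esub> inv\<^bsub>D\<^esub> d' \<in> ?Z i" if "d \<in> carrier D" "d' \<in> carrier D" for d d'
      using D.coset_eq_iff[OF Z_sub] that by blast
    have q_one: "?q d = ?Z i \<longleftrightarrow> d \<in> ?Z i" if "d \<in> carrier D" for d
      using D.coset_eq_self_iff[OF Z_sub] that by blast
    have Z_car: "d \<in> carrier D" if "d \<in> ?Z j" for d j using that subgroup.mem_carrier[OF Z_sub] by blast
    \<comment> \<open>A coset representative; the trivial coset gets \<open>1\<close>, so that finite supports are kept.\<close>
    define \<rho> where "\<rho> a = (if a = ?Z i then \<one>\<^bsub>D\<^esub> else SOME d. d \<in> ?Z (Suc i) \<and> ?q d = a)" for a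
    have \<rho>: "\<rho> a \<in> ?Z (Suc i)" "?q (\<rho> a) = a" if a: "a \<in> carrier ?A" for a
    proof -
      have "\<exists>d. d \<in> ?Z (Suc i) \<and> ?q d = a" using a by (auto simp: D.carrier_upper_central_factor)
      then have "\<rho> a \<in> ?Z (Suc i) \<and> ?q (\<rho> a) = a"
        unfolding \<rho>_def using someI_ex[of "\<lambda>d. d \<in> ?Z (Suc i) \<and> ?q d = a"] q_one[of "\<one>\<^bsub>D\<^esub>"]
          subgroup.one_closed[OF Z_sub] by simp
      then show "\<rho> a \<in> ?Z (Suc i)" "?q (\<rho> a) = a" by blast+
    qed
    have \<rho>_one: "\<rho> (?Z i) = \<one>\<^bsub>D\<^esub>" by (simp add: \<rho>_def)
    define rep where "rep u = ((\<lambda>x\<in>carrier T. \<rho> (fst u x)), \<one>\<^bsub>T\<^esub>)" for u :: "('b \<Rightarrow> 'a set) \<times> 'b"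
    define q where "q b g = ((\<lambda>x\<in>carrier T. ?q (fst b x)), g)" for b :: "('b \<Rightarrow> 'a) \<times> 'b" and g :: 'b
    have rep: "rep u \<in> B (Suc i)" if u: "u \<in> carrier V.W" for u
    proof -
      have fin: "finite {x \<in> carrier T. \<rho> (fst u x) \<noteq> \<one>\<^bsub>D\<^esub>}"
        by (rule finite_subset[OF _ V.finite_support[OF u]]) (auto simp: \<rho>_one)
      have mem: "\<rho> (fst u x) \<in> ?Z (Suc i)" if "x \<in> carrier T" for x using u that \<rho> by simp
      then have "rep u \<in> carrier W" unfolding rep_def using Z_car by (intro restrict_W[OF _ fin]) auto
      then have "rep u \<in> base" by (rule baseI) (simp add: rep_def)
      then show ?thesis using mem by (simp add: B_def) (simp add: rep_def)
    qed
    have q_W: "q b g \<in> carrier V.W" if b: "b \<in> B (Suc i)" and g: "g \<in> carrier T" for b g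
      unfolding q_def
    proof (rule V.restrict_W[OF _ _ g])
      show "(\<lambda>x. ?q (fst b x)) \<in> carrier T \<rightarrow> carrier ?A"
        using b by (auto simp: B_def D.carrier_upper_central_factor)
      show "finite {x \<in> carrier T. ?q (fst b x) \<noteq> \<one>\<^bsub>?A\<^esub>}"
        by (rule finite_subset[OF _ finite_support[OF B_W[OF b]]])
          (use q_one[of "\<one>\<^bsub>D\<^esub>"] subgroup.one_closed[OF Z_sub] in auto)
    qed
    have q_rep: "q (rep u) (snd u) = u" if u: "u \<in> carrier V.W" for u
      using u q_W[OF rep[OF u] V.snd_closed[OF u]] \<rho>
      by (intro V.W_eqI) (simp_all add: q_def rep_def)
    have q_iff: "q a g = q b g \<longleftrightarrow> a \<otimes>\<^bsub>W\<^esub> inv\<^bsub>W\<^esub> b \<in> B i"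
      if a: "a \<in> B (Suc i)" and b: "b \<in> B (Suc i)" for a b g
    proof -
      have "q a g = q b g \<longleftrightarrow> (\<forall>x\<in>carrier T. ?q (fst a x) = ?q (fst b x))"
        by (auto simp: q_def fun_eq_iff)
      also have "\<dots> \<longleftrightarrow> (\<forall>x\<in>carrier T. fst (a \<otimes>\<^bsub>W\<^esub> inv\<^bsub>W\<^esub> b) x \<in> ?Z i)"
        using a b by (intro ball_cong refl) (simp add: B_def q_eq)
      also have "\<dots> \<longleftrightarrow> a \<otimes>\<^bsub>W\<^esub> inv\<^bsub>W\<^esub> b \<in> B i"
        using a b by (simp add: B_def)
      finally show ?thesis .
    qed
    have q_\<phi>: "q (\<phi> a) g = q (\<phi> b) g" if a: "a \<in> B (Suc i)" and b: "b \<in> B (Suc i)" and "q a g = q b g" for a b g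
    proof -
      have "a \<otimes>\<^bsub>W\<^esub> inv\<^bsub>W\<^esub> b \<in> B i" using q_iff that by blast
      then have "\<phi> (a \<otimes>\<^bsub>W\<^esub> inv\<^bsub>W\<^esub> b) \<in> B i" by (rule \<phi>_B)
      then show ?thesis using a b B_W by (subst q_iff) (simp_all add: \<phi>_B)
    qed
    \<comment> \<open>The endomorphism that \<open>\<phi>\<close> induces on the wreath product of the factor with \<open>T\<close>.\<close>
    define \<Phi> where "\<Phi> u = q (\<phi> (rep u)) (snd u)" for u
    have \<Phi>_closed: "\<Phi> u \<in> carrier V.W" if u: "u \<in> carrier V.W" for u
      unfolding \<Phi>_def by (rule q_W[OF \<phi>_B[OF rep[OF u]] V.snd_closed[OF u]])
    \<comment> \<open>Modulo the term of index \<open>i\<close>, conjugation by \<open>v\<close> only shifts, as \<open>b\<close> takes values in the next term.\<close>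
    have q_mult: "q (a \<otimes>\<^bsub>W\<^esub> (v \<otimes>\<^bsub>W\<^esub> b \<otimes>\<^bsub>W\<^esub> inv\<^bsub>W\<^esub> v)) (snd v \<otimes>\<^bsub>T\<^esub> h) = q a (snd v) \<otimes>\<^bsub>V.W\<^esub> q b h"
      if a: "a \<in> B (Suc i)" and b: "b \<in> B (Suc i)" and v: "v \<in> carrier W" and h: "h \<in> carrier T" for a b v h
    proof -
      have "?q (fst (a \<otimes>\<^bsub>W\<^esub> (v \<otimes>\<^bsub>W\<^esub> b \<otimes>\<^bsub>W\<^esub> inv\<^bsub>W\<^esub> v)) x) = fst (q a (snd v) \<otimes>\<^bsub>V.W\<^esub> q b h) x"
        if x: "x \<in> carrier T" for x
      proof -
        let ?y = "inv\<^bsub>T\<^esub> (snd v) \<otimes>\<^bsub>T\<^esub> x"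
        have y: "?y \<in> carrier T" using x v by simp
        have az: "fst a x \<in> ?Z (Suc i)" and bz: "fst b ?y \<in> ?Z (Suc i)" using a b x y by (simp_all add: B_def)
        have c: "fst a x \<in> carrier D" "fst b ?y \<in> carrier D" "fst v x \<in> carrier D"
          using az bz Z_car v x by auto
        interpret Z: normal "?Z i" D by (rule D.upper_central_normal)
        have "commutator D (fst b ?y) (inv\<^bsub>D\<^esub> (fst v x)) \<in> ?Z i"
          using bz c by (simp add: D.upper_central_Suc)
        then have "(fst a x \<otimes>\<^bsub>D\<^esub> fst v x) \<otimes>\<^bsub>D\<^esub> commutator D (fst b ?y) (inv\<^bsub>D\<^esub> (fst v x)) \<otimes>\<^bsub>D\<^esub>
            inv\<^bsub>D\<^esub> (fst a x \<otimes>\<^bsub>D\<^esub> fst v x) \<in> ?Z i"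
          using c Z.inv_op_closed2 by simp
        then have "?q (fst a x \<otimes>\<^bsub>D\<^esub> (fst v x \<otimes>\<^bsub>D\<^esub> fst b ?y \<otimes>\<^bsub>D\<^esub> inv\<^bsub>D\<^esub> (fst v x))) =
            ?q (fst a x \<otimes>\<^bsub>D\<^esub> fst b ?y)"
          using c by (subst q_eq) (simp_all add: commutator_def D.word_simps)
        also have "\<dots> = fst (q a (snd v) \<otimes>\<^bsub>V.W\<^esub> q b h) x"
          using x y az bz by (simp add: q_def D.mult_upper_central_factor)
        also have "fst a x \<otimes>\<^bsub>D\<^esub> (fst v x \<otimes>\<^bsub>D\<^esub> fst b ?y \<otimes>\<^bsub>D\<^esub> inv\<^bsub>D\<^esub> (fst v x)) =
            fst (a \<otimes>\<^bsub>W\<^esub> (v \<otimes>\<^bsub>W\<^esub> b \<otimes>\<^bsub>W\<^esub> inv\<^bsub>W\<^esub> v)) x"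
          using a b v x by (simp add: B_def T.word_simps)
        finally show ?thesis .
      qed
      then have "fst (q (a \<otimes>\<^bsub>W\<^esub> (v \<otimes>\<^bsub>W\<^esub> b \<otimes>\<^bsub>W\<^esub> inv\<^bsub>W\<^esub> v)) (snd v \<otimes>\<^bsub>T\<^esub> h)) = fst (q a (snd v) \<otimes>\<^bsub>V.W\<^esub> q b h)"
        by (auto simp: q_def V.W_mult fun_eq_iff)
      then show ?thesis by (intro prod_eqI) (simp_all add: q_def)
    qed
    have B_conj: "a \<otimes>\<^bsub>W\<^esub> (v \<otimes>\<^bsub>W\<^esub> b \<otimes>\<^bsub>W\<^esub> inv\<^bsub>W\<^esub> v) \<in> B (Suc i)"
      if a: "a \<in> B (Suc i)" and b: "b \<in> B (Suc i)" and v: "v \<in> carrier W" for a b v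
    proof -
      have "fst (a \<otimes>\<^bsub>W\<^esub> (v \<otimes>\<^bsub>W\<^esub> b \<otimes>\<^bsub>W\<^esub> inv\<^bsub>W\<^esub> v)) x \<in> ?Z (Suc i)" if x: "x \<in> carrier T" for x
        using a b v x subgroup.m_closed[OF Z_sub]
          normal.inv_op_closed2[OF D.upper_central_normal, of "fst v x" "fst b (inv\<^bsub>T\<^esub> (snd v) \<otimes>\<^bsub>T\<^esub> x)"]
        by (simp add: B_def T.word_simps)
      moreover have "a \<otimes>\<^bsub>W\<^esub> (v \<otimes>\<^bsub>W\<^esub> b \<otimes>\<^bsub>W\<^esub> inv\<^bsub>W\<^esub> v) \<in> base"
        using a b v base.inv_op_closed2 B_base by simp
      ultimately show ?thesis by (simp add: B_def)
    qed
    have \<Phi>_mult: "\<Phi> (u \<otimes>\<^bsub>V.W\<^esub> v) = \<Phi> u \<otimes>\<^bsub>V.W\<^esub> \<Phi> v" if uv: "u \<in> carrier V.W" "v \<in> carrier V.W" for u v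
    proof -
      let ?t = "top (snd u)"
      let ?r = "rep u \<otimes>\<^bsub>W\<^esub> (?t \<otimes>\<^bsub>W\<^esub> rep v \<otimes>\<^bsub>W\<^esub> inv\<^bsub>W\<^esub> ?t)"
      let ?g = "snd u \<otimes>\<^bsub>T\<^esub> snd v"
      have t: "?t \<in> carrier W" using uv by simp
      note r = rep[OF uv(1)] rep[OF uv(2)]
      have "q ?r ?g = u \<otimes>\<^bsub>V.W\<^esub> v"
        using q_mult[OF r t V.snd_closed[OF uv(2)]] uv q_rep by simp
      also have "\<dots> = q (rep (u \<otimes>\<^bsub>V.W\<^esub> v)) ?g"
        using q_rep[of "u \<otimes>\<^bsub>V.W\<^esub> v"] uv by simp
      finally have "q (rep (u \<otimes>\<^bsub>V.W\<^esub> v)) ?g = q ?r ?g" ..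
      then have "q (\<phi> (rep (u \<otimes>\<^bsub>V.W\<^esub> v))) ?g = q (\<phi> ?r) ?g"
        using uv by (intro q_\<phi> rep B_conj r t) simp_all
      also have "\<phi> ?r = \<phi> (rep u) \<otimes>\<^bsub>W\<^esub> (\<phi> ?t \<otimes>\<^bsub>W\<^esub> \<phi> (rep v) \<otimes>\<^bsub>W\<^esub> inv\<^bsub>W\<^esub> \<phi> ?t)"
        using r[THEN B_W] t by simp
      also have "q \<dots> ?g = q (\<phi> (rep u)) (snd u) \<otimes>\<^bsub>V.W\<^esub> q (\<phi> (rep v)) (snd v)"
        using q_mult[OF \<phi>_B[OF r(1)] \<phi>_B[OF r(2)] \<phi>.hom_closed[OF t] V.snd_closed[OF uv(2)]] over[OF t]
        by simp
      finally show ?thesis by (simp add: \<Phi>_def)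
    qed
    have \<Phi>_q: "\<Phi> (q a g) = q (\<phi> a) g" if a: "a \<in> B (Suc i)" and g: "g \<in> carrier T" for a g
    proof -
      have "q (rep (q a g)) g = q a g" using q_rep[OF q_W[OF a g]] by (simp add: q_def)
      then have "q (\<phi> (rep (q a g))) g = q (\<phi> a) g" by (rule q_\<phi>[OF rep[OF q_W[OF a g]] a])
      then show ?thesis by (simp add: \<Phi>_def q_def)
    qed
    have \<Phi>_surj: "u \<in> \<Phi> ` carrier V.W" if u: "u \<in> carrier V.W" for u
    proof -
      obtain a where a: "a \<in> carrier W" "\<phi> a = rep u" using surj_pre B_W[OF rep[OF u]] by blast
      then have "a \<in> B (Suc i)" using pre rep[OF u] by simp
      moreover from this have "\<Phi> (q a (snd u)) = u" using \<Phi>_q a q_rep u by simp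
      ultimately show ?thesis using q_W u by (metis V.snd_closed imageI)
    qed
    have "inj_on \<Phi> (carrier V.W)"
    proof (rule hopfianD)
      show "hopfian V.W" using factors i by blast
      show "\<Phi> \<in> hom V.W V.W" using \<Phi>_closed \<Phi>_mult by (simp add: hom_def)
      show "\<Phi> ` carrier V.W = carrier V.W" using \<Phi>_closed \<Phi>_surj by blast
    qed
    moreover have one: "\<one>\<^bsub>W\<^esub> \<in> B j" for j
      using subgroup.one_closed[OF Z_sub] by (simp add: B_def)
    have "q (\<phi> b) \<one>\<^bsub>T\<^esub> = q (\<phi> \<one>\<^bsub>W\<^esub>) \<one>\<^bsub>T\<^esub>"
      using b one \<phi>_B B_W by (subst q_iff) simp_all
    then have "\<Phi> (q b \<one>\<^bsub>T\<^esub>) = \<Phi> (q \<one>\<^bsub>W\<^esub> \<one>\<^bsub>T\<^esub>)" using \<Phi>_q b one by simp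
    ultimately have "q b \<one>\<^bsub>T\<^esub> = q \<one>\<^bsub>W\<^esub> \<one>\<^bsub>T\<^esub>"
      using q_W b one by (metis T.one_closed inj_onD)
    then show "b \<in> B i" using q_iff b one B_W by fastforce
  qed

  have "u \<in> B (c - k)" if "u \<in> carrier W" "\<phi> u \<in> B (c - k)" for u k
    using that
  proof (induction k arbitrary: u)
    case 0
    then show ?case using c \<phi>_base by (simp add: B_def)
  next
    case (Suc k)
    show ?case
    proof (cases "k < c")
      case True
      define i where "i = c - Suc k"
      have i: "i < c" "c - k = Suc i" using True by (auto simp: i_def)
      have "B i \<subseteq> B (Suc i)" using D.upper_central_mono_Suc by (auto simp: B_def)
      then have "u \<in> B (Suc i)" using Suc i by (metis i_def subsetD)
      then have "u \<in> B i" using step[OF i(1)] Suc i by (metis i_def)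
      then show ?thesis by (simp add: i_def)
    next
      case False
      then show ?thesis using Suc by simp
    qed
  qed
  from this[of w c] have "w \<in> B 0" using w by (simp add: B_def)
  then show "w = \<one>\<^bsub>W\<^esub>" by (intro base_eqI) (simp_all add: B_def)
qed

end

section \<open>Group rings\<close>

lemma (in abelian_monoid) finsum_mono_neutral:
  assumes "finite F" "A \<subseteq> F" "\<And>i. i \<in> F - A \<Longrightarrow> f i = \<zero>" "f \<in> F \<rightarrow> carrier G"
  shows "finsum G f A = finsum G f F"
  by (rule add.finprod_mono_neutral_cong_left) (use assms in auto)

lemma (in abelian_monoid) finsum_swap:
  assumes "finite A" "finite B" "\<And>i j. i \<in> A \<Longrightarrow> j \<in> B \<Longrightarrow> f i j \<in> carrier G"
  shows "(\<Oplus>i\<in>A. \<Oplus>j\<in>B. f i j) = (\<Oplus>j\<in>B. \<Oplus>i\<in>A. f i j)"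
  using assms(1,3)
proof (induction A)
  case empty
  then show ?case by (simp add: finsum_zero)
next
  case (insert a A)
  have "(\<Oplus>i\<in>insert a A. \<Oplus>j\<in>B. f i j) = (\<Oplus>j\<in>B. f a j) \<oplus> (\<Oplus>i\<in>A. \<Oplus>j\<in>B. f i j)"
    using insert by (intro finsum_insert) (auto intro!: finsum_closed)
  also have "\<dots> = (\<Oplus>j\<in>B. f a j) \<oplus> (\<Oplus>j\<in>B. \<Oplus>i\<in>A. f i j)" using insert by simp
  also have "\<dots> = (\<Oplus>j\<in>B. f a j \<oplus> (\<Oplus>i\<in>A. f i j))"
    using insert by (intro finsum_addf[symmetric]) (auto intro!: finsum_closed)
  also have "\<dots> = (\<Oplus>j\<in>B. \<Oplus>i\<in>insert a A. f i j)"
    using insert by (intro finsum_cong' finsum_insert[symmetric]) (auto intro!: finsum_closed)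
  finally show ?case .
qed

locale grp_ring = R: ring R + G: group G
  for R :: "('k, 'm) ring_scheme" and G :: "('g, 'n) monoid_scheme"
begin

abbreviation P :: "('g \<Rightarrow> 'k) ring" where "P \<equiv> group_ring R G"

definition supp :: "('g \<Rightarrow> 'k) \<Rightarrow> 'g set" where
  "supp x = {g \<in> carrier G. x g \<noteq> \<zero>\<^bsub>R\<^esub>}"

lemma supp_subset: "supp x \<subseteq> carrier G"
  by (auto simp: supp_def)

lemma supp_mem: "g \<in> supp x \<Longrightarrow> g \<in> carrier G"
  by (simp add: supp_def)

lemma carrier_P: "x \<in> carrier P \<longleftrightarrow> x \<in> carrier G \<rightarrow>\<^sub>E carrier R \<and> finite (supp x)"
  by (auto simp: group_ring_def supp_def)

lemma P_closed [simp]: "x \<in> carrier P \<Longrightarrow> g \<in> carrier G \<Longrightarrow> x g \<in> carrier R"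
  by (auto simp: carrier_P)

lemma finite_supp [simp]: "x \<in> carrier P \<Longrightarrow> finite (supp x)"
  by (simp add: carrier_P)

lemma P_eqI:
  assumes "x \<in> carrier P" "y \<in> carrier P" "\<And>g. g \<in> carrier G \<Longrightarrow> x g = y g"
  shows "x = y"
  by (rule PiE_ext[of _ "carrier G" "\<lambda>_. carrier R"]) (use assms in \<open>auto simp: carrier_P\<close>)

lemma P_restrictI:
  assumes "\<And>g. g \<in> carrier G \<Longrightarrow> f g \<in> carrier R" "finite F"
    "\<And>g. g \<in> carrier G \<Longrightarrow> f g \<noteq> \<zero>\<^bsub>R\<^esub> \<Longrightarrow> g \<in> F"
  shows "restrict f (carrier G) \<in> carrier P"
proof -
  have "supp (restrict f (carrier G)) \<subseteq> F" using assms(3) by (auto simp: supp_def)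
  then show ?thesis using assms(1,2) finite_subset by (auto simp: carrier_P)
qed

lemma P_zero [simp]: "g \<in> carrier G \<Longrightarrow> \<zero>\<^bsub>P\<^esub> g = \<zero>\<^bsub>R\<^esub>"
  and P_one [simp]: "g \<in> carrier G \<Longrightarrow> \<one>\<^bsub>P\<^esub> g = (if g = \<one>\<^bsub>G\<^esub> then \<one>\<^bsub>R\<^esub> else \<zero>\<^bsub>R\<^esub>)"
  and P_add [simp]: "g \<in> carrier G \<Longrightarrow> (x \<oplus>\<^bsub>P\<^esub> y) g = x g \<oplus>\<^bsub>R\<^esub> y g"
  by (simp_all add: group_ring_def)

lemma P_mult:
  "g \<in> carrier G \<Longrightarrow> (x \<otimes>\<^bsub>P\<^esub> y) g = (\<Oplus>\<^bsub>R\<^esub>h\<in>supp x. x h \<otimes>\<^bsub>R\<^esub> y (inv\<^bsub>G\<^esub> h \<otimes>\<^bsub>G\<^esub> g))"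
  by (simp add: group_ring_def supp_def)

lemma P_mult_superset:
  assumes "x \<in> carrier P" "y \<in> carrier P" "g \<in> carrier G"
    and F: "finite F" "supp x \<subseteq> F" "F \<subseteq> carrier G"
  shows "(x \<otimes>\<^bsub>P\<^esub> y) g = (\<Oplus>\<^bsub>R\<^esub>h\<in>F. x h \<otimes>\<^bsub>R\<^esub> y (inv\<^bsub>G\<^esub> h \<otimes>\<^bsub>G\<^esub> g))"
  unfolding P_mult[OF assms(3)]
proof (rule R.finsum_mono_neutral[OF F(1,2)])
  show "x h \<otimes>\<^bsub>R\<^esub> y (inv\<^bsub>G\<^esub> h \<otimes>\<^bsub>G\<^esub> g) = \<zero>\<^bsub>R\<^esub>" if h: "h \<in> F - supp x" for h
  proof -
    have "h \<in> carrier G" "x h = \<zero>\<^bsub>R\<^esub>" using h F(3) by (auto simp: supp_def)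
    then show ?thesis using assms by simp
  qed
qed (use assms in auto)

lemma P_mult_closed:
  assumes x: "x \<in> carrier P" and y: "y \<in> carrier P" shows "x \<otimes>\<^bsub>P\<^esub> y \<in> carrier P"
proof -
  let ?f = "\<lambda>g. \<Oplus>\<^bsub>R\<^esub>h\<in>supp x. x h \<otimes>\<^bsub>R\<^esub> y (inv\<^bsub>G\<^esub> h \<otimes>\<^bsub>G\<^esub> g)"
  have "restrict ?f (carrier G) \<in> carrier P"
  proof (rule P_restrictI)
    show "finite ((\<lambda>(h, l). h \<otimes>\<^bsub>G\<^esub> l) ` (supp x \<times> supp y))" using x y by simp
    fix g assume g: "g \<in> carrier G"
    show "?f g \<in> carrier R" using x y g by (intro R.finsum_closed) (auto dest: supp_mem)
    assume ne: "?f g \<noteq> \<zero>\<^bsub>R\<^esub>"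
    have "\<exists>h\<in>supp x. x h \<otimes>\<^bsub>R\<^esub> y (inv\<^bsub>G\<^esub> h \<otimes>\<^bsub>G\<^esub> g) \<noteq> \<zero>\<^bsub>R\<^esub>"
    proof (rule ccontr)
      assume "\<not> ?thesis"
      then have "?f g = (\<Oplus>\<^bsub>R\<^esub>h\<in>supp x. \<zero>\<^bsub>R\<^esub>)" by (intro R.finsum_cong') auto
      then show False using ne by (simp add: R.finsum_zero)
    qed
    then obtain h where h: "h \<in> supp x" "x h \<otimes>\<^bsub>R\<^esub> y (inv\<^bsub>G\<^esub> h \<otimes>\<^bsub>G\<^esub> g) \<noteq> \<zero>\<^bsub>R\<^esub>" by blast
    have hG: "h \<in> carrier G" using h supp_subset by blast
    have "y (inv\<^bsub>G\<^esub> h \<otimes>\<^bsub>G\<^esub> g) \<noteq> \<zero>\<^bsub>R\<^esub>" using h hG x by auto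
    then have "inv\<^bsub>G\<^esub> h \<otimes>\<^bsub>G\<^esub> g \<in> supp y" using hG g by (simp add: supp_def)
    moreover have "g = h \<otimes>\<^bsub>G\<^esub> (inv\<^bsub>G\<^esub> h \<otimes>\<^bsub>G\<^esub> g)" using hG g by (simp add: G.inv_mult_cancel)
    ultimately show "g \<in> (\<lambda>(h, l). h \<otimes>\<^bsub>G\<^esub> l) ` (supp x \<times> supp y)"
      using h by (intro image_eqI[of _ _ "(h, inv\<^bsub>G\<^esub> h \<otimes>\<^bsub>G\<^esub> g)"]) auto
  qed
  moreover have "x \<otimes>\<^bsub>P\<^esub> y = restrict ?f (carrier G)" by (simp add: group_ring_def supp_def)
  ultimately show ?thesis by simp
qed

text \<open>Both sides of the associative law are the sum of \<open>x\<^sub>h y\<^sub>l z\<^sub>k\<close> over \<open>h l k = g\<close>.\<close>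

lemma P_mult_assoc:
  assumes x: "x \<in> carrier P" and y: "y \<in> carrier P" and z: "z \<in> carrier P"
  shows "x \<otimes>\<^bsub>P\<^esub> y \<otimes>\<^bsub>P\<^esub> z = x \<otimes>\<^bsub>P\<^esub> (y \<otimes>\<^bsub>P\<^esub> z)"
proof (rule P_eqI)
  show "x \<otimes>\<^bsub>P\<^esub> y \<otimes>\<^bsub>P\<^esub> z \<in> carrier P" "x \<otimes>\<^bsub>P\<^esub> (y \<otimes>\<^bsub>P\<^esub> z) \<in> carrier P"
    using assms P_mult_closed by simp_all
  fix g assume g: "g \<in> carrier G"
  note car = subsetD[OF supp_subset]
  define F where "F = supp (x \<otimes>\<^bsub>P\<^esub> y) \<union> (\<lambda>(h, l). h \<otimes>\<^bsub>G\<^esub> l) ` (supp x \<times> supp y)"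
  have F_fin: "finite F" using x y P_mult_closed by (simp add: F_def)
  have F_car: "F \<subseteq> carrier G" using car by (auto simp: F_def)
  have Fx: "h \<otimes>\<^bsub>G\<^esub> l \<in> F" if "h \<in> supp x" "l \<in> supp y" for h l using that by (auto simp: F_def)
  have inner: "(\<Oplus>\<^bsub>R\<^esub>m\<in>F. y (inv\<^bsub>G\<^esub> h \<otimes>\<^bsub>G\<^esub> m) \<otimes>\<^bsub>R\<^esub> z (inv\<^bsub>G\<^esub> m \<otimes>\<^bsub>G\<^esub> g)) = (y \<otimes>\<^bsub>P\<^esub> z) (inv\<^bsub>G\<^esub> h \<otimes>\<^bsub>G\<^esub> g)"
    if h: "h \<in> supp x" for h
  proof -
    let ?f = "\<lambda>m. y (inv\<^bsub>G\<^esub> h \<otimes>\<^bsub>G\<^esub> m) \<otimes>\<^bsub>R\<^esub> z (inv\<^bsub>G\<^esub> m \<otimes>\<^bsub>G\<^esub> g)"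
    have hG: "h \<in> carrier G" using h car by blast
    have "finsum R ?f ((\<lambda>l. h \<otimes>\<^bsub>G\<^esub> l) ` supp y) = finsum R ?f F"
    proof (rule R.finsum_mono_neutral[OF F_fin])
      show "(\<lambda>l. h \<otimes>\<^bsub>G\<^esub> l) ` supp y \<subseteq> F" using Fx h by blast
      show "?f m = \<zero>\<^bsub>R\<^esub>" if m: "m \<in> F - (\<lambda>l. h \<otimes>\<^bsub>G\<^esub> l) ` supp y" for m
      proof -
        have mG: "m \<in> carrier G" using m F_car by blast
        have "m = h \<otimes>\<^bsub>G\<^esub> (inv\<^bsub>G\<^esub> h \<otimes>\<^bsub>G\<^esub> m)" using hG mG by (simp add: G.inv_mult_cancel)
        then have "inv\<^bsub>G\<^esub> h \<otimes>\<^bsub>G\<^esub> m \<notin> supp y" using m by blast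
        then have "y (inv\<^bsub>G\<^esub> h \<otimes>\<^bsub>G\<^esub> m) = \<zero>\<^bsub>R\<^esub>" using hG mG by (simp add: supp_def)
        then show ?thesis using z mG g by simp
      qed
      show "?f \<in> F \<rightarrow> carrier R" using y z hG g F_car by auto
    qed
    also have "finsum R ?f ((\<lambda>l. h \<otimes>\<^bsub>G\<^esub> l) ` supp y) = (\<Oplus>\<^bsub>R\<^esub>l\<in>supp y. ?f (h \<otimes>\<^bsub>G\<^esub> l))"
      by (rule R.finsum_reindex) (use y z hG g car in \<open>auto simp: inj_on_def\<close>)
    also have "\<dots> = (\<Oplus>\<^bsub>R\<^esub>l\<in>supp y. y l \<otimes>\<^bsub>R\<^esub> z (inv\<^bsub>G\<^esub> l \<otimes>\<^bsub>G\<^esub> (inv\<^bsub>G\<^esub> h \<otimes>\<^bsub>G\<^esub> g)))"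
      by (rule R.finsum_cong') (use y z hG g car in \<open>auto simp: G.word_simps\<close>)
    also have "\<dots> = (y \<otimes>\<^bsub>P\<^esub> z) (inv\<^bsub>G\<^esub> h \<otimes>\<^bsub>G\<^esub> g)" using hG g by (simp add: P_mult)
    finally show ?thesis ..
  qed
  have "(x \<otimes>\<^bsub>P\<^esub> y \<otimes>\<^bsub>P\<^esub> z) g = (\<Oplus>\<^bsub>R\<^esub>m\<in>F. (x \<otimes>\<^bsub>P\<^esub> y) m \<otimes>\<^bsub>R\<^esub> z (inv\<^bsub>G\<^esub> m \<otimes>\<^bsub>G\<^esub> g))"
    by (rule P_mult_superset) (use x y z g F_fin F_car P_mult_closed in \<open>auto simp: F_def\<close>)
  also have "\<dots> = (\<Oplus>\<^bsub>R\<^esub>m\<in>F. \<Oplus>\<^bsub>R\<^esub>h\<in>supp x.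
      x h \<otimes>\<^bsub>R\<^esub> (y (inv\<^bsub>G\<^esub> h \<otimes>\<^bsub>G\<^esub> m) \<otimes>\<^bsub>R\<^esub> z (inv\<^bsub>G\<^esub> m \<otimes>\<^bsub>G\<^esub> g)))"
  proof (rule R.finsum_cong'[OF refl])
    fix m assume m: "m \<in> F"
    then have mG: "m \<in> carrier G" using F_car by blast
    have "(x \<otimes>\<^bsub>P\<^esub> y) m \<otimes>\<^bsub>R\<^esub> z (inv\<^bsub>G\<^esub> m \<otimes>\<^bsub>G\<^esub> g) =
        (\<Oplus>\<^bsub>R\<^esub>h\<in>supp x. x h \<otimes>\<^bsub>R\<^esub> y (inv\<^bsub>G\<^esub> h \<otimes>\<^bsub>G\<^esub> m) \<otimes>\<^bsub>R\<^esub> z (inv\<^bsub>G\<^esub> m \<otimes>\<^bsub>G\<^esub> g))"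
      unfolding P_mult[OF mG]
      by (rule R.finsum_ldistr) (use x y z g mG car in auto)
    also have "\<dots> = (\<Oplus>\<^bsub>R\<^esub>h\<in>supp x. x h \<otimes>\<^bsub>R\<^esub> (y (inv\<^bsub>G\<^esub> h \<otimes>\<^bsub>G\<^esub> m) \<otimes>\<^bsub>R\<^esub> z (inv\<^bsub>G\<^esub> m \<otimes>\<^bsub>G\<^esub> g)))"
      by (rule R.finsum_cong') (use x y z g mG car in \<open>auto simp: R.m_assoc\<close>)
    finally show "(x \<otimes>\<^bsub>P\<^esub> y) m \<otimes>\<^bsub>R\<^esub> z (inv\<^bsub>G\<^esub> m \<otimes>\<^bsub>G\<^esub> g) = \<dots>" .
  qed (use x y z g car F_car in \<open>auto intro!: R.finsum_closed\<close>)
  also have "\<dots> = (\<Oplus>\<^bsub>R\<^esub>h\<in>supp x. \<Oplus>\<^bsub>R\<^esub>m\<in>F.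
      x h \<otimes>\<^bsub>R\<^esub> (y (inv\<^bsub>G\<^esub> h \<otimes>\<^bsub>G\<^esub> m) \<otimes>\<^bsub>R\<^esub> z (inv\<^bsub>G\<^esub> m \<otimes>\<^bsub>G\<^esub> g)))"
    by (rule R.finsum_swap) (use x y z g F_fin F_car car in auto)
  also have "\<dots> = (\<Oplus>\<^bsub>R\<^esub>h\<in>supp x. x h \<otimes>\<^bsub>R\<^esub> (y \<otimes>\<^bsub>P\<^esub> z) (inv\<^bsub>G\<^esub> h \<otimes>\<^bsub>G\<^esub> g))"
  proof (rule R.finsum_cong'[OF refl])
    fix h assume h: "h \<in> supp x"
    have "(\<Oplus>\<^bsub>R\<^esub>m\<in>F. x h \<otimes>\<^bsub>R\<^esub> (y (inv\<^bsub>G\<^esub> h \<otimes>\<^bsub>G\<^esub> m) \<otimes>\<^bsub>R\<^esub> z (inv\<^bsub>G\<^esub> m \<otimes>\<^bsub>G\<^esub> g))) =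
        x h \<otimes>\<^bsub>R\<^esub> (\<Oplus>\<^bsub>R\<^esub>m\<in>F. y (inv\<^bsub>G\<^esub> h \<otimes>\<^bsub>G\<^esub> m) \<otimes>\<^bsub>R\<^esub> z (inv\<^bsub>G\<^esub> m \<otimes>\<^bsub>G\<^esub> g))"
      by (rule R.finsum_rdistr[symmetric]) (use x y z g h F_fin F_car car in auto)
    then show "(\<Oplus>\<^bsub>R\<^esub>m\<in>F. x h \<otimes>\<^bsub>R\<^esub> (y (inv\<^bsub>G\<^esub> h \<otimes>\<^bsub>G\<^esub> m) \<otimes>\<^bsub>R\<^esub> z (inv\<^bsub>G\<^esub> m \<otimes>\<^bsub>G\<^esub> g))) =
        x h \<otimes>\<^bsub>R\<^esub> (y \<otimes>\<^bsub>P\<^esub> z) (inv\<^bsub>G\<^esub> h \<otimes>\<^bsub>G\<^esub> g)" using inner[OF h] by simp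
  qed (use x y z g car P_mult_closed in auto)
  also have "\<dots> = (x \<otimes>\<^bsub>P\<^esub> (y \<otimes>\<^bsub>P\<^esub> z)) g" using g by (simp add: P_mult)
  finally show "(x \<otimes>\<^bsub>P\<^esub> y \<otimes>\<^bsub>P\<^esub> z) g = (x \<otimes>\<^bsub>P\<^esub> (y \<otimes>\<^bsub>P\<^esub> z)) g" .
qed

lemma P_zero_closed: "\<zero>\<^bsub>P\<^esub> \<in> carrier P"
  using P_restrictI[of "\<lambda>_. \<zero>\<^bsub>R\<^esub>" "{}"] by (simp add: group_ring_def)

lemma P_one_closed: "\<one>\<^bsub>P\<^esub> \<in> carrier P"
proof -
  have "restrict (\<lambda>g. if g = \<one>\<^bsub>G\<^esub> then \<one>\<^bsub>R\<^esub> else \<zero>\<^bsub>R\<^esub>) (carrier G) \<in> carrier P"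
    by (rule P_restrictI[where F = "{\<one>\<^bsub>G\<^esub>}"]) (auto split: if_splits)
  then show ?thesis by (simp add: group_ring_def)
qed

lemma P_add_closed: "x \<in> carrier P \<Longrightarrow> y \<in> carrier P \<Longrightarrow> x \<oplus>\<^bsub>P\<^esub> y \<in> carrier P"
proof -
  assume xy: "x \<in> carrier P" "y \<in> carrier P"
  have "restrict (\<lambda>g. x g \<oplus>\<^bsub>R\<^esub> y g) (carrier G) \<in> carrier P"
  proof (rule P_restrictI[where F = "supp x \<union> supp y"])
    show "g \<in> supp x \<union> supp y" if "g \<in> carrier G" "x g \<oplus>\<^bsub>R\<^esub> y g \<noteq> \<zero>\<^bsub>R\<^esub>" for g
      using that by (auto simp: supp_def)
  qed (use xy in auto)
  moreover have "x \<oplus>\<^bsub>P\<^esub> y = restrict (\<lambda>g. x g \<oplus>\<^bsub>R\<^esub> y g) (carrier G)" by (simp add: group_ring_def)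
  ultimately show ?thesis by simp
qed

lemma supp_one: "supp \<one>\<^bsub>P\<^esub> \<subseteq> {\<one>\<^bsub>G\<^esub>}"
  by (auto simp: supp_def split: if_splits)

sublocale P: ring P
proof (rule ringI)
  show "abelian_group P"
  proof (rule abelian_groupI)
    fix x assume x: "x \<in> carrier P"
    show "\<zero>\<^bsub>P\<^esub> \<oplus>\<^bsub>P\<^esub> x = x"
      by (rule P_eqI) (use x P_zero_closed P_add_closed in auto)
    have m: "restrict (\<lambda>g. \<ominus>\<^bsub>R\<^esub> x g) (carrier G) \<in> carrier P"
      by (rule P_restrictI[where F = "supp x"]) (use x in \<open>auto simp: supp_def carrier_P\<close>)
    show "\<exists>y\<in>carrier P. y \<oplus>\<^bsub>P\<^esub> x = \<zero>\<^bsub>P\<^esub>"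
      by (rule bexI[OF _ m], rule P_eqI)
        (use x m P_zero_closed P_add_closed R.l_neg in auto)
  next
    fix x y assume "x \<in> carrier P" "y \<in> carrier P"
    then show "x \<oplus>\<^bsub>P\<^esub> y = y \<oplus>\<^bsub>P\<^esub> x"
      by (intro P_eqI) (simp_all add: P_add_closed R.a_comm)
  next
    fix x y z assume "x \<in> carrier P" "y \<in> carrier P" "z \<in> carrier P"
    then show "x \<oplus>\<^bsub>P\<^esub> y \<oplus>\<^bsub>P\<^esub> z = x \<oplus>\<^bsub>P\<^esub> (y \<oplus>\<^bsub>P\<^esub> z)"
      by (intro P_eqI) (simp_all add: P_add_closed R.a_assoc)
  qed (simp_all add: P_zero_closed P_add_closed)
  show "monoid P"
  proof (rule monoidI)
    fix x assume x: "x \<in> carrier P"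
    show "\<one>\<^bsub>P\<^esub> \<otimes>\<^bsub>P\<^esub> x = x"
    proof (rule P_eqI)
      fix g assume g: "g \<in> carrier G"
      have "(\<one>\<^bsub>P\<^esub> \<otimes>\<^bsub>P\<^esub> x) g = (\<Oplus>\<^bsub>R\<^esub>h\<in>{\<one>\<^bsub>G\<^esub>}. \<one>\<^bsub>P\<^esub> h \<otimes>\<^bsub>R\<^esub> x (inv\<^bsub>G\<^esub> h \<otimes>\<^bsub>G\<^esub> g))"
        by (rule P_mult_superset) (use x g P_one_closed supp_one in auto)
      also have "\<dots> = \<one>\<^bsub>P\<^esub> \<one>\<^bsub>G\<^esub> \<otimes>\<^bsub>R\<^esub> x (inv\<^bsub>G\<^esub> \<one>\<^bsub>G\<^esub> \<otimes>\<^bsub>G\<^esub> g)"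
        using x g by (subst R.finsum_insert) simp_all
      finally show "(\<one>\<^bsub>P\<^esub> \<otimes>\<^bsub>P\<^esub> x) g = x g" using x g by simp
    qed (use x P_one_closed P_mult_closed in auto)
    show "x \<otimes>\<^bsub>P\<^esub> \<one>\<^bsub>P\<^esub> = x"
    proof (rule P_eqI)
      fix g assume g: "g \<in> carrier G"
      have "(x \<otimes>\<^bsub>P\<^esub> \<one>\<^bsub>P\<^esub>) g = (\<Oplus>\<^bsub>R\<^esub>h\<in>insert g (supp x). x h \<otimes>\<^bsub>R\<^esub> \<one>\<^bsub>P\<^esub> (inv\<^bsub>G\<^esub> h \<otimes>\<^bsub>G\<^esub> g))"
        by (rule P_mult_superset) (use x g P_one_closed supp_subset in auto)
      also have "\<dots> = (\<Oplus>\<^bsub>R\<^esub>h\<in>{g}. x h \<otimes>\<^bsub>R\<^esub> \<one>\<^bsub>P\<^esub> (inv\<^bsub>G\<^esub> h \<otimes>\<^bsub>G\<^esub> g))"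
      proof (rule R.finsum_mono_neutral[symmetric])
        fix h assume h: "h \<in> insert g (supp x) - {g}"
        then have hG: "h \<in> carrier G" "h \<noteq> g" using supp_subset by auto
        then have "inv\<^bsub>G\<^esub> h \<otimes>\<^bsub>G\<^esub> g \<noteq> \<one>\<^bsub>G\<^esub>" using g by (metis G.inv_closed G.inv_equality G.inv_inv G.inv_comm)
        then show "x h \<otimes>\<^bsub>R\<^esub> \<one>\<^bsub>P\<^esub> (inv\<^bsub>G\<^esub> h \<otimes>\<^bsub>G\<^esub> g) = \<zero>\<^bsub>R\<^esub>" using hG g x by simp
      qed (use x g P_one_closed in \<open>auto simp del: P_one dest: supp_mem\<close>)
      also have "\<dots> = x g \<otimes>\<^bsub>R\<^esub> \<one>\<^bsub>P\<^esub> (inv\<^bsub>G\<^esub> g \<otimes>\<^bsub>G\<^esub> g)"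
        using x g by (subst R.finsum_insert) simp_all
      finally show "(x \<otimes>\<^bsub>P\<^esub> \<one>\<^bsub>P\<^esub>) g = x g" using x g by simp
    qed (use x P_one_closed P_mult_closed in auto)
  qed (simp_all add: P_one_closed P_mult_closed P_mult_assoc)
  fix x y z assume xyz: "x \<in> carrier P" "y \<in> carrier P" "z \<in> carrier P"
  note car = subsetD[OF supp_subset]
  show "(x \<oplus>\<^bsub>P\<^esub> y) \<otimes>\<^bsub>P\<^esub> z = x \<otimes>\<^bsub>P\<^esub> z \<oplus>\<^bsub>P\<^esub> y \<otimes>\<^bsub>P\<^esub> z"
  proof (rule P_eqI)
    fix g assume g: "g \<in> carrier G"
    let ?F = "supp x \<union> supp y \<union> supp (x \<oplus>\<^bsub>P\<^esub> y)"
    have F: "finite ?F" "?F \<subseteq> carrier G" using xyz P_add_closed supp_subset by auto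
    have "((x \<oplus>\<^bsub>P\<^esub> y) \<otimes>\<^bsub>P\<^esub> z) g = (\<Oplus>\<^bsub>R\<^esub>h\<in>?F. (x \<oplus>\<^bsub>P\<^esub> y) h \<otimes>\<^bsub>R\<^esub> z (inv\<^bsub>G\<^esub> h \<otimes>\<^bsub>G\<^esub> g))"
      by (rule P_mult_superset) (use xyz g F P_add_closed in auto)
    also have "\<dots> = (\<Oplus>\<^bsub>R\<^esub>h\<in>?F. x h \<otimes>\<^bsub>R\<^esub> z (inv\<^bsub>G\<^esub> h \<otimes>\<^bsub>G\<^esub> g) \<oplus>\<^bsub>R\<^esub> y h \<otimes>\<^bsub>R\<^esub> z (inv\<^bsub>G\<^esub> h \<otimes>\<^bsub>G\<^esub> g))"
      by (rule R.finsum_cong') (use xyz g F car in \<open>auto simp: R.l_distr\<close>)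
    also have "\<dots> = (\<Oplus>\<^bsub>R\<^esub>h\<in>?F. x h \<otimes>\<^bsub>R\<^esub> z (inv\<^bsub>G\<^esub> h \<otimes>\<^bsub>G\<^esub> g)) \<oplus>\<^bsub>R\<^esub> (\<Oplus>\<^bsub>R\<^esub>h\<in>?F. y h \<otimes>\<^bsub>R\<^esub> z (inv\<^bsub>G\<^esub> h \<otimes>\<^bsub>G\<^esub> g))"
      by (rule R.finsum_addf) (use xyz g F car in auto)
    also have "(\<Oplus>\<^bsub>R\<^esub>h\<in>?F. x h \<otimes>\<^bsub>R\<^esub> z (inv\<^bsub>G\<^esub> h \<otimes>\<^bsub>G\<^esub> g)) = (x \<otimes>\<^bsub>P\<^esub> z) g"
      by (rule P_mult_superset[symmetric]) (use xyz g F in auto)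
    also have "(\<Oplus>\<^bsub>R\<^esub>h\<in>?F. y h \<otimes>\<^bsub>R\<^esub> z (inv\<^bsub>G\<^esub> h \<otimes>\<^bsub>G\<^esub> g)) = (y \<otimes>\<^bsub>P\<^esub> z) g"
      by (rule P_mult_superset[symmetric]) (use xyz g F in auto)
    finally show "((x \<oplus>\<^bsub>P\<^esub> y) \<otimes>\<^bsub>P\<^esub> z) g = (x \<otimes>\<^bsub>P\<^esub> z \<oplus>\<^bsub>P\<^esub> y \<otimes>\<^bsub>P\<^esub> z) g" using g by simp
  qed (use xyz P_add_closed P_mult_closed in auto)
  show "z \<otimes>\<^bsub>P\<^esub> (x \<oplus>\<^bsub>P\<^esub> y) = z \<otimes>\<^bsub>P\<^esub> x \<oplus>\<^bsub>P\<^esub> z \<otimes>\<^bsub>P\<^esub> y"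
  proof (rule P_eqI)
    fix g assume g: "g \<in> carrier G"
    have "(z \<otimes>\<^bsub>P\<^esub> (x \<oplus>\<^bsub>P\<^esub> y)) g =
        (\<Oplus>\<^bsub>R\<^esub>h\<in>supp z. z h \<otimes>\<^bsub>R\<^esub> x (inv\<^bsub>G\<^esub> h \<otimes>\<^bsub>G\<^esub> g) \<oplus>\<^bsub>R\<^esub> z h \<otimes>\<^bsub>R\<^esub> y (inv\<^bsub>G\<^esub> h \<otimes>\<^bsub>G\<^esub> g))"
      unfolding P_mult[OF g]
      by (rule R.finsum_cong') (use xyz g car in \<open>auto simp: R.r_distr\<close>)
    also have "\<dots> = (z \<otimes>\<^bsub>P\<^esub> x) g \<oplus>\<^bsub>R\<^esub> (z \<otimes>\<^bsub>P\<^esub> y) g"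
      unfolding P_mult[OF g] by (rule R.finsum_addf) (use xyz g car in auto)
    finally show "(z \<otimes>\<^bsub>P\<^esub> (x \<oplus>\<^bsub>P\<^esub> y)) g = (z \<otimes>\<^bsub>P\<^esub> x \<oplus>\<^bsub>P\<^esub> z \<otimes>\<^bsub>P\<^esub> y) g" using g by simp
  qed (use xyz P_add_closed P_mult_closed in auto)
qed

definition shift :: "'g \<Rightarrow> ('g \<Rightarrow> 'k) \<Rightarrow> 'g \<Rightarrow> 'k" where
  "shift s x = (\<lambda>g\<in>carrier G. x (inv\<^bsub>G\<^esub> s \<otimes>\<^bsub>G\<^esub> g))"

lemma shift_apply [simp]: "g \<in> carrier G \<Longrightarrow> shift s x g = x (inv\<^bsub>G\<^esub> s \<otimes>\<^bsub>G\<^esub> g)"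
  by (simp add: shift_def)

lemma supp_shift:
  assumes "s \<in> carrier G" shows "supp (shift s x) = (\<lambda>g. s \<otimes>\<^bsub>G\<^esub> g) ` supp x"
proof (intro equalityI subsetI)
  fix g assume "g \<in> supp (shift s x)"
  then show "g \<in> (\<lambda>g. s \<otimes>\<^bsub>G\<^esub> g) ` supp x"
    using assms by (intro image_eqI[of _ _ "inv\<^bsub>G\<^esub> s \<otimes>\<^bsub>G\<^esub> g"]) (auto simp: supp_def G.inv_mult_cancel)
qed (use assms in \<open>auto simp: supp_def G.inv_mult_cancel\<close>)

lemma shift_closed [simp]: "s \<in> carrier G \<Longrightarrow> x \<in> carrier P \<Longrightarrow> shift s x \<in> carrier P"
proof -
  assume s: "s \<in> carrier G" and x: "x \<in> carrier P"
  have "finite (supp (shift s x))" using s x by (simp add: supp_shift)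
  moreover have "shift s x \<in> carrier G \<rightarrow>\<^sub>E carrier R" using s x by (simp add: shift_def)
  ultimately show ?thesis by (simp add: carrier_P)
qed

lemma shift_mult:
  assumes s: "s \<in> carrier G" and x: "x \<in> carrier P" and y: "y \<in> carrier P"
  shows "shift s x \<otimes>\<^bsub>P\<^esub> y = shift s (x \<otimes>\<^bsub>P\<^esub> y)"
proof (rule P_eqI)
  fix g assume g: "g \<in> carrier G"
  note car = subsetD[OF supp_subset]
  have "(shift s x \<otimes>\<^bsub>P\<^esub> y) g = (\<Oplus>\<^bsub>R\<^esub>h\<in>(\<lambda>g. s \<otimes>\<^bsub>G\<^esub> g) ` supp x. shift s x h \<otimes>\<^bsub>R\<^esub> y (inv\<^bsub>G\<^esub> h \<otimes>\<^bsub>G\<^esub> g))"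
    using g s by (simp add: P_mult supp_shift)
  also have "\<dots> = (\<Oplus>\<^bsub>R\<^esub>h\<in>supp x. shift s x (s \<otimes>\<^bsub>G\<^esub> h) \<otimes>\<^bsub>R\<^esub> y (inv\<^bsub>G\<^esub> (s \<otimes>\<^bsub>G\<^esub> h) \<otimes>\<^bsub>G\<^esub> g))"
    by (rule R.finsum_reindex) (use s x y g car in \<open>auto simp: inj_on_def G.inv_mult_cancel\<close>)
  also have "\<dots> = (\<Oplus>\<^bsub>R\<^esub>h\<in>supp x. x h \<otimes>\<^bsub>R\<^esub> y (inv\<^bsub>G\<^esub> h \<otimes>\<^bsub>G\<^esub> (inv\<^bsub>G\<^esub> s \<otimes>\<^bsub>G\<^esub> g)))"
    by (rule R.finsum_cong') (use s x y g car in \<open>auto simp: G.word_simps\<close>)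
  also have "\<dots> = shift s (x \<otimes>\<^bsub>P\<^esub> y) g" using s g by (simp add: P_mult)
  finally show "(shift s x \<otimes>\<^bsub>P\<^esub> y) g = shift s (x \<otimes>\<^bsub>P\<^esub> y) g" .
qed (use assms in auto)

lemma shift_add:
  "s \<in> carrier G \<Longrightarrow> x \<in> carrier P \<Longrightarrow> y \<in> carrier P \<Longrightarrow>
   shift s (x \<oplus>\<^bsub>P\<^esub> y) = shift s x \<oplus>\<^bsub>P\<^esub> shift s y"
  by (rule P_eqI) auto

end

section \<open>Matrices over a ring\<close>

definition row_times_matrix ::
  "('a, 'm) ring_scheme \<Rightarrow> nat \<Rightarrow> (nat \<Rightarrow> 'a) \<Rightarrow> (nat \<times> nat \<Rightarrow> 'a) \<Rightarrow> nat \<Rightarrow> 'a" where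
  "row_times_matrix R d v M = (\<lambda>j\<in>{..<d}. \<Oplus>\<^bsub>R\<^esub>i\<in>{..<d}. v i \<otimes>\<^bsub>R\<^esub> M (i, j))"

context ring
begin

abbreviation rows :: "nat \<Rightarrow> (nat \<Rightarrow> 'a) set" where "rows d \<equiv> {..<d} \<rightarrow>\<^sub>E carrier R"

abbreviation unit_row :: "nat \<Rightarrow> nat \<Rightarrow> nat \<Rightarrow> 'a" where
  "unit_row d i \<equiv> (\<lambda>j\<in>{..<d}. if i = j then \<one> else \<zero>)"

definition matrix_row :: "nat \<Rightarrow> (nat \<times> nat \<Rightarrow> 'a) \<Rightarrow> nat \<Rightarrow> nat \<Rightarrow> 'a" where
  "matrix_row d M i = (\<lambda>j\<in>{..<d}. M (i, j))"

lemma carrier_matrix_ring: "carrier (matrix_ring d R) = ({..<d} \<times> {..<d}) \<rightarrow>\<^sub>E carrier R"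
  by (simp add: matrix_ring_def)

lemma matrix_closed [simp]:
  "M \<in> carrier (matrix_ring d R) \<Longrightarrow> i < d \<Longrightarrow> j < d \<Longrightarrow> M (i, j) \<in> carrier R"
  by (auto simp: carrier_matrix_ring)

lemma matrix_mult:
  "i < d \<Longrightarrow> j < d \<Longrightarrow>
   (M \<otimes>\<^bsub>matrix_ring d R\<^esub> N) (i, j) = (\<Oplus>k\<in>{..<d}. M (i, k) \<otimes> N (k, j))"
  by (simp add: matrix_ring_def)

lemma matrix_one:
  "i < d \<Longrightarrow> j < d \<Longrightarrow> \<one>\<^bsub>matrix_ring d R\<^esub> (i, j) = (if i = j then \<one> else \<zero>)"
  by (simp add: matrix_ring_def)

lemma matrix_mult_closed:
  assumes "M \<in> carrier (matrix_ring d R)" "N \<in> carrier (matrix_ring d R)"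
  shows "M \<otimes>\<^bsub>matrix_ring d R\<^esub> N \<in> carrier (matrix_ring d R)"
  using assms by (auto simp: matrix_ring_def intro!: finsum_closed)

lemma matrix_one_closed: "\<one>\<^bsub>matrix_ring d R\<^esub> \<in> carrier (matrix_ring d R)"
  by (auto simp: matrix_ring_def)

lemma matrix_eqI:
  assumes "M \<in> carrier (matrix_ring d R)" "N \<in> carrier (matrix_ring d R)"
    "\<And>i j. i < d \<Longrightarrow> j < d \<Longrightarrow> M (i, j) = N (i, j)"
  shows "M = N"
  by (rule PiE_ext[of _ "{..<d} \<times> {..<d}" "\<lambda>_. carrier R"])
    (use assms in \<open>auto simp: carrier_matrix_ring\<close>)

lemma row_closed [simp]: "v \<in> rows d \<Longrightarrow> i < d \<Longrightarrow> v i \<in> carrier R"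
  by auto

lemma row_times_matrix_closed [simp]:
  "v \<in> rows d \<Longrightarrow> M \<in> carrier (matrix_ring d R) \<Longrightarrow> row_times_matrix R d v M \<in> rows d"
  by (auto simp: row_times_matrix_def intro!: finsum_closed)

lemma matrix_row_closed [simp]:
  "M \<in> carrier (matrix_ring d R) \<Longrightarrow> i < d \<Longrightarrow> matrix_row d M i \<in> rows d"
  by (auto simp: matrix_row_def)

lemma matrix_row_mult:
  "M \<in> carrier (matrix_ring d R) \<Longrightarrow> N \<in> carrier (matrix_ring d R) \<Longrightarrow> i < d \<Longrightarrow> matrix_row d (M \<otimes>\<^bsub>matrix_ring d R\<^esub> N) i = row_times_matrix R d (matrix_row d M i) N"
  by (auto simp: matrix_row_def row_times_matrix_def matrix_mult fun_eq_iff intro!: finsum_cong')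

lemma matrix_row_one: "i < d \<Longrightarrow> matrix_row d \<one>\<^bsub>matrix_ring d R\<^esub> i = unit_row d i"
  by (auto simp: matrix_row_def matrix_one fun_eq_iff)

lemma row_times_matrix_assoc:
  assumes v: "v \<in> rows d" and M: "M \<in> carrier (matrix_ring d R)" and N: "N \<in> carrier (matrix_ring d R)"
  shows "row_times_matrix R d (row_times_matrix R d v M) N =
           row_times_matrix R d v (M \<otimes>\<^bsub>matrix_ring d R\<^esub> N)"
proof -
  have "(\<Oplus>k\<in>{..<d}. (\<Oplus>i\<in>{..<d}. v i \<otimes> M (i, k)) \<otimes> N (k, j)) =
        (\<Oplus>i\<in>{..<d}. v i \<otimes> (\<Oplus>k\<in>{..<d}. M (i, k) \<otimes> N (k, j)))" if j: "j < d" for j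
  proof -
    have "(\<Oplus>k\<in>{..<d}. (\<Oplus>i\<in>{..<d}. v i \<otimes> M (i, k)) \<otimes> N (k, j)) =
        (\<Oplus>k\<in>{..<d}. \<Oplus>i\<in>{..<d}. v i \<otimes> (M (i, k) \<otimes> N (k, j)))"
    proof (rule finsum_cong'[OF refl])
      fix k assume k: "k \<in> {..<d}"
      have "(\<Oplus>i\<in>{..<d}. v i \<otimes> M (i, k)) \<otimes> N (k, j) = (\<Oplus>i\<in>{..<d}. v i \<otimes> M (i, k) \<otimes> N (k, j))"
        using v M N j k by (intro finsum_ldistr) auto
      also have "\<dots> = (\<Oplus>i\<in>{..<d}. v i \<otimes> (M (i, k) \<otimes> N (k, j)))"
        using v M N j k by (intro finsum_cong') (auto simp: m_assoc)
      finally show "(\<Oplus>i\<in>{..<d}. v i \<otimes> M (i, k)) \<otimes> N (k, j) = \<dots>" .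
    qed (use v M N j in \<open>auto intro!: finsum_closed\<close>)
    also have "\<dots> = (\<Oplus>i\<in>{..<d}. \<Oplus>k\<in>{..<d}. v i \<otimes> (M (i, k) \<otimes> N (k, j)))"
      using v M N j by (intro finsum_swap) auto
    also have "\<dots> = (\<Oplus>i\<in>{..<d}. v i \<otimes> (\<Oplus>k\<in>{..<d}. M (i, k) \<otimes> N (k, j)))"
      using v M N j by (intro finsum_cong' finsum_rdistr[symmetric]) (auto intro!: finsum_closed)
    finally show ?thesis .
  qed
  moreover have "(\<Oplus>k\<in>{..<d}. row_times_matrix R d v M k \<otimes> N (k, j)) =
      (\<Oplus>k\<in>{..<d}. (\<Oplus>i\<in>{..<d}. v i \<otimes> M (i, k)) \<otimes> N (k, j))" if j: "j < d" for j
    using v M N j by (intro finsum_cong') (auto simp: row_times_matrix_def intro!: finsum_closed)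
  moreover have "(\<Oplus>i\<in>{..<d}. v i \<otimes> (M \<otimes>\<^bsub>matrix_ring d R\<^esub> N) (i, j)) =
      (\<Oplus>i\<in>{..<d}. v i \<otimes> (\<Oplus>k\<in>{..<d}. M (i, k) \<otimes> N (k, j)))" if j: "j < d" for j
    using v M N j by (intro finsum_cong') (auto simp: matrix_mult intro!: finsum_closed)
  ultimately show ?thesis
    by (auto simp: row_times_matrix_def[of R d "row_times_matrix R d v M"]
        row_times_matrix_def[of R d v "M \<otimes>\<^bsub>matrix_ring d R\<^esub> N"] fun_eq_iff)
qed

lemma row_times_one:
  assumes v: "v \<in> rows d" shows "row_times_matrix R d v \<one>\<^bsub>matrix_ring d R\<^esub> = v"
proof (rule PiE_ext)
  show "row_times_matrix R d v \<one>\<^bsub>matrix_ring d R\<^esub> \<in> rows d" "v \<in> rows d"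
    using v matrix_one_closed by simp_all
  fix j assume j: "j \<in> {..<d}"
  have "(\<Oplus>i\<in>{..<d}. v i \<otimes> \<one>\<^bsub>matrix_ring d R\<^esub> (i, j)) = (\<Oplus>i\<in>{..<d}. if j = i then v i else \<zero>)"
    using v j by (intro finsum_cong') (auto simp: matrix_one)
  also have "\<dots> = v j" using v j by (intro finsum_singleton) auto
  finally show "row_times_matrix R d v \<one>\<^bsub>matrix_ring d R\<^esub> j = v j"
    using j by (simp add: row_times_matrix_def)
qed

lemma unit_row_times_matrix:
  assumes M: "M \<in> carrier (matrix_ring d R)" and i: "i < d"
  shows "row_times_matrix R d (unit_row d i) M = matrix_row d M i"
proof (rule PiE_ext)
  show "row_times_matrix R d (unit_row d i) M \<in> rows d" "matrix_row d M i \<in> rows d"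
    using M i by (auto intro!: row_times_matrix_closed)
  fix j assume j: "j \<in> {..<d}"
  have "(\<Oplus>k\<in>{..<d}. unit_row d i k \<otimes> M (k, j)) = (\<Oplus>k\<in>{..<d}. if i = k then M (k, j) else \<zero>)"
    using M i j by (intro finsum_cong') auto
  also have "\<dots> = M (i, j)" using M i j by (intro finsum_singleton) auto
  finally show "row_times_matrix R d (unit_row d i) M j = matrix_row d M i j"
    using j by (simp add: row_times_matrix_def matrix_row_def)
qed

lemma row_times_matrix_add:
  assumes v: "v \<in> rows d" and w: "w \<in> rows d" and M: "M \<in> carrier (matrix_ring d R)"
  shows "row_times_matrix R d (\<lambda>i\<in>{..<d}. v i \<oplus> w i) M =
           (\<lambda>j\<in>{..<d}. row_times_matrix R d v M j \<oplus> row_times_matrix R d w M j)"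
proof -
  have "(\<Oplus>i\<in>{..<d}. (v i \<oplus> w i) \<otimes> M (i, j)) =
        (\<Oplus>i\<in>{..<d}. v i \<otimes> M (i, j)) \<oplus> (\<Oplus>i\<in>{..<d}. w i \<otimes> M (i, j))" if j: "j < d" for j
  proof -
    have "(\<Oplus>i\<in>{..<d}. (v i \<oplus> w i) \<otimes> M (i, j)) = (\<Oplus>i\<in>{..<d}. v i \<otimes> M (i, j) \<oplus> w i \<otimes> M (i, j))"
      using v w M j by (intro finsum_cong') (auto simp: l_distr)
    also have "\<dots> = (\<Oplus>i\<in>{..<d}. v i \<otimes> M (i, j)) \<oplus> (\<Oplus>i\<in>{..<d}. w i \<otimes> M (i, j))"
      using v w M j by (intro finsum_addf) auto
    finally show ?thesis .
  qed
  moreover have "(\<Oplus>i\<in>{..<d}. (\<lambda>i\<in>{..<d}. v i \<oplus> w i) i \<otimes> M (i, j)) =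
      (\<Oplus>i\<in>{..<d}. (v i \<oplus> w i) \<otimes> M (i, j))" if j: "j < d" for j
    using v w M j by (intro finsum_cong') auto
  ultimately show ?thesis by (auto simp: row_times_matrix_def fun_eq_iff)
qed

lemma row_times_matrix_inj:
  assumes "directly_finite (matrix_ring d R)"
    and A: "A \<in> carrier (matrix_ring d R)" and B: "B \<in> carrier (matrix_ring d R)"
    and AB: "A \<otimes>\<^bsub>matrix_ring d R\<^esub> B = \<one>\<^bsub>matrix_ring d R\<^esub>"
  shows "inj_on (\<lambda>v. row_times_matrix R d v B) (rows d)"
proof (rule inj_on_inverseI)
  fix v assume v: "v \<in> rows d"
  have "B \<otimes>\<^bsub>matrix_ring d R\<^esub> A = \<one>\<^bsub>matrix_ring d R\<^esub>"
    using assms unfolding directly_finite_def by blast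
  then show "row_times_matrix R d (row_times_matrix R d v B) A = v"
    using row_times_matrix_assoc[OF v B A] row_times_one[OF v] by simp
qed

text \<open>The rows of \<open>B A\<close> and of the identity matrix have the same image under \<open>v \<mapsto> v B\<close>.\<close>

lemma row_times_matrix_not_inj:
  assumes A: "A \<in> carrier (matrix_ring d R)" and B: "B \<in> carrier (matrix_ring d R)"
    and AB: "A \<otimes>\<^bsub>matrix_ring d R\<^esub> B = \<one>\<^bsub>matrix_ring d R\<^esub>"
    and BA: "B \<otimes>\<^bsub>matrix_ring d R\<^esub> A \<noteq> \<one>\<^bsub>matrix_ring d R\<^esub>"
  shows "\<not> inj_on (\<lambda>v. row_times_matrix R d v B) (rows d)"
proof
  assume inj: "inj_on (\<lambda>v. row_times_matrix R d v B) (rows d)"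
  let ?BA = "B \<otimes>\<^bsub>matrix_ring d R\<^esub> A"
  have BA_closed: "?BA \<in> carrier (matrix_ring d R)" using A B matrix_mult_closed by simp
  have "matrix_row d ?BA i = matrix_row d \<one>\<^bsub>matrix_ring d R\<^esub> i" if i: "i < d" for i
  proof (rule inj_onD[OF inj])
    have u: "matrix_row d B i \<in> rows d" using B i by simp
    have "row_times_matrix R d (matrix_row d ?BA i) B =
        row_times_matrix R d (row_times_matrix R d (matrix_row d B i) A) B"
      using i A B by (simp add: matrix_row_mult matrix_mult_closed)
    also have "\<dots> = matrix_row d B i"
      using row_times_matrix_assoc[OF u A B] AB row_times_one[OF u] by simp
    also have "\<dots> = row_times_matrix R d (matrix_row d \<one>\<^bsub>matrix_ring d R\<^esub> i) B"
      using i B by (simp only: matrix_row_one unit_row_times_matrix)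
    finally show "row_times_matrix R d (matrix_row d ?BA i) B =
        row_times_matrix R d (matrix_row d \<one>\<^bsub>matrix_ring d R\<^esub> i) B" .
  qed (use i BA_closed matrix_one_closed in simp_all)
  then have rows_eq: "matrix_row d ?BA i j = matrix_row d \<one>\<^bsub>matrix_ring d R\<^esub> i j" if "i < d" for i j
    using that by simp
  have "?BA = \<one>\<^bsub>matrix_ring d R\<^esub>"
  proof (rule matrix_eqI[OF BA_closed matrix_one_closed])
    show "?BA (i, j) = \<one>\<^bsub>matrix_ring d R\<^esub> (i, j)" if "i < d" "j < d" for i j
      using rows_eq[OF that(1), of j] that by (simp add: matrix_row_def)
  qed
  then show False using BA by simp
qed

end

lemma (in grp_ring) shift_zero: "s \<in> carrier G \<Longrightarrow> shift s \<zero>\<^bsub>P\<^esub> = \<zero>\<^bsub>P\<^esub>"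
  by (rule P_eqI) auto

lemma (in grp_ring) shift_finsum:
  assumes "s \<in> carrier G" "finite F" "f \<in> F \<rightarrow> carrier P"
  shows "shift s (finsum P f F) = (\<Oplus>\<^bsub>P\<^esub>i\<in>F. shift s (f i))"
  using assms(2,3)
proof (induction F)
  case empty
  then show ?case using assms(1) by (simp add: shift_zero)
next
  case (insert a F)
  have "(\<Oplus>\<^bsub>P\<^esub>i\<in>insert a F. shift s (f i)) = shift s (f a) \<oplus>\<^bsub>P\<^esub> (\<Oplus>\<^bsub>P\<^esub>i\<in>F. shift s (f i))"
    using insert assms(1) by (intro P.finsum_insert) (auto simp: Pi_iff)
  moreover have "finsum P f (insert a F) = f a \<oplus>\<^bsub>P\<^esub> finsum P f F"
    using insert by (intro P.finsum_insert) auto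
  ultimately show ?case using insert assms(1) by (simp add: shift_add)
qed

lemma (in grp_ring) shift_row_times_matrix:
  assumes s: "s \<in> carrier G" and v: "v \<in> P.rows d" and M: "M \<in> carrier (matrix_ring d P)"
  shows "row_times_matrix P d (\<lambda>i\<in>{..<d}. shift s (v i)) M = (\<lambda>j\<in>{..<d}. shift s (row_times_matrix P d v M j))"
proof
  fix j
  show "row_times_matrix P d (\<lambda>i\<in>{..<d}. shift s (v i)) M j = (\<lambda>j\<in>{..<d}. shift s (row_times_matrix P d v M j)) j"
  proof (cases "j < d")
    case True
    have car: "v i \<in> carrier P" "M (i, j) \<in> carrier P" if "i < d" for i
      using v M that True by auto
    have "(\<Oplus>\<^bsub>P\<^esub>i\<in>{..<d}. (\<lambda>i\<in>{..<d}. shift s (v i)) i \<otimes>\<^bsub>P\<^esub> M (i, j)) = (\<Oplus>\<^bsub>P\<^esub>i\<in>{..<d}. shift s (v i \<otimes>\<^bsub>P\<^esub> M (i, j)))"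
      by (rule P.finsum_cong') (use s car in \<open>simp_all add: shift_mult\<close>)
    also have "\<dots> = shift s (\<Oplus>\<^bsub>P\<^esub>i\<in>{..<d}. v i \<otimes>\<^bsub>P\<^esub> M (i, j))"
      by (rule shift_finsum[symmetric]) (use s car in auto)
    finally show ?thesis using True by (simp add: row_times_matrix_def)
  qed (simp add: row_times_matrix_def)
qed

text \<open>For a ring homomorphism \<open>h\<close> that is only defined on the subset \<open>Q\<close>.\<close>

lemma map_one_sided_inverse:
  assumes "ring R" "ring R'" and Q: "Q \<subseteq> carrier R" "\<zero>\<^bsub>R\<^esub> \<in> Q"
    and Q_closed: "\<And>x y. x \<in> Q \<Longrightarrow> y \<in> Q \<Longrightarrow> x \<oplus>\<^bsub>R\<^esub> y \<in> Q" "\<And>x y. x \<in> Q \<Longrightarrow> y \<in> Q \<Longrightarrow> x \<otimes>\<^bsub>R\<^esub> y \<in> Q"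
    and h: "\<And>x. x \<in> Q \<Longrightarrow> h x \<in> carrier R'" "h \<zero>\<^bsub>R\<^esub> = \<zero>\<^bsub>R'\<^esub>" "h \<one>\<^bsub>R\<^esub> = \<one>\<^bsub>R'\<^esub>"
      "\<And>x y. x \<in> Q \<Longrightarrow> y \<in> Q \<Longrightarrow> h (x \<oplus>\<^bsub>R\<^esub> y) = h x \<oplus>\<^bsub>R'\<^esub> h y"
      "\<And>x y. x \<in> Q \<Longrightarrow> y \<in> Q \<Longrightarrow> h (x \<otimes>\<^bsub>R\<^esub> y) = h x \<otimes>\<^bsub>R'\<^esub> h y"
    and A: "A \<in> {..<d} \<times> {..<d} \<rightarrow>\<^sub>E Q" and B: "B \<in> {..<d} \<times> {..<d} \<rightarrow>\<^sub>E Q"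
  defines "hm M \<equiv> \<lambda>p\<in>{..<d} \<times> {..<d}. h (M p)"
  shows "hm A \<in> carrier (matrix_ring d R')" "hm B \<in> carrier (matrix_ring d R')"
    "hm (A \<otimes>\<^bsub>matrix_ring d R\<^esub> B) = hm A \<otimes>\<^bsub>matrix_ring d R'\<^esub> hm B"
    "hm \<one>\<^bsub>matrix_ring d R\<^esub> = \<one>\<^bsub>matrix_ring d R'\<^esub>"
proof -
  interpret R: ring R by fact
  interpret R': ring R' by fact
  have sum: "finsum R f F \<in> Q \<and> h (finsum R f F) = finsum R' (\<lambda>k. h (f k)) F"
    if "finite F" "f \<in> F \<rightarrow> Q" for f and F :: "nat set"
    using that
  proof (induction F)
    case (insert a F)
    have "finsum R f (insert a F) = f a \<oplus>\<^bsub>R\<^esub> finsum R f F"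
      using insert Q by (intro R.finsum_insert) auto
    moreover have "finsum R' (\<lambda>k. h (f k)) (insert a F) = h (f a) \<oplus>\<^bsub>R'\<^esub> finsum R' (\<lambda>k. h (f k)) F"
      using insert h(1) by (intro R'.finsum_insert) auto
    ultimately show ?case using insert Q_closed h by auto
  qed (use Q h in simp)
  have entries: "A (i, j) \<in> Q" "B (i, j) \<in> Q" if "i < d" "j < d" for i j
    using A B that by auto
  show hA: "hm A \<in> carrier (matrix_ring d R')" and hB: "hm B \<in> carrier (matrix_ring d R')"
    using A B h(1) by (auto simp: hm_def R'.carrier_matrix_ring)
  have "h (\<Oplus>\<^bsub>R\<^esub>k\<in>{..<d}. A (i, k) \<otimes>\<^bsub>R\<^esub> B (k, j)) = (\<Oplus>\<^bsub>R'\<^esub>k\<in>{..<d}. hm A (i, k) \<otimes>\<^bsub>R'\<^esub> hm B (k, j))"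
    if ij: "i < d" "j < d" for i j
  proof -
    have "h (\<Oplus>\<^bsub>R\<^esub>k\<in>{..<d}. A (i, k) \<otimes>\<^bsub>R\<^esub> B (k, j)) = (\<Oplus>\<^bsub>R'\<^esub>k\<in>{..<d}. h (A (i, k) \<otimes>\<^bsub>R\<^esub> B (k, j)))"
      using sum[of "{..<d}" "\<lambda>k. A (i, k) \<otimes>\<^bsub>R\<^esub> B (k, j)"] entries Q_closed ij by auto
    also have "\<dots> = (\<Oplus>\<^bsub>R'\<^esub>k\<in>{..<d}. hm A (i, k) \<otimes>\<^bsub>R'\<^esub> hm B (k, j))"
      using entries h ij by (intro R'.finsum_cong') (auto simp: hm_def)
    finally show ?thesis .
  qed
  then show "hm (A \<otimes>\<^bsub>matrix_ring d R\<^esub> B) = hm A \<otimes>\<^bsub>matrix_ring d R'\<^esub> hm B"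
    unfolding hm_def[of "A \<otimes>\<^bsub>matrix_ring d R\<^esub> B"]
    unfolding matrix_ring_def by (auto simp: fun_eq_iff)
  show "hm \<one>\<^bsub>matrix_ring d R\<^esub> = \<one>\<^bsub>matrix_ring d R'\<^esub>"
    using h by (auto simp: hm_def matrix_ring_def fun_eq_iff)
qed

section \<open>Maps between group rings\<close>

text \<open>The coefficients are reduced by \<open>q\<close>, defined on the subring \<open>S\<close>, and the group elements are
  mapped by the embedding \<open>\<iota>\<close>, defined on the subgroup \<open>H\<close>.\<close>

locale grp_ring_map = A: grp_ring R G + B: grp_ring R' G'
  for R :: "('k, 'm) ring_scheme" and G :: "('g, 'n) monoid_scheme"
    and R' :: "('l, 'p) ring_scheme" and G' :: "('h, 'q) monoid_scheme" +
  fixes S :: "'k set" and q :: "'k \<Rightarrow> 'l" and H :: "'g set" and \<iota> :: "'g \<Rightarrow> 'h"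
  assumes S: "subring S R" and q: "q \<in> ring_hom (R\<lparr>carrier := S\<rparr>) R'"
    and H: "subgroup H G" and \<iota>: "\<iota> \<in> hom (G\<lparr>carrier := H\<rparr>) G'" and inj: "inj_on \<iota> H"
begin

lemmas S_simps [simp] = subringE(2,3,5,6,7)[OF S]

lemma S_subset: "S \<subseteq> carrier R" by (rule subringE(1)[OF S])

sublocale H: subgroup H G by (rule H)

definition Q :: "('g \<Rightarrow> 'k) set" where
  "Q = {x \<in> carrier A.P. A.supp x \<subseteq> H \<and> x ` carrier G \<subseteq> S}"

definition h :: "('g \<Rightarrow> 'k) \<Rightarrow> 'h \<Rightarrow> 'l" where
  "h x = (\<lambda>g\<in>carrier G'. if g \<in> \<iota> ` H then q (x (inv_into H \<iota> g)) else \<zero>\<^bsub>R'\<^esub>)"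

lemma q_simps [simp]:
  "a \<in> S \<Longrightarrow> q a \<in> carrier R'" "a \<in> S \<Longrightarrow> b \<in> S \<Longrightarrow> q (a \<oplus>\<^bsub>R\<^esub> b) = q a \<oplus>\<^bsub>R'\<^esub> q b"
  "a \<in> S \<Longrightarrow> b \<in> S \<Longrightarrow> q (a \<otimes>\<^bsub>R\<^esub> b) = q a \<otimes>\<^bsub>R'\<^esub> q b" "q \<one>\<^bsub>R\<^esub> = \<one>\<^bsub>R'\<^esub>"
  using q by (auto simp: ring_hom_def)

lemma q_zero [simp]: "q \<zero>\<^bsub>R\<^esub> = \<zero>\<^bsub>R'\<^esub>"
proof -
  have "q \<zero>\<^bsub>R\<^esub> \<oplus>\<^bsub>R'\<^esub> q \<zero>\<^bsub>R\<^esub> = q \<zero>\<^bsub>R\<^esub>" using q_simps(2)[of "\<zero>\<^bsub>R\<^esub>" "\<zero>\<^bsub>R\<^esub>"] subringE(2)[OF S] by simp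
  then show ?thesis using q_simps(1)[OF subringE(2)[OF S]] by (metis B.R.add.r_cancel_one)
qed

lemma \<iota>_simps [simp]:
  "g \<in> H \<Longrightarrow> \<iota> g \<in> carrier G'" "g \<in> H \<Longrightarrow> g' \<in> H \<Longrightarrow> \<iota> (g \<otimes>\<^bsub>G\<^esub> g') = \<iota> g \<otimes>\<^bsub>G'\<^esub> \<iota> g'"
  using \<iota> by (auto simp: hom_def)

lemma \<iota>_one [simp]: "\<iota> \<one>\<^bsub>G\<^esub> = \<one>\<^bsub>G'\<^esub>"
proof -
  have "\<iota> \<one>\<^bsub>G\<^esub> \<otimes>\<^bsub>G'\<^esub> \<iota> \<one>\<^bsub>G\<^esub> = \<iota> \<one>\<^bsub>G\<^esub>" using \<iota>_simps(2)[of "\<one>\<^bsub>G\<^esub>" "\<one>\<^bsub>G\<^esub>"] by simp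
  then show ?thesis by (metis B.G.r_cancel_one H.one_closed \<iota>_simps(1))
qed

lemma \<iota>_inv [simp]: "g \<in> H \<Longrightarrow> \<iota> (inv\<^bsub>G\<^esub> g) = inv\<^bsub>G'\<^esub> (\<iota> g)"
  using \<iota>_simps(2)[of "inv\<^bsub>G\<^esub> g" g] by (intro B.G.inv_equality[symmetric]) simp_all

lemma h_\<iota> [simp]: "g \<in> H \<Longrightarrow> h x (\<iota> g) = q (x g)"
  using inj by (simp add: h_def)

lemma h_outside: "g \<in> carrier G' \<Longrightarrow> g \<notin> \<iota> ` H \<Longrightarrow> h x g = \<zero>\<^bsub>R'\<^esub>"
  by (simp add: h_def)

lemma Q_simps: "x \<in> Q \<Longrightarrow> x \<in> carrier A.P" "x \<in> Q \<Longrightarrow> A.supp x \<subseteq> H" "x \<in> Q \<Longrightarrow> g \<in> carrier G \<Longrightarrow> x g \<in> S"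
  by (auto simp: Q_def)

lemma Q_outside: "x \<in> Q \<Longrightarrow> g \<in> carrier G \<Longrightarrow> g \<notin> H \<Longrightarrow> x g = \<zero>\<^bsub>R\<^esub>"
  by (auto simp: Q_def A.supp_def)

lemma QI:
  assumes "x \<in> carrier A.P" "\<And>g. g \<in> carrier G \<Longrightarrow> g \<notin> H \<Longrightarrow> x g = \<zero>\<^bsub>R\<^esub>" "\<And>g. g \<in> carrier G \<Longrightarrow> x g \<in> S"
  shows "x \<in> Q"
  using assms by (auto simp: Q_def A.supp_def)

lemma finsum_S:
  assumes "finite F" "f \<in> F \<rightarrow> S"
  shows "finsum R f F \<in> S \<and> q (finsum R f F) = finsum R' (\<lambda>k. q (f k)) F"
  using assms
proof (induction F)
  case (insert a F)
  have "finsum R f (insert a F) = f a \<oplus>\<^bsub>R\<^esub> finsum R f F"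
    using insert S_subset by (intro A.R.finsum_insert) auto
  moreover have "finsum R' (\<lambda>k. q (f k)) (insert a F) = q (f a) \<oplus>\<^bsub>R'\<^esub> finsum R' (\<lambda>k. q (f k)) F"
    using insert by (intro B.R.finsum_insert) (auto intro!: q_simps(1) dest: funcset_mem)
  ultimately show ?case using insert by auto
qed (simp add: subringE(2)[OF S])

lemma h_closed: assumes x: "x \<in> Q" shows "h x \<in> carrier B.P"
  unfolding h_def
proof (rule B.P_restrictI)
  show "finite (\<iota> ` A.supp x)" using x Q_simps by simp
  fix g assume g: "g \<in> carrier G'"
  let ?f = "if g \<in> \<iota> ` H then q (x (inv_into H \<iota> g)) else \<zero>\<^bsub>R'\<^esub>"
  show "?f \<in> carrier R'"
    using Q_simps(3)[OF x] inv_into_into[of g \<iota> H] H.mem_carrier by simp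
  assume ne: "?f \<noteq> \<zero>\<^bsub>R'\<^esub>"
  then obtain k where k: "k \<in> H" "g = \<iota> k" by (auto split: if_splits)
  then have "x k \<noteq> \<zero>\<^bsub>R\<^esub>" using ne inj by auto
  then show "g \<in> \<iota> ` A.supp x" using k by (auto simp: A.supp_def)
qed

lemma h_eqI:
  assumes "u \<in> carrier B.P" "v \<in> carrier B.P" "\<And>g. g \<in> H \<Longrightarrow> u (\<iota> g) = v (\<iota> g)"
    "\<And>g. g \<in> carrier G' \<Longrightarrow> g \<notin> \<iota> ` H \<Longrightarrow> u g = v g"
  shows "u = v"
  using assms by (intro B.P_eqI) blast+

lemma Q_zero: "\<zero>\<^bsub>A.P\<^esub> \<in> Q" and Q_one: "\<one>\<^bsub>A.P\<^esub> \<in> Q"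
  by (auto intro!: QI simp: subringE(2)[OF S])

lemma Q_add: "x \<in> Q \<Longrightarrow> y \<in> Q \<Longrightarrow> x \<oplus>\<^bsub>A.P\<^esub> y \<in> Q"
  by (rule QI) (simp_all add: Q_simps Q_outside)

lemma Q_mult: assumes x: "x \<in> Q" and y: "y \<in> Q" shows "x \<otimes>\<^bsub>A.P\<^esub> y \<in> Q"
proof (rule QI)
  show "x \<otimes>\<^bsub>A.P\<^esub> y \<in> carrier A.P" using x y Q_simps by simp
  fix g assume g: "g \<in> carrier G"
  show "(x \<otimes>\<^bsub>A.P\<^esub> y) g \<in> S"
    unfolding A.P_mult[OF g] using x y g Q_simps
    by (intro conjunct1[OF finsum_S]) (auto dest: A.supp_mem)
  assume gH: "g \<notin> H"
  have "x k \<otimes>\<^bsub>R\<^esub> y (inv\<^bsub>G\<^esub> k \<otimes>\<^bsub>G\<^esub> g) = \<zero>\<^bsub>R\<^esub>" if k: "k \<in> A.supp x" for k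
  proof -
    have kH: "k \<in> H" using k x Q_simps by blast
    have "inv\<^bsub>G\<^esub> k \<otimes>\<^bsub>G\<^esub> g \<notin> H"
    proof
      assume "inv\<^bsub>G\<^esub> k \<otimes>\<^bsub>G\<^esub> g \<in> H"
      then have "k \<otimes>\<^bsub>G\<^esub> (inv\<^bsub>G\<^esub> k \<otimes>\<^bsub>G\<^esub> g) \<in> H" using kH by blast
      then show False using gH kH g by (simp add: A.G.inv_mult_cancel)
    qed
    then show ?thesis using Q_outside[OF y] kH g Q_simps[OF x] by simp
  qed
  then have "(x \<otimes>\<^bsub>A.P\<^esub> y) g = (\<Oplus>\<^bsub>R\<^esub>k\<in>A.supp x. \<zero>\<^bsub>R\<^esub>)"
    unfolding A.P_mult[OF g] by (intro A.R.finsum_cong') auto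
  then show "(x \<otimes>\<^bsub>A.P\<^esub> y) g = \<zero>\<^bsub>R\<^esub>" by (simp add: A.R.finsum_zero)
qed

lemma h_zero: "h \<zero>\<^bsub>A.P\<^esub> = \<zero>\<^bsub>B.P\<^esub>"
  by (rule h_eqI) (simp_all add: h_closed Q_zero h_outside)

lemma h_one: "h \<one>\<^bsub>A.P\<^esub> = \<one>\<^bsub>B.P\<^esub>"
proof (rule h_eqI)
  fix g assume g: "g \<in> H"
  have "\<iota> g = \<one>\<^bsub>G'\<^esub> \<longleftrightarrow> g = \<one>\<^bsub>G\<^esub>" using g inj by (metis H.one_closed \<iota>_one inj_onD)
  then show "h \<one>\<^bsub>A.P\<^esub> (\<iota> g) = \<one>\<^bsub>B.P\<^esub> (\<iota> g)" using g by simp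
next
  fix g assume "g \<in> carrier G'" "g \<notin> \<iota> ` H"
  moreover from this have "g \<noteq> \<one>\<^bsub>G'\<^esub>" using \<iota>_one H.one_closed by (metis imageI)
  ultimately show "h \<one>\<^bsub>A.P\<^esub> g = \<one>\<^bsub>B.P\<^esub> g" by (simp add: h_outside)
qed (simp_all add: h_closed Q_one)

lemma h_add: "x \<in> Q \<Longrightarrow> y \<in> Q \<Longrightarrow> h (x \<oplus>\<^bsub>A.P\<^esub> y) = h x \<oplus>\<^bsub>B.P\<^esub> h y"
  by (rule h_eqI) (auto simp: h_closed Q_add h_outside Q_simps)

lemma h_mult: assumes x: "x \<in> Q" and y: "y \<in> Q" shows "h (x \<otimes>\<^bsub>A.P\<^esub> y) = h x \<otimes>\<^bsub>B.P\<^esub> h y"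
proof (rule h_eqI)
  have F: "finite (\<iota> ` A.supp x)" "\<iota> ` A.supp x \<subseteq> carrier G'"
    using x Q_simps(1,2)[OF x] by auto
  have supp: "B.supp (h x) \<subseteq> \<iota> ` A.supp x"
  proof
    fix g assume g: "g \<in> B.supp (h x)"
    then have "g \<in> \<iota> ` H" using h_outside by (auto simp: B.supp_def)
    then obtain k where k: "k \<in> H" "g = \<iota> k" by blast
    then have "x k \<noteq> \<zero>\<^bsub>R\<^esub>" using g by (auto simp: B.supp_def)
    moreover have "k \<in> carrier G" using k by simp
    ultimately show "g \<in> \<iota> ` A.supp x" using k by (simp add: A.supp_def)
  qed
  have mult: "(h x \<otimes>\<^bsub>B.P\<^esub> h y) g = (\<Oplus>\<^bsub>R'\<^esub>k\<in>A.supp x. q (x k) \<otimes>\<^bsub>R'\<^esub> h y (inv\<^bsub>G'\<^esub> (\<iota> k) \<otimes>\<^bsub>G'\<^esub> g))"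
    if g: "g \<in> carrier G'" for g
  proof -
    have hk: "h x (\<iota> k) = q (x k)" if "k \<in> A.supp x" for k using that Q_simps[OF x] by auto
    have "(h x \<otimes>\<^bsub>B.P\<^esub> h y) g = (\<Oplus>\<^bsub>R'\<^esub>k\<in>\<iota> ` A.supp x. h x k \<otimes>\<^bsub>R'\<^esub> h y (inv\<^bsub>G'\<^esub> k \<otimes>\<^bsub>G'\<^esub> g))"
      by (rule B.P_mult_superset) (use x y g F supp h_closed in auto)
    also have "\<dots> = (\<Oplus>\<^bsub>R'\<^esub>k\<in>A.supp x. h x (\<iota> k) \<otimes>\<^bsub>R'\<^esub> h y (inv\<^bsub>G'\<^esub> (\<iota> k) \<otimes>\<^bsub>G'\<^esub> g))"
      by (rule B.R.finsum_reindex)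
        (use x y g F h_closed Q_simps[OF x] in \<open>auto intro: inj_on_subset[OF inj]\<close>)
    also have "\<dots> = (\<Oplus>\<^bsub>R'\<^esub>k\<in>A.supp x. q (x k) \<otimes>\<^bsub>R'\<^esub> h y (inv\<^bsub>G'\<^esub> (\<iota> k) \<otimes>\<^bsub>G'\<^esub> g))"
      by (rule B.R.finsum_cong')
        (use y g F h_closed hk Q_simps[OF x] A.supp_subset in auto)
    finally show ?thesis .
  qed
  fix g assume g: "g \<in> H"
  have gG: "g \<in> carrier G" using g by simp
  have kH: "k \<in> H" if "k \<in> A.supp x" for k using that Q_simps(2)[OF x] by blast
  have S1: "x k \<otimes>\<^bsub>R\<^esub> y (inv\<^bsub>G\<^esub> k \<otimes>\<^bsub>G\<^esub> g) \<in> S" if "k \<in> A.supp x" for k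
    using kH[OF that] g Q_simps(3)[OF x] Q_simps(3)[OF y] by simp
  have "h (x \<otimes>\<^bsub>A.P\<^esub> y) (\<iota> g) = (\<Oplus>\<^bsub>R'\<^esub>k\<in>A.supp x. q (x k \<otimes>\<^bsub>R\<^esub> y (inv\<^bsub>G\<^esub> k \<otimes>\<^bsub>G\<^esub> g)))"
    using g S1 Q_simps(1)[OF x]
      conjunct2[OF finsum_S[of "A.supp x" "\<lambda>k. x k \<otimes>\<^bsub>R\<^esub> y (inv\<^bsub>G\<^esub> k \<otimes>\<^bsub>G\<^esub> g)"]]
    by (simp add: A.P_mult[OF gG])
  also have "\<dots> = (\<Oplus>\<^bsub>R'\<^esub>k\<in>A.supp x. q (x k) \<otimes>\<^bsub>R'\<^esub> h y (inv\<^bsub>G'\<^esub> (\<iota> k) \<otimes>\<^bsub>G'\<^esub> \<iota> g))"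
  proof (rule B.R.finsum_cong'[OF refl])
    fix k assume k: "k \<in> A.supp x"
    have "inv\<^bsub>G'\<^esub> (\<iota> k) \<otimes>\<^bsub>G'\<^esub> \<iota> g = \<iota> (inv\<^bsub>G\<^esub> k \<otimes>\<^bsub>G\<^esub> g)" using kH[OF k] g by simp
    then have "h y (inv\<^bsub>G'\<^esub> (\<iota> k) \<otimes>\<^bsub>G'\<^esub> \<iota> g) = q (y (inv\<^bsub>G\<^esub> k \<otimes>\<^bsub>G\<^esub> g))"
      using kH[OF k] g by (metis H.m_closed H.m_inv_closed h_\<iota>)
    then show "q (x k \<otimes>\<^bsub>R\<^esub> y (inv\<^bsub>G\<^esub> k \<otimes>\<^bsub>G\<^esub> g)) = q (x k) \<otimes>\<^bsub>R'\<^esub> h y (inv\<^bsub>G'\<^esub> (\<iota> k) \<otimes>\<^bsub>G'\<^esub> \<iota> g)"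
      using kH[OF k] g Q_simps(3)[OF x] Q_simps(3)[OF y] by simp
  qed (use g kH h_closed[OF y] Q_simps(3)[OF x] A.supp_subset in \<open>auto simp del: h_\<iota>\<close>)
  also have "\<dots> = (h x \<otimes>\<^bsub>B.P\<^esub> h y) (\<iota> g)" using g mult by simp
  finally show "h (x \<otimes>\<^bsub>A.P\<^esub> y) (\<iota> g) = (h x \<otimes>\<^bsub>B.P\<^esub> h y) (\<iota> g)" .
next
  fix g assume g: "g \<in> carrier G'" "g \<notin> \<iota> ` H"
  have kH: "k \<in> H" if "k \<in> A.supp x" for k using that Q_simps(2)[OF x] by blast
  have zero: "h x k \<otimes>\<^bsub>R'\<^esub> h y (inv\<^bsub>G'\<^esub> k \<otimes>\<^bsub>G'\<^esub> g) = \<zero>\<^bsub>R'\<^esub>" if k: "k \<in> B.supp (h x)" for k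
  proof -
    have "k \<in> \<iota> ` H" using k h_outside by (auto simp: B.supp_def)
    then obtain l where l: "l \<in> H" "k = \<iota> l" by blast
    have "inv\<^bsub>G'\<^esub> k \<otimes>\<^bsub>G'\<^esub> g \<notin> \<iota> ` H"
    proof
      assume "inv\<^bsub>G'\<^esub> k \<otimes>\<^bsub>G'\<^esub> g \<in> \<iota> ` H"
      then obtain m where m: "m \<in> H" "inv\<^bsub>G'\<^esub> k \<otimes>\<^bsub>G'\<^esub> g = \<iota> m" by blast
      then have "g = \<iota> l \<otimes>\<^bsub>G'\<^esub> \<iota> m" using l g by (metis B.G.inv_mult_cancel(1) \<iota>_simps(1))
      then have "g = \<iota> (l \<otimes>\<^bsub>G\<^esub> m)" using l m by simp
      then show False using g l m by blast
    qed
    then show ?thesis using h_outside l g Q_simps(3)[OF x] by simp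
  qed
  have "(h x \<otimes>\<^bsub>B.P\<^esub> h y) g = (\<Oplus>\<^bsub>R'\<^esub>k\<in>B.supp (h x). \<zero>\<^bsub>R'\<^esub>)"
    unfolding B.P_mult[OF g(1)] by (rule B.R.finsum_cong') (use zero in auto)
  then show "h (x \<otimes>\<^bsub>A.P\<^esub> y) g = (h x \<otimes>\<^bsub>B.P\<^esub> h y) g"
    using g by (simp add: h_outside B.R.finsum_zero)
qed (use x y in \<open>simp_all add: h_closed Q_mult\<close>)

text \<open>Applied entrywise, \<open>h\<close> preserves products of matrices, so it turns one-sided inverses over \<open>R[G]\<close> into
  one-sided inverses over \<open>R'[G']\<close>.\<close>

lemma transport_directly_finite:
  assumes df: "directly_finite (matrix_ring d B.P)"
    and M: "M \<in> {..<d} \<times> {..<d} \<rightarrow>\<^sub>E Q" and N: "N \<in> {..<d} \<times> {..<d} \<rightarrow>\<^sub>E Q"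
    and MN: "M \<otimes>\<^bsub>matrix_ring d A.P\<^esub> N = \<one>\<^bsub>matrix_ring d A.P\<^esub>"
    and ij: "i < d" "j < d"
  shows "h ((N \<otimes>\<^bsub>matrix_ring d A.P\<^esub> M) (i, j)) = h (\<one>\<^bsub>matrix_ring d A.P\<^esub> (i, j))"
proof -
  have Q: "Q \<subseteq> carrier A.P" by (auto simp: Q_def)
  let ?h = "\<lambda>M. \<lambda>p\<in>{..<d} \<times> {..<d}. h (M p)"
  have map: "?h M \<in> carrier (matrix_ring d B.P)"
      "?h (M \<otimes>\<^bsub>matrix_ring d A.P\<^esub> N) = ?h M \<otimes>\<^bsub>matrix_ring d B.P\<^esub> ?h N"
      "?h \<one>\<^bsub>matrix_ring d A.P\<^esub> = \<one>\<^bsub>matrix_ring d B.P\<^esub>"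
    if "M \<in> {..<d} \<times> {..<d} \<rightarrow>\<^sub>E Q" "N \<in> {..<d} \<times> {..<d} \<rightarrow>\<^sub>E Q" for M N
    using map_one_sided_inverse[where h = h and A = M and B = N, OF A.P.ring_axioms B.P.ring_axioms Q
        Q_zero _ _ _ h_zero h_one _ _ that] Q_add Q_mult h_closed h_add h_mult by simp_all
  have "?h M \<otimes>\<^bsub>matrix_ring d B.P\<^esub> ?h N = \<one>\<^bsub>matrix_ring d B.P\<^esub>"
    using map(2,3)[OF M N] MN by simp
  then have "?h N \<otimes>\<^bsub>matrix_ring d B.P\<^esub> ?h M = \<one>\<^bsub>matrix_ring d B.P\<^esub>"
    using df map(1)[OF M N] map(1)[OF N M] unfolding directly_finite_def by blast
  then have "?h (N \<otimes>\<^bsub>matrix_ring d A.P\<^esub> M) = ?h \<one>\<^bsub>matrix_ring d A.P\<^esub>"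
    using map(2,3)[OF N M] by simp
  then have "?h (N \<otimes>\<^bsub>matrix_ring d A.P\<^esub> M) (i, j) = ?h \<one>\<^bsub>matrix_ring d A.P\<^esub> (i, j)" by simp
  then show ?thesis using ij by simp
qed

end

section \<open>Finitely generated abelian groups modulo a prime\<close>

context comm_group
begin

lemma subgroup_powers: "subgroup {x [^] (n::nat) | x. x \<in> carrier G} G"
proof (rule subgroupI)
  show "{x [^] n |x. x \<in> carrier G} \<noteq> {}" by blast
  show "inv a \<in> {x [^] n |x. x \<in> carrier G}" if "a \<in> {x [^] n |x. x \<in> carrier G}" for a
    using that by (auto simp: nat_pow_inv[symmetric])
  show "a \<otimes> b \<in> {x [^] n |x. x \<in> carrier G}"
    if "a \<in> {x [^] n |x. x \<in> carrier G}" "b \<in> {x [^] n |x. x \<in> carrier G}" for a b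
    using that by (auto simp: nat_pow_distrib[symmetric])
qed auto

lemma subgroup_times_int_powers:
  assumes "subgroup M G" "s \<in> carrier G"
  shows "subgroup {x \<in> carrier G. \<exists>k::int. x \<otimes> inv (s [^] k) \<in> M} G"
proof (rule subgroupI)
  interpret M: subgroup M G by fact
  have "\<one> \<otimes> inv (s [^] (0::int)) \<in> M" by simp
  then show "{x \<in> carrier G. \<exists>k::int. x \<otimes> inv (s [^] k) \<in> M} \<noteq> {}" by blast
  fix a assume "a \<in> {x \<in> carrier G. \<exists>k::int. x \<otimes> inv (s [^] k) \<in> M}"
  then obtain k :: int where a: "a \<in> carrier G" "a \<otimes> inv (s [^] k) \<in> M" by blast
  have "inv a \<otimes> inv (s [^] (- k)) = inv (a \<otimes> inv (s [^] k))"
    using a assms by (simp add: int_pow_neg inv_mult)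
  then show "inv a \<in> {x \<in> carrier G. \<exists>k::int. x \<otimes> inv (s [^] k) \<in> M}"
    using a M.m_inv_closed by (metis (mono_tags, lifting) inv_closed mem_Collect_eq)
  fix b assume "b \<in> {x \<in> carrier G. \<exists>k::int. x \<otimes> inv (s [^] k) \<in> M}"
  then obtain l :: int where b: "b \<in> carrier G" "b \<otimes> inv (s [^] l) \<in> M" by blast
  have "(a \<otimes> b) \<otimes> inv (s [^] (k + l)) = (a \<otimes> inv (s [^] k)) \<otimes> (b \<otimes> inv (s [^] l))"
    using a b assms by (simp add: int_pow_mult inv_mult m_ac)
  then have "(a \<otimes> b) \<otimes> inv (s [^] (k + l)) \<in> M" using a b by simp
  then show "a \<otimes> b \<in> {x \<in> carrier G. \<exists>k::int. x \<otimes> inv (s [^] k) \<in> M}" using a b by auto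
qed auto

lemma generate_insert_int_power:
  assumes "Y \<subseteq> carrier G" "s \<in> carrier G" "x \<in> generate G (insert s Y)"
  shows "\<exists>k::int. x \<otimes> inv (s [^] k) \<in> generate G Y"
proof -
  let ?E = "{x \<in> carrier G. \<exists>k::int. x \<otimes> inv (s [^] k) \<in> generate G Y}"
  have "s \<in> ?E" using assms by (auto intro!: exI[of _ 1] generate.one)
  moreover have "y \<in> ?E" if "y \<in> Y" for y
    using that assms by (auto intro!: exI[of _ 0] generate.incl)
  ultimately have "generate G (insert s Y) \<subseteq> ?E"
    using subgroup_times_int_powers[OF generate_is_subgroup[OF assms(1)] assms(2)]
    by (intro generate_subgroup_incl) auto
  then show ?thesis using assms(3) by blast
qed

text \<open>A basis of \<open>G\<close> modulo \<open>p\<close>: a finite set \<open>S\<close> of least cardinality that generates \<open>G\<close> together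
  with the \<open>p\<close>-th powers. The coordinate of \<open>x\<close> at \<open>s\<close> is the exponent of \<open>s\<close> in \<open>x\<close> modulo the
  subgroup that the other elements of \<open>S\<close> generate with the \<open>p\<close>-th powers; by minimality this
  subgroup does not contain \<open>s\<close>, so that the exponent is well defined modulo \<open>p\<close>.\<close>

lemma coordinates_mod_prime:
  assumes fg: "finitely_generated G" and p: "Factorial_Ring.prime (p::nat)"
  obtains S :: "'a set" and \<kappa> :: "'a \<Rightarrow> 'a \<Rightarrow> int" where
    "finite S" "S \<subseteq> carrier G" "generate G (S \<union> {x [^] p | x. x \<in> carrier G}) = carrier G"
    "\<forall>s\<in>S. \<forall>x\<in>carrier G. \<forall>y\<in>carrier G. int p dvd \<kappa> s (x \<otimes> y) - (\<kappa> s x + \<kappa> s y)"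
    "\<forall>s\<in>S. \<forall>t\<in>S. int p dvd \<kappa> s t - (if s = t then 1 else 0)"
    "\<forall>x\<in>carrier G. (\<forall>s\<in>S. int p dvd \<kappa> s x) \<longleftrightarrow> (\<exists>y\<in>carrier G. x = y [^] p)"
proof -
  define Pw where "Pw = {x [^] p | x. x \<in> carrier G}"
  have Pw: "subgroup Pw G" unfolding Pw_def by (rule subgroup_powers)
  note Pw_car = subgroup.subset[OF Pw]
  define good where "good S \<longleftrightarrow> finite S \<and> S \<subseteq> carrier G \<and> generate G (S \<union> Pw) = carrier G" for S
  obtain S0 where S0: "finite S0" "S0 \<subseteq> carrier G" "generate G S0 = carrier G"
    using fg unfolding finitely_generated_def by blast
  have "generate G (S0 \<union> Pw) = carrier G"
    using mono_generate[of S0 "S0 \<union> Pw"] generate_incl[of "S0 \<union> Pw"] S0 Pw_car by blast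
  then have "good S0" using S0 by (simp add: good_def)
  then obtain S where S: "good S" and least: "\<And>S'. good S' \<Longrightarrow> card S \<le> card S'"
    using ex_has_least_nat[of good S0 card] by blast
  have S_fin: "finite S" and S_car: "S \<subseteq> carrier G" and S_gen: "generate G (S \<union> Pw) = carrier G"
    using S by (simp_all add: good_def)
  define M where "M s = generate G ((S - {s}) \<union> Pw)" for s
  have SP: "(S - {s}) \<union> Pw \<subseteq> carrier G" for s using S_car Pw_car by blast
  have M: "subgroup (M s) G" for s unfolding M_def by (rule generate_is_subgroup[OF SP])
  have M_incl: "(S - {s}) \<union> Pw \<subseteq> M s" for s by (auto simp: M_def intro: generate.incl)
  have s_M: "s \<notin> M s" if s: "s \<in> S" for s
  proof
    assume "s \<in> M s"
    then have "S \<union> Pw \<subseteq> M s" using M_incl[of s] by blast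
    then have "carrier G \<subseteq> M s" using generate_subgroup_incl[OF _ M] S_gen by blast
    then have "good (S - {s})"
      using S_fin S_car subgroup.subset[OF M[of s]] by (auto simp: good_def M_def)
    from least[OF this] have "card S \<le> card (S - {s})" .
    moreover have "card (S - {s}) < card S" using S_fin s by (rule card_Diff1_less)
    ultimately show False by simp
  qed
  have pow_M: "int p dvd k" if s: "s \<in> S" and k: "s [^] k \<in> M s" for s and k :: int
  proof (rule ccontr)
    assume not_dvd: "\<not> int p dvd k"
    have "Factorial_Ring.prime (int p)" using p by simp
    then have "coprime (int p) k" using not_dvd by (rule prime_imp_coprime)
    then obtain u v where uv: "u * k + v * int p = 1"
      using bezout_int[of k "int p"] by (metis coprime_commute coprime_iff_gcd_eq_1)
    have sc: "s \<in> carrier G" using s S_car by blast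
    have "s [^] p \<in> M s" using M_incl[of s] sc by (auto simp: Pw_def)
    then have "(s [^] k) [^] u \<otimes> (s [^] int p) [^] v \<in> M s"
      using subgroup_int_pow_closed[OF M k, of u] subgroup_int_pow_closed[OF M, of "s [^] int p" s v]
        subgroup.m_closed[OF M] by (simp add: int_pow_int)
    moreover have "(s [^] k) [^] u \<otimes> (s [^] int p) [^] v = s [^] (u * k + v * int p)"
      using sc by (simp add: int_pow_pow int_pow_mult mult.commute)
    ultimately have "s \<in> M s" using uv sc by simp
    then show False using s_M s by blast
  qed
  have uniq: "int p dvd k - l"
    if s: "s \<in> S" and x: "x \<in> carrier G" and kl: "x \<otimes> inv (s [^] k) \<in> M s" "x \<otimes> inv (s [^] l) \<in> M s"
    for s x and k l :: int
  proof (rule pow_M[OF s])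
    have sc: "s \<in> carrier G" using s S_car by blast
    have "inv (x \<otimes> inv (s [^] k)) \<otimes> (x \<otimes> inv (s [^] l)) = s [^] k \<otimes> inv (s [^] l)"
      using sc x by (simp add: word_simps)
    then show "s [^] (k - l) \<in> M s"
      using subgroup.m_closed[OF M subgroup.m_inv_closed[OF M kl(1)] kl(2)] sc
      by (simp add: int_pow_diff)
  qed
  define \<kappa> where "\<kappa> s x = (SOME k::int. x \<otimes> inv (s [^] k) \<in> M s)" for s x
  have \<kappa>: "x \<otimes> inv (s [^] \<kappa> s x) \<in> M s" if s: "s \<in> S" and x: "x \<in> carrier G" for s x
  proof -
    have "insert s ((S - {s}) \<union> Pw) = S \<union> Pw" using s by blast
    then have "\<exists>k::int. x \<otimes> inv (s [^] k) \<in> M s"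
      unfolding M_def using generate_insert_int_power[OF SP[of s], of s x] s x S_gen S_car by auto
    then show ?thesis unfolding \<kappa>_def by (rule someI_ex)
  qed
  have \<kappa>_eq: "int p dvd \<kappa> s x - k"
    if "s \<in> S" "x \<in> carrier G" "x \<otimes> inv (s [^] k) \<in> M s" for s x and k :: int
    using uniq[OF that(1,2) \<kappa>[OF that(1,2)] that(3)] .
  show thesis
  proof (rule that[of S \<kappa>]; (intro ballI)?)
    show "generate G (S \<union> {x [^] p |x. x \<in> carrier G}) = carrier G" using S_gen by (simp add: Pw_def)
    fix s x y assume s: "s \<in> S" and xy: "x \<in> carrier G" "y \<in> carrier G"
    have sc: "s \<in> carrier G" using s S_car by blast
    have "(x \<otimes> y) \<otimes> inv (s [^] (\<kappa> s x + \<kappa> s y)) = (x \<otimes> inv (s [^] \<kappa> s x)) \<otimes> (y \<otimes> inv (s [^] \<kappa> s y))"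
      using xy sc by (simp add: int_pow_mult inv_mult m_ac)
    then show "int p dvd \<kappa> s (x \<otimes> y) - (\<kappa> s x + \<kappa> s y)"
      using s xy \<kappa> subgroup.m_closed[OF M] by (intro \<kappa>_eq) simp_all
  next
    fix s t assume st: "s \<in> S" "t \<in> S"
    have tc: "t \<in> carrier G" using st S_car by blast
    show "int p dvd \<kappa> s t - (if s = t then 1 else 0)"
    proof (rule \<kappa>_eq[OF st(1) tc])
      show "t \<otimes> inv (s [^] (if s = t then 1 else 0 :: int)) \<in> M s"
        using st tc M_incl[of s] subgroup.one_closed[OF M] by auto
    qed
  next
    fix x assume x: "x \<in> carrier G"
    have "x \<in> Pw" if "finite S'" "S' \<subseteq> S" "x \<in> generate G (S' \<union> Pw)" "\<forall>s\<in>S'. int p dvd \<kappa> s x" for S'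
      using that
    proof (induction S')
      case empty
      then show ?case using generate_subgroup_incl[OF _ Pw, of Pw] by auto
    next
      case (insert s S')
      have s: "s \<in> S" "s \<in> carrier G" and SP': "S' \<union> Pw \<subseteq> carrier G"
        using insert.prems S_car Pw_car by auto
      obtain k :: int where k: "x \<otimes> inv (s [^] k) \<in> generate G (S' \<union> Pw)"
        using generate_insert_int_power[OF SP' s(2), of x] insert.prems by auto
      have "S' \<union> Pw \<subseteq> (S - {s}) \<union> Pw" using insert by blast
      then have "x \<otimes> inv (s [^] k) \<in> M s" unfolding M_def using k mono_generate by blast
      then have "int p dvd \<kappa> s x - k" using \<kappa>_eq s x by blast
      then have "int p dvd k" using insert.prems by (metis dvd_diff_right_iff insertI1 dvd_diff_commute)
      then obtain l where l: "k = l * int p" by (metis dvd_div_mult_self)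
      have "s [^] k = (s [^] l) [^] p"
        using s l int_pow_pow[of s l "int p"] by (simp add: int_pow_int)
      then have "s [^] k \<in> Pw" using s by (auto simp: Pw_def)
      then have "s [^] k \<in> generate G (S' \<union> Pw)" by (auto intro: generate.incl)
      then have "(x \<otimes> inv (s [^] k)) \<otimes> s [^] k \<in> generate G (S' \<union> Pw)" using k by (blast intro: generate.eng)
      then have "x \<in> generate G (S' \<union> Pw)" using x s by (simp add: m_assoc)
      then show ?case using insert by simp
    qed
    then have "\<forall>s\<in>S. int p dvd \<kappa> s x \<Longrightarrow> x \<in> Pw" using S_fin S_gen x by blast
    moreover have "int p dvd \<kappa> s x" if "x \<in> Pw" "s \<in> S" for s
    proof -
      have "x \<otimes> inv (s [^] (0::int)) \<in> M s" using that M_incl[of s] x by auto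
      from \<kappa>_eq[OF that(2) x this] show ?thesis by simp
    qed
    ultimately show "(\<forall>s\<in>S. int p dvd \<kappa> s x) \<longleftrightarrow> (\<exists>y\<in>carrier G. x = y [^] p)"
      by (auto simp: Pw_def)
  qed (use S_fin S_car in auto)
qed

lemma nilpotent_class_comm: "nilpotent_class G 1"
  unfolding nilpotent_class_def
proof (intro ballI allI impI)
  fix x ys assume x: "x \<in> carrier G" and ys: "set ys \<subseteq> carrier G" "length ys = 1"
  then obtain y where "ys = [y]" "y \<in> carrier G" by (cases ys) auto
  then show "left_normed G x ys = \<one>" using x by (simp add: commutator_eq_one_iff m_comm)
qed

text \<open>The roots of \<open>x\<close> and of its powers form a finitely generated subgroup \<open>I\<close>, of finite exponent
  modulo the subgroup generated by \<open>x\<close>. Taking roots of \<open>x\<close> of order a multiple of this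
  exponent, \<open>x\<close> is a power of itself in several ways, first of exponent \<open>2 j\<close>, so that \<open>x\<close> has
  finite order, and then of exponent divisible by its order.\<close>

lemma divisible_element_trivial:
  assumes fg: "finitely_generated G" and x: "x \<in> carrier G"
    and div: "\<And>n::nat. 0 < n \<Longrightarrow> \<exists>y\<in>carrier G. y [^] n = x"
  shows "x = \<one>"
proof -
  have noeth: "noetherian_in G (carrier G)"
    by (rule finitely_generated_nilpotent_noetherian[OF fg nilpotent_class_comm])
  let ?x = "generate G {x}"
  have gx: "subgroup ?x G" using x by (intro generate_is_subgroup) simp
  have roots: "subgroup {a \<in> carrier G. a [^] m \<in> ?x} G" for m :: nat
  proof (rule subgroupI)
    have "\<one> \<in> {a \<in> carrier G. a [^] m \<in> ?x}" using generate.one by simp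
    then show "{a \<in> carrier G. a [^] m \<in> ?x} \<noteq> {}" by blast
    show "inv a \<in> {a \<in> carrier G. a [^] m \<in> ?x}" if "a \<in> {a \<in> carrier G. a [^] m \<in> ?x}" for a
      using that subgroup.m_inv_closed[OF gx] by (simp add: nat_pow_inv)
    show "a \<otimes> b \<in> {a \<in> carrier G. a [^] m \<in> ?x}"
      if "a \<in> {a \<in> carrier G. a [^] m \<in> ?x}" "b \<in> {a \<in> carrier G. a [^] m \<in> ?x}" for a b
      using that subgroup.m_closed[OF gx] by (simp add: nat_pow_distrib)
  qed blast
  have roots_mult: "a [^] (m * n) \<in> ?x" if "a \<in> carrier G" "a [^] m \<in> ?x" for a and m n :: nat
    using that subgroup_int_pow_closed[OF gx that(2), of "int n"]
    by (simp add: int_pow_int nat_pow_pow[symmetric])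
  define I where "I = {a \<in> carrier G. \<exists>m::nat. 0 < m \<and> a [^] m \<in> ?x}"
  have I: "subgroup I G"
  proof (rule subgroupI)
    have "\<one> \<in> I" using generate.one by (auto simp: I_def intro!: exI[of _ 1])
    then show "I \<noteq> {}" by blast
    show "inv a \<in> I" if "a \<in> I" for a
      using that subgroup.m_inv_closed[OF roots] unfolding I_def by fastforce
    fix a b assume "a \<in> I" "b \<in> I"
    then obtain m n :: nat where mn: "a \<in> carrier G" "0 < m" "a [^] m \<in> ?x" "b \<in> carrier G" "0 < n" "b [^] n \<in> ?x"
      unfolding I_def by blast
    then have "a [^] (m * n) \<in> ?x" "b [^] (m * n) \<in> ?x"
      using roots_mult[of a m n] roots_mult[of b n m] by (simp_all add: mult.commute)
    then have "(a \<otimes> b) [^] (m * n) \<in> ?x" using mn subgroup.m_closed[OF gx] by (simp add: nat_pow_distrib)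
    moreover have "0 < m * n" using mn by simp
    ultimately show "a \<otimes> b \<in> I" unfolding I_def using mn by blast
  qed (auto simp: I_def)
  obtain S where S: "finite S" "S \<subseteq> I" "generate G S = I"
    using noetherian_inE[OF noeth I subgroup.subset[OF I]] .
  have "\<exists>M>0. \<forall>s\<in>S. s [^] (M::nat) \<in> ?x"
    using S(1,2)
  proof (induction S)
    case empty show ?case by (intro exI[of _ 1]) simp
  next
    case (insert s S)
    then obtain M where M: "M > 0" "\<forall>s\<in>S. s [^] (M::nat) \<in> ?x" by blast
    obtain m :: nat where m: "s \<in> carrier G" "0 < m" "s [^] m \<in> ?x" using insert.prems by (auto simp: I_def)
    have "\<forall>t\<in>insert s S. t [^] (M * m) \<in> ?x"
      using M m insert.prems roots_mult[of s m M] roots_mult[of _ M m]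
      by (auto simp: I_def mult.commute)
    then show ?case using M m by (intro exI[of _ "M * m"]) simp
  qed
  then obtain M :: nat where M: "M > 0" "\<forall>s\<in>S. s [^] M \<in> ?x" by blast
  have "S \<subseteq> {a \<in> carrier G. a [^] M \<in> ?x}" using M S I_def by auto
  then have I_M: "I \<subseteq> {a \<in> carrier G. a [^] M \<in> ?x}"
    using generate_subgroup_incl[OF _ roots] S(3) by blast
  have key: "\<exists>j::int. x = x [^] (j * int n)" if n: "n > 0" for n :: nat
  proof -
    obtain y where y: "y \<in> carrier G" "y [^] (M * n) = x" using div[of "M * n"] M n by auto
    have "x \<in> ?x" by (auto intro: generate.incl)
    then have "y \<in> I" unfolding I_def using y M n by (auto intro!: exI[of _ "M * n"])
    then have "y [^] M \<in> ?x" using I_M by blast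
    then obtain j :: int where j: "y [^] M = x [^] j" using generate_pow[OF x] by blast
    have "x = (y [^] M) [^] n" using y by (simp add: nat_pow_pow)
    also have "\<dots> = x [^] (j * int n)" using j x int_pow_pow[of x j "int n"] by (simp add: int_pow_int)
    finally show ?thesis by blast
  qed
  obtain j :: int where j: "x = x [^] (j * 2)" using key[of 2] by auto
  let ?N = "nat \<bar>2 * j - 1\<bar>"
  have "x [^] (2 * j - 1) = \<one>"
    using x j int_pow_diff[OF x, of "2 * j" 1] by (simp add: mult.commute)
  then have N: "x [^] int ?N = \<one>" "?N > 0"
    using x int_pow_neg[OF x, of "2 * j - 1"] by (auto simp: abs_if) presburger
  obtain i :: int where "x = x [^] (i * int ?N)" using key[OF N(2)] by blast
  also have "\<dots> = (x [^] int ?N) [^] i" using x by (simp add: int_pow_pow mult.commute)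
  finally show ?thesis using N by simp
qed

end

section \<open>Abelian base groups\<close>

context wreath
begin

definition move :: "'b \<Rightarrow> ('b \<Rightarrow> 'a) \<times> 'b \<Rightarrow> ('b \<Rightarrow> 'a) \<times> 'b" where
  "move s b = ((\<lambda>x\<in>carrier T. fst b (inv\<^bsub>T\<^esub> s \<otimes>\<^bsub>T\<^esub> x)), \<one>\<^bsub>T\<^esub>)"

lemma fst_move [simp]: "x \<in> carrier T \<Longrightarrow> fst (move s b) x = fst b (inv\<^bsub>T\<^esub> s \<otimes>\<^bsub>T\<^esub> x)"
  by (simp add: move_def)

lemma move_base [simp]: assumes "s \<in> carrier T" "b \<in> base" shows "move s b \<in> base"
proof (rule baseI)
  show "move s b \<in> carrier W"
    unfolding move_def using assms finite_shifted_support[OF finite_support, of b "inv\<^bsub>T\<^esub> s"]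
    by (intro restrict_W) auto
qed (simp add: move_def)

lemma move_single:
  assumes "x \<in> carrier T" "d \<in> carrier D" shows "move x (single \<one>\<^bsub>T\<^esub> d) = single x d"
proof (rule base_eqI)
  have "(inv\<^bsub>T\<^esub> x \<otimes>\<^bsub>T\<^esub> y = \<one>\<^bsub>T\<^esub>) = (y = x)" if "y \<in> carrier T" for y
    using that assms by (metis T.inv_closed T.inv_equality T.inv_inv T.l_inv)
  then show "fst (move x (single \<one>\<^bsub>T\<^esub> d)) y = fst (single x d) y" if "y \<in> carrier T" for y
    using that assms by simp
qed (use assms in simp_all)

lemma base_mult [simp]: "a \<in> base \<Longrightarrow> b \<in> base \<Longrightarrow> a \<otimes>\<^bsub>W\<^esub> b \<in> base"
  by simp

lemma fst_base_pow:
  "b \<in> base \<Longrightarrow> x \<in> carrier T \<Longrightarrow> fst (b [^]\<^bsub>W\<^esub> (n::nat)) x = fst b x [^]\<^bsub>D\<^esub> n"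
proof (induction n)
  case (Suc n)
  have "b [^]\<^bsub>W\<^esub> n \<in> base" using Suc.prems by (induction n) auto
  then show ?case using Suc by simp
qed simp

lemma base_pow [simp]: "b \<in> base \<Longrightarrow> b [^]\<^bsub>W\<^esub> (n::nat) \<in> base"
  by (induction n) auto

lemma base_induct [consumes 1, case_names one single mult]:
  assumes f: "f \<in> base" and one: "P \<one>\<^bsub>W\<^esub>"
    and single: "\<And>x d. x \<in> carrier T \<Longrightarrow> d \<in> carrier D \<Longrightarrow> P (single x d)"
    and mult: "\<And>a b. a \<in> base \<Longrightarrow> b \<in> base \<Longrightarrow> P a \<Longrightarrow> P b \<Longrightarrow> P (a \<otimes>\<^bsub>W\<^esub> b)"
  shows "P f"
proof -
  have claim: "P f" if "finite F" "F \<subseteq> carrier T" "f \<in> base" "\<forall>x\<in>carrier T - F. fst f x = \<one>\<^bsub>D\<^esub>" for F f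
    using that
  proof (induction F arbitrary: f)
    case empty
    then have "f = \<one>\<^bsub>W\<^esub>" by (intro base_eqI) auto
    then show ?case using one by simp
  next
    case (insert x F)
    let ?s = "single x (fst f x)"
    have x: "x \<in> carrier T" and s: "?s \<in> base" using insert.prems by auto
    let ?f = "inv\<^bsub>W\<^esub> ?s \<otimes>\<^bsub>W\<^esub> f"
    have f': "?f \<in> base" using s insert.prems by simp
    have "P ?f"
    proof (rule insert.IH)
      show "\<forall>y\<in>carrier T - F. fst ?f y = \<one>\<^bsub>D\<^esub>" using insert.prems x s by auto
    qed (use insert.prems f' in auto)
    moreover have "P ?s" using single x insert.prems by simp
    ultimately have "P (?s \<otimes>\<^bsub>W\<^esub> ?f)" using mult s f' by blast
    then show ?case using s insert.prems(2) by (simp add: W.inv_mult_cancel)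
  qed
  show ?thesis
    by (rule claim[of "{x \<in> carrier T. fst f x \<noteq> \<one>\<^bsub>D\<^esub>}"]) (use f in \<open>simp_all add: subset_iff\<close>)
qed

text \<open>Modulo \<open>p\<close> the base group is the free module of rank \<open>d\<close> over \<open>\<bbbF>\<^sub>p[T]\<close>, which \<open>\<chi>\<close> embeds in
  \<open>K[T]\<^sup>d\<close>, and \<open>\<phi>\<close> is right multiplication by a matrix \<open>B\<close>. Preimages of the unit vectors give a left
  inverse \<open>A\<close> of \<open>B\<close>; direct finiteness makes \<open>A\<close> two-sided.\<close>

lemma kernel_in_powers:
  assumes comm: "comm_group D" and fg: "finitely_generated D" and p: "Factorial_Ring.prime (p::nat)"
    and K: "ring (K :: 'k ring)"
    and \<chi>_closed: "\<And>k::int. \<chi> k \<in> carrier K" and \<chi>_add: "\<And>k l. \<chi> (k + l) = \<chi> k \<oplus>\<^bsub>K\<^esub> \<chi> l"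
    and \<chi>_one: "\<chi> 1 = \<one>\<^bsub>K\<^esub>" and \<chi>_zero: "\<And>k. \<chi> k = \<zero>\<^bsub>K\<^esub> \<longleftrightarrow> int p dvd k"
    and df: "\<And>d. 1 \<le> d \<Longrightarrow> directly_finite (matrix_ring d (group_ring K T))"
    and \<phi>_base: "\<And>a. a \<in> base \<Longrightarrow> \<phi> a \<in> base"
    and \<phi>_mult: "\<And>a b. a \<in> base \<Longrightarrow> b \<in> base \<Longrightarrow> \<phi> (a \<otimes>\<^bsub>W\<^esub> b) = \<phi> a \<otimes>\<^bsub>W\<^esub> \<phi> b"
    and \<phi>_move: "\<And>s a. s \<in> carrier T \<Longrightarrow> a \<in> base \<Longrightarrow> \<phi> (move s a) = move s (\<phi> a)"
    and \<phi>_surj: "\<And>u. u \<in> base \<Longrightarrow> \<exists>a\<in>base. \<phi> a = u"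
    and b: "b \<in> base" "\<phi> b = \<one>\<^bsub>W\<^esub>" and x: "x \<in> carrier T"
  shows "\<exists>y\<in>carrier D. fst b x = y [^]\<^bsub>D\<^esub> p"
proof -
  interpret C: comm_group D by (rule comm)
  interpret K: ring K by (rule K)
  interpret GR: grp_ring K T by unfold_locales
  obtain S :: "'a set" and \<kappa> :: "'a \<Rightarrow> 'a \<Rightarrow> int" where
    S: "finite S" "S \<subseteq> carrier D" "generate D (S \<union> {x [^]\<^bsub>D\<^esub> p | x. x \<in> carrier D}) = carrier D"
    and \<kappa>_mult: "\<forall>s\<in>S. \<forall>x\<in>carrier D. \<forall>y\<in>carrier D.
       int p dvd \<kappa> s (x \<otimes>\<^bsub>D\<^esub> y) - (\<kappa> s x + \<kappa> s y)"
    and \<kappa>_basis: "\<forall>s\<in>S. \<forall>t\<in>S. int p dvd \<kappa> s t - (if s = t then 1 else 0)"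
    and \<kappa>_zero: "\<forall>x\<in>carrier D. (\<forall>s\<in>S. int p dvd \<kappa> s x) \<longleftrightarrow> (\<exists>y\<in>carrier D. x = y [^]\<^bsub>D\<^esub> p)"
    using C.coordinates_mod_prime[OF fg p] .
  define d where "d = card S"
  obtain e where e: "bij_betw e {..<d} S"
    using ex_bij_betw_nat_finite[OF S(1)] unfolding d_def by (metis atLeast0LessThan)
  have eS: "e i \<in> S" if "i < d" for i using e that by (auto simp: bij_betw_def)
  have eD: "e i \<in> carrier D" if "i < d" for i using eS that S by blast
  have e_inj: "e i = e j \<longleftrightarrow> i = j" if "i < d" "j < d" for i j
    using e that by (auto simp: bij_betw_def inj_on_def)
  have e_surj: "\<exists>i<d. e i = s" if "s \<in> S" for s using e that by (auto simp: bij_betw_def)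
  have \<chi>_cong: "\<chi> k = \<chi> l" if "int p dvd k - l" for k l
    using \<chi>_add[of l "k - l"] that \<chi>_zero \<chi>_closed by simp
  define c where "c i a = \<chi> (\<kappa> (e i) a)" for i a
  have c_closed [simp]: "c i a \<in> carrier K" for i a by (simp add: c_def \<chi>_closed)
  have c_mult: "c i (a \<otimes>\<^bsub>D\<^esub> a') = c i a \<oplus>\<^bsub>K\<^esub> c i a'"
    if "i < d" "a \<in> carrier D" "a' \<in> carrier D" for i a a'
    unfolding c_def
    using \<chi>_cong[OF bspec[OF bspec[OF bspec[OF \<kappa>_mult eS[OF that(1)]] that(2)] that(3)]] \<chi>_add by simp
  have c_basis: "c i (e j) = (if i = j then \<one>\<^bsub>K\<^esub> else \<zero>\<^bsub>K\<^esub>)" if "i < d" "j < d" for i j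
  proof -
    have "\<chi> 0 = \<zero>\<^bsub>K\<^esub>" by (simp add: \<chi>_zero)
    then show ?thesis
      unfolding c_def using \<chi>_cong[OF bspec[OF bspec[OF \<kappa>_basis eS[OF that(1)]] eS[OF that(2)]]] e_inj[OF that] \<chi>_one
      by simp
  qed
  have c_zero: "(\<forall>i<d. c i a = \<zero>\<^bsub>K\<^esub>) \<longleftrightarrow> (\<exists>y\<in>carrier D. a = y [^]\<^bsub>D\<^esub> p)" if "a \<in> carrier D" for a
    unfolding bspec[OF \<kappa>_zero that, symmetric] c_def \<chi>_zero using e_surj eS by metis
  have c_one [simp]: "c i \<one>\<^bsub>D\<^esub> = \<zero>\<^bsub>K\<^esub>" if "i < d" for i
    using c_zero[of "\<one>\<^bsub>D\<^esub>"] that by (metis D.nat_pow_one D.one_closed)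
  show ?thesis
  proof (cases "d = 0")
    case True
    then show ?thesis using c_zero[of "fst b x"] b x by auto
  next
    case False
    \<comment> \<open>The coordinates modulo \<open>p\<close> of the values of \<open>f\<close>, as a row of length \<open>d\<close> over \<open>K[T]\<close>.\<close>
    define Q where "Q f = (\<lambda>i\<in>{..<d}. \<lambda>g\<in>carrier T. c i (fst f g))" for f :: "('b \<Rightarrow> 'a) \<times> 'b"
    have Q_row: "Q f i \<in> carrier GR.P" if "f \<in> base" "i < d" for f i
    proof -
      have "(\<lambda>g\<in>carrier T. c i (fst f g)) \<in> carrier GR.P"
        by (rule GR.P_restrictI[where F = "{x \<in> carrier T. fst f x \<noteq> \<one>\<^bsub>D\<^esub>}"]) (use that in auto)
      then show ?thesis using that by (simp add: Q_def)
    qed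
    have Q_rows: "Q f \<in> GR.P.rows d" if "f \<in> base" for f
      using Q_row[OF that] by (auto simp: Q_def)
    have Q_apply: "Q f i g = c i (fst f g)" if "i < d" "g \<in> carrier T" for f i g
      using that by (simp add: Q_def)
    have row_eqI: "v = w" if "v \<in> GR.P.rows d" "w \<in> GR.P.rows d"
        "\<And>i g. i < d \<Longrightarrow> g \<in> carrier T \<Longrightarrow> v i g = w i g" for v w
    proof (rule PiE_ext[OF that(1,2)])
      show "v i = w i" if "i \<in> {..<d}" for i
        using that \<open>v \<in> GR.P.rows d\<close> \<open>w \<in> GR.P.rows d\<close> \<open>\<And>i g. i < d \<Longrightarrow> g \<in> carrier T \<Longrightarrow> v i g = w i g\<close>
        by (intro GR.P_eqI) auto
    qed
    define plus where "plus v w = (\<lambda>i\<in>{..<d}. v i \<oplus>\<^bsub>GR.P\<^esub> w i)" for v w :: "nat \<Rightarrow> 'b \<Rightarrow> 'k"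
    define zero where "zero = (\<lambda>i\<in>{..<d}. \<zero>\<^bsub>GR.P\<^esub>)"
    have plus_rows: "plus v w \<in> GR.P.rows d" if "v \<in> GR.P.rows d" "w \<in> GR.P.rows d" for v w
      using that by (auto simp: plus_def)
    have zero_rows: "zero \<in> GR.P.rows d" by (auto simp: zero_def)
    have plus_cancel: "w = w'" if "v \<in> GR.P.rows d" "w \<in> GR.P.rows d" "w' \<in> GR.P.rows d"
        "plus v w = plus v w'" for v w w'
    proof (rule PiE_ext[OF that(2,3)])
      fix i assume i: "i \<in> {..<d}"
      have "plus v w i = plus v w' i" using that(4) by simp
      then show "w i = w' i"
        using i that(1-3) GR.P.add.l_cancel[of "v i" "w i" "w' i"] by (simp add: plus_def PiE_iff)
    qed
    have plus_zero: "plus v zero = v" if "v \<in> GR.P.rows d" for v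
      by (rule PiE_ext[OF plus_rows[OF that zero_rows] that]) (use that in \<open>auto simp: plus_def zero_def\<close>)
    have Q_mult: "Q (f \<otimes>\<^bsub>W\<^esub> g) = plus (Q f) (Q g)" if "f \<in> base" "g \<in> base" for f g
    proof (rule row_eqI)
      show "Q (f \<otimes>\<^bsub>W\<^esub> g) \<in> GR.P.rows d" using that by (intro Q_rows base_mult)
      show "plus (Q f) (Q g) \<in> GR.P.rows d" using that by (intro plus_rows Q_rows)
      show "Q (f \<otimes>\<^bsub>W\<^esub> g) i x = plus (Q f) (Q g) i x" if "i < d" "x \<in> carrier T" for i x
        using that \<open>f \<in> base\<close> \<open>g \<in> base\<close> by (simp add: plus_def Q_apply c_mult)
    qed
    have Q_zeroI: "Q f = zero" if "f \<in> base" "\<And>g. g \<in> carrier T \<Longrightarrow> \<exists>y\<in>carrier D. fst f g = y [^]\<^bsub>D\<^esub> p" for f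
    proof (rule row_eqI[OF Q_rows[OF that(1)] zero_rows])
      show "Q f i g = zero i g" if "i < d" "g \<in> carrier T" for i g
        using that \<open>f \<in> base\<close> \<open>\<And>g. g \<in> carrier T \<Longrightarrow> \<exists>y\<in>carrier D. fst f g = y [^]\<^bsub>D\<^esub> p\<close>[of g]
          c_zero[of "fst f g"] by (simp add: zero_def Q_apply)
    qed
    have Q_one: "Q \<one>\<^bsub>W\<^esub> = zero"
      by (rule row_eqI) (use Q_rows zero_rows in \<open>auto simp: zero_def Q_apply\<close>)
    have Q_single: "Q (single \<one>\<^bsub>T\<^esub> (e j)) = GR.P.unit_row d j" if "j < d" for j
    proof (rule row_eqI)
      show "Q (single \<one>\<^bsub>T\<^esub> (e j)) \<in> GR.P.rows d" using Q_rows eD that by simp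
      show "GR.P.unit_row d j \<in> GR.P.rows d" by auto
      show "Q (single \<one>\<^bsub>T\<^esub> (e j)) i g = GR.P.unit_row d j i g" if "i < d" "g \<in> carrier T" for i g
        using that \<open>j < d\<close> by (auto simp: Q_apply c_basis)
    qed
    have \<phi>_one: "\<phi> \<one>\<^bsub>W\<^esub> = \<one>\<^bsub>W\<^esub>"
    proof -
      have "\<phi> \<one>\<^bsub>W\<^esub> \<otimes>\<^bsub>W\<^esub> \<phi> \<one>\<^bsub>W\<^esub> = \<phi> \<one>\<^bsub>W\<^esub>" using \<phi>_mult[of "\<one>\<^bsub>W\<^esub>" "\<one>\<^bsub>W\<^esub>"] by simp
      then show ?thesis using \<phi>_base[of "\<one>\<^bsub>W\<^esub>"] by simp
    qed
    have \<phi>_pow: "\<phi> (a [^]\<^bsub>W\<^esub> (n::nat)) = \<phi> a [^]\<^bsub>W\<^esub> n" if "a \<in> base" for a n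
      using that by (induction n) (auto simp: \<phi>_one \<phi>_mult)
    define B where "B = (\<lambda>(i, j)\<in>{..<d} \<times> {..<d}. Q (\<phi> (single \<one>\<^bsub>T\<^esub> (e i))) j)"
    have B: "B \<in> carrier (matrix_ring d GR.P)"
      unfolding GR.P.carrier_matrix_ring B_def
      by (rule restrict_PiE_iff[THEN iffD2]) (auto intro!: Q_row \<phi>_base single_base eD)
    define L where "L v = row_times_matrix GR.P d v B" for v
    have L_rows: "L v \<in> GR.P.rows d" if "v \<in> GR.P.rows d" for v
      unfolding L_def using that B by simp
    have L_plus: "L (plus v w) = plus (L v) (L w)" if "v \<in> GR.P.rows d" "w \<in> GR.P.rows d" for v w
      unfolding L_def plus_def by (rule GR.P.row_times_matrix_add[OF that B])
    have L_zero: "L zero = zero"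
    proof (rule plus_cancel[OF L_rows[OF zero_rows] L_rows[OF zero_rows] zero_rows])
      show "plus (L zero) (L zero) = plus (L zero) zero"
        using L_plus[OF zero_rows zero_rows] plus_zero zero_rows L_rows by metis
    qed
    have L_unit: "L (GR.P.unit_row d i) = Q (\<phi> (single \<one>\<^bsub>T\<^esub> (e i)))" if i: "i < d" for i
    proof -
      have "L (GR.P.unit_row d i) = GR.P.matrix_row d B i"
        unfolding L_def by (rule GR.P.unit_row_times_matrix[OF B i])
      also have "\<dots> = Q (\<phi> (single \<one>\<^bsub>T\<^esub> (e i)))"
        using i by (auto simp: GR.P.matrix_row_def B_def Q_def fun_eq_iff)
      finally show ?thesis .
    qed
    have L_shift: "L (\<lambda>i\<in>{..<d}. GR.shift s (v i)) = (\<lambda>j\<in>{..<d}. GR.shift s (L v j))"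
      if s: "s \<in> carrier T" and v: "v \<in> GR.P.rows d" for s v
      unfolding L_def by (rule GR.shift_row_times_matrix[OF s v B])
    \<comment> \<open>It suffices to compare \<open>\<phi>\<close> and \<open>B\<close> at the unit vectors and at \<open>p\<close>-th powers, as both are additive and
      commute with shifts.\<close>
    define E where "E f \<longleftrightarrow> Q (\<phi> f) = L (Q f)" for f
    have E_one: "E \<one>\<^bsub>W\<^esub>" by (simp add: E_def \<phi>_one Q_one L_zero)
    have E_mult: "E (f \<otimes>\<^bsub>W\<^esub> g)" if "f \<in> base" "g \<in> base" "E f" "E g" for f g
      using that by (simp add: E_def \<phi>_mult \<phi>_base Q_mult L_plus Q_rows)
    have E_inv: "E (inv\<^bsub>W\<^esub> f)" if f: "f \<in> base" "E f" for f
      unfolding E_def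
    proof (rule plus_cancel)
      have f': "inv\<^bsub>W\<^esub> f \<in> base" using f by simp
      have "plus (Q (\<phi> f)) (Q (\<phi> (inv\<^bsub>W\<^esub> f))) = Q (\<phi> (f \<otimes>\<^bsub>W\<^esub> inv\<^bsub>W\<^esub> f))"
        using f f' by (simp only: \<phi>_mult Q_mult \<phi>_base)
      also have "\<dots> = L (Q (f \<otimes>\<^bsub>W\<^esub> inv\<^bsub>W\<^esub> f))" using f E_one by (simp add: E_def)
      also have "\<dots> = plus (L (Q f)) (L (Q (inv\<^bsub>W\<^esub> f)))"
        using f f' Q_rows by (simp only: Q_mult L_plus)
      finally show "plus (L (Q f)) (Q (\<phi> (inv\<^bsub>W\<^esub> f))) = plus (L (Q f)) (L (Q (inv\<^bsub>W\<^esub> f)))"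
        using f by (simp add: E_def)
    qed (use f Q_rows L_rows \<phi>_base in simp_all)
    have E_move: "E (move s f)" if s: "s \<in> carrier T" and f: "f \<in> base" "E f" for s f
    proof -
      have Q_move: "Q (move s g) = (\<lambda>i\<in>{..<d}. GR.shift s (Q g i))" if "g \<in> base" for g
        using s by (auto simp: Q_def GR.shift_def fun_eq_iff)
      have "Q (\<phi> (move s f)) = (\<lambda>i\<in>{..<d}. GR.shift s (Q (\<phi> f) i))"
        using s f by (simp add: \<phi>_move Q_move \<phi>_base)
      also have "\<dots> = L (Q (move s f))"
        using s f Q_rows by (simp add: Q_move L_shift E_def)
      finally show ?thesis by (simp add: E_def)
    qed
    have E_single_one: "E (single \<one>\<^bsub>T\<^esub> a)" if a: "a \<in> carrier D" for a
    proof -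
      let ?A = "{a \<in> carrier D. E (single \<one>\<^bsub>T\<^esub> a)}"
      have "subgroup ?A D"
      proof (rule D.subgroupI)
        have "single \<one>\<^bsub>T\<^esub> \<one>\<^bsub>D\<^esub> = \<one>\<^bsub>W\<^esub>" by (rule base_eqI) auto
        then show "?A \<noteq> {}" using E_one by (metis (mono_tags, lifting) D.one_closed empty_iff mem_Collect_eq)
        show "inv\<^bsub>D\<^esub> u \<in> ?A" if u: "u \<in> ?A" for u
        proof -
          have "single \<one>\<^bsub>T\<^esub> (inv\<^bsub>D\<^esub> u) = inv\<^bsub>W\<^esub> single \<one>\<^bsub>T\<^esub> u"
            using u by (intro base_eqI) auto
          then show ?thesis using u E_inv[of "single \<one>\<^bsub>T\<^esub> u"] by simp
        qed
        show "u \<otimes>\<^bsub>D\<^esub> v \<in> ?A" if uv: "u \<in> ?A" "v \<in> ?A" for u v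
        proof -
          have "single \<one>\<^bsub>T\<^esub> (u \<otimes>\<^bsub>D\<^esub> v) = single \<one>\<^bsub>T\<^esub> u \<otimes>\<^bsub>W\<^esub> single \<one>\<^bsub>T\<^esub> v"
            using uv by (intro base_eqI) auto
          then show ?thesis using uv E_mult[of "single \<one>\<^bsub>T\<^esub> u" "single \<one>\<^bsub>T\<^esub> v"] by simp
        qed
      qed auto
      moreover have "s \<in> ?A" if s: "s \<in> S" for s
      proof -
        obtain i where i: "i < d" "e i = s" using e_surj s by blast
        have "Q (\<phi> (single \<one>\<^bsub>T\<^esub> s)) = L (Q (single \<one>\<^bsub>T\<^esub> s))"
          using Q_single[OF i(1)] L_unit[OF i(1)] i by simp
        then show ?thesis using s S by (auto simp: E_def)
      qed
      moreover have "y [^]\<^bsub>D\<^esub> p \<in> ?A" if y: "y \<in> carrier D" for y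
      proof -
        let ?y = "single \<one>\<^bsub>T\<^esub> y"
        have y': "?y \<in> base" using y by simp
        have eq: "single \<one>\<^bsub>T\<^esub> (y [^]\<^bsub>D\<^esub> p) = ?y [^]\<^bsub>W\<^esub> p"
          using y by (intro base_eqI) (auto simp: fst_base_pow)
        have pow: "Q (f [^]\<^bsub>W\<^esub> p) = zero" if "f \<in> base" for f
          using that by (intro Q_zeroI) (auto simp: fst_base_pow)
        have "Q (\<phi> (?y [^]\<^bsub>W\<^esub> p)) = L (Q (?y [^]\<^bsub>W\<^esub> p))"
          using y' by (simp add: \<phi>_pow pow \<phi>_base L_zero)
        then show ?thesis using y eq by (simp add: E_def)
      qed
      ultimately have "generate D (S \<union> {x [^]\<^bsub>D\<^esub> p | x. x \<in> carrier D}) \<subseteq> ?A"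
        by (intro D.generate_subgroup_incl) auto
      then show ?thesis using S(3) a by blast
    qed
    have E: "E f" if "f \<in> base" for f
      using that
    proof (induction rule: base_induct)
      case (single x a)
      have "E (move x (single \<one>\<^bsub>T\<^esub> a))" using single E_single_one by (intro E_move) simp_all
      then show ?case using single by (simp add: move_single)
    qed (use E_one E_mult in auto)
    have "\<exists>a. i < d \<longrightarrow> a \<in> base \<and> \<phi> a = single \<one>\<^bsub>T\<^esub> (e i)" for i
      using \<phi>_surj[OF single_base[OF T.one_closed eD]] by blast
    then obtain g where g: "\<And>i. i < d \<Longrightarrow> g i \<in> base \<and> \<phi> (g i) = single \<one>\<^bsub>T\<^esub> (e i)" by metis
    define A where "A = (\<lambda>(i, j)\<in>{..<d} \<times> {..<d}. Q (g i) j)"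
    have A: "A \<in> carrier (matrix_ring d GR.P)"
      unfolding GR.P.carrier_matrix_ring A_def
      by (rule restrict_PiE_iff[THEN iffD2]) (use g in \<open>auto intro!: Q_row\<close>)
    have "A \<otimes>\<^bsub>matrix_ring d GR.P\<^esub> B = \<one>\<^bsub>matrix_ring d GR.P\<^esub>"
    proof (rule GR.P.matrix_eqI[OF GR.P.matrix_mult_closed[OF A B] GR.P.matrix_one_closed])
      fix i j assume ij: "i < d" "j < d"
      have "GR.P.matrix_row d A i = Q (g i)" using ij by (auto simp: GR.P.matrix_row_def A_def Q_def fun_eq_iff)
      then have "GR.P.matrix_row d (A \<otimes>\<^bsub>matrix_ring d GR.P\<^esub> B) i = L (Q (g i))"
        using ij by (simp add: GR.P.matrix_row_mult[OF A B] L_def)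
      also have "\<dots> = GR.P.unit_row d i"
        using E[of "g i"] g[of i] ij Q_single by (simp add: E_def)
      finally have "GR.P.matrix_row d (A \<otimes>\<^bsub>matrix_ring d GR.P\<^esub> B) i j = GR.P.unit_row d i j" by simp
      then show "(A \<otimes>\<^bsub>matrix_ring d GR.P\<^esub> B) (i, j) = \<one>\<^bsub>matrix_ring d GR.P\<^esub> (i, j)"
        using ij by (simp add: GR.P.matrix_row_def GR.P.matrix_one)
    qed
    then have inj: "inj_on L (GR.P.rows d)"
      unfolding L_def using GR.P.row_times_matrix_inj[OF df A B] False by simp
    have "L (Q b) = Q \<one>\<^bsub>W\<^esub>" using E[OF b(1)] b(2) by (simp add: E_def)
    then have "L (Q b) = L zero" using Q_one L_zero by simp
    then have "Q b = zero" using inj Q_rows[OF b(1)] zero_rows by (meson inj_onD)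
    moreover have "zero i x = \<zero>\<^bsub>K\<^esub>" if "i < d" for i using that x by (simp add: zero_def)
    ultimately have "\<forall>i<d. c i (fst b x) = \<zero>\<^bsub>K\<^esub>" using x Q_apply by metis
    then show ?thesis using c_zero b x by simp
  qed
qed

end

context wreath
begin

lemma move_eq_conjugate:
  assumes "s \<in> carrier T" "b \<in> base"
  shows "move s b = top s \<otimes>\<^bsub>W\<^esub> b \<otimes>\<^bsub>W\<^esub> inv\<^bsub>W\<^esub> top s"
  by (rule base_eqI) (use assms base.inv_op_closed2 in \<open>simp_all add: T.word_simps\<close>)

text \<open>An element of the kernel takes values in the \<open>n\<close>-th powers for every \<open>n\<close>, one prime factor of
  \<open>n\<close> at a time: \<open>\<phi>\<close> maps the functions with values in the \<open>m\<close>-th powers onto themselves.\<close>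

theorem hopfian_wreath_abelian:
  assumes comm: "comm_group D" and fg: "finitely_generated D" and hopf: "hopfian T"
    and K: "\<And>p::nat. Factorial_Ring.prime p \<Longrightarrow> \<exists>(K :: 'k ring) (\<chi> :: int \<Rightarrow> 'k). ring K \<and>
      (\<forall>k. \<chi> k \<in> carrier K) \<and> (\<forall>k l. \<chi> (k + l) = \<chi> k \<oplus>\<^bsub>K\<^esub> \<chi> l) \<and> \<chi> 1 = \<one>\<^bsub>K\<^esub> \<and>
      (\<forall>k. \<chi> k = \<zero>\<^bsub>K\<^esub> \<longleftrightarrow> int p dvd k) \<and>
      (\<forall>d\<ge>1. directly_finite (matrix_ring d (group_ring K T)))"
  shows "hopfian W"
proof (rule hopfian_if_injective_over_top[OF hopf fg comm_group.nilpotent_class_comm[OF comm]])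
  interpret C: comm_group D by (rule comm)
  fix \<phi> w assume hom: "\<phi> \<in> hom W W" and surj: "\<phi> ` carrier W = carrier W"
    and over: "\<And>u. u \<in> carrier W \<Longrightarrow> snd (\<phi> u) = snd u"
    and w: "w \<in> base" "\<phi> w = \<one>\<^bsub>W\<^esub>"
  interpret \<phi>: group_hom W W \<phi>
    using hom W.is_group by (simp add: group_hom_def group_hom_axioms_def)
  have \<phi>_base: "\<phi> a \<in> base" if "a \<in> base" for a
    using that over[of a] by (intro baseI) simp_all
  have \<phi>_surj: "\<exists>a\<in>base. \<phi> a = u" if u: "u \<in> base" for u
  proof -
    have "u \<in> \<phi> ` carrier W" using surj u by simp
    then obtain a where a: "a \<in> carrier W" "u = \<phi> a" by blast
    then have "a \<in> base" using over[of a] u by (intro baseI) simp_all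
    then show ?thesis using a by blast
  qed
  have \<phi>_move: "\<phi> (move s a) = move s (\<phi> a)" if s: "s \<in> carrier T" and a: "a \<in> base" for s a
  proof (rule base_eqI)
    show "\<phi> (move s a) \<in> base" "move s (\<phi> a) \<in> base" using s a \<phi>_base by simp_all
    fix x assume x: "x \<in> carrier T"
    let ?h = "\<phi> (top s)"
    let ?y = "inv\<^bsub>T\<^esub> s \<otimes>\<^bsub>T\<^esub> x"
    have y: "?y \<in> carrier T" using s x by simp
    have h: "?h \<in> carrier W" "snd ?h = s" using s over[of "top s"] by simp_all
    have "\<phi> (move s a) = ?h \<otimes>\<^bsub>W\<^esub> \<phi> a \<otimes>\<^bsub>W\<^esub> inv\<^bsub>W\<^esub> ?h"
      using s a by (simp add: move_eq_conjugate)
    then have "fst (\<phi> (move s a)) x = fst ?h x \<otimes>\<^bsub>D\<^esub> fst (\<phi> a) ?y \<otimes>\<^bsub>D\<^esub> inv\<^bsub>D\<^esub> (fst ?h x)"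
      using x s a h \<phi>_base[OF a] by (simp add: T.word_simps)
    also have "\<dots> = fst (\<phi> a) ?y"
      using x y h \<phi>_base[OF a] C.m_comm[of "fst ?h x" "fst (\<phi> a) ?y"] by (simp add: D.m_assoc)
    finally show "fst (\<phi> (move s a)) x = fst (move s (\<phi> a)) x" using x by simp
  qed
  have \<phi>_pow: "\<phi> (a [^]\<^bsub>W\<^esub> (n::nat)) = \<phi> a [^]\<^bsub>W\<^esub> n" if "a \<in> base" for a n
    using that by (simp add: \<phi>.hom_nat_pow)
  have noeth: "noetherian_in D (carrier D)"
    by (rule D.finitely_generated_nilpotent_noetherian[OF fg C.nilpotent_class_comm])

  have powers: "\<exists>y\<in>carrier D. fst b x = y [^]\<^bsub>D\<^esub> n"
    if "0 < n" "b \<in> base" "\<phi> b = \<one>\<^bsub>W\<^esub>" "x \<in> carrier T" for n :: nat and b x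
    using that
  proof (induction n arbitrary: b x rule: less_induct)
    case (less n)
    show ?case
    proof (cases "n = 1")
      case True
      then show ?thesis using less.prems by (intro bexI[of _ "fst b x"]) simp_all
    next
      case False
      then obtain p where p: "Factorial_Ring.prime p" "p dvd n" using prime_factor_nat by blast
      then obtain m where m: "n = m * p" by (metis dvd_div_mult_self)
      have "1 < p" using p prime_gt_1_nat by blast
      then have m_less: "0 < m" "m < n" using m less.prems(1) by auto
      \<comment> \<open>The same wreath product with \<open>D\<close> replaced by its \<open>m\<close>-th powers.\<close>
      define E where "E = {x [^]\<^bsub>D\<^esub> m | x. x \<in> carrier D}"
      have E: "subgroup E D" unfolding E_def by (rule C.subgroup_powers)
      have E_car: "e \<in> carrier D" if "e \<in> E" for e using that subgroup.mem_carrier[OF E] by blast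
      let ?E = "D\<lparr>carrier := E\<rparr>"
      have E_comm: "comm_group ?E"
        by (rule group.group_comm_groupI[OF D.subgroup_imp_group[OF E]]) (use E_car C.m_comm in simp)
      have E_fg: "finitely_generated ?E"
      proof -
        obtain S where "finite S" "S \<subseteq> E" "generate D S = E"
          using noetherian_inE[OF noeth E subgroup.subset[OF E]] .
        then show ?thesis unfolding finitely_generated_def
          using D.generate_consistent[OF _ E] by auto
      qed
      interpret V: wreath ?E T
        using E_comm by (intro wreath.intro) (auto simp: comm_group.axioms T.is_group)
      have V_mult: "u \<otimes>\<^bsub>V.W\<^esub> v = u \<otimes>\<^bsub>W\<^esub> v" for u v by (simp add: V.W_mult W_mult)
      have V_one: "\<one>\<^bsub>V.W\<^esub> = \<one>\<^bsub>W\<^esub>" by (simp add: wreath_product_def semidirect_product_def)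
      have V_base: "f \<in> V.base \<longleftrightarrow> f \<in> base \<and> (\<forall>x\<in>carrier T. fst f x \<in> E)" for f
        unfolding V.base_def base_def mem_Collect_eq V.carrier_W carrier_W
        using E_car by (auto simp: PiE_iff)
      have root: "\<exists>a\<in>base. f = a [^]\<^bsub>W\<^esub> m" if f: "f \<in> V.base" for f
      proof -
        have f_base: "f \<in> base" using f V_base by blast
        define r where "r x = (if fst f x = \<one>\<^bsub>D\<^esub> then \<one>\<^bsub>D\<^esub> else SOME y. y \<in> carrier D \<and> fst f x = y [^]\<^bsub>D\<^esub> m)" for x
        have r: "r x \<in> carrier D \<and> fst f x = r x [^]\<^bsub>D\<^esub> m" if x: "x \<in> carrier T" for x
        proof (cases "fst f x = \<one>\<^bsub>D\<^esub>")
          case False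
          have "\<exists>y. y \<in> carrier D \<and> fst f x = y [^]\<^bsub>D\<^esub> m" using f x V_base by (auto simp: E_def)
          from someI_ex[OF this] show ?thesis using False by (simp add: r_def)
        qed (simp add: r_def)
        let ?a = "(restrict r (carrier T), \<one>\<^bsub>T\<^esub>)"
        have "finite {x \<in> carrier T. r x \<noteq> \<one>\<^bsub>D\<^esub>}"
          by (rule finite_subset[OF _ finite_support[OF base_carrier[OF f_base]]]) (auto simp: r_def)
        then have "?a \<in> carrier W" using r by (intro restrict_W) auto
        then have a: "?a \<in> base" by (rule baseI) simp
        have "f = ?a [^]\<^bsub>W\<^esub> m"
          by (rule base_eqI[OF f_base base_pow[OF a]]) (use a r in \<open>simp add: fst_base_pow\<close>)
        then show ?thesis using a by blast
      qed
      have pow_V: "a [^]\<^bsub>W\<^esub> m \<in> V.base" if "a \<in> base" for a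
        using that V_base[of "a [^]\<^bsub>W\<^esub> m"] by (auto simp: fst_base_pow E_def)
      obtain K :: "'k ring" and \<chi> where K: "ring K" "\<forall>k. \<chi> k \<in> carrier K"
          "\<forall>k l. \<chi> (k + l) = \<chi> k \<oplus>\<^bsub>K\<^esub> \<chi> l" "\<chi> 1 = \<one>\<^bsub>K\<^esub>" "\<forall>k. \<chi> k = \<zero>\<^bsub>K\<^esub> \<longleftrightarrow> int p dvd k"
          "\<forall>d\<ge>1. directly_finite (matrix_ring d (group_ring K T))"
        using K[OF p(1)] by blast
      have "\<exists>y\<in>carrier ?E. fst b x = y [^]\<^bsub>?E\<^esub> p"
      proof (rule V.kernel_in_powers[OF E_comm E_fg p(1) K(1)])
        show "\<chi> k \<in> carrier K" "\<chi> (k + l) = \<chi> k \<oplus>\<^bsub>K\<^esub> \<chi> l" "\<chi> 1 = \<one>\<^bsub>K\<^esub>"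
          "\<chi> k = \<zero>\<^bsub>K\<^esub> \<longleftrightarrow> int p dvd k" for k l using K by blast+
        show "directly_finite (matrix_ring d (group_ring K T))" if "1 \<le> d" for d using K that by blast
        show "\<phi> a \<in> V.base" if a: "a \<in> V.base" for a
        proof -
          obtain a' where a': "a' \<in> base" "a = a' [^]\<^bsub>W\<^esub> m" using root[OF a] by blast
          then show ?thesis using pow_V[OF \<phi>_base[OF a'(1)]] by (simp add: \<phi>_pow)
        qed
        show "\<phi> (a \<otimes>\<^bsub>V.W\<^esub> b) = \<phi> a \<otimes>\<^bsub>V.W\<^esub> \<phi> b" if "a \<in> V.base" "b \<in> V.base" for a b
        proof -
          have "a \<in> carrier W" "b \<in> carrier W" using that V_base[of a] V_base[of b] by simp_all
          then show ?thesis by (simp only: V_mult \<phi>.hom_mult)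
        qed
        show "\<phi> (V.move s a) = V.move s (\<phi> a)" if "s \<in> carrier T" "a \<in> V.base" for s a
        proof -
          have "a \<in> base" using that V_base[of a] by simp
          then show ?thesis by (rule \<phi>_move[OF that(1)])
        qed
        show "\<exists>a\<in>V.base. \<phi> a = u" if u: "u \<in> V.base" for u
        proof -
          obtain u' where u': "u' \<in> base" "u = u' [^]\<^bsub>W\<^esub> m" using root[OF u] by blast
          obtain a where a: "a \<in> base" "\<phi> a = u'" using \<phi>_surj[OF u'(1)] by blast
          have "\<phi> (a [^]\<^bsub>W\<^esub> m) = u" using a u' \<phi>_pow by simp
          then show ?thesis using pow_V[OF a(1)] by blast
        qed
        show "b \<in> V.base" 
        proof -
          have "fst b x \<in> E" if "x \<in> carrier T" for x
            using less.IH[OF m_less(2,1) less.prems(2,3) that] unfolding E_def by blast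
          then show ?thesis using V_base[of b] less.prems(2) by simp
        qed
        show "\<phi> b = \<one>\<^bsub>V.W\<^esub>" using less.prems by (simp add: V_one)
      qed (rule less.prems)
      then obtain y where y: "y \<in> E" "fst b x = y [^]\<^bsub>D\<^esub> p"
        by (auto simp: D.nat_pow_consistent[symmetric])
      then obtain z where z: "z \<in> carrier D" "y = z [^]\<^bsub>D\<^esub> m" by (auto simp: E_def)
      have "fst b x = z [^]\<^bsub>D\<^esub> n" using y z m by (simp add: D.nat_pow_pow)
      then show ?thesis using z by blast
    qed
  qed
  show "w = \<one>\<^bsub>W\<^esub>"
  proof (rule base_eqI)
    fix x assume x: "x \<in> carrier T"
    have "fst w x = \<one>\<^bsub>D\<^esub>"
    proof (rule C.divisible_element_trivial[OF fg])
      show "fst w x \<in> carrier D" using w x by simp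
      show "\<exists>y\<in>carrier D. y [^]\<^bsub>D\<^esub> n = fst w x" if "0 < n" for n :: nat
        using powers[OF that w x] by metis
    qed
    then show "fst w x = fst \<one>\<^bsub>W\<^esub> x" using x by simp
  qed (use w in simp_all)
qed

end

section \<open>Changing the underlying types\<close>

lemma countable_inj_on:
  assumes "countable A" "infinite (UNIV :: 'b set)"
  obtains f :: "'a \<Rightarrow> 'b" where "inj_on f A"
proof -
  obtain g :: "nat \<Rightarrow> 'b" where g: "inj g" using infinite_countable_subset[OF assms(2)] by blast
  have "inj_on (g \<circ> to_nat_on A) A"
    by (rule comp_inj_on[OF inj_on_to_nat_on[OF assms(1)]]) (use g in \<open>auto intro: inj_on_subset\<close>)
  then show thesis by (rule that)
qed

lemma (in group) countable_generate:
  assumes "countable S" "S \<subseteq> carrier G" shows "countable (generate G S)"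
proof -
  let ?A = "S \<union> (\<lambda>x. inv x) ` S"
  let ?p = "\<lambda>xs. foldr (\<otimes>) xs \<one>"
  have A: "?A \<subseteq> carrier G" using assms by auto
  have closed: "?p xs \<in> carrier G" if "xs \<in> lists ?A" for xs
    using that A by (induction xs) auto
  have append: "?p (xs @ ys) = ?p xs \<otimes> ?p ys" if "xs \<in> lists ?A" "ys \<in> lists ?A" for xs ys
    using that(1)
  proof (induction xs)
    case (Cons x xs)
    then have "x \<in> carrier G" "?p xs \<in> carrier G" "?p ys \<in> carrier G" using A closed that(2) by auto
    then show ?case using Cons by (simp add: m_assoc)
  qed (use closed that in simp)
  have "generate G S \<subseteq> ?p ` lists ?A"
  proof
    fix x assume "x \<in> generate G S"
    then show "x \<in> ?p ` lists ?A"
    proof (induction rule: generate.induct)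
      case one show ?case by (rule image_eqI[of _ _ "[]"]) auto
    next
      case (incl h)
      then show ?case using assms by (intro image_eqI[of _ _ "[h]"]) auto
    next
      case (inv h)
      then show ?case using assms by (intro image_eqI[of _ _ "[inv h]"]) auto
    next
      case (eng h1 h2)
      then obtain xs ys where "xs \<in> lists ?A" "h1 = ?p xs" "ys \<in> lists ?A" "h2 = ?p ys" by blast
      then show ?case using append by (intro image_eqI[of _ _ "xs @ ys"]) auto
    qed
  qed
  moreover have "countable (?p ` lists ?A)" using assms(1) by simp
  ultimately show ?thesis using countable_subset by blast
qed

lemma (in group) countable_finitely_generated:
  "finitely_generated G \<Longrightarrow> countable (carrier G)"
  unfolding finitely_generated_def using countable_generate countable_finite by metis

text \<open>A copy of the prime field on a given infinite type, with the reduction map from the integers.\<close>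

lemma exists_prime_field:
  assumes inf: "infinite (UNIV :: 'k set)" and p: "Factorial_Ring.prime (p::nat)"
  obtains K :: "'k ring" and \<chi> :: "int \<Rightarrow> 'k" where "field K" "\<forall>k. \<chi> k \<in> carrier K"
    "\<forall>k l. \<chi> (k + l) = \<chi> k \<oplus>\<^bsub>K\<^esub> \<chi> l" "\<chi> 1 = \<one>\<^bsub>K\<^esub>" "\<forall>k. \<chi> k = \<zero>\<^bsub>K\<^esub> \<longleftrightarrow> int p dvd k"
proof -
  interpret F: residues_prime p "residue_ring (int p)"
    by unfold_locales (use p in simp_all)
  interpret F: field "residue_ring (int p)" by (rule F.is_field)
  obtain f :: "int \<Rightarrow> 'k" where f: "inj_on f (carrier (residue_ring (int p)))"
    using countable_inj_on[OF countable_finite[OF F.finite] inf] .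
  let ?K = "image_ring f (residue_ring (int p))"
  have iso: "f \<in> ring_iso (residue_ring (int p)) ?K" by (rule inj_imp_image_ring_iso[OF f])
  then have hom: "f \<in> ring_hom (residue_ring (int p)) ?K" by (simp add: ring_iso_def)
  have K: "field ?K" by (rule F.inj_imp_image_ring_is_field[OF f])
  have zero: "\<zero>\<^bsub>?K\<^esub> = f 0" using image_ring_zero[of f "residue_ring (int p)"] F.res_zero_eq by simp
  show thesis
  proof (rule that[of ?K "\<lambda>k. f (k mod int p)"])
    show "\<forall>k. f (k mod int p) \<in> carrier ?K" using ring_hom_closed[OF hom] by simp
    show "\<forall>k l. f ((k + l) mod int p) = f (k mod int p) \<oplus>\<^bsub>?K\<^esub> f (l mod int p)"
      using ring_hom_add[OF hom, of "_ mod int p" "_ mod int p"] F.add_cong by simp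
    show "f (1 mod int p) = \<one>\<^bsub>?K\<^esub>"
      using ring_hom_one[OF hom] F.one_cong by simp
    show "\<forall>k. (f (k mod int p) = \<zero>\<^bsub>?K\<^esub>) = (int p dvd k)"
    proof
      fix k
      have "f (k mod int p) = f 0 \<longleftrightarrow> k mod int p = 0"
        using f F.mod_in_carrier[of k] F.mod_in_carrier[of 0] by (auto simp: inj_on_def)
      then show "(f (k mod int p) = \<zero>\<^bsub>?K\<^esub>) = (int p dvd k)" using zero by (simp add: dvd_eq_mod_eq_0)
    qed
  qed (rule K)
qed

text \<open>The group is moved to the type \<open>'g\<close> of the hypothesis, which has room for all countable groups.\<close>

lemma directly_finite_if_stably_finite:
  assumes stable: "\<And>(G :: 'g monoid) (F :: 'k ring). group G \<Longrightarrow> field F \<Longrightarrow> stably_finite (group_ring F G)"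
    and inf: "infinite (UNIV :: 'g set)"
    and T: "group (T :: ('c, 'n) monoid_scheme)" "countable (carrier T)" and K: "field (K :: 'k ring)" and d: "1 \<le> d"
  shows "directly_finite (matrix_ring d (group_ring K T))"
proof -
  interpret K: field K by (rule K)
  interpret T: group T by (rule T(1))
  obtain f :: "'c \<Rightarrow> 'g" where f: "inj_on f (carrier T)" using countable_inj_on[OF T(2) inf] .
  let ?G = "image_group f T"
  have G: "group ?G" by (rule T.inj_imp_image_group_is_group[OF f])
  interpret h: grp_ring_map K T K ?G "carrier K" "\<lambda>x. x" "carrier T" f
  proof (intro grp_ring_map.intro grp_ring.intro grp_ring_map_axioms.intro)
    show "subring (carrier K) K" by (rule K.carrier_is_subring)
    show "(\<lambda>x. x) \<in> ring_hom (K\<lparr>carrier := carrier K\<rparr>) K" by (simp add: ring_hom_def)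
    show "subgroup (carrier T) T" by (rule T.subgroup_self)
    show "f \<in> hom (T\<lparr>carrier := carrier T\<rparr>) ?G"
      using inj_imp_image_group_iso[OF f] by (simp add: iso_def)
  qed (use f G in \<open>simp_all add: K.ring_axioms T.is_group\<close>)
  have Q: "h.Q = carrier h.A.P" unfolding h.Q_def using h.A.supp_subset h.A.P_closed by blast
  have df: "directly_finite (matrix_ring d h.B.P)"
    using stable[OF G K] d unfolding stably_finite_def by blast
  show ?thesis
    unfolding directly_finite_def
  proof (intro ballI impI)
    fix M N assume M: "M \<in> carrier (matrix_ring d h.A.P)" and N: "N \<in> carrier (matrix_ring d h.A.P)"
      and MN: "M \<otimes>\<^bsub>matrix_ring d h.A.P\<^esub> N = \<one>\<^bsub>matrix_ring d h.A.P\<^esub>"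
    show "N \<otimes>\<^bsub>matrix_ring d h.A.P\<^esub> M = \<one>\<^bsub>matrix_ring d h.A.P\<^esub>"
    proof (rule h.A.P.matrix_eqI[OF h.A.P.matrix_mult_closed[OF N M] h.A.P.matrix_one_closed])
      fix i j assume ij: "i < d" "j < d"
      let ?u = "(N \<otimes>\<^bsub>matrix_ring d h.A.P\<^esub> M) (i, j)" and ?v = "\<one>\<^bsub>matrix_ring d h.A.P\<^esub> (i, j)"
      have eq: "h.h ?u = h.h ?v"
        by (rule h.transport_directly_finite[OF df])
          (use M N MN ij in \<open>simp_all add: Q h.A.P.carrier_matrix_ring\<close>)
      show "?u = ?v"
      proof (rule h.A.P_eqI)
        show "?u \<in> carrier h.A.P" "?v \<in> carrier h.A.P"
          using ij h.A.P.matrix_closed[OF h.A.P.matrix_mult_closed[OF N M]]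
            h.A.P.matrix_closed[OF h.A.P.matrix_one_closed] by blast+
        show "?u g = ?v g" if "g \<in> carrier T" for g
          using eq h.h_\<iota>[OF that, of ?u] h.h_\<iota>[OF that, of ?v] by simp
      qed
    qed
  qed
qed

lemma (in group) finitely_generated_upper_central_factor:
  assumes fg: "finitely_generated G" and nil: "nilpotent_class G c"
  shows "finitely_generated (upper_central_factor G (Suc i))"
proof -
  let ?Z = "upper_central G (Suc i)"
  let ?G = "G\<lparr>carrier := ?Z\<rparr>"
  have noeth: "noetherian_in G (carrier G)"
    by (rule finitely_generated_nilpotent_noetherian[OF fg nil])
  obtain S where S: "finite S" "S \<subseteq> ?Z" "generate G S = ?Z"
    using noetherian_inE[OF noeth upper_central_subgroup subgroup.subset[OF upper_central_subgroup]] .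
  have gen: "generate ?G S = ?Z" using generate_consistent[OF S(2) upper_central_subgroup] S(3) by simp
  interpret N: normal "upper_central G i" ?G by (rule upper_central_normal_Suc)
  let ?q = "\<lambda>x. upper_central G i #>\<^bsub>?G\<^esub> x"
  interpret q: group_hom ?G "?G Mod upper_central G i" ?q
    using N.r_coset_hom_Mod N.factorgroup_is_group N.is_group
    by (simp add: group_hom_def group_hom_axioms_def)
  have "generate (?G Mod upper_central G i) (?q ` S) = ?q ` generate ?G S"
    by (rule q.generate_img) (use S in simp)
  also have "\<dots> = carrier (?G Mod upper_central G i)" using gen by (simp add: carrier_FactGroup)
  finally show ?thesis
    unfolding finitely_generated_def upper_central_factor_Suc
    using S by (intro exI[of _ "?q ` S"]) (auto simp: carrier_FactGroup)
qed

text \<open>The factors of the upper central series are finitely generated and abelian, so the abelian case supplies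
  the hypotheses of the nilpotent one.\<close>

theorem hopfian_wreath_if_stably_finite:
  fixes \<Delta> :: "'d monoid" and \<Gamma> :: "'c monoid"
  assumes stable: "\<And>(G :: 'g monoid) (F :: 'k ring). group G \<Longrightarrow> field F \<Longrightarrow> stably_finite (group_ring F G)"
    and inf: "infinite (UNIV :: 'g set)" "infinite (UNIV :: 'k set)"
    and nil: "nilpotent_group \<Delta>" and fg: "finitely_generated \<Delta>"
    and \<Gamma>: "group \<Gamma>" "finitely_generated \<Gamma>" "hopfian \<Gamma>"
  shows "hopfian (\<Delta> \<wr> \<Gamma>)"
proof -
  obtain c where "group \<Delta>" and c: "upper_central \<Delta> c = carrier \<Delta>"
    using nil unfolding nilpotent_group_def by blast
  interpret D: group \<Delta> by fact
  interpret T: group \<Gamma> by fact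
  interpret wreath \<Delta> \<Gamma> by unfold_locales
  show ?thesis
  proof (rule hopfian_wreath_nilpotent[OF fg c \<Gamma>(3)])
    fix i assume "i < c"
    let ?A = "upper_central_factor \<Delta> (Suc i)"
    interpret A: comm_group ?A by (rule D.comm_group_upper_central_factor)
    interpret V: wreath ?A \<Gamma> by unfold_locales
    show "hopfian (?A \<wr> \<Gamma>)"
    proof (rule V.hopfian_wreath_abelian[where ?'k = 'k, OF A.comm_group_axioms _ \<Gamma>(3)])
      show "finitely_generated ?A"
        by (rule D.finitely_generated_upper_central_factor[OF fg D.nilpotent_classI[OF c]])
      fix p :: nat assume p: "Factorial_Ring.prime p"
      obtain K :: "'k ring" and \<chi> where K: "field K" and \<chi>: "\<forall>k. \<chi> k \<in> carrier K"
          "\<forall>k l. \<chi> (k + l) = \<chi> k \<oplus>\<^bsub>K\<^esub> \<chi> l" "\<chi> 1 = \<one>\<^bsub>K\<^esub>" "\<forall>k. \<chi> k = \<zero>\<^bsub>K\<^esub> \<longleftrightarrow> int p dvd k"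
        using exists_prime_field[OF inf(2) p] .
      interpret K: field K by (rule K)
      have "\<forall>d\<ge>1. directly_finite (matrix_ring d (group_ring K \<Gamma>))"
        using directly_finite_if_stably_finite[OF stable inf(1) \<Gamma>(1)
            T.countable_finitely_generated[OF \<Gamma>(2)] K] by blast
      then show "\<exists>(K :: 'k ring) \<chi>. ring K \<and> (\<forall>k. \<chi> k \<in> carrier K) \<and>
          (\<forall>k l. \<chi> (k + l) = \<chi> k \<oplus>\<^bsub>K\<^esub> \<chi> l) \<and> \<chi> 1 = \<one>\<^bsub>K\<^esub> \<and> (\<forall>k. \<chi> k = \<zero>\<^bsub>K\<^esub> \<longleftrightarrow> int p dvd k) \<and>
          (\<forall>d\<ge>1. directly_finite (matrix_ring d (group_ring K \<Gamma>)))"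
        using \<chi> K.ring_axioms by blast
    qed
  qed
qed

section \<open>Finitely generated subrings of a field have finite residue fields\<close>

lemma (in ring) eval_Cons: "eval (c # l) y = c \<otimes> y [^] length l \<oplus> eval l y"
  by simp

lemma (in ring) eval_combination:
  assumes "length l = length p" "set l \<subseteq> carrier R" "set p \<subseteq> carrier R" "c \<in> carrier R" "y \<in> carrier R"
    and comm: "cring R"
  shows "eval (map2 (\<lambda>a b. a \<oplus> c \<otimes> b) l p) y = eval l y \<oplus> c \<otimes> eval p y"
  using assms(1-3)
proof (induction l p rule: list_induct2)
  case Nil then show ?case using assms by simp
next
  case (Cons a l b p)
  interpret cring R by (rule comm)
  have *: "a \<in> carrier R" "b \<in> carrier R" "eval l y \<in> carrier R" "eval p y \<in> carrier R"
    using Cons.prems assms(4,5) by (auto intro: eval_in_carrier)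
  have "eval (map2 (\<lambda>a b. a \<oplus> c \<otimes> b) (a # l) (b # p)) y =
      (a \<oplus> c \<otimes> b) \<otimes> y [^] length l \<oplus> eval (map2 (\<lambda>a b. a \<oplus> c \<otimes> b) l p) y"
    using Cons.hyps by simp
  also have "\<dots> = (a \<oplus> c \<otimes> b) \<otimes> y [^] length l \<oplus> (eval l y \<oplus> c \<otimes> eval p y)"
    using Cons by simp
  also have "\<dots> = (a \<otimes> y [^] length l \<oplus> eval l y) \<oplus> c \<otimes> (b \<otimes> y [^] length l \<oplus> eval p y)"
    using * assms(4,5) by (simp add: l_distr r_distr m_assoc a_ac)
  also have "\<dots> = eval (a # l) y \<oplus> c \<otimes> eval (b # p) y"
    using Cons.hyps by simp
  finally show ?case .
qed

lemma (in ring) eval_scale: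
  assumes "set l \<subseteq> carrier R" "c \<in> carrier R" "y \<in> carrier R"
  shows "eval (map ((\<otimes>) c) l) y = c \<otimes> eval l y"
  using assms(1)
proof (induction l)
  case Nil then show ?case using assms by simp
next
  case (Cons a l)
  then show ?case using assms(2,3) by (simp add: r_distr m_assoc eval_in_carrier)
qed

text \<open>Once a power \<open>y\<^sup>n\<close> is a combination of lower ones, so are all of them.\<close>

lemma (in domain) simple_extension_reduce:
  assumes D: "subring D R" and y: "y \<in> carrier R" and p: "set p \<subseteq> D" "y [^] length p = eval p y"
    and z: "z \<in> simple_extension D y"
  obtains l where "set l \<subseteq> D" "length l = length p" "eval l y = z"
proof -
  note [simp] = subringE(2,5-7)[OF D]
  have DR: "D \<subseteq> carrier R" by (rule subringE(1)[OF D])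
  from z have "\<exists>l. set l \<subseteq> D \<and> length l = length p \<and> eval l y = z"
  proof induction
    case zero
    have "eval (replicate n \<zero>) y = \<zero>" for n
      using y by (induction n) simp_all
    then show ?case by (intro exI[of _ "replicate (length p) \<zero>"]) auto
  next
    case (lin z k)
    then obtain l where l: "set l \<subseteq> D" "length l = length p" "eval l y = z" by blast
    have "p \<noteq> []" using p(2) by auto
    then obtain c m where cm: "l = c # m" using l(2) by (cases l) auto
    have c: "c \<in> D" "set m \<subseteq> D" using l(1) cm by auto
    have cR: "c \<in> carrier R" "set m \<subseteq> carrier R" "k \<in> carrier R" using c lin.hyps(2) DR by auto
    have len: "length (m @ [k]) = length p" using l(2) cm by simp
    have "z \<otimes> y \<oplus> k = eval (l @ [k]) y"
      using l(3) eval_append_aux[of l k y] cR y l(1) DR by auto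
    also have "\<dots> = eval (m @ [k]) y \<oplus> c \<otimes> eval p y"
    proof -
      have "eval (l @ [k]) y = c \<otimes> y [^] length p \<oplus> eval (m @ [k]) y"
        using len unfolding cm by (simp del: eval.simps add: eval_Cons)
      then show ?thesis using p cR y DR by (auto simp: a_comm eval_in_carrier)
    qed
    also have "\<dots> = eval (map2 (\<lambda>a b. a \<oplus> c \<otimes> b) (m @ [k]) p) y"
      by (rule eval_combination[symmetric]) (use len cR p DR y in \<open>auto intro: is_cring\<close>)
    finally have "eval (map2 (\<lambda>a b. a \<oplus> c \<otimes> b) (m @ [k]) p) y = z \<otimes> y \<oplus> k" by simp
    moreover have "set (map2 (\<lambda>a b. a \<oplus> c \<otimes> b) (m @ [k]) p) \<subseteq> D"
    proof -
      have "set (map2 (\<lambda>a b. a \<oplus> c \<otimes> b) xs p) \<subseteq> D" if "set xs \<subseteq> D" for xs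
      proof
        fix z assume "z \<in> set (map2 (\<lambda>a b. a \<oplus> c \<otimes> b) xs p)"
        then obtain a b where ab: "(a, b) \<in> set (zip xs p)" "z = a \<oplus> c \<otimes> b" by auto
        have "a \<in> D" "b \<in> D"
          using set_zip_leftD[OF ab(1)] set_zip_rightD[OF ab(1)] that p(1) by blast+
        then show "z \<in> D" using ab(2) c(1) by simp
      qed
      then show ?thesis using c lin.hyps(2) by simp
    qed
    ultimately show ?case using len by (intro exI[of _ "map2 (\<lambda>a b. a \<oplus> c \<otimes> b) (m @ [k]) p"]) simp
  qed
  then show thesis using that by blast
qed

lemma (in field) inverse_in_finite_subring:
  assumes A: "subring A R" "finite A" and a: "a \<in> A" "a \<noteq> \<zero>"
  shows "inv a \<in> A"
proof -
  note [simp] = subringE(3,6)[OF A(1)]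
  have AR: "\<And>x. x \<in> A \<Longrightarrow> x \<in> carrier R" using subringE(1)[OF A(1)] by blast
  have "(\<lambda>x. a \<otimes> x) ` A = A"
  proof (rule endo_inj_surj[OF A(2)])
    show "(\<lambda>x. a \<otimes> x) ` A \<subseteq> A" using a by auto
    show "inj_on (\<lambda>x. a \<otimes> x) A" using a AR by (auto intro!: inj_onI simp: m_lcancel)
  qed
  then have "\<one> \<in> (\<lambda>x. a \<otimes> x) ` A" by simp
  then obtain x where x: "x \<in> A" "a \<otimes> x = \<one>" by force
  then have "inv a = x" using a AR by (intro comm_inv_char) auto
  then show ?thesis using x by simp
qed

text \<open>Among the linear dependences of the powers of \<open>y\<close>, one of least degree expresses a power of \<open>y\<close>
  by lower powers that are independent.\<close>

lemma (in field) minimal_relation: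
  assumes K: "subfield K R" and y: "y \<in> carrier R"
    and l: "set l \<subseteq> K" "\<not> set l \<subseteq> {\<zero>}" "eval l y = \<zero>"
  obtains p where "set p \<subseteq> K" "y [^] length p = eval p y"
    "\<forall>l. set l \<subseteq> K \<and> length l = length p \<and> eval l y = \<zero> \<longrightarrow> set l \<subseteq> {\<zero>}"
proof -
  have Ks: "subring K R" by (rule subfieldE(1)[OF K])
  note [simp] = subringE(2,3,5-7)[OF Ks]
  have KR: "K \<subseteq> carrier R" by (rule subringE(1)[OF Ks])
  define dep where "dep n \<longleftrightarrow> (\<exists>c l. c \<in> K \<and> c \<noteq> \<zero> \<and> set l \<subseteq> K \<and> length l = n \<and> eval (c # l) y = \<zero>)" for n
  have ex: "\<exists>n<length l. dep n" if "set l \<subseteq> K" "\<not> set l \<subseteq> {\<zero>}" "eval l y = \<zero>" for l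
    using that
  proof (induction l)
    case Nil then show ?case by simp
  next
    case (Cons c l)
    show ?case
    proof (cases "c = \<zero>")
      case True
      have "eval l y = \<zero>" using Cons.prems True y KR by (auto simp: eval_in_carrier)
      then show ?thesis using Cons True by (auto simp: less_Suc_eq)
    next
      case False
      then show ?thesis using Cons.prems unfolding dep_def by (intro exI[of _ "length l"]) auto
    qed
  qed
  define n where "n = (LEAST n. dep n)"
  have "dep n" unfolding n_def by (rule LeastI_ex) (use ex[OF l] in blast)
  then obtain c m where c: "c \<in> K" "c \<noteq> \<zero>" and m: "set m \<subseteq> K" "length m = n"
    and e: "eval (c # m) y = \<zero>"
    unfolding dep_def by blast
  have cR: "c \<in> carrier R" "set m \<subseteq> carrier R" using c m KR by auto
  have ic: "inv c \<in> carrier R" "inv c \<in> K" "inv c \<otimes> c = \<one>"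
    using subfield_m_inv[OF K, of c] c KR by auto
  define p where "p = map ((\<otimes>) (\<ominus> (inv c))) m"
  show thesis
  proof (rule that[of p])
    show "set p \<subseteq> K" using m ic unfolding p_def by auto
    have "y [^] n = inv c \<otimes> (c \<otimes> y [^] n)" using ic cR y by (simp add: m_assoc[symmetric])
    also have "c \<otimes> y [^] n = \<ominus> eval m y"
    proof -
      have "c \<otimes> y [^] n \<oplus> eval m y = \<zero>" using e m by simp
      then show ?thesis using cR y by (intro minus_equality[symmetric]) (auto simp: eval_in_carrier)
    qed
    also have "inv c \<otimes> (\<ominus> eval m y) = eval p y"
      unfolding p_def using eval_scale[of m "\<ominus> (inv c)" y] cR ic y
      by (simp add: eval_in_carrier l_minus r_minus)
    finally show "y [^] length p = eval p y" using m unfolding p_def by simp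
    show "\<forall>l. set l \<subseteq> K \<and> length l = length p \<and> eval l y = \<zero> \<longrightarrow> set l \<subseteq> {\<zero>}"
    proof (intro allI impI)
      fix l assume l: "set l \<subseteq> K \<and> length l = length p \<and> eval l y = \<zero>"
      show "set l \<subseteq> {\<zero>}"
      proof (rule ccontr)
        assume "\<not> set l \<subseteq> {\<zero>}"
        then obtain k where "k < n" "dep k" using ex[of l] l m unfolding p_def by auto
        then show False unfolding n_def using not_less_Least by blast
      qed
    qed
  qed
qed

text \<open>A Goldman domain (or G-domain): inverting a single element yields its field of fractions.\<close>

definition (in ring) goldman :: "'a set \<Rightarrow> bool" where
  "goldman A \<longleftrightarrow> (\<exists>u\<in>A. u \<noteq> \<zero> \<and> (\<forall>b\<in>A. b \<noteq> \<zero> \<longrightarrow> (\<exists>n::nat. \<exists>t\<in>A. b \<otimes> t = u [^] n)))"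

text \<open>Modulo \<open>1 + y u\<close> the element \<open>u\<close> has the inverse \<open>- y\<close>; so if a power of \<open>u\<close> vanishes there, so does \<open>1\<close>.\<close>

lemma (in cring) unit_if_divides_power:
  assumes B: "subring B R" and y: "y \<in> B" "u \<in> B" and t: "t \<in> B" "(\<one> \<oplus> y \<otimes> u) \<otimes> t = u [^] (n::nat)"
  shows "\<exists>w\<in>B. (\<one> \<oplus> y \<otimes> u) \<otimes> w = \<one>"
  using t
proof (induction n arbitrary: t)
  case 0 then show ?case by auto
next
  case (Suc n)
  note [simp] = subringE(2,3,5-7)[OF B]
  have BR: "x \<in> carrier R" if "x \<in> B" for x using subringE(1)[OF B] that by blast
  have un: "u [^] n \<in> B" using y by (induction n) auto
  have R: "u [^] n \<in> carrier R" "t \<in> carrier R" "y \<in> carrier R" "u \<in> carrier R"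
    using un Suc.prems y BR by auto
  have "u [^] n = (\<one> \<oplus> y \<otimes> u) \<otimes> u [^] n \<ominus> y \<otimes> u [^] Suc n"
    using R unfolding nat_pow_Suc by algebra
  also have "\<dots> = (\<one> \<oplus> y \<otimes> u) \<otimes> u [^] n \<ominus> y \<otimes> ((\<one> \<oplus> y \<otimes> u) \<otimes> t)"
    using Suc.prems by simp
  also have "\<dots> = (\<one> \<oplus> y \<otimes> u) \<otimes> (u [^] n \<ominus> y \<otimes> t)"
    using R by algebra
  finally have "(\<one> \<oplus> y \<otimes> u) \<otimes> (u [^] n \<ominus> y \<otimes> t) = u [^] n" by simp
  moreover have "u [^] n \<ominus> y \<otimes> t \<in> B" using un y Suc.prems by (simp add: a_minus_def)
  ultimately show ?case by (rule Suc.IH[rotated])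
qed

text \<open>A polynomial ring is not a Goldman domain: \<open>1 + y u\<close> would divide a power of \<open>u\<close>, hence be a
  unit.\<close>

lemma (in domain) algebraic_if_goldman:
  assumes A: "subring A R" and y: "y \<in> carrier R" and G: "goldman (simple_extension A y)"
  obtains p where "p \<in> carrier (A[X])" "p \<noteq> []" "eval p y = \<zero>"
proof -
  define B where "B = simple_extension A y"
  have B: "subring B R" unfolding B_def by (rule simple_extension_is_subring[OF A y])
  have yB: "y \<in> B" unfolding B_def by (rule simple_extension_mem[OF A y])
  have AR: "A \<subseteq> carrier R" by (rule subringE(1)[OF A])
  have as_poly: "\<exists>p. polynomial A p \<and> eval p y = z" if "z \<in> B" for z
    using that unfolding B_def simple_extension_as_eval_img[OF AR y] by (auto simp: univ_poly_carrier)
  note [simp] = subringE(2,3,5-7)[OF B] subringE(2,3,5)[OF A]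
  obtain u where u: "u \<in> B" "u \<noteq> \<zero>" and inverts: "\<And>b. b \<in> B \<Longrightarrow> b \<noteq> \<zero> \<Longrightarrow> \<exists>n::nat. \<exists>t\<in>B. b \<otimes> t = u [^] n"
    using G unfolding goldman_def B_def by metis
  obtain pu where pu: "polynomial A pu" "eval pu y = u" using as_poly u by blast
  have "pu \<noteq> []" using pu u by auto
  have puA: "set pu \<subseteq> A" using pu(1) unfolding polynomial_def by auto
  define q where "q = pu @ [\<one>]"
  have q: "polynomial A q" using pu(1) \<open>pu \<noteq> []\<close> puA unfolding q_def polynomial_def by auto
  have uR: "u \<in> carrier R" using u B subringE(1) by blast
  have eq: "eval q y = \<one> \<oplus> y \<otimes> u"
    unfolding q_def using eval_append_aux[of pu \<one> y] puA AR y pu(2) uR by (simp add: a_comm m_comm)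
  show thesis
  proof (cases "\<one> \<oplus> y \<otimes> u = \<zero>")
    case True
    show ?thesis by (rule that[of q]) (use q eq True \<open>pu \<noteq> []\<close> in \<open>auto simp: univ_poly_carrier[symmetric] q_def\<close>)
  next
    case False
    obtain n :: nat and t where t: "t \<in> B" "(\<one> \<oplus> y \<otimes> u) \<otimes> t = u [^] n"
      using inverts[OF _ False] u yB by auto
    obtain w where w: "w \<in> B" "(\<one> \<oplus> y \<otimes> u) \<otimes> w = \<one>"
      using unit_if_divides_power[OF B yB u(1) t] by blast
    obtain pw where pw: "polynomial A pw" "eval pw y = w" using as_poly w by blast
    have pwA: "set pw \<subseteq> A" using pw(1) unfolding polynomial_def by auto
    have wR: "w \<in> carrier R" using w B subringE(1) by blast
    have "pw \<noteq> []"
    proof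
      assume "pw = []"
      then have "w = \<zero>" using pw(2) by simp
      then show False using w uR y by simp
    qed
    define r where "r = poly_mult q pw"
    have r: "polynomial A r" unfolding r_def
      proof (rule poly_mult_is_polynomial[OF A _ pwA])
      show "set q \<subseteq> A" using puA unfolding q_def by simp
    qed
    have dr: "degree r = length pu + degree pw"
      unfolding r_def using poly_mult_degree_eq[OF A q pw(1)] \<open>pw \<noteq> []\<close> unfolding q_def by simp
    have rA: "set r \<subseteq> A" using r unfolding polynomial_def by auto
    have pos: "length pu > 0" using \<open>pu \<noteq> []\<close> by simp
    have one: "polynomial A [\<ominus> \<one>]" unfolding polynomial_def by simp
    define s where "s = poly_add r [\<ominus> \<one>]"
    have s: "polynomial A s" unfolding s_def
      by (rule poly_add_is_polynomial[OF A]) (use rA in auto)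
    have "degree s = max (degree r) (degree [\<ominus> \<one>])" unfolding s_def
      by (rule poly_add_degree_eq[OF A r one]) (use dr pos in simp)
    then have "s \<noteq> []" using dr pos by auto
    moreover have "eval s y = \<zero>"
    proof -
      have qA: "set q \<subseteq> A" using q unfolding polynomial_def by auto
      have "eval s y = eval r y \<oplus> \<ominus> \<one>"
        unfolding s_def using eval_poly_add[of r "[\<ominus> \<one>]" y] rA AR y by auto
      also have "eval r y = \<one>"
        unfolding r_def using eval_poly_mult[of q pw y] qA pwA AR y eq pw(2) w(2) by auto
      finally show ?thesis by (simp add: r_neg)
    qed
    ultimately show ?thesis using that s by (simp add: univ_poly_carrier[symmetric])
  qed
qed

lemma (in field) subfield_of_fractions:
  assumes A: "subring A R"
  shows "subfield {x \<in> carrier R. \<exists>b\<in>A. b \<noteq> \<zero> \<and> b \<otimes> x \<in> A} R" (is "subfield ?K R")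
proof (rule subfieldI')
  note A_simps [simp] = subringE(2,3,5-7)[OF A]
  have AR [simp]: "x \<in> carrier R" if "x \<in> A" for x using subringE(1)[OF A] that by blast
  show "subring ?K R"
  proof (rule subringI)
    show "\<one> \<in> ?K" by (auto intro!: bexI[of _ \<one>])
    fix x assume x: "x \<in> ?K"
    then obtain b where b: "b \<in> A" "b \<noteq> \<zero>" "b \<otimes> x \<in> A" by blast
    show "\<ominus> x \<in> ?K" using x b by (auto intro!: bexI[of _ b] simp: r_minus)
    fix x' assume x': "x' \<in> ?K"
    then obtain b' where b': "b' \<in> A" "b' \<noteq> \<zero>" "b' \<otimes> x' \<in> A" by blast
    have R: "x \<in> carrier R" "x' \<in> carrier R" "b \<in> carrier R" "b' \<in> carrier R" using x x' b b' by auto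
    have nz: "b \<otimes> b' \<in> A" "b \<otimes> b' \<noteq> \<zero>" using b b' R by (auto simp: integral_iff)
    have "(b \<otimes> b') \<otimes> (x \<otimes> x') = (b \<otimes> x) \<otimes> (b' \<otimes> x')" using R by algebra
    then have "(b \<otimes> b') \<otimes> (x \<otimes> x') \<in> A" using b b' by simp
    then show "x \<otimes> x' \<in> ?K" using nz R by blast
    have "(b \<otimes> b') \<otimes> (x \<oplus> x') = b' \<otimes> (b \<otimes> x) \<oplus> b \<otimes> (b' \<otimes> x')" using R by algebra
    then have "(b \<otimes> b') \<otimes> (x \<oplus> x') \<in> A" using b b' by simp
    then show "x \<oplus> x' \<in> ?K" using nz R by blast
  qed auto
  fix x assume x: "x \<in> ?K - {\<zero>}"
  then obtain b where b: "b \<in> A" "b \<noteq> \<zero>" "b \<otimes> x \<in> A" by blast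
  have R: "x \<in> carrier R" "x \<noteq> \<zero>" "x \<in> Units R" using x by (auto simp: field_Units)
  have "(b \<otimes> x) \<otimes> inv x = b" using R b by (simp add: m_assoc)
  moreover have "b \<otimes> x \<noteq> \<zero>" using R b by (auto simp: integral_iff)
  ultimately show "inv x \<in> ?K" using R b by (auto intro!: bexI[of _ "b \<otimes> x"])
qed

lemma (in domain) common_denominator:
  assumes A: "subring A R" and V: "finite V" "V \<subseteq> {x \<in> carrier R. \<exists>b\<in>A. b \<noteq> \<zero> \<and> b \<otimes> x \<in> A}"
  shows "\<exists>a\<in>A. a \<noteq> \<zero> \<and> (\<forall>x\<in>V. a \<otimes> x \<in> A)"
  using V
proof (induction V)
  case empty
  then show ?case using subringE(3)[OF A] by (auto intro!: bexI[of _ \<one>])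
next
  case (insert x V)
  have AR: "x \<in> carrier R" if "x \<in> A" for x using subringE(1)[OF A] that by blast
  note [simp] = subringE(6)[OF A]
  obtain a where a: "a \<in> A" "a \<noteq> \<zero>" "\<forall>x\<in>V. a \<otimes> x \<in> A" using insert by blast
  obtain b where b: "b \<in> A" "b \<noteq> \<zero>" "b \<otimes> x \<in> A" using insert.prems by blast
  have "a \<otimes> b \<otimes> z \<in> A" if "z \<in> insert x V" for z
  proof (cases "z = x")
    case True
    have "a \<otimes> b \<otimes> x = a \<otimes> (b \<otimes> x)" using a b AR insert.prems by (simp add: m_assoc)
    then show ?thesis using True a b by simp
  next
    case False
    have "a \<otimes> b \<otimes> z = b \<otimes> (a \<otimes> z)" using a b AR insert.prems that False by (auto simp: m_ac)
    then show ?thesis using False that a b by simp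
  qed
  moreover have "a \<otimes> b \<in> A" "a \<otimes> b \<noteq> \<zero>" using a b AR by (auto simp: integral_iff)
  ultimately show ?case by blast
qed

lemma (in domain) localization_subring:
  assumes A: "subring A R" and a: "a \<in> A"
  shows "subring {x \<in> carrier R. \<exists>m::nat. a [^] m \<otimes> x \<in> A} R" (is "subring ?L R")
proof (rule subringI)
  note [simp] = subringE(2,3,5-7)[OF A]
  have AR: "x \<in> carrier R" if "x \<in> A" for x using subringE(1)[OF A] that by blast
  have am: "a [^] m \<in> A" for m :: nat using a by (induction m) auto
  have aR: "a \<in> carrier R" using a AR by simp
  show "\<one> \<in> ?L" using aR by (auto intro!: exI[of _ 0])
  fix x assume x: "x \<in> ?L"
  then obtain m :: nat where m: "a [^] m \<otimes> x \<in> A" by blast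
  show "\<ominus> x \<in> ?L" using x m aR by (auto intro!: exI[of _ m] simp: r_minus)
  fix x' assume x': "x' \<in> ?L"
  then obtain m' :: nat where m': "a [^] m' \<otimes> x' \<in> A" by blast
  have R: "x \<in> carrier R" "x' \<in> carrier R" "a [^] m \<in> carrier R" "a [^] m' \<in> carrier R" using x x' aR by auto
  have "a [^] (m + m') \<otimes> (x \<otimes> x') = (a [^] m \<otimes> x) \<otimes> (a [^] m' \<otimes> x')"
    using R aR unfolding nat_pow_mult[OF aR, symmetric] by algebra
  then have "a [^] (m + m') \<otimes> (x \<otimes> x') \<in> A" using m m' by simp
  then show "x \<otimes> x' \<in> ?L" using R by blast
  have "a [^] (m + m') \<otimes> (x \<oplus> x') = a [^] m' \<otimes> (a [^] m \<otimes> x) \<oplus> a [^] m \<otimes> (a [^] m' \<otimes> x')"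
    using R aR unfolding nat_pow_mult[OF aR, symmetric] by algebra
  then have "a [^] (m + m') \<otimes> (x \<oplus> x') \<in> A" using m m' am by simp
  then show "x \<oplus> x' \<in> ?L" using R by blast
qed auto

text \<open>Goldman domains descend. Let \<open>u\<close> witness the property for \<open>A[y]\<close>, and let \<open>a \<in> A\<close> be a common
  denominator of the coefficients of a minimal monic relation of \<open>y\<close> and of the coordinates of \<open>1/u\<close>. For
  \<open>0 \<noteq> b \<in> A\<close> the element \<open>1/b\<close> lies in \<open>A[1/a][y]\<close>, which is free over \<open>A[1/a]\<close> on the powers of \<open>y\<close> below
  the degree of that relation; so \<open>1/b\<close> lies in \<open>A[1/a]\<close>.\<close>

lemma (in field) goldman_descends:
  assumes A: "subring A R" and y: "y \<in> carrier R" and G: "goldman (simple_extension A y)"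
  shows "goldman A"
proof -
  define B where "B = simple_extension A y"
  have B: "subring B R" unfolding B_def by (rule simple_extension_is_subring[OF A y])
  have AR: "A \<subseteq> carrier R" by (rule subringE(1)[OF A])
  have AB: "A \<subseteq> B" unfolding B_def by (rule simple_extension_incl[OF AR y])
  have BR: "B \<subseteq> carrier R" by (rule subringE(1)[OF B])
  obtain u where u: "u \<in> B" "u \<noteq> \<zero>" and inverts: "\<And>b. b \<in> B \<Longrightarrow> b \<noteq> \<zero> \<Longrightarrow> \<exists>n::nat. \<exists>t\<in>B. b \<otimes> t = u [^] n"
    using G unfolding goldman_def B_def by metis
  have uR: "u \<in> carrier R" "u \<in> Units R" using u BR by (auto simp: field_Units)
  define K where "K = {x \<in> carrier R. \<exists>b\<in>A. b \<noteq> \<zero> \<and> b \<otimes> x \<in> A}"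
  have K: "subfield K R" unfolding K_def by (rule subfield_of_fractions[OF A])
  have KR: "K \<subseteq> carrier R" unfolding K_def by blast
  have AK: "A \<subseteq> K" unfolding K_def using subringE(3)[OF A] AR by (auto intro!: bexI[of _ \<one>])
  note [simp] = subringE(2,3,5-7)[OF subfieldE(1)[OF K]]
  obtain l where l: "l \<in> carrier (A[X])" "l \<noteq> []" "eval l y = \<zero>"
    by (rule algebraic_if_goldman[OF A y G])
  have alg: "(algebraic over K) y"
    by (rule algebraic_mono[OF AK algebraicI[OF l]])
  have lA: "set l \<subseteq> A" "hd l \<noteq> \<zero>" "hd l \<in> set l"
    using l(1,2) unfolding univ_poly_carrier[symmetric] polynomial_def by auto
  obtain p where p: "set p \<subseteq> K" "y [^] length p = eval p y"
    and indep: "\<forall>l. set l \<subseteq> K \<and> length l = length p \<and> eval l y = \<zero> \<longrightarrow> set l \<subseteq> {\<zero>}"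
    by (rule minimal_relation[OF K y, of l]) (use l lA AK in \<open>blast+\<close>)
  \<comment> \<open>\<open>y\<close> is algebraic over the field of fractions \<open>K\<close>, so \<open>K[y]\<close> is a field.\<close>
  have "inv u \<in> simple_extension K y"
  proof -
    have "subfield (simple_extension K y) R"
      using simple_extension_is_subfield[OF K y] alg by simp
    moreover have "u \<in> simple_extension K y"
      using u mono_simple_extension[OF AK] unfolding B_def by blast
    ultimately show ?thesis using subfield_m_inv[of "simple_extension K y" u] u by simp
  qed
  then obtain v where v: "set v \<subseteq> K" "length v = length p" "eval v y = inv u"
    by (rule simple_extension_reduce[OF subfieldE(1)[OF K] y p])
  obtain a where a: "a \<in> A" "a \<noteq> \<zero>" "\<forall>x\<in>set p \<union> set v. a \<otimes> x \<in> A"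
    using common_denominator[OF A, of "set p \<union> set v"] p v unfolding K_def by auto
  have aR: "a \<in> carrier R" using a AR by blast
  define L where "L = {x \<in> carrier R. \<exists>m::nat. a [^] m \<otimes> x \<in> A}"
  have L: "subring L R" unfolding L_def by (rule localization_subring[OF A a(1)])
  have LR: "L \<subseteq> carrier R" by (rule subringE(1)[OF L])
  have AL: "A \<subseteq> L" unfolding L_def using AR by (auto intro!: exI[of _ 0])
  have LK: "L \<subseteq> K"
  proof
    fix x assume "x \<in> L"
    then obtain m :: nat where m: "x \<in> carrier R" "a [^] m \<otimes> x \<in> A" unfolding L_def by blast
    have "a [^] m \<in> A" using a(1) subringE(3,6)[OF A] by (induction m) auto
    moreover have "a [^] m \<noteq> \<zero>" using a(2) aR by (induction m) (auto simp: integral_iff)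
    ultimately show "x \<in> K" unfolding K_def using m by blast
  qed
  have pvL: "set p \<subseteq> L" "set v \<subseteq> L"
  proof -
    have "x \<in> L" if "x \<in> set p \<union> set v" for x
      using a(3) that p(1) v(1) KR aR unfolding L_def by (auto intro!: exI[of _ 1])
    then show "set p \<subseteq> L" "set v \<subseteq> L" by auto
  qed
  define E where "E = simple_extension L y"
  have E: "subring E R" unfolding E_def by (rule simple_extension_is_subring[OF L y])
  have BE: "B \<subseteq> E" unfolding B_def E_def by (rule mono_simple_extension[OF AL])
  have iuE: "inv u \<in> E"
  proof -
    have "eval l y \<in> E" if "set l \<subseteq> L" for l
      using that
    proof (induction l)
      case Nil then show ?case using subringE(2)[OF E] by simp
    next
      case (Cons c l)
      have "y \<in> E" unfolding E_def by (rule simple_extension_mem[OF L y])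
      then have "y [^] n \<in> E" for n :: nat using subringE(3,6)[OF E] by (induction n) auto
      moreover have "c \<in> E" using Cons.prems simple_extension_incl[OF LR y] unfolding E_def by auto
      ultimately show ?case using Cons subringE(6,7)[OF E] by simp
    qed
    then show ?thesis using v(3) pvL(2) by metis
  qed
  have "\<exists>n::nat. \<exists>t\<in>A. b \<otimes> t = a [^] n" if b: "b \<in> A" "b \<noteq> \<zero>" for b
  proof -
    have bR: "b \<in> carrier R" "b \<in> Units R" using b AR by (auto simp: field_Units)
    obtain n :: nat and t where t: "t \<in> B" "b \<otimes> t = u [^] n" using inverts b AB by blast
    have tR: "t \<in> carrier R" using t BR by blast
    have iun: "inv u [^] n \<in> E" for n :: nat using iuE subringE(3,6)[OF E] by (induction n) auto
    have "b \<otimes> (t \<otimes> inv u [^] n) = u [^] n \<otimes> inv u [^] n"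
      using t bR tR uR by (simp add: m_assoc[symmetric])
    also have "\<dots> = \<one>" using uR by (simp add: nat_pow_distrib[symmetric])
    finally have "inv b = t \<otimes> inv u [^] n"
      using bR tR uR by (intro comm_inv_char) auto
    then have "inv b \<in> E" using t BE iun subringE(6)[OF E] by auto
    then obtain w where w: "set w \<subseteq> L" "length w = length p" "eval w y = inv b"
      unfolding E_def by (rule simple_extension_reduce[OF L y pvL(1) p(2)])
    have "w \<noteq> []"
    proof
      assume "w = []"
      then have "inv b = \<zero>" using w(3) by simp
      then show False using bR Units_r_inv[of b] by simp
    qed
    then obtain w' e where we: "w = w' @ [e]" by (cases w rule: rev_cases) auto
    have eR: "set w' \<subseteq> carrier R" "e \<in> carrier R" "e \<in> L" "set w' \<subseteq> L" using w(1) LR unfolding we by auto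
    have "eval (w' @ [e \<ominus> inv b]) y = eval w' y \<otimes> y \<oplus> (e \<ominus> inv b)"
      by (rule eval_append_aux) (use eR bR y in auto)
    also have "\<dots> = (eval w' y \<otimes> y \<oplus> e) \<ominus> inv b"
      using eR bR y by (simp add: a_minus_def a_assoc eval_in_carrier)
    also have "eval w' y \<otimes> y \<oplus> e = inv b"
      using eval_append_aux[of w' e y] eR y w(3) unfolding we by simp
    also have "inv b \<ominus> inv b = \<zero>" using bR by (simp add: a_minus_def r_neg)
    finally have "eval (w' @ [e \<ominus> inv b]) y = \<zero>" .
    moreover have "inv b \<in> K" using subfield_m_inv(1)[OF K, of b] b AK by auto
    then have "set (w' @ [e \<ominus> inv b]) \<subseteq> K" using eR LK by (auto simp: a_minus_def)
    moreover have "length (w' @ [e \<ominus> inv b]) = length p" using w(2) unfolding we by simp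
    ultimately have "set (w' @ [e \<ominus> inv b]) \<subseteq> {\<zero>}" using indep by blast
    then have "inv b = e" using eR bR by simp
    then obtain m :: nat where "a [^] m \<otimes> inv b \<in> A" using eR unfolding L_def by blast
    moreover have "b \<otimes> (a [^] m \<otimes> inv b) = a [^] m"
      using bR aR m_lcomm[of b "a [^] m" "inv b"] by simp
    ultimately show ?thesis by blast
  qed
  then show ?thesis unfolding goldman_def using a by blast
qed


text \<open>The image of the integers, if it is a Goldman domain, has positive characteristic: \<open>|m| + 1\<close> divides
  no power of \<open>m\<close> in \<open>\<int>\<close> unless \<open>m = 0\<close>.\<close>

lemma (in domain) finite_prime_subring:
  defines "Z \<equiv> range (\<lambda>k::int. [k] \<cdot> \<one>)"
  shows "subring Z R" "goldman Z \<Longrightarrow> finite Z"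
proof -
  define \<chi> where "\<chi> k = [k] \<cdot> \<one>" for k :: int
  have \<chi>R [simp]: "\<chi> k \<in> carrier R" for k unfolding \<chi>_def by simp
  have \<chi>_add: "\<chi> (k + l) = \<chi> k \<oplus> \<chi> l" for k l
    unfolding \<chi>_def by (rule add.int_pow_mult) simp
  have \<chi>_mult: "\<chi> (k * l) = \<chi> k \<otimes> \<chi> l" for k l
  proof -
    have "\<chi> k \<otimes> \<chi> l = [k] \<cdot> ([l] \<cdot> \<one>)"
      unfolding \<chi>_def by (simp add: add_pow_ldistr_int)
    also have "\<dots> = \<chi> (k * l)" unfolding \<chi>_def by (simp add: add.int_pow_pow mult.commute)
    finally show ?thesis by simp
  qed
  have \<chi>1: "\<chi> 1 = \<one>" unfolding \<chi>_def using add.int_pow_1[of \<one>] by simp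
  have \<chi>0: "\<chi> 0 = \<zero>" unfolding \<chi>_def by (simp add: add_pow_def)
  have \<chi>_minus: "\<chi> (- k) = \<ominus> \<chi> k" for k
  proof -
    have "\<chi> (- k) \<oplus> \<chi> k = \<zero>" using \<chi>_add[of "- k" k] \<chi>0 by simp
    then show ?thesis by (intro minus_equality[symmetric]) auto
  qed
  have Z: "Z = range \<chi>" unfolding Z_def \<chi>_def by simp
  show "subring Z R"
  proof (rule subringI)
    show "\<one> \<in> Z" using \<chi>1 unfolding Z by (metis rangeI)
    show "Z \<subseteq> carrier R" unfolding Z by auto
    fix x assume "x \<in> Z"
    then obtain k where k: "x = \<chi> k" unfolding Z by blast
    show "\<ominus> x \<in> Z" unfolding k \<chi>_minus[symmetric] Z by blast
    fix y assume "y \<in> Z"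
    then obtain l where l: "y = \<chi> l" unfolding Z by blast
    show "x \<otimes> y \<in> Z" unfolding k l \<chi>_mult[symmetric] Z by blast
    show "x \<oplus> y \<in> Z" unfolding k l \<chi>_add[symmetric] Z by blast
  qed
  assume "goldman Z"
  then obtain u where u: "u \<in> Z" "u \<noteq> \<zero>" and inverts: "\<And>b. b \<in> Z \<Longrightarrow> b \<noteq> \<zero> \<Longrightarrow> \<exists>n::nat. \<exists>t\<in>Z. b \<otimes> t = u [^] n"
    unfolding goldman_def by metis
  obtain m where m: "u = \<chi> m" using u unfolding Z by blast
  have "\<exists>N>0. \<chi> N = \<zero>"
  proof (cases "\<chi> (\<bar>m\<bar> + 1) = \<zero>")
    case True then show ?thesis by (intro exI[of _ "\<bar>m\<bar> + 1"]) simp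
  next
    case False
    obtain n :: nat and t where t: "t \<in> Z" "\<chi> (\<bar>m\<bar> + 1) \<otimes> t = u [^] n"
      using inverts[of "\<chi> (\<bar>m\<bar> + 1)"] False unfolding Z by blast
    obtain s where s: "t = \<chi> s" using t unfolding Z by blast
    have pow: "u [^] n = \<chi> (m ^ n)" for n :: nat
      by (induction n) (simp_all add: m \<chi>1 \<chi>_mult[symmetric] mult.commute)
    have eq: "\<chi> ((\<bar>m\<bar> + 1) * s) = \<chi> (m ^ n)" using t s by (simp add: \<chi>_mult pow)
    have "(\<bar>m\<bar> + 1) * s \<noteq> m ^ n"
    proof
      assume "(\<bar>m\<bar> + 1) * s = m ^ n"
      then have dvd: "\<bar>m\<bar> + 1 dvd m ^ n" by (metis dvd_triv_left)
      have "coprime (\<bar>m\<bar> + 1) m"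
      proof -
        have "coprime (\<bar>m\<bar> + 1) \<bar>m\<bar>" by (rule coprime_add_one_left)
        then show ?thesis by simp
      qed
      then have "coprime (\<bar>m\<bar> + 1) (m ^ n)" by simp
      then have "\<bar>m\<bar> + 1 dvd 1" using dvd by (metis coprime_absorb_left)
      then have "m = 0" by (simp add: zdvd1_eq)
      then show False using u m \<chi>0 by simp
    qed
    moreover define N where "N = (\<bar>m\<bar> + 1) * s - m ^ n"
    ultimately have "N \<noteq> 0" by simp
    have "\<chi> N = \<zero>"
    proof -
      have "\<chi> N = \<chi> ((\<bar>m\<bar> + 1) * s) \<oplus> \<ominus> \<chi> (m ^ n)"
        unfolding N_def \<chi>_minus[symmetric] \<chi>_add[symmetric] by simp
      then show ?thesis unfolding eq by (simp add: r_neg)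
    qed
    then have "\<chi> \<bar>N\<bar> = \<zero>" using \<chi>_minus[of N] by (simp add: abs_if)
    then show ?thesis using \<open>N \<noteq> 0\<close> by (intro exI[of _ "\<bar>N\<bar>"]) simp
  qed
  then obtain N where N: "N > 0" "\<chi> N = \<zero>" by blast
  have "\<chi> k \<in> \<chi> ` {0..<N}" for k
  proof -
    have "\<chi> k = \<chi> (k mod N)"
      using \<chi>_add[of "k div N * N" "k mod N"] \<chi>_mult[of "k div N" N] N by simp
    then show ?thesis using N by simp
  qed
  then have "Z \<subseteq> \<chi> ` {0..<N}" unfolding Z by blast
  then show "finite Z" by (rule finite_subset) simp
qed

text \<open>A field that is finitely generated as a ring is finite: it is a Goldman domain, hence so is every
  ring of the chain \<open>\<int>1 \<subseteq> \<int>[x\<^sub>1] \<subseteq> \<int>[x\<^sub>1, x\<^sub>2] \<subseteq> \<dots>\<close>, and climbing this chain each generator is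
  algebraic over the finite field below it.\<close>

lemma (in field) finite_if_goldman:
  assumes Z: "subring Z R" "goldman Z \<Longrightarrow> finite Z" and xs: "set xs \<subseteq> carrier R"
    and G: "goldman (finite_extension Z xs)"
  shows "finite (finite_extension Z xs)"
  using xs G
proof (induction xs)
  case Nil then show ?case using Z by simp
next
  case (Cons y xs)
  define A where "A = finite_extension Z xs"
  have y: "y \<in> carrier R" and G: "goldman (simple_extension A y)" using Cons.prems unfolding A_def by auto
  have A: "subring A R" unfolding A_def by (rule finite_extension_is_subring[OF Z(1)]) (use Cons.prems in simp)
  have AR: "A \<subseteq> carrier R" by (rule subringE(1)[OF A])
  have fin: "finite A"
    using Cons.IH Cons.prems goldman_descends[OF A y G] unfolding A_def by simp
  have sf: "subfield A R"
    by (rule subfieldI'[OF A]) (use inverse_in_finite_subring[OF A fin] in auto)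
  obtain l where l: "l \<in> carrier (A[X])" "l \<noteq> []" "eval l y = \<zero>"
    by (rule algebraic_if_goldman[OF A y G])
  have lA: "set l \<subseteq> A" "hd l \<noteq> \<zero>" "hd l \<in> set l"
    using l(1,2) unfolding univ_poly_carrier[symmetric] polynomial_def by auto
  obtain p where p: "set p \<subseteq> A" "y [^] length p = eval p y"
    by (rule minimal_relation[OF sf y, of l]) (use l lA in blast)+
  have "simple_extension A y \<subseteq> (\<lambda>l. eval l y) ` {l. set l \<subseteq> A \<and> length l = length p}"
  proof
    fix z assume "z \<in> simple_extension A y"
    then obtain l where "set l \<subseteq> A" "length l = length p" "eval l y = z"
      by (rule simple_extension_reduce[OF A y p])
    then show "z \<in> (\<lambda>l. eval l y) ` {l. set l \<subseteq> A \<and> length l = length p}" by blast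
  qed
  then have "finite (simple_extension A y)"
    by (rule finite_subset) (simp add: finite_lists_length_eq fin)
  then show ?case unfolding A_def by simp
qed

text \<open>Zorn's lemma for the ideals without \<open>1\<close>.\<close>

lemma (in cring) exists_maximal_ideal:
  assumes "\<one> \<noteq> \<zero>"
  obtains M where "maximalideal M R"
proof -
  define \<I> where "\<I> = {I. ideal I R \<and> \<one> \<notin> I}"
  have "\<exists>M\<in>\<I>. \<forall>J\<in>\<I>. M \<subseteq> J \<longrightarrow> J = M"
  proof (rule subset_Zorn_nonempty)
    show "\<I> \<noteq> {}" using zeroideal assms unfolding \<I>_def by auto
    fix \<C> assume \<C>: "\<C> \<noteq> {}" "subset.chain \<I> \<C>"
    then have "\<Union>\<C> = (if \<C> = {} then {\<zero>} else \<Union>\<C>)" by simp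
    have "ideal (\<Union>\<C>) R"
    proof (rule idealI[OF ring_axioms])
      have sub: "additive_subgroup I R" if "I \<in> \<C>" for I
        using that \<C>(2) ideal.axioms(1) unfolding subset.chain_def \<I>_def by blast
      show "subgroup (\<Union>\<C>) (add_monoid R)"
      proof (rule add.subgroupI)
        show "\<Union>\<C> \<subseteq> carrier R" using additive_subgroup.a_subset[OF sub] by blast
        show "\<Union>\<C> \<noteq> {}" using additive_subgroup.zero_closed[OF sub] \<C>(1) by blast
        fix x assume "x \<in> \<Union>\<C>"
        then obtain I where I: "I \<in> \<C>" "x \<in> I" by blast
        then show "\<ominus> x \<in> \<Union>\<C>" using additive_subgroup.a_inv_closed[OF sub] by blast
        fix y assume "y \<in> \<Union>\<C>"
        then obtain J where J: "J \<in> \<C>" "y \<in> J" by blast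
        have "I \<subseteq> J \<or> J \<subseteq> I" using \<C>(2) I(1) J(1) unfolding subset_chain_def by blast
        then show "x \<oplus> y \<in> \<Union>\<C>"
          using I J additive_subgroup.a_closed[OF sub[OF I(1)]] additive_subgroup.a_closed[OF sub[OF J(1)]]
          by blast
      qed
      fix a x assume a: "a \<in> \<Union>\<C>" and x: "x \<in> carrier R"
      then obtain I where I: "I \<in> \<C>" "a \<in> I" by blast
      then have "ideal I R" using \<C>(2) unfolding subset.chain_def \<I>_def by blast
      then show "x \<otimes> a \<in> \<Union>\<C>" "a \<otimes> x \<in> \<Union>\<C>"
        using I x ideal.I_l_closed[of I R a x] ideal.I_r_closed[of I R a x] by auto
    qed
    moreover have "\<one> \<notin> \<Union>\<C>" using \<C>(2) unfolding subset.chain_def \<I>_def by blast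
    ultimately show "\<Union>\<C> \<in> \<I>" unfolding \<I>_def by simp
  qed
  then obtain M where M: "M \<in> \<I>" "\<forall>J\<in>\<I>. M \<subseteq> J \<longrightarrow> J = M" by blast
  have "maximalideal M R"
  proof (rule maximalidealI)
    show "ideal M R" using M(1) unfolding \<I>_def by simp
    show "carrier R \<noteq> M" using M(1) one_closed unfolding \<I>_def by auto
    fix J assume J: "ideal J R" "M \<subseteq> J"
    then show "J = M \<or> J = carrier R"
      using M(2) ideal.one_imp_carrier[OF J(1)] unfolding \<I>_def by blast
  qed
  then show thesis by (rule that)
qed

text \<open>Coefficients in a field can be specialised to a finite field: a maximal ideal of a finitely generated
  subring has finite residue field.\<close>

theorem (in field) exists_finite_residue_field:
  assumes C: "finite C" "C \<subseteq> carrier R"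
  shows "\<exists>S (k :: 'a set ring) q. subring S R \<and> C \<subseteq> S \<and> field k \<and> finite (carrier k) \<and>
    q \<in> ring_hom (R\<lparr>carrier := S\<rparr>) k"
proof -
  define S where "S = generate_ring R C"
  have S: "subring S R" unfolding S_def by (rule generate_ring_is_subring[OF C(2)])
  have CS: "C \<subseteq> S" unfolding S_def by (auto intro: generate_ring.incl)
  define Q where "Q = R\<lparr>carrier := S\<rparr>"
  have Qsimps [simp]: "carrier Q = S" "\<one>\<^bsub>Q\<^esub> = \<one>" "\<zero>\<^bsub>Q\<^esub> = \<zero>" "x \<otimes>\<^bsub>Q\<^esub> y = x \<otimes> y" "x \<oplus>\<^bsub>Q\<^esub> y = x \<oplus> y" for x y
    unfolding Q_def by simp_all
  have "cring Q"
    unfolding Q_def using subcring_iff[OF subringE(1)[OF S]] subcringI'[OF S] by simp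
  then interpret Q: cring Q .
  obtain M where "maximalideal M Q" by (rule Q.exists_maximal_ideal) simp_all
  then interpret M: maximalideal M Q .
  define k where "k = Q Quot M"
  define q where "q = (\<lambda>x. M +>\<^bsub>Q\<^esub> x)"
  have k: "field k" unfolding k_def by (rule M.quotient_is_field[OF Q.is_cring])
  interpret k: field k by (rule k)
  interpret q: ring_hom_ring Q k q unfolding k_def q_def by (rule M.rcos_ring_hom_ring)
  have onto: "carrier k = q ` S" unfolding k_def q_def FactRing_def A_RCOSETS_def' by auto
  obtain cs where cs: "set cs = C" using C(1) finite_list by blast
  define Z where "Z = range (\<lambda>n::int. [n] \<cdot>\<^bsub>k\<^esub> \<one>\<^bsub>k\<^esub>)"
  have Z: "subring Z k" "k.goldman Z \<Longrightarrow> finite Z"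
    unfolding Z_def by (rule k.finite_prime_subring)+
  define E where "E = k.finite_extension Z (map q cs)"
  have gen: "set (map q cs) \<subseteq> carrier k" using cs CS onto by auto
  have E: "subring E k" unfolding E_def by (rule k.finite_extension_is_subring[OF Z(1) gen])
  have SE: "S \<subseteq> {x \<in> S. q x \<in> E}"
  proof -
    have minus: "\<ominus> x \<in> S \<and> q (\<ominus> x) = \<ominus>\<^bsub>k\<^esub> q x" if "x \<in> S" for x
    proof -
      have mS: "\<ominus> x \<in> S" and xR: "x \<in> carrier R" using subringE(1,5)[OF S] that by auto
      have "q (\<ominus> x) \<oplus>\<^bsub>k\<^esub> q x = q (\<ominus> x \<oplus> x)" using q.hom_add[of "\<ominus> x" x] mS that by simp
      also have "\<dots> = \<zero>\<^bsub>k\<^esub>" using q.hom_zero xR by (simp add: l_neg)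
      finally show ?thesis using q.hom_closed mS that by (simp add: k.minus_equality)
    qed
    have "subring {x \<in> S. q x \<in> E} R"
    proof (rule subringI)
      show "{x \<in> S. q x \<in> E} \<subseteq> carrier R" using subringE(1)[OF S] by blast
      show "\<one> \<in> {x \<in> S. q x \<in> E}" using subringE(3)[OF S] subringE(3)[OF E] q.hom_one by simp
      fix x assume x: "x \<in> {x \<in> S. q x \<in> E}"
      show "\<ominus> x \<in> {x \<in> S. q x \<in> E}" using minus[of x] x subringE(5)[OF E] by simp
      fix y assume y: "y \<in> {x \<in> S. q x \<in> E}"
      show "x \<otimes> y \<in> {x \<in> S. q x \<in> E}"
        using q.hom_mult[of x y] x y subringE(6)[OF E] subringE(6)[OF S] by simp
      show "x \<oplus> y \<in> {x \<in> S. q x \<in> E}"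
        using q.hom_add[of x y] x y subringE(7)[OF E] subringE(7)[OF S] by simp
    qed
    moreover have "C \<subseteq> {x \<in> S. q x \<in> E}"
      using CS k.finite_extension_mem[OF Z(1) gen] cs unfolding E_def by auto
    ultimately have "generate_ring R C \<subseteq> {x \<in> S. q x \<in> E}"
      by (rule generate_ring_min_subring1[OF C(2)])
    then show ?thesis unfolding S_def[symmetric] .
  qed
  have EK: "E = carrier k"
  proof (rule subset_antisym)
    show "E \<subseteq> carrier k" by (rule subringE(1)[OF E])
    have "q ` S \<subseteq> E" using SE by (intro image_subsetI) (simp add: subset_iff)
    then show "carrier k \<subseteq> E" unfolding onto .
  qed
  have "k.goldman (carrier k)"
    unfolding k.goldman_def
  proof (intro bexI[of _ "\<one>\<^bsub>k\<^esub>"] conjI ballI impI)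
    fix b assume b: "b \<in> carrier k" "b \<noteq> \<zero>\<^bsub>k\<^esub>"
    then have "b \<in> Units k" by (simp add: k.field_Units)
    then show "\<exists>n::nat. \<exists>t\<in>carrier k. b \<otimes>\<^bsub>k\<^esub> t = \<one>\<^bsub>k\<^esub> [^]\<^bsub>k\<^esub> n"
      by (intro exI[of _ 0] bexI[of _ "inv\<^bsub>k\<^esub> b"]) (auto simp: k.Units_r_inv)
  qed simp_all
  then have "finite E"
    using k.finite_if_goldman[OF Z gen] EK unfolding E_def by simp
  then have "finite (carrier k)" using EK by simp
  moreover have "q \<in> ring_hom (R\<lparr>carrier := S\<rparr>) k"
    using q.homh unfolding Q_def by simp
  ultimately show ?thesis using S CS k by blast
qed

section \<open>Finitely generated groups embed in finitely generated Hopfian groups\<close>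

text \<open>A normal subgroup \<open>N\<close> maximal among those avoiding \<open>\<tau>\<close> has Hopfian quotient, if every quotient in
  which \<open>\<tau>\<close> dies is abelian and conversely: a noninjective surjective endomorphism would present
  \<open>G / N\<close> as a quotient of itself in which \<open>\<tau>\<close> dies.\<close>

lemma (in group) hopfian_quotient_avoiding:
  assumes \<tau>: "\<tau> \<in> carrier G" "\<tau> \<noteq> \<one>"
    and dies: "\<And>N. N \<lhd> G \<Longrightarrow> \<tau> \<in> N \<longleftrightarrow> (\<forall>x\<in>carrier G. \<forall>y\<in>carrier G. commutator G x y \<in> N)"
  obtains N where "N \<lhd> G" "\<tau> \<notin> N" "hopfian (G Mod N)"
proof -
  define \<N> where "\<N> = {N. N \<lhd> G \<and> \<tau> \<notin> N}"
  have "\<exists>N\<in>\<N>. \<forall>M\<in>\<N>. N \<subseteq> M \<longrightarrow> M = N"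
  proof (rule subset_Zorn_nonempty)
    show "\<N> \<noteq> {}" using one_is_normal \<tau> unfolding \<N>_def by blast
    fix \<C> assume \<C>: "\<C> \<noteq> {}" "subset.chain \<N> \<C>"
    have nor: "N \<lhd> G" "\<tau> \<notin> N" if "N \<in> \<C>" for N
      using that \<C>(2) unfolding subset.chain_def \<N>_def by blast+
    have sub: "subgroup N G" if "N \<in> \<C>" for N by (rule normal_imp_subgroup[OF nor(1)[OF that]])
    have "subgroup (\<Union>\<C>) G"
    proof (rule subgroupI)
      show "\<Union>\<C> \<subseteq> carrier G" using subgroup.subset[OF sub] by blast
      show "\<Union>\<C> \<noteq> {}" using subgroup.one_closed[OF sub] \<C>(1) by blast
      fix x assume "x \<in> \<Union>\<C>"
      then obtain I where I: "I \<in> \<C>" "x \<in> I" by blast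
      then show "inv x \<in> \<Union>\<C>" using subgroup.m_inv_closed[OF sub] by blast
      fix y assume "y \<in> \<Union>\<C>"
      then obtain J where J: "J \<in> \<C>" "y \<in> J" by blast
      have "I \<subseteq> J \<or> J \<subseteq> I" using \<C>(2) I(1) J(1) unfolding subset_chain_def by blast
      then show "x \<otimes> y \<in> \<Union>\<C>"
        using I J subgroup.m_closed[OF sub[OF I(1)]] subgroup.m_closed[OF sub[OF J(1)]] by blast
    qed
    then have "\<Union>\<C> \<lhd> G"
    proof (rule normal_invI)
      fix x h assume x: "x \<in> carrier G" and "h \<in> \<Union>\<C>"
      then obtain I where I: "I \<in> \<C>" "h \<in> I" by blast
      then have "x \<otimes> h \<otimes> inv x \<in> I" using normal_invE(2)[OF nor(1)[OF I(1)] x] by simp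
      then show "x \<otimes> h \<otimes> inv x \<in> \<Union>\<C>" using I(1) by blast
    qed
    then show "\<Union>\<C> \<in> \<N>" using nor(2) unfolding \<N>_def by blast
  qed
  then obtain N where N: "N \<in> \<N>" "\<forall>M\<in>\<N>. N \<subseteq> M \<longrightarrow> M = N" by (rule bexE)
  then have nor: "N \<lhd> G" "\<tau> \<notin> N" unfolding \<N>_def by blast+
  interpret N: normal N G by (rule nor(1))
  define \<pi> where "\<pi> = (\<lambda>a. N #> a)"
  define Q where "Q = G Mod N"
  have Q: "group Q" unfolding Q_def by (rule N.factorgroup_is_group)
  interpret Q: group Q by (rule Q)
  have \<pi>hom: "\<pi> \<in> hom G Q" unfolding \<pi>_def Q_def by (rule N.r_coset_hom_Mod)
  interpret \<pi>: group_hom G Q \<pi> using \<pi>hom by (simp add: group_hom_def group_hom_axioms_def is_group Q)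
  have onto: "carrier Q = \<pi> ` carrier G" unfolding Q_def \<pi>_def by (rule carrier_FactGroup)
  have \<pi>_one: "\<pi> a = \<one>\<^bsub>Q\<^esub> \<longleftrightarrow> a \<in> N" if "a \<in> carrier G" for a
    using coset_eq_self_iff[OF N.subgroup_axioms that] unfolding \<pi>_def Q_def by simp
  have "hopfian Q"
  proof (rule hopfianI[OF Q])
    fix \<phi> x assume \<phi>: "\<phi> \<in> hom Q Q" "\<phi> ` carrier Q = carrier Q" and x: "x \<in> carrier Q" "\<phi> x = \<one>\<^bsub>Q\<^esub>"
    interpret \<phi>: group_hom Q Q \<phi> using \<phi> by (simp add: group_hom_def group_hom_axioms_def Q)
    have hom: "\<phi> \<circ> \<pi> \<in> hom G Q" by (rule Group.hom_compose[OF \<pi>hom \<phi>(1)])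
    interpret \<psi>: group_hom G Q "\<phi> \<circ> \<pi>" using hom by (simp add: group_hom_def group_hom_axioms_def is_group Q)
    define M where "M = kernel G Q (\<phi> \<circ> \<pi>)"
    have M: "M \<lhd> G" unfolding M_def by (rule \<psi>.normal_kernel)
    have M_iff: "a \<in> M \<longleftrightarrow> \<phi> (\<pi> a) = \<one>\<^bsub>Q\<^esub>" if "a \<in> carrier G" for a
      using that unfolding M_def kernel_def by simp
    have NM: "N \<subseteq> M"
    proof
      fix a assume a: "a \<in> N"
      then have "a \<in> carrier G" "\<pi> a = \<one>\<^bsub>Q\<^esub>" using \<pi>_one[of a] by auto
      then show "a \<in> M" using M_iff by simp
    qed
    obtain a where a: "a \<in> carrier G" "x = \<pi> a" using x(1) onto by blast
    show "x = \<one>\<^bsub>Q\<^esub>"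
    proof (rule ccontr)
      assume "x \<noteq> \<one>\<^bsub>Q\<^esub>"
      then have "a \<in> M" "a \<notin> N" using a x(2) M_iff \<pi>_one by simp_all
      then have "M \<noteq> N" by blast
      then have "\<tau> \<in> M" using N(2) NM M unfolding \<N>_def by blast
      then have abM: "commutator G b c \<in> M" if "b \<in> carrier G" "c \<in> carrier G" for b c
        using dies[OF M] that by blast
      have "commutator G b c \<in> N" if bc: "b \<in> carrier G" "c \<in> carrier G" for b c
      proof -
        have lift: "\<exists>b'\<in>carrier G. \<pi> b = \<phi> (\<pi> b')" if b: "b \<in> carrier G" for b
        proof -
          have "\<pi> b \<in> \<phi> ` carrier Q" using b \<phi>(2) by simp
          then show ?thesis unfolding onto by blast
        qed
        obtain b' where b': "b' \<in> carrier G" "\<pi> b = \<phi> (\<pi> b')" using lift[OF bc(1)] by (rule bexE)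
        obtain c' where c': "c' \<in> carrier G" "\<pi> c = \<phi> (\<pi> c')" using lift[OF bc(2)] by (rule bexE)
        have "\<pi> (commutator G b c) = \<phi> (\<pi> (commutator G b' c'))"
          using b' c' bc by (simp add: \<pi>.hom_commutator \<phi>.hom_commutator)
        also have "\<dots> = \<one>\<^bsub>Q\<^esub>" using M_iff abM b' c' by simp
        finally show ?thesis using \<pi>_one bc by simp
      qed
      then show False using dies[OF nor(1)] nor(2) by simp
    qed
  qed
  then show thesis using that nor unfolding Q_def by simp
qed

definition perms :: "('a \<Rightarrow> 'a) monoid" where
  "perms = \<lparr>carrier = {f. bij f}, monoid.mult = (\<circ>), one = id\<rparr>"

lemma perms_simps [simp]:
  "f \<in> carrier perms \<longleftrightarrow> bij f" "f \<otimes>\<^bsub>perms\<^esub> g = f \<circ> g" "\<one>\<^bsub>perms\<^esub> = id"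
  by (simp_all add: perms_def)

lemma group_perms: "group perms"
proof (rule groupI)
  fix f :: "'a \<Rightarrow> 'a" assume "f \<in> carrier perms"
  then show "\<exists>g\<in>carrier perms. g \<otimes>\<^bsub>perms\<^esub> f = \<one>\<^bsub>perms\<^esub>"
    by (intro bexI[of _ "inv_into UNIV f"]) (auto simp: bij_is_inj bij_imp_bij_inv)
qed (auto simp: bij_comp comp_assoc)

text \<open>A 3-cycle of the blocks \<open>{a} \<times> \<nat>\<close>.\<close>

definition cycle3 :: "nat \<Rightarrow> nat \<Rightarrow> nat \<Rightarrow> nat \<times> nat \<Rightarrow> nat \<times> nat" where
  "cycle3 a b c p = (if fst p = a then b else if fst p = b then c else if fst p = c then a else fst p, snd p)"

lemma cycle3_rotate: "a \<noteq> b \<Longrightarrow> b \<noteq> c \<Longrightarrow> c \<noteq> a \<Longrightarrow> cycle3 a b c = cycle3 b c a"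
  by (auto simp: cycle3_def)

lemma cycle3_inverse: "a \<noteq> b \<Longrightarrow> b \<noteq> c \<Longrightarrow> c \<noteq> a \<Longrightarrow> cycle3 a b c \<circ> cycle3 c b a = id"
  by (auto simp: cycle3_def)

lemma cycle3_bij: "a \<noteq> b \<Longrightarrow> b \<noteq> c \<Longrightarrow> c \<noteq> a \<Longrightarrow> bij (cycle3 a b c)"
  using cycle3_inverse[of a b c] cycle3_inverse[of c b a] by (intro o_bij[of "cycle3 c b a"]) auto

lemma cycle3_conjugate:
  assumes "a \<noteq> b" "b \<noteq> c" "c \<noteq> a" "d \<notin> {a, b, c}" "e \<notin> {a, b, c, d}"
  shows "cycle3 a d e \<circ> cycle3 a b c \<circ> cycle3 e d a = cycle3 d b c"
proof
  have ne: "a \<noteq> b" "b \<noteq> a" "b \<noteq> c" "c \<noteq> b" "c \<noteq> a" "a \<noteq> c" "a \<noteq> d" "d \<noteq> a" "b \<noteq> d" "d \<noteq> b"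
    "c \<noteq> d" "d \<noteq> c" "a \<noteq> e" "e \<noteq> a" "b \<noteq> e" "e \<noteq> b" "c \<noteq> e" "e \<noteq> c" "d \<noteq> e" "e \<noteq> d"
    using assms by auto
  fix p :: "nat \<times> nat"
  consider "fst p = a" | "fst p = b" | "fst p = c" | "fst p = d" | "fst p = e" | "fst p \<notin> {a, b, c, d, e}"
    by blast
  then show "(cycle3 a d e \<circ> cycle3 a b c \<circ> cycle3 e d a) p = cycle3 d b c p"
    by cases (simp_all add: cycle3_def ne)
qed

lemma cycle3_commutator: "cycle3 2 1 0 \<circ> cycle3 2 3 4 \<circ> cycle3 0 1 2 \<circ> cycle3 4 3 2 = cycle3 2 1 3"
  by (intro ext) (auto simp: cycle3_def)

text \<open>Six blocks carry an action of the given group; twelve more leave room to conjugate it away from itself.\<close>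

definition cycles :: "(nat \<times> nat \<Rightarrow> nat \<times> nat) set" where
  "cycles = (\<lambda>(a, b, c). cycle3 a b c) `
     {(a, b, c). a < 18 \<and> b < 18 \<and> c < 18 \<and> a \<noteq> b \<and> b \<noteq> c \<and> c \<noteq> a}"

lemma cyclesI: "a < 18 \<Longrightarrow> b < 18 \<Longrightarrow> c < 18 \<Longrightarrow> a \<noteq> b \<Longrightarrow> b \<noteq> c \<Longrightarrow> c \<noteq> a \<Longrightarrow> cycle3 a b c \<in> cycles"
  unfolding cycles_def by force

lemma cyclesE:
  assumes "f \<in> cycles"
  obtains a b c where "f = cycle3 a b c" "a < 18" "b < 18" "c < 18" "a \<noteq> b" "b \<noteq> c" "c \<noteq> a"
  using assms unfolding cycles_def by auto

lemma finite_cycles: "finite cycles"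
proof -
  have "finite ({..<18 :: nat} \<times> {..<18 :: nat} \<times> {..<18 :: nat})" by simp
  then have "finite {(a, b, c). a < 18 \<and> b < 18 \<and> c < (18::nat) \<and> a \<noteq> b \<and> b \<noteq> c \<and> c \<noteq> a}"
    by (rule finite_subset[rotated]) auto
  then show ?thesis unfolding cycles_def by (rule finite_imageI)
qed

lemma fresh_block:
  assumes "length xs < 18" obtains x :: nat where "x < 18" "\<forall>z\<in>set xs. x \<noteq> z \<and> z \<noteq> x"
proof -
  have "\<not> {..<18} \<subseteq> set xs"
  proof
    assume "{..<18} \<subseteq> set xs"
    then have "card {..<18::nat} \<le> card (set xs)" by (rule card_mono[rotated]) simp
    also have "\<dots> \<le> length xs" by (rule card_length)
    finally show False using assms by simp
  qed
  then show thesis using that by auto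
qed

locale countable_group = group G for G :: "('g, 'n) monoid_scheme" (structure) +
  assumes countable: "countable (carrier G)"
begin

text \<open>The group acts by left translation on \<open>G \<times> \<nat>\<close>, which is embedded in the first six blocks. The copies
  of the identity fill the blocks \<open>0, \<dots>, 4\<close>, so that every nontrivial element moves all of these away.\<close>

definition slot :: "'g \<times> nat \<Rightarrow> nat \<times> nat" where
  "slot q = (if fst q = \<one> then (snd q mod 5, snd q div 5)
             else (5, prod_encode (to_nat_on (carrier G) (fst q), snd q)))"

definition act :: "'g \<Rightarrow> nat \<times> nat \<Rightarrow> nat \<times> nat" where
  "act g p = (if p \<in> slot ` (carrier G \<times> UNIV)
     then slot (g \<otimes> fst (inv_into (carrier G \<times> UNIV) slot p), snd (inv_into (carrier G \<times> UNIV) slot p))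
     else p)"

lemma slot_inj: "inj_on slot (carrier G \<times> UNIV)"
proof (rule inj_onI)
  fix p q assume p: "p \<in> carrier G \<times> UNIV" and q: "q \<in> carrier G \<times> UNIV" and eq: "slot p = slot q"
  show "p = q"
  proof (cases "fst p = \<one>")
    case True
    have m: "snd p mod 5 < 5" by simp
    have 1: "fst q = \<one>" using eq True m unfolding slot_def by (auto split: if_splits)
    have "snd p mod 5 = snd q mod 5" "snd p div 5 = snd q div 5"
      using eq True 1 unfolding slot_def by auto
    then have "snd p = snd q" by (metis div_mult_mod_eq)
    then show ?thesis using True 1 by (simp add: prod_eq_iff)
  next
    case False
    have m: "snd q mod 5 < 5" by simp
    have 1: "fst q \<noteq> \<one>" using eq False m unfolding slot_def by (auto split: if_splits)
    have "to_nat_on (carrier G) (fst p) = to_nat_on (carrier G) (fst q)" "snd p = snd q"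
      using eq False 1 unfolding slot_def by auto
    then show ?thesis using p q countable by (auto simp: prod_eq_iff)
  qed
qed

lemma fst_slot: "fst (slot q) < 6" "fst q \<noteq> \<one> \<Longrightarrow> fst (slot q) = 5"
proof -
  have "snd q mod 5 < 5" by simp
  then have "snd q mod 5 < 6" by linarith
  then show "fst (slot q) < 6" unfolding slot_def by simp
qed (simp add: slot_def)

lemma identity_slot: "fst p < 5 \<Longrightarrow> p = slot (\<one>, fst p + 5 * snd p)"
  by (simp add: slot_def prod_eq_iff)

lemma act_slot: "x \<in> carrier G \<Longrightarrow> act g (slot (x, n)) = slot (g \<otimes> x, n)"
  using inv_into_f_f[OF slot_inj, of "(x, n)"] by (simp add: act_def)

lemma act_elsewhere: "p \<notin> slot ` (carrier G \<times> UNIV) \<Longrightarrow> act g p = p"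
  by (simp add: act_def)

lemma slot_cases:
  obtains x n where "x \<in> carrier G" "p = slot (x, n)" | "p \<notin> slot ` (carrier G \<times> UNIV)"
  by blast

lemma act_mult:
  assumes "g \<in> carrier G" "h \<in> carrier G"
  shows "act (g \<otimes> h) = act g \<circ> act h"
proof
  fix p
  show "act (g \<otimes> h) p = (act g \<circ> act h) p"
    by (cases p rule: slot_cases) (use assms in \<open>simp_all add: act_slot act_elsewhere m_assoc\<close>)
qed

lemma act_one: "act \<one> = id"
proof
  fix p show "act \<one> p = id p"
    by (cases p rule: slot_cases) (simp_all add: act_slot act_elsewhere)
qed

lemma act_inverse: "g \<in> carrier G \<Longrightarrow> act g \<circ> act (inv g) = id" "g \<in> carrier G \<Longrightarrow> act (inv g) \<circ> act g = id"
  by (simp_all flip: act_mult add: act_one)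

lemma act_inverse_apply: "g \<in> carrier G \<Longrightarrow> act g (act (inv g) p) = p" "g \<in> carrier G \<Longrightarrow> act (inv g) (act g p) = p"
  using fun_cong[OF act_inverse(1), of g p] fun_cong[OF act_inverse(2), of g p] by simp_all

lemma act_bij: "g \<in> carrier G \<Longrightarrow> bij (act g)"
  using act_inverse by (intro o_bij[of "act (inv g)"])

lemma act_fixes: "6 \<le> fst p \<Longrightarrow> act g p = p"
  by (cases p rule: slot_cases) (use fst_slot(1) in \<open>auto simp: act_elsewhere not_le[symmetric]\<close>)

lemma act_preserves: "g \<in> carrier G \<Longrightarrow> fst p < 6 \<Longrightarrow> fst (act g p) < 6"
  by (cases p rule: slot_cases) (simp_all add: act_elsewhere act_slot fst_slot)

lemma act_displaces:
  assumes "g \<in> carrier G" "g \<noteq> \<one>" "fst p < 5" shows "fst (act g p) = 5"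
  using assms by (subst identity_slot[OF assms(3)]) (simp add: act_slot fst_slot)

definition H :: "(nat \<times> nat \<Rightarrow> nat \<times> nat) set" where
  "H = generate perms (cycles \<union> act ` carrier G)"

definition E :: "(nat \<times> nat \<Rightarrow> nat \<times> nat) monoid" where
  "E = perms\<lparr>carrier := H\<rparr>"

lemma generators: "cycles \<union> act ` carrier G \<subseteq> carrier perms"
  using act_bij by (auto elim!: cyclesE intro: cycle3_bij)

lemma H_subgroup: "subgroup H perms"
  unfolding H_def by (rule group.generate_is_subgroup[OF group_perms generators])

sublocale E: group E
  unfolding E_def by (rule group.subgroup_imp_group[OF group_perms H_subgroup])

lemma E_simps [simp]: "carrier E = H" "f \<otimes>\<^bsub>E\<^esub> g = f \<circ> g" "\<one>\<^bsub>E\<^esub> = id"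
  by (simp_all add: E_def)

lemma H_closed:
  "f \<in> H \<Longrightarrow> g \<in> H \<Longrightarrow> f \<circ> g \<in> H"
  using subgroup.m_closed[OF H_subgroup, of f g] by simp

lemma act_H [simp]: "g \<in> carrier G \<Longrightarrow> act g \<in> H"
  unfolding H_def by (auto intro: generate.incl)

lemma cycle3_H [simp]:
  "a < 18 \<Longrightarrow> b < 18 \<Longrightarrow> c < 18 \<Longrightarrow> a \<noteq> b \<Longrightarrow> b \<noteq> c \<Longrightarrow> c \<noteq> a \<Longrightarrow> cycle3 a b c \<in> H"
  unfolding H_def by (auto intro: generate.incl cyclesI)

lemma inv_act: "g \<in> carrier G \<Longrightarrow> inv\<^bsub>E\<^esub> (act g) = act (inv g)"
  by (rule E.inv_equality) (simp_all add: act_inverse)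

lemma inv_cycle3:
  "a < 18 \<Longrightarrow> b < 18 \<Longrightarrow> c < 18 \<Longrightarrow> a \<noteq> b \<Longrightarrow> b \<noteq> c \<Longrightarrow> c \<noteq> a \<Longrightarrow> inv\<^bsub>E\<^esub> (cycle3 a b c) = cycle3 c b a"
  by (rule E.inv_equality) (auto simp: cycle3_inverse)

lemma act_hom: "act \<in> hom G E"
  by (auto simp: hom_def act_mult)

context
  fixes N assumes N: "N \<lhd> E"
begin

lemma N_closed: "x \<in> N \<Longrightarrow> y \<in> N \<Longrightarrow> x \<circ> y \<in> N" "x \<in> N \<Longrightarrow> x \<in> H"
  using subgroup.m_closed[OF normal_imp_subgroup[OF N], of x y] subgroup.mem_carrier[OF normal_imp_subgroup[OF N], of x]
  by simp_all

lemma N_conjugate: "f \<in> H \<Longrightarrow> x \<in> N \<Longrightarrow> inv\<^bsub>E\<^esub> f = f' \<Longrightarrow> f \<circ> x \<circ> f' \<in> N"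
  using E.normal_invE(2)[OF N, of f x] by simp

lemma cycle3_change_entry:
  assumes "cycle3 a b c \<in> N" "a < 18" "b < 18" "c < 18" "a \<noteq> b" "b \<noteq> c" "c \<noteq> a" "d < 18" "d \<notin> {a, b, c}"
  shows "cycle3 d b c \<in> N"
proof -
  obtain e :: nat where e: "e < 18" "\<forall>z\<in>set [a, b, c, d]. e \<noteq> z \<and> z \<noteq> e" by (rule fresh_block[of "[a, b, c, d]"]) simp
  have "cycle3 a d e \<circ> cycle3 a b c \<circ> cycle3 e d a \<in> N"
    by (rule N_conjugate) (use assms e in \<open>auto simp: inv_cycle3\<close>)
  then show ?thesis using assms e by (subst (asm) cycle3_conjugate) auto
qed

lemma cycle3_normal_closure:
  assumes N: "cycle3 a b c \<in> N" and abc: "a < 18" "b < 18" "c < 18" "a \<noteq> b" "b \<noteq> c" "c \<noteq> a"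
    and ijk: "i < 18" "j < 18" "k < 18" "i \<noteq> j" "j \<noteq> k" "k \<noteq> i"
  shows "cycle3 i j k \<in> N"
proof -
  \<comment> \<open>Change an entry and rotate: three steps lead to three fresh blocks, three more to \<open>i, j, k\<close>.\<close>
  have step: "cycle3 q r s \<in> N \<Longrightarrow> {q, r, s, t} \<subseteq> {..<18} \<Longrightarrow> distinct [q, r, s, t] \<Longrightarrow> cycle3 r s t \<in> N" for q r s t
    using cycle3_change_entry[of q r s t] cycle3_rotate[of t r s] by auto
  obtain x where x: "x < 18" "\<forall>t\<in>set [a, b, c, i, j, k]. x \<noteq> t \<and> t \<noteq> x"
    by (rule fresh_block[of "[a, b, c, i, j, k]"]) simp
  obtain y where y: "y < 18" "\<forall>t\<in>set [a, b, c, i, j, k, x]. y \<noteq> t \<and> t \<noteq> y"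
    by (rule fresh_block[of "[a, b, c, i, j, k, x]"]) simp
  obtain z where z: "z < 18" "\<forall>t\<in>set [a, b, c, i, j, k, x, y]. z \<noteq> t \<and> t \<noteq> z"
    by (rule fresh_block[of "[a, b, c, i, j, k, x, y]"]) simp
  have "cycle3 b c x \<in> N" by (rule step[OF N]) (use abc abc(4-6)[symmetric] x in simp_all)
  then have "cycle3 c x y \<in> N" by (rule step) (use abc abc(4-6)[symmetric] x y in simp_all)
  then have "cycle3 x y z \<in> N" by (rule step) (use abc abc(4-6)[symmetric] x y z in simp_all)
  then have "cycle3 y z i \<in> N" by (rule step) (use ijk ijk(4-6)[symmetric] x y z in simp_all)
  then have "cycle3 z i j \<in> N" by (rule step) (use ijk ijk(4-6)[symmetric] x y z in simp_all)
  then show ?thesis by (rule step) (use ijk ijk(4-6)[symmetric] x y z in simp_all)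
qed

text \<open>Since \<open>g\<close> displaces the blocks \<open>0, \<dots>, 4\<close>, the conjugate by \<open>act g\<close> of a cycle \<open>v\<close> of these blocks
  commutes with \<open>v\<close> and with every other such cycle \<open>w\<close>; so \<open>[[act g, v], w] = [v\<inverse>, w]\<close>.\<close>

lemma cycle3_if_act:
  assumes g: "g \<in> carrier G" "g \<noteq> \<one>" "act g \<in> N"
  shows "cycle3 2 1 3 \<in> N"
proof -
  note One_nat_def [simp del]
  let ?a = "act g" and ?a' = "act (inv g)"
  let ?v = "cycle3 0 1 2" and ?v' = "cycle3 2 1 0"
  let ?w = "cycle3 2 3 4" and ?w' = "cycle3 4 3 2"
  define k where "k = ?a \<circ> ?v \<circ> ?a' \<circ> ?v'"
  define k' where "k' = ?v \<circ> ?a \<circ> ?v' \<circ> ?a'"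
  have ig: "inv g \<in> carrier G" "inv g \<noteq> \<one>" using g by auto
  have a': "?a' \<in> N"
    using subgroup.m_inv_closed[OF normal_imp_subgroup[OF N] g(3)] inv_act[OF g(1)] by simp
  have "?v \<circ> ?a' \<circ> ?v' \<in> N" by (rule N_conjugate) (simp_all add: a' inv_cycle3)
  then have k: "k \<in> N" unfolding k_def using N_closed(1)[OF g(3)] by (simp add: comp_assoc)
  have "?v \<circ> ?a \<circ> ?v' \<in> N" by (rule N_conjugate) (simp_all add: g inv_cycle3)
  then have k': "k' \<in> N" unfolding k'_def by (rule N_closed(1)[OF _ a'])
  have "?w \<circ> k' \<circ> ?w' \<in> N" by (rule N_conjugate) (simp_all add: k' inv_cycle3)
  then have "k \<circ> (?w \<circ> k' \<circ> ?w') \<in> N" by (rule N_closed(1)[OF k])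
  moreover have "k \<circ> (?w \<circ> k' \<circ> ?w') = cycle3 2 1 3"
  proof
    fix p
    have vv: "?v (?v' q) = q" "?v' (?v q) = q" for q
      by (auto simp: cycle3_def prod_eq_iff)
    have v5: "?v q = q" "?v' q = q" if "fst q = 5" for q
      using that by (auto simp: cycle3_def prod_eq_iff)
    have kk': "k (k' q) = q" for q
      unfolding k_def k'_def by (simp add: vv act_inverse_apply[OF g(1)])
    have v_small: "fst (?v q) < 5" "fst (?v' q) < 5" "fst (?w' q) < 5" "fst (?w q) < 5" if "fst q < 5" for q
      using that by (auto simp: cycle3_def)
    have k_small: "k q = ?v' q" if q: "fst q < 5" for q
    proof -
      have "fst (?a' (?v' q)) = 5" by (rule act_displaces[OF ig v_small(2)[OF q]])
      then show ?thesis unfolding k_def by (simp add: v5 act_inverse_apply[OF g(1)])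
    qed
    have k'_small: "k' q = ?v q" if q: "fst q < 5" for q
    proof -
      have "fst (?a' q) = 5" by (rule act_displaces[OF ig q])
      then show ?thesis unfolding k'_def by (simp add: v5 act_inverse_apply[OF g(1)])
    qed
    show "(k \<circ> (?w \<circ> k' \<circ> ?w')) p = cycle3 2 1 3 p"
    proof (cases "fst p < 5")
      case True
      have "(k \<circ> (?w \<circ> k' \<circ> ?w')) p = ?v' (?w (?v (?w' p)))"
        using True by (simp add: k'_small k_small v_small)
      also have "\<dots> = cycle3 2 1 3 p" using fun_cong[OF cycle3_commutator, of p] by simp
      finally show ?thesis .
    next
      case False
      have far: "?w q = q" "?w' q = q" "cycle3 2 1 3 q = q" if "\<not> fst q < 5" for q
        using that by (auto simp: cycle3_def prod_eq_iff)
      have "\<not> fst (k' p) < 5"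
      proof
        assume *: "fst (k' p) < 5"
        have "fst (k (k' p)) < 5" unfolding k_small[OF *] by (rule v_small(2)[OF *])
        then show False using False kk' by simp
      qed
      then show ?thesis using False by (simp add: far kk' del: fst_conv)
    qed
  qed
  ultimately show ?thesis by simp
qed

text \<open>Modulo all 3-cycles, \<open>act g\<close> is congruent to a conjugate of itself supported away from the blocks
  \<open>0, \<dots>, 5\<close>, which commutes with all \<open>act h\<close>.\<close>

lemma commutator_in_N:
  assumes cyc: "cycles \<subseteq> N" and xy: "x \<in> H" "y \<in> H"
  shows "commutator E x y \<in> N"
proof -
  define \<pi> where "\<pi> = (\<lambda>a. N #>\<^bsub>E\<^esub> a)"
  define Q where "Q = E Mod N"
  interpret N: normal N E by (rule N)
  have Q: "group Q" unfolding Q_def by (rule N.factorgroup_is_group)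
  interpret Q: group Q by (rule Q)
  have \<pi>hom: "\<pi> \<in> hom E Q" unfolding \<pi>_def Q_def by (rule N.r_coset_hom_Mod)
  interpret \<pi>: group_hom E Q \<pi> using \<pi>hom by (simp add: group_hom_def group_hom_axioms_def E.is_group Q)
  have \<pi>_one: "\<pi> a = \<one>\<^bsub>Q\<^esub> \<longleftrightarrow> a \<in> N" if "a \<in> H" for a
    using E.coset_eq_self_iff[OF N.subgroup_axioms, of a] that unfolding \<pi>_def Q_def by simp
  have \<pi>_comp: "\<pi> (f \<circ> g) = \<pi> f \<otimes>\<^bsub>Q\<^esub> \<pi> g" if "f \<in> H" "g \<in> H" for f g
    using \<pi>.hom_mult[of f g] that by simp
  have \<pi>_closed: "\<pi> f \<in> carrier Q" if "f \<in> H" for f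
    using \<pi>.hom_closed[of f] that by simp
  define \<sigma> where "\<sigma> = cycle3 0 6 12 \<circ> cycle3 1 7 13 \<circ> cycle3 2 8 14 \<circ> cycle3 3 9 15 \<circ> cycle3 4 10 16 \<circ> cycle3 5 11 17"
  have cycN: "cycle3 i (i + 6) (i + 12) \<in> N" if "i < 6" for i
    using that cyc cyclesI[of i "i + 6" "i + 12"] by auto
  have \<sigma>: "\<sigma> \<in> N" unfolding \<sigma>_def
    using cycN[of 0] cycN[of 1] cycN[of 2] cycN[of 3] cycN[of 4] cycN[of 5]
    by (intro N_closed(1)) simp_all
  have \<sigma>H: "\<sigma> \<in> H" by (rule N_closed(2)[OF \<sigma>])
  define \<sigma>' where "\<sigma>' = inv\<^bsub>E\<^esub> \<sigma>"
  have \<sigma>': "\<sigma>' \<in> H" "\<sigma> \<circ> \<sigma>' = id" "\<sigma>' \<circ> \<sigma> = id"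
    unfolding \<sigma>'_def using \<sigma>H E.inv_closed[of \<sigma>] E.r_inv[of \<sigma>] E.l_inv[of \<sigma>] by simp_all
  have \<sigma>\<sigma>': "\<sigma> (\<sigma>' p) = p" "\<sigma>' (\<sigma> p) = p" for p
    using fun_cong[OF \<sigma>'(2), of p] fun_cong[OF \<sigma>'(3), of p] by simp_all
  have \<sigma>_moves: "6 \<le> fst (\<sigma> p)" if "fst p < 6" for p
  proof -
    have "fst p = 0 \<or> fst p = 1 \<or> fst p = 2 \<or> fst p = 3 \<or> fst p = 4 \<or> fst p = 5" using that by linarith
    moreover have "cycle3 a b c (a, y) = (b, y)" "i \<noteq> a \<Longrightarrow> i \<noteq> b \<Longrightarrow> i \<noteq> c \<Longrightarrow> cycle3 a b c (i, y) = (i, y)" for a b c i y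
      by (simp_all add: cycle3_def)
    ultimately show ?thesis unfolding \<sigma>_def by (cases p) (elim disjE, simp_all)
  qed
  have act_comm: "\<pi> (act g) \<otimes>\<^bsub>Q\<^esub> \<pi> (act h) = \<pi> (act h) \<otimes>\<^bsub>Q\<^esub> \<pi> (act g)"
    if g: "g \<in> carrier G" and h: "h \<in> carrier G" for g h
  proof -
    define g' where "g' = \<sigma> \<circ> act g \<circ> \<sigma>'"
    have g'H: "g' \<in> H" unfolding g'_def using g \<sigma>H \<sigma>' by (intro H_closed) simp_all
    have "\<pi> g' = \<pi> (act g)"
    proof -
      have one: "\<pi> \<sigma> = \<one>\<^bsub>Q\<^esub>" using \<pi>_one[OF \<sigma>H] \<sigma> by simp
      have "\<pi> \<sigma>' = \<one>\<^bsub>Q\<^esub>" unfolding \<sigma>'_def using \<sigma>H one by simp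
      then show ?thesis unfolding g'_def using g \<sigma>H \<sigma>' one \<pi>_closed[of "act g"] by (simp add: \<pi>_comp H_closed)
    qed
    moreover have "g' \<circ> act h = act h \<circ> g'"
    proof
      fix p
      \<comment> \<open>On blocks below 6 only \<open>act h\<close> acts, elsewhere only \<open>g'\<close>.\<close>
      have fixed: "g' q = q" if q: "fst q < 6" for q
      proof -
        have "\<not> fst (\<sigma>' q) < 6" using \<sigma>_moves[of "\<sigma>' q"] q \<sigma>\<sigma>' by auto
        then show ?thesis unfolding g'_def by (simp add: act_fixes \<sigma>\<sigma>')
      qed
      show "(g' \<circ> act h) p = (act h \<circ> g') p"
      proof (cases "fst p < 6")
        case True
        then show ?thesis using act_preserves[OF h True] by (simp add: fixed)
      next
        case False
        have "\<not> fst (g' p) < 6"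
        proof
          assume *: "fst (g' p) < 6"
          have inj: "inj g'" using subgroup.mem_carrier[OF H_subgroup g'H] by (simp add: bij_is_inj)
          have "g' (g' p) = g' p" by (rule fixed[OF *])
          then have "g' p = p" using inj by (simp add: inj_eq)
          then show False using * False by simp
        qed
        then show ?thesis using False by (simp add: act_fixes)
      qed
    qed
    ultimately show ?thesis using \<pi>_comp[OF g'H act_H[OF h]] \<pi>_comp[OF act_H[OF h] g'H] by simp
  qed
  have covered: "f \<in> H \<and> (\<exists>g\<in>carrier G. \<pi> f = \<pi> (act g))" if "f \<in> H" for f
    using that unfolding H_def
  proof (induction f rule: generate.induct)
    case one
    then show ?case using generate.one[of perms "cycles \<union> act ` carrier G"]
      unfolding perms_simps by (intro conjI bexI[of _ \<one>]) (simp_all only: act_one one_closed)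
  next
    case (incl f)
    then have fH: "f \<in> H" unfolding H_def by (rule generate.incl)
    show ?case
    proof (cases "f \<in> cycles")
      case True
      then have "\<pi> f = \<pi> (act \<one>)" using cyc \<pi>_one[OF fH] \<pi>_one[of id] E.one_closed \<pi>.hom_one by (auto simp: act_one)
      then show ?thesis using fH unfolding H_def by blast
    next
      case False
      then show ?thesis using incl fH unfolding H_def by blast
    qed
  next
    case (inv f)
    have fH: "f \<in> H" using inv unfolding H_def by (rule generate.incl)
    have eq: "inv\<^bsub>perms\<^esub> f = inv\<^bsub>E\<^esub> f"
      unfolding E_def using group.m_inv_consistent[OF group_perms H_subgroup fH] by simp
    have "\<exists>g\<in>carrier G. \<pi> f = \<pi> (act g)"
    proof (cases "f \<in> cycles")
      case True
      then have "\<pi> f = \<pi> (act \<one>)" using cyc \<pi>_one[OF fH] \<pi>_one[of id] E.one_closed \<pi>.hom_one by (auto simp: act_one)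
      then show ?thesis by blast
    next
      case False
      then show ?thesis using inv by blast
    qed
    then obtain g where g: "g \<in> carrier G" "\<pi> f = \<pi> (act g)" by blast
    have "\<pi> (inv\<^bsub>E\<^esub> f) = \<pi> (act (inv g))"
      using \<pi>.hom_inv[of f] \<pi>.hom_inv[of "act g"] fH g by (simp add: inv_act)
    moreover have "inv\<^bsub>E\<^esub> f \<in> H" using E.inv_closed[of f] fH by simp
    ultimately show ?case unfolding eq H_def[symmetric] using g(1) by blast
  next
    case (eng f f')
    then obtain g g' where g: "g \<in> carrier G" "\<pi> f = \<pi> (act g)" "f \<in> H"
      and g': "g' \<in> carrier G" "\<pi> f' = \<pi> (act g')" "f' \<in> H" unfolding H_def by blast
    have "\<pi> (f \<circ> f') = \<pi> (act (g \<otimes> g'))"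
      using g g' by (simp add: \<pi>_comp act_mult)
    moreover have "g \<otimes> g' \<in> carrier G" "f \<circ> f' \<in> H" using g g' H_closed[of f f'] by simp_all
    ultimately show ?case unfolding H_def[symmetric] perms_simps by blast
  qed
  obtain g where g: "g \<in> carrier G" "\<pi> x = \<pi> (act g)" using covered[OF xy(1)] by blast
  obtain h where h: "h \<in> carrier G" "\<pi> y = \<pi> (act h)" using covered[OF xy(2)] by blast
  have "\<pi> x \<otimes>\<^bsub>Q\<^esub> \<pi> y = \<pi> y \<otimes>\<^bsub>Q\<^esub> \<pi> x" unfolding g h by (rule act_comm[OF g(1) h(1)])
  then have "commutator Q (\<pi> x) (\<pi> y) = \<one>\<^bsub>Q\<^esub>"
    using Q.commutator_eq_one_iff[OF \<pi>_closed[OF xy(1)] \<pi>_closed[OF xy(2)]] by simp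
  then have "\<pi> (commutator E x y) = \<one>\<^bsub>Q\<^esub>" using \<pi>.hom_commutator[of x y] xy by simp
  then show ?thesis using \<pi>_one E.commutator_closed[of x y] xy by simp
qed

text \<open>Conversely, a 3-cycle is a commutator of 3-cycles.\<close>

lemma cycle3_in_N_iff:
  "cycle3 0 1 2 \<in> N \<longleftrightarrow> (\<forall>x\<in>carrier E. \<forall>y\<in>carrier E. commutator E x y \<in> N)"
proof
  assume *: "cycle3 0 1 2 \<in> N"
  have "cycles \<subseteq> N"
  proof
    fix f assume "f \<in> cycles"
    then obtain a b c where "f = cycle3 a b c" "a < 18" "b < 18" "c < 18" "a \<noteq> b" "b \<noteq> c" "c \<noteq> a"
      by (rule cyclesE)
    then show "f \<in> N" using cycle3_normal_closure[OF *, of a b c] by simp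
  qed
  then show "\<forall>x\<in>carrier E. \<forall>y\<in>carrier E. commutator E x y \<in> N" using commutator_in_N by simp
next
  assume "\<forall>x\<in>carrier E. \<forall>y\<in>carrier E. commutator E x y \<in> N"
  then have "commutator E (cycle3 2 1 0) (cycle3 2 3 4) \<in> N" by simp
  then have "cycle3 2 1 3 \<in> N"
    unfolding commutator_def by (simp add: inv_cycle3 cycle3_commutator del: One_nat_def)
  then show "cycle3 0 1 2 \<in> N" by (rule cycle3_normal_closure) simp_all
qed

lemma act_in_N_imp: "g \<in> carrier G \<Longrightarrow> act g \<in> N \<Longrightarrow> g \<noteq> \<one> \<Longrightarrow> cycle3 0 1 2 \<in> N"
  using cycle3_normal_closure[OF cycle3_if_act, of g 0 1 2] by simp

end

lemma E_finitely_generated: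
  assumes "finitely_generated G" shows "finitely_generated E"
proof -
  obtain S where S: "finite S" "S \<subseteq> carrier G" "generate G S = carrier G"
    using assms unfolding finitely_generated_def by blast
  let ?S = "cycles \<union> act ` S"
  interpret A: group_hom G perms act
    using act_bij by (simp add: group_hom_def group_hom_axioms_def is_group group_perms hom_def act_mult)
  have "generate perms ?S = H"
  proof
    show "generate perms ?S \<subseteq> H" unfolding H_def
      by (rule group.mono_generate[OF group_perms]) (use S in blast)
    have "act ` carrier G = generate perms (act ` S)"
      using A.generate_img[OF S(2)] S(3) by simp
    also have "\<dots> \<subseteq> generate perms ?S" by (rule group.mono_generate[OF group_perms]) blast
    finally have "cycles \<union> act ` carrier G \<subseteq> generate perms ?S" by (auto intro: generate.incl)
    moreover have "subgroup (generate perms ?S) perms"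
      by (rule group.generate_is_subgroup[OF group_perms]) (use generators S(2) in blast)
    ultimately show "H \<subseteq> generate perms ?S"
      unfolding H_def by (rule group.generate_subgroup_incl[OF group_perms])
  qed
  moreover have "?S \<subseteq> H" using S act_H by (auto elim!: cyclesE)
  then have "generate E ?S = generate perms ?S"
    unfolding E_def by (intro group.generate_consistent[OF group_perms _ H_subgroup])
  ultimately have "generate E ?S = carrier E" by simp
  then show ?thesis unfolding finitely_generated_def
    using \<open>?S \<subseteq> H\<close> S(1) finite_cycles by (intro exI[of _ ?S]) simp
qed

end

lemma (in group_hom) finitely_generated_image:
  assumes "finitely_generated G" "h ` carrier G = carrier H" shows "finitely_generated H"
proof -
  obtain S where S: "finite S" "S \<subseteq> carrier G" "generate G S = carrier G"
    using assms unfolding finitely_generated_def by blast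
  then have "generate H (h ` S) = carrier H" using generate_img[OF S(2)] assms(2) by simp
  then show ?thesis using S unfolding finitely_generated_def by (intro exI[of _ "h ` S"]) auto
qed

text \<open>The quotient by a normal subgroup maximal among those without 3-cycles is Hopfian. The group still
  embeds, since a normal subgroup that contains a nontrivial \<open>act g\<close> contains a 3-cycle.\<close>

theorem (in group) embeds_in_hopfian:
  assumes fg: "finitely_generated G"
  shows "\<exists>(\<Gamma> :: (nat \<times> nat \<Rightarrow> nat \<times> nat) set monoid) \<iota>. group \<Gamma> \<and> finitely_generated \<Gamma> \<and> hopfian \<Gamma> \<and>
    \<iota> \<in> hom G \<Gamma> \<and> inj_on \<iota> (carrier G)"
proof -
  interpret countable_group G by unfold_locales (rule countable_finitely_generated[OF fg])
  have "cycle3 0 1 2 \<noteq> id"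
  proof
    assume "cycle3 0 1 2 = id"
    then have "cycle3 0 1 2 (0, 0) = (0, 0)" by simp
    then show False by (simp add: cycle3_def)
  qed
  then obtain N where N: "N \<lhd> E" "cycle3 0 1 2 \<notin> N" "hopfian (E Mod N)"
    using E.hopfian_quotient_avoiding[of "cycle3 0 1 2"] cycle3_in_N_iff by auto
  interpret N: normal N E by (rule N(1))
  interpret \<pi>: group_hom E "E Mod N" "\<lambda>a. N #>\<^bsub>E\<^esub> a"
    using N.r_coset_hom_Mod by (simp add: group_hom_def group_hom_axioms_def E.is_group N.factorgroup_is_group)
  have fgQ: "finitely_generated (E Mod N)"
    by (rule \<pi>.finitely_generated_image[OF E_finitely_generated[OF fg]]) (simp add: carrier_FactGroup)
  have hom: "(\<lambda>a. N #>\<^bsub>E\<^esub> a) \<circ> act \<in> hom G (E Mod N)"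
    by (rule Group.hom_compose[OF act_hom N.r_coset_hom_Mod])
  interpret \<iota>: group_hom G "E Mod N" "(\<lambda>a. N #>\<^bsub>E\<^esub> a) \<circ> act"
    using hom by (simp add: group_hom_def group_hom_axioms_def is_group N.factorgroup_is_group)
  have "inj_on ((\<lambda>a. N #>\<^bsub>E\<^esub> a) \<circ> act) (carrier G)"
      unfolding \<iota>.inj_on_one_iff
  proof (intro allI impI)
    fix g assume g: "g \<in> carrier G" "((\<lambda>a. N #>\<^bsub>E\<^esub> a) \<circ> act) g = \<one>\<^bsub>E Mod N\<^esub>"
    then have "act g \<in> N" using E.coset_eq_self_iff[OF N.subgroup_axioms, of "act g"] by simp
    then show "g = \<one>" using act_in_N_imp[OF N(1) g(1)] N(2) by blast
  qed
  then show ?thesis using N.factorgroup_is_group fgQ N(3) hom by blast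
qed

section \<open>Matrices over a group ring as endomorphisms of a wreath product\<close>

text \<open>If \<open>D\<close> is the additive group \<open>R\<^sup>d\<close>, the base group of \<open>D \<wr> G\<close> consists of the rows of length
  \<open>d\<close> over \<open>R[G]\<close>, and the top group acts by shifts.\<close>

locale row_wreath = grp_ring R G + D: group D
  for R :: "('k, 'm) ring_scheme" and G :: "('g, 'n) monoid_scheme" and D :: "('d, 'p) monoid_scheme" +
  fixes d :: nat and \<theta> :: "'d \<Rightarrow> nat \<Rightarrow> 'k"
  assumes \<theta>: "\<theta> \<in> iso D (product_group {..<d} (\<lambda>_. add_monoid R))"
begin

sublocale wreath D G by unfold_locales

lemma product: "group (product_group {..<d} (\<lambda>_. add_monoid R))"
  by (rule product_group) (rule R.a_group)

sublocale \<theta>: group_hom D "product_group {..<d} (\<lambda>_. add_monoid R)" \<theta>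
  using \<theta> product by (simp add: group_hom_def group_hom_axioms_def iso_def)

lemma \<theta>_closed: "a \<in> carrier D \<Longrightarrow> i < d \<Longrightarrow> \<theta> a i \<in> carrier R"
  using \<theta>.hom_closed[of a] by auto

lemma \<theta>_one: "i < d \<Longrightarrow> \<theta> \<one>\<^bsub>D\<^esub> i = \<zero>\<^bsub>R\<^esub>"
  using \<theta>.hom_one by simp

lemma \<theta>_eqI:
  assumes "a \<in> carrier D" "b \<in> carrier D" "\<And>i. i < d \<Longrightarrow> \<theta> a i = \<theta> b i"
  shows "a = b"
proof -
  have "\<theta> a = \<theta> b"
    by (rule PiE_ext[of _ "{..<d}" "\<lambda>_. carrier R"]) (use \<theta>.hom_closed assms in auto)
  then show ?thesis using \<theta> assms unfolding iso_def by (auto simp: bij_betw_def inj_on_def)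
qed

definition row :: "('g \<Rightarrow> 'd) \<times> 'g \<Rightarrow> nat \<Rightarrow> 'g \<Rightarrow> 'k" where
  "row w = (\<lambda>i\<in>{..<d}. \<lambda>g\<in>carrier G. \<theta> (fst w g) i)"

definition unrow :: "(nat \<Rightarrow> 'g \<Rightarrow> 'k) \<Rightarrow> 'g \<Rightarrow> ('g \<Rightarrow> 'd) \<times> 'g" where
  "unrow v \<gamma> = ((\<lambda>g\<in>carrier G. inv_into (carrier D) \<theta> (\<lambda>i\<in>{..<d}. v i g)), \<gamma>)"

lemma row_apply: "i < d \<Longrightarrow> g \<in> carrier G \<Longrightarrow> row w i g = \<theta> (fst w g) i"
  by (simp add: row_def)

lemma row_closed: assumes w: "w \<in> carrier W" shows "row w \<in> P.rows d"
proof -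
  have "row w i \<in> carrier P" if i: "i < d" for i
    unfolding carrier_P
  proof
    show "row w i \<in> carrier G \<rightarrow>\<^sub>E carrier R" using w i unfolding row_def by (simp add: \<theta>_closed)
    have "finite {g \<in> carrier G. fst w g \<noteq> \<one>\<^bsub>D\<^esub>}" using iffD1[OF carrier_W w] by (elim conjE)
    then show "finite (supp (row w i))"
      by (rule rev_finite_subset) (use i in \<open>auto simp: supp_def row_apply \<theta>_one\<close>)
  qed
  then show ?thesis by (auto simp: row_def)
qed

lemma unrow_coordinates:
  assumes v: "v \<in> P.rows d" and g: "g \<in> carrier G"
  shows "fst (unrow v \<gamma>) g \<in> carrier D" "\<theta> (fst (unrow v \<gamma>) g) = (\<lambda>i\<in>{..<d}. v i g)"
proof -
  have "(\<lambda>i\<in>{..<d}. v i g) \<in> {..<d} \<rightarrow>\<^sub>E carrier R" using v g by auto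
  then have "(\<lambda>i\<in>{..<d}. v i g) \<in> \<theta> ` carrier D" using \<theta> by (simp add: iso_def bij_betw_def)
  then show "fst (unrow v \<gamma>) g \<in> carrier D" "\<theta> (fst (unrow v \<gamma>) g) = (\<lambda>i\<in>{..<d}. v i g)"
    using g by (simp_all add: unrow_def inv_into_into f_inv_into_f)
qed

lemma snd_unrow [simp]: "snd (unrow v \<gamma>) = \<gamma>" by (simp add: unrow_def)

lemma unrow_closed:
  assumes v: "v \<in> P.rows d" and \<gamma>: "\<gamma> \<in> carrier G"
  shows "unrow v \<gamma> \<in> carrier W"
  unfolding carrier_W
proof (intro conjI)
  have "fst (unrow v \<gamma>) \<in> extensional (carrier G)" by (simp add: unrow_def)
  then show "fst (unrow v \<gamma>) \<in> carrier G \<rightarrow>\<^sub>E carrier D"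
    using unrow_coordinates(1)[OF v] by (simp add: PiE_iff)
  have "finite (\<Union>i\<in>{..<d}. supp (v i))" using v by auto
  moreover have "{g \<in> carrier G. fst (unrow v \<gamma>) g \<noteq> \<one>\<^bsub>D\<^esub>} \<subseteq> (\<Union>i\<in>{..<d}. supp (v i))"
  proof
    fix g assume "g \<in> {g \<in> carrier G. fst (unrow v \<gamma>) g \<noteq> \<one>\<^bsub>D\<^esub>}"
    then have g: "g \<in> carrier G" "fst (unrow v \<gamma>) g \<noteq> \<one>\<^bsub>D\<^esub>" by simp_all
    have "\<exists>i<d. v i g \<noteq> \<zero>\<^bsub>R\<^esub>"
    proof (rule ccontr)
      assume *: "\<not> (\<exists>i<d. v i g \<noteq> \<zero>\<^bsub>R\<^esub>)"
      have "fst (unrow v \<gamma>) g = \<one>\<^bsub>D\<^esub>"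
        by (rule \<theta>_eqI) (use * unrow_coordinates[OF v g(1)] in \<open>auto simp: \<theta>_one\<close>)
      then show False using g(2) by simp
    qed
    then show "g \<in> (\<Union>i\<in>{..<d}. supp (v i))" using g(1) by (auto simp: supp_def)
  qed
  ultimately show "finite {g \<in> carrier G. fst (unrow v \<gamma>) g \<noteq> \<one>\<^bsub>D\<^esub>}" by (rule finite_subset[rotated])
qed (use \<gamma> in simp)

lemma row_eqI:
  assumes "v \<in> P.rows d" "w \<in> P.rows d" "\<And>i g. i < d \<Longrightarrow> g \<in> carrier G \<Longrightarrow> v i g = w i g"
  shows "v = w"
proof (rule PiE_ext[of _ "{..<d}" "\<lambda>_. carrier P"])
  fix i assume "i \<in> {..<d}"
  then show "v i = w i" using assms by (intro P_eqI) auto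
qed (use assms in auto)

lemma row_unrow: assumes "v \<in> P.rows d" "\<gamma> \<in> carrier G" shows "row (unrow v \<gamma>) = v"
  by (rule row_eqI) (use assms in \<open>simp_all add: row_closed unrow_closed row_apply unrow_coordinates\<close>)

lemma W_eq_if_row_eq:
  assumes u: "u \<in> carrier W" and w: "w \<in> carrier W" and "snd u = snd w" and eq: "row u = row w"
  shows "u = w"
proof (rule W_eqI[OF u w])
  fix g assume g: "g \<in> carrier G"
  show "fst u g = fst w g"
    by (rule \<theta>_eqI) (use u w g eq row_apply[of _ g u] row_apply[of _ g w] in simp_all)
qed fact

lemma row_mult:
  assumes u: "u \<in> carrier W" and w: "w \<in> carrier W"
  shows "row (u \<otimes>\<^bsub>W\<^esub> w) = (\<lambda>i\<in>{..<d}. row u i \<oplus>\<^bsub>P\<^esub> (\<lambda>i\<in>{..<d}. shift (snd u) (row w i)) i)"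
proof (rule row_eqI)
  have r: "row u i \<in> carrier P" "row w i \<in> carrier P" if "i < d" for i
    using row_closed[OF u] row_closed[OF w] that by auto
  show "row (u \<otimes>\<^bsub>W\<^esub> w) \<in> P.rows d" using u w by (intro row_closed W.m_closed)
  show "(\<lambda>i\<in>{..<d}. row u i \<oplus>\<^bsub>P\<^esub> (\<lambda>i\<in>{..<d}. shift (snd u) (row w i)) i) \<in> P.rows d"
    using r u by auto
  fix i g assume i: "i < d" and g: "g \<in> carrier G"
  show "row (u \<otimes>\<^bsub>W\<^esub> w) i g = (\<lambda>i\<in>{..<d}. row u i \<oplus>\<^bsub>P\<^esub> (\<lambda>i\<in>{..<d}. shift (snd u) (row w i)) i) i g"
    using u w i g r by (simp add: row_apply)
qed

text \<open>Multiplication of rows by \<open>B\<close> extends to an endomorphism of \<open>D \<wr> G\<close>, surjective if \<open>A B = 1\<close> and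
  not injective if \<open>B A \<noteq> 1\<close>.\<close>

theorem directly_finite_if_hopfian:
  assumes hopf: "hopfian W"
  shows "directly_finite (matrix_ring d P)"
  unfolding directly_finite_def
proof (intro ballI impI)
  fix A B assume A: "A \<in> carrier (matrix_ring d P)" and B: "B \<in> carrier (matrix_ring d P)"
    and AB: "A \<otimes>\<^bsub>matrix_ring d P\<^esub> B = \<one>\<^bsub>matrix_ring d P\<^esub>"
  let ?T = "\<lambda>v. row_times_matrix P d v B"
  have T: "?T v \<in> P.rows d" if "v \<in> P.rows d" for v using that B by simp
  define \<phi> where "\<phi> w = unrow (?T (row w)) (snd w)" for w
  have \<phi>_closed: "\<phi> w \<in> carrier W" if "w \<in> carrier W" for w
    unfolding \<phi>_def using that by (intro unrow_closed T row_closed) simp_all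
  have row_\<phi>: "row (\<phi> w) = ?T (row w)" if "w \<in> carrier W" for w
    unfolding \<phi>_def using that by (intro row_unrow T row_closed) simp_all
  have snd_\<phi>: "snd (\<phi> w) = snd w" for w by (simp add: \<phi>_def)
  have "\<phi> \<in> hom W W"
  proof (rule homI)
    fix u w assume u: "u \<in> carrier W" and w: "w \<in> carrier W"
    have sw: "(\<lambda>i\<in>{..<d}. shift (snd u) (row w i)) \<in> P.rows d"
      using u row_closed[OF w] by auto
    show "\<phi> (u \<otimes>\<^bsub>W\<^esub> w) = \<phi> u \<otimes>\<^bsub>W\<^esub> \<phi> w"
    proof (rule W_eq_if_row_eq)
      have "row (\<phi> (u \<otimes>\<^bsub>W\<^esub> w)) = ?T (row (u \<otimes>\<^bsub>W\<^esub> w))" by (rule row_\<phi>) (use u w in simp)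
      also have "\<dots> = (\<lambda>j\<in>{..<d}. ?T (row u) j \<oplus>\<^bsub>P\<^esub> ?T (\<lambda>i\<in>{..<d}. shift (snd u) (row w i)) j)"
        unfolding row_mult[OF u w] by (rule P.row_times_matrix_add[OF row_closed[OF u] sw B])
      also have "\<dots> = row (\<phi> u \<otimes>\<^bsub>W\<^esub> \<phi> w)"
        unfolding row_mult[OF \<phi>_closed[OF u] \<phi>_closed[OF w]] row_\<phi>[OF u] row_\<phi>[OF w] snd_\<phi>
        by (simp only: shift_row_times_matrix[OF snd_closed[OF u] row_closed[OF w] B])
      finally show "row (\<phi> (u \<otimes>\<^bsub>W\<^esub> w)) = row (\<phi> u \<otimes>\<^bsub>W\<^esub> \<phi> w)" .
    qed (use u w \<phi>_closed snd_\<phi> in simp_all)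
  qed (rule \<phi>_closed)
  moreover have "\<phi> ` carrier W = carrier W"
  proof
    show "\<phi> ` carrier W \<subseteq> carrier W" using \<phi>_closed by (intro image_subsetI)
    show "carrier W \<subseteq> \<phi> ` carrier W"
    proof
      fix w assume w: "w \<in> carrier W"
      let ?v = "row_times_matrix P d (row w) A"
      have v: "?v \<in> P.rows d" by (rule P.row_times_matrix_closed[OF row_closed[OF w] A])
      have u: "unrow ?v (snd w) \<in> carrier W" by (rule unrow_closed[OF v]) (use w in simp)
      have "?T ?v = row w"
        using P.row_times_matrix_assoc[OF row_closed[OF w] A B] AB P.row_times_one[OF row_closed[OF w]] by simp
      then have "\<phi> (unrow ?v (snd w)) = w"
        by (intro W_eq_if_row_eq) (use u w v in \<open>simp_all add: \<phi>_closed row_\<phi> snd_\<phi> row_unrow\<close>)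
      then show "w \<in> \<phi> ` carrier W" using u by (rule image_eqI[OF sym])
    qed
  qed
  ultimately have inj: "inj_on \<phi> (carrier W)" by (rule hopfianD[OF hopf])
  have "inj_on ?T (P.rows d)"
  proof (rule inj_onI)
    fix v w assume v: "v \<in> P.rows d" and w: "w \<in> P.rows d" and eq: "?T v = ?T w"
    have "\<phi> (unrow v \<one>\<^bsub>G\<^esub>) = \<phi> (unrow w \<one>\<^bsub>G\<^esub>)"
      unfolding \<phi>_def by (simp add: row_unrow v w eq)
    then have "unrow v \<one>\<^bsub>G\<^esub> = unrow w \<one>\<^bsub>G\<^esub>"
      by (rule inj_onD[OF inj]) (use v w unrow_closed in simp_all)
    then show "v = w" using row_unrow[OF v G.one_closed] row_unrow[OF w G.one_closed] by metis
  qed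
  then show "B \<otimes>\<^bsub>matrix_ring d P\<^esub> A = \<one>\<^bsub>matrix_ring d P\<^esub>"
    using P.row_times_matrix_not_inj[OF A B AB] by blast
qed

end

section \<open>Stable finiteness from the Hopfian property\<close>

lemma hopfian_iso:
  assumes f: "f \<in> iso G H" and G: "group G" and H: "group H" and hopf: "hopfian G"
  shows "hopfian H"
proof (rule hopfianI[OF H])
  interpret G: group G by (rule G)
  define g where "g = inv_into (carrier G) f"
  have g: "g \<in> iso H G" unfolding g_def by (rule G.iso_set_sym[OF f])
  interpret f: group_hom G H f using f G H by (simp add: group_hom_def group_hom_axioms_def iso_def)
  interpret g: group_hom H G g using g G H by (simp add: group_hom_def group_hom_axioms_def iso_def)
  have onto: "f ` carrier G = carrier H" "g ` carrier H = carrier G" using f g by (auto simp: iso_def bij_betw_def)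
  fix \<phi> y assume \<phi>: "\<phi> \<in> hom H H" "\<phi> ` carrier H = carrier H" and y: "y \<in> carrier H" "\<phi> y = \<one>\<^bsub>H\<^esub>"
  have hom: "g \<circ> (\<phi> \<circ> f) \<in> hom G G"
    by (intro Group.hom_compose[OF _ g.homh] Group.hom_compose[OF f.homh \<phi>(1)])
  have "(g \<circ> (\<phi> \<circ> f)) ` carrier G = carrier G" by (simp only: image_comp[symmetric] onto \<phi>(2))
  then have inj: "inj_on (g \<circ> (\<phi> \<circ> f)) (carrier G)" by (rule hopfianD[OF hopf hom])
  obtain x where x: "x \<in> carrier G" "y = f x" using y(1) onto(1) by blast
  interpret \<psi>: group_hom G G "g \<circ> (\<phi> \<circ> f)" using hom by (simp add: group_hom_def group_hom_axioms_def G)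
  have "(g \<circ> (\<phi> \<circ> f)) x = \<one>\<^bsub>G\<^esub>" using x y by simp
  then have "x = \<one>\<^bsub>G\<^esub>" using inj x(1) unfolding \<psi>.inj_on_one_iff by blast
  then show "y = \<one>\<^bsub>H\<^esub>" using x by simp
qed

lemma (in comm_group) nilpotent_group_if_comm: "nilpotent_group G"
proof -
  have "upper_central G 1 = carrier G"
    by (auto simp: upper_central_Suc commutator_eq_one_iff m_comm)
  then show ?thesis unfolding nilpotent_group_def using is_group by blast
qed

lemma (in group) finitely_generated_if_finite: "finite (carrier G) \<Longrightarrow> finitely_generated G"
  unfolding finitely_generated_def
  using generate_incl[of "carrier G"] generate.incl[of _ "carrier G" G] by (intro exI[of _ "carrier G"]) auto

text \<open>Over a finite field and a Hopfian group the base group \<open>k\<^sup>d\<close> is finite, and the hypothesis applies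
  directly.\<close>

lemma directly_finite_over_finite_field:
  assumes hopf: "\<And>(\<Delta> :: 'd monoid) (\<Gamma> :: 'c monoid). nilpotent_group \<Delta> \<Longrightarrow> finitely_generated \<Delta> \<Longrightarrow>
      group \<Gamma> \<Longrightarrow> finitely_generated \<Gamma> \<Longrightarrow> hopfian \<Gamma> \<Longrightarrow> hopfian (\<Delta> \<wr> \<Gamma>)"
    and inf: "infinite (UNIV :: 'd set)"
    and k: "field k" "finite (carrier k)"
    and \<Gamma>: "group (\<Gamma> :: 'c monoid)" "finitely_generated \<Gamma>" "hopfian \<Gamma>"
  shows "directly_finite (matrix_ring d (group_ring k \<Gamma>))"
proof -
  interpret k: field k by (rule k(1))
  let ?V = "product_group {..<d} (\<lambda>_. add_monoid k)"
  have V: "group ?V" by (rule product_group) (rule k.a_group)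
  interpret V: group ?V by (rule V)
  have finV: "finite (carrier ?V)" using k(2) by (simp add: finite_PiE)
  obtain f :: "(nat \<Rightarrow> _) \<Rightarrow> 'd" where f: "inj_on f (carrier ?V)"
    using countable_inj_on[OF countable_finite[OF finV] inf] .
  define \<Delta> where "\<Delta> = image_group f ?V"
  have iso: "f \<in> iso ?V \<Delta>" unfolding \<Delta>_def by (rule inj_imp_image_group_iso[OF f])
  have \<Delta>: "group \<Delta>" unfolding \<Delta>_def by (rule V.inj_imp_image_group_is_group[OF f])
  have \<theta>: "inv_into (carrier ?V) f \<in> iso \<Delta> ?V" by (rule V.iso_set_sym[OF iso])
  have onto: "carrier \<Delta> = f ` carrier ?V" unfolding \<Delta>_def by (rule image_group_carrier)
  interpret f: group_hom ?V \<Delta> f using iso V \<Delta> by (simp add: group_hom_def group_hom_axioms_def iso_def)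
  have "comm_group \<Delta>"
  proof (rule group.group_comm_groupI[OF \<Delta>])
    fix x y assume "x \<in> carrier \<Delta>" "y \<in> carrier \<Delta>"
    then obtain a b where ab: "a \<in> carrier ?V" "b \<in> carrier ?V" "x = f a" "y = f b" unfolding onto by blast
    have "a \<otimes>\<^bsub>?V\<^esub> b = b \<otimes>\<^bsub>?V\<^esub> a" using ab(1,2) by (auto simp: fun_eq_iff k.a_comm PiE_iff)
    then show "x \<otimes>\<^bsub>\<Delta>\<^esub> y = y \<otimes>\<^bsub>\<Delta>\<^esub> x" using ab f.hom_mult[of a b] f.hom_mult[of b a] by simp
  qed
  then interpret C: comm_group \<Delta> .
  interpret \<Gamma>: group \<Gamma> by (rule \<Gamma>(1))
  interpret row_wreath k \<Gamma> \<Delta> d "inv_into (carrier ?V) f"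
    by unfold_locales (rule \<theta>)
  have "finite (carrier \<Delta>)" unfolding onto using finV by simp
  then have "hopfian (\<Delta> \<wr> \<Gamma>)"
    by (intro hopf C.nilpotent_group_if_comm f.H.finitely_generated_if_finite \<Gamma>)
  then show ?thesis by (rule directly_finite_if_hopfian)
qed

text \<open>A failure of direct finiteness over \<open>F[G]\<close> involves finitely many coefficients and group elements. It
  survives the reduction of the coefficients to a finite field, chosen so that a nonzero coefficient of
  \<open>B A - 1\<close> stays nonzero, and the embedding of the group elements in a Hopfian group.\<close>

theorem stably_finite_if_hopfian_wreath:
  assumes hopf: "\<And>(\<Delta> :: 'd monoid) (\<Gamma> :: 'c monoid). nilpotent_group \<Delta> \<Longrightarrow> finitely_generated \<Delta> \<Longrightarrow>
      group \<Gamma> \<Longrightarrow> finitely_generated \<Gamma> \<Longrightarrow> hopfian \<Gamma> \<Longrightarrow> hopfian (\<Delta> \<wr> \<Gamma>)"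
    and inf: "infinite (UNIV :: 'd set)" "infinite (UNIV :: 'c set)"
    and G: "group (G :: ('g, 'n) monoid_scheme)" and F: "field (F :: ('k, 'm) ring_scheme)"
  shows "stably_finite (group_ring F G)"
  unfolding stably_finite_def directly_finite_def
proof (intro allI ballI impI)
  interpret G: group G by (rule G)
  interpret F: field F by (rule F)
  interpret grp_ring F G by unfold_locales
  fix d :: nat and A B
  assume A: "A \<in> carrier (matrix_ring d P)" and B: "B \<in> carrier (matrix_ring d P)"
    and AB: "A \<otimes>\<^bsub>matrix_ring d P\<^esub> B = \<one>\<^bsub>matrix_ring d P\<^esub>"
  let ?BA = "B \<otimes>\<^bsub>matrix_ring d P\<^esub> A" and ?I = "\<one>\<^bsub>matrix_ring d P\<^esub>"
  have BA: "?BA \<in> carrier (matrix_ring d P)" by (rule P.matrix_mult_closed[OF B A])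
  have I: "?I \<in> carrier (matrix_ring d P)" by (rule P.matrix_one_closed)
  show "?BA = ?I"
  proof (rule P.matrix_eqI[OF BA I], rule P_eqI)
    fix i j g assume ij: "i < d" "j < d" and g: "g \<in> carrier G"
    let ?u = "?BA (i, j)" and ?v = "?I (i, j)"
    show "?u g = ?v g"
    proof (rule ccontr)
      assume neq: "?u g \<noteq> ?v g"
      have entry: "A (i, j) \<in> carrier P" "B (i, j) \<in> carrier P" "?BA (i, j) \<in> carrier P" "?I (i, j) \<in> carrier P"
        if "i < d" "j < d" for i j
        using A B BA I that P.matrix_closed by blast+
      have uv: "?u g \<in> carrier F" "?v g \<in> carrier F" using entry(3,4)[OF ij] g by simp_all
      define r where "r = ?u g \<ominus>\<^bsub>F\<^esub> ?v g"
      have r: "r \<in> carrier F" "r \<noteq> \<zero>\<^bsub>F\<^esub>" "?u g = r \<oplus>\<^bsub>F\<^esub> ?v g"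
        unfolding r_def using uv neq F.r_right_minus_eq[OF uv] by (simp_all add: a_minus_def F.a_assoc F.l_neg)
      have ir: "inv\<^bsub>F\<^esub> r \<in> carrier F" "r \<otimes>\<^bsub>F\<^esub> inv\<^bsub>F\<^esub> r = \<one>\<^bsub>F\<^esub>"
        using r F.field_Units by simp_all
      \<comment> \<open>The coefficient at \<open>g\<close> is to be compared, so \<open>g\<close> itself has to survive.\<close>
      define Y where "Y = (\<Union>p\<in>{..<d} \<times> {..<d}. supp (A p) \<union> supp (B p)) \<union> {g}"
      have Y: "finite Y" "Y \<subseteq> carrier G"
        unfolding Y_def using entry g by (auto dest: supp_mem)
      define K where "K = generate G Y"
      have K: "subgroup K G" unfolding K_def by (rule G.generate_is_subgroup[OF Y(2)])
      have YK: "Y \<subseteq> K" unfolding K_def by (auto intro: generate.incl)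
      \<comment> \<open>The inverse of \<open>r\<close> prevents \<open>r\<close> from becoming zero.\<close>
      define C where "C = (\<Union>p\<in>{..<d} \<times> {..<d}. A p ` supp (A p) \<union> B p ` supp (B p)) \<union> {r, inv\<^bsub>F\<^esub> r, ?v g}"
      have C: "finite C" "C \<subseteq> carrier F"
        unfolding C_def using entry uv r ir by (auto dest: supp_mem)
      obtain S and k :: "'k set ring" and q where S: "subring S F" "C \<subseteq> S" and k: "field k" "finite (carrier k)"
        and q: "q \<in> ring_hom (F\<lparr>carrier := S\<rparr>) k"
        using F.exists_finite_residue_field[OF C] by blast
      have "group (G\<lparr>carrier := K\<rparr>)" by (rule G.subgroup_imp_group[OF K])
      then interpret K: group "G\<lparr>carrier := K\<rparr>" .
      have "finitely_generated (G\<lparr>carrier := K\<rparr>)"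
        unfolding finitely_generated_def
        using G.generate_consistent[OF YK K] Y(1) YK by (intro exI[of _ Y]) (simp add: K_def)
      then obtain \<Gamma>0 :: "(nat \<times> nat \<Rightarrow> nat \<times> nat) set monoid" and \<iota>0
        where \<Gamma>0: "group \<Gamma>0" "finitely_generated \<Gamma>0" "hopfian \<Gamma>0"
          and \<iota>0: "\<iota>0 \<in> hom (G\<lparr>carrier := K\<rparr>) \<Gamma>0" "inj_on \<iota>0 K"
        using K.embeds_in_hopfian by auto
      interpret \<Gamma>0: group \<Gamma>0 by (rule \<Gamma>0(1))
      obtain f :: "_ \<Rightarrow> 'c" where f: "inj_on f (carrier \<Gamma>0)"
        using countable_inj_on[OF \<Gamma>0.countable_finitely_generated[OF \<Gamma>0(2)] inf(2)] .
      define \<Gamma> where "\<Gamma> = image_group f \<Gamma>0"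
      have iso: "f \<in> iso \<Gamma>0 \<Gamma>" unfolding \<Gamma>_def by (rule inj_imp_image_group_iso[OF f])
      have \<Gamma>: "group \<Gamma>" unfolding \<Gamma>_def by (rule \<Gamma>0.inj_imp_image_group_is_group[OF f])
      interpret f: group_hom \<Gamma>0 \<Gamma> f using iso \<Gamma> by (simp add: group_hom_def group_hom_axioms_def iso_def \<Gamma>0(1))
      have fg: "finitely_generated \<Gamma>"
        by (rule f.finitely_generated_image[OF \<Gamma>0(2)]) (use iso in \<open>simp add: iso_def bij_betw_def\<close>)
      have hopf_\<Gamma>: "hopfian \<Gamma>" by (rule hopfian_iso[OF iso \<Gamma>0(1) \<Gamma> \<Gamma>0(3)])
      interpret k: field k by (rule k(1))
      interpret h: grp_ring_map F G k \<Gamma> S q K "f \<circ> \<iota>0"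
      proof (intro grp_ring_map.intro grp_ring.intro grp_ring_map_axioms.intro)
        show "f \<circ> \<iota>0 \<in> hom (G\<lparr>carrier := K\<rparr>) \<Gamma>" by (rule Group.hom_compose[OF \<iota>0(1) f.homh])
        have "\<iota>0 ` K \<subseteq> carrier \<Gamma>0" using \<iota>0(1) by (auto simp: hom_def)
        then show "inj_on (f \<circ> \<iota>0) K" by (intro comp_inj_on \<iota>0(2) inj_on_subset[OF f])
      qed (use S(1) q K \<Gamma> G in \<open>simp_all add: F.ring_axioms k.ring_axioms\<close>)
      have Q: "M p \<in> h.Q" if M: "M = A \<or> M = B" and p: "p \<in> {..<d} \<times> {..<d}" for M p
      proof (rule h.QI)
        have Mp: "M p \<in> carrier P" using M p entry by auto
        show "M p \<in> carrier P" by (rule Mp)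
        have MY: "supp (M p) \<subseteq> Y" "M p ` supp (M p) \<subseteq> C"
          unfolding Y_def C_def using M p by blast+
        fix x assume x: "x \<in> carrier G"
        show "M p x = \<zero>\<^bsub>F\<^esub>" if "x \<notin> K"
          using that x MY(1) YK unfolding supp_def by blast
        show "M p x \<in> S"
        proof (cases "M p x = \<zero>\<^bsub>F\<^esub>")
          case True then show ?thesis using subringE(2)[OF S(1)] by simp
        next
          case False
          then have "x \<in> supp (M p)" using x by (simp add: supp_def)
          then show ?thesis using MY(2) S(2) by blast
        qed
      qed
      have "directly_finite (matrix_ring d (group_ring k \<Gamma>))"
        by (rule directly_finite_over_finite_field[OF hopf inf(1) k \<Gamma> fg hopf_\<Gamma>])
      then have "h.h ?u = h.h ?v"
        by (rule h.transport_directly_finite)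
          (use A B AB ij Q in \<open>auto simp: P.carrier_matrix_ring PiE_iff\<close>)
      moreover have gK: "g \<in> K" using YK unfolding Y_def by blast
      ultimately have eq: "q (?u g) = q (?v g)"
        using h.h_\<iota>[OF gK, of ?u] h.h_\<iota>[OF gK, of ?v] by simp
      have inS: "r \<in> S" "inv\<^bsub>F\<^esub> r \<in> S" "?v g \<in> S" using S(2) unfolding C_def by blast+
      have "q (?u g) = q r \<oplus>\<^bsub>k\<^esub> q (?v g)" unfolding r(3) using inS by simp
      then have "q r \<oplus>\<^bsub>k\<^esub> q (?v g) = \<zero>\<^bsub>k\<^esub> \<oplus>\<^bsub>k\<^esub> q (?v g)" using eq inS by simp
      then have "q r = \<zero>\<^bsub>k\<^esub>" using inS by (subst (asm) k.add.right_cancel) simp_all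
      then have "q (r \<otimes>\<^bsub>F\<^esub> inv\<^bsub>F\<^esub> r) = \<zero>\<^bsub>k\<^esub>" using inS by simp
      then show False using ir(2) by simp
    qed
  qed (use BA I P.matrix_closed in blast)+
qed

section \<open>The Hopf property and stable finiteness\<close>

theorem theorem1p12:
  shows
    "(\<forall>(\<Delta> :: 'a monoid) (\<Gamma> :: 'b monoid) (c :: nat).
        nilpotent_group \<Delta> \<and> finitely_generated \<Delta> \<and>
        1 \<le> c \<and> upper_central \<Delta> c = carrier \<Delta> \<and>
        group \<Gamma> \<and> finitely_generated \<Gamma> \<and>
        (\<forall>i\<in>{1..c}. hopfian (upper_central_factor \<Delta> i \<wr> \<Gamma>))
        \<longrightarrow> hopfian (\<Delta> \<wr> \<Gamma>))
   \<and> (infinite (UNIV :: 'g set) \<and> infinite (UNIV :: 'k set) \<and>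
      infinite (UNIV :: 'd set) \<and> infinite (UNIV :: 'c set) \<longrightarrow>
        ((\<forall>(G :: 'g monoid) (F :: 'k ring). group G \<and> field F \<longrightarrow> stably_finite (group_ring F G))
         \<longleftrightarrow>
         (\<forall>(\<Delta> :: 'd monoid) (\<Gamma> :: 'c monoid).
            nilpotent_group \<Delta> \<and> finitely_generated \<Delta> \<and>
            group \<Gamma> \<and> finitely_generated \<Gamma> \<and> hopfian \<Gamma>
            \<longrightarrow> hopfian (\<Delta> \<wr> \<Gamma>))))"
proof (intro conjI allI impI iffI; (elim conjE)?)
  fix \<Delta> :: "'a monoid" and \<Gamma> :: "'b monoid" and c :: nat
  assume "nilpotent_group \<Delta>" and fg: "finitely_generated \<Delta>" and c: "1 \<le> c" "upper_central \<Delta> c = carrier \<Delta>"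
    and \<Gamma>: "group \<Gamma>" and factors: "\<forall>i\<in>{1..c}. hopfian (upper_central_factor \<Delta> i \<wr> \<Gamma>)"
  then interpret D: group \<Delta> by (simp add: nilpotent_group_def)
  interpret T: group \<Gamma> by (rule \<Gamma>)
  interpret wreath \<Delta> \<Gamma> by unfold_locales
  have factor: "hopfian (upper_central_factor \<Delta> (Suc i) \<wr> \<Gamma>)" if "i < c" for i
    using factors that by auto
  \<comment> \<open>The first factor alone makes \<open>\<Gamma>\<close> Hopfian.\<close>
  interpret A: comm_group "upper_central_factor \<Delta> (Suc 0)" by (rule D.comm_group_upper_central_factor)
  interpret V: wreath "upper_central_factor \<Delta> (Suc 0)" \<Gamma> by unfold_locales
  have "hopfian \<Gamma>"
    by (rule V.hopfian_top_if_comm[OF A.comm_group_axioms factor]) (use c in simp)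
  then show "hopfian (\<Delta> \<wr> \<Gamma>)" by (rule hopfian_wreath_nilpotent[OF fg c(2) _ factor])
next
  fix \<Delta> :: "'d monoid" and \<Gamma> :: "'c monoid"
  assume "infinite (UNIV :: 'g set)" "infinite (UNIV :: 'k set)"
    and "\<forall>(G :: 'g monoid) (F :: 'k ring). group G \<and> field F \<longrightarrow> stably_finite (group_ring F G)"
    and "nilpotent_group \<Delta>" "finitely_generated \<Delta>" "group \<Gamma>" "finitely_generated \<Gamma>" "hopfian \<Gamma>"
  then show "hopfian (\<Delta> \<wr> \<Gamma>)"
    by (intro hopfian_wreath_if_stably_finite[where ?'g = 'g and ?'k = 'k]) simp_all
next
  fix G :: "'g monoid" and F :: "'k ring"
  assume inf: "infinite (UNIV :: 'd set)" "infinite (UNIV :: 'c set)"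
    and hopf: "\<forall>(\<Delta> :: 'd monoid) (\<Gamma> :: 'c monoid).
            nilpotent_group \<Delta> \<and> finitely_generated \<Delta> \<and>
            group \<Gamma> \<and> finitely_generated \<Gamma> \<and> hopfian \<Gamma>
            \<longrightarrow> hopfian (\<Delta> \<wr> \<Gamma>)"
    and GF: "group G" "field F"
  show "stably_finite (group_ring F G)"
    by (rule stably_finite_if_hopfian_wreath[where ?'d = 'd and ?'c = 'c, OF _ inf GF]) (use hopf in blast)
qed

end
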